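(* For $\theta=(\theta_1,\theta_2)\in\{0,1\}^2$ write $Z^\theta(\lambda,T):=c_\theta^{\lambda,n}\det(I+T\,C^{\lambda+\theta_1\pi\iota,\theta_2})$. Then the probability measure $\mathbf{P}_n^{\lambda,T}$ on occupation processes on $\mathbb{T}_n$ may be written as an affine combination $$\mathbf{P}_n^{\lambda,T}=\sum_{\theta\in\{0,1\}^2}\frac{Z^\theta(\lambda,T)}{Z(\lambda,T)}\,\mathbf{P}_n^{\lambda+\theta_1\pi\iota,\theta_2,T}$$ of signed probability measures. For $\beta$ and $T$ such that $\beta+Tz\notin2\pi\iota\mathbb{Z}$ for all $z$ with $z^n=(-1)^{\theta_2}$, $\mathbf{P}_n^{\beta,\theta_2,T}$ is a complex probability measure with mixed correlation functions given by $$p_N^{\beta,\theta_2,T}(w_1,\ldots,w_N)=\det_{i,j=1}^N H_{\alpha_i}^{\beta,\theta_2,T}(y_j-y_i),$$ where $w_i=(\alpha_i,y_i)\in\{b,o,u\}\times\mathbb{T}_n$, $y_i=(t_i,h_i)$, $y_j-y_i=(t_j-t_i,h_j-h_i)$, and for $\alpha\in\{b,o,u\}$, $t\in(-1,1)$ and $h\in\mathbb{Z}$, $$H^{\beta,\theta_2,T}_\alpha(t,h)=(-1)^{\mathbf{1}_{\{\alpha=o\}}}\frac{T^{\mathbf{1}_{\{\alpha=b\}}}}{n}\sum_{z^n=(-1)^{\theta_2}}z^{\mathbf{1}_{\{\alpha=b\}}-h}\,\frac{e^{-(\beta+Tz)[t]_\alpha}}{1-e^{-(\beta+Tz)}},\qquad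 [t]_\alpha:=t+\mathbf{1}_{\{t<0\}}+\mathbf{1}_{\{\alpha=o\}}\mathbf{1}_{\{t=0\}}.$$ When $\beta=\lambda+\theta_1\pi\iota$ for $\lambda\in\mathbb{R}$ and $\theta_1\in\{0,1\}$, $\mathbf{P}_n^{\beta,\theta_2,T}$ is a signed probability measure.
   Context: $\iota=\sqrt{-1}$; $\mathbb{Z}_n=\mathbb{Z}/n\mathbb{Z}=\{0,\ldots,n-1\}$, $\mathbb{T}_n=[0,1)\times\mathbb{Z}_n$ (string $h$ is $[0,1)\times\{h\}$; string labels mod $n$), with measure $\mathrm{d}y$ giving mass $b-a$ to $(a,b]\times\{h\}$. In $y_j-y_i$ the representatives $h_i\in\{0,\ldots,n-1\}$ are used and the differences are not reduced. A signed (resp. complex) probability measure is a countably additive real-valued (resp. complex-valued) function on a sigma algebra with total mass $1$. Bead configuration: for $k\ge1$, $nk$ distinct points of $\mathbb{T}_n$, exactly $k$ on each string, such that for every $h$, if $t_1<\cdots<t_k$ and $t_1'<\cdots<t_k'$ are the horizontal coordinates on strings $h$ and $h+1$, then either $t_1\le t_1'<\cdots<t_k\le t_k'$ or $t_1'<t_1\le\cdots\le t_k'<t_k$. Occupation number: $\ell:=\#\{h:\ \text{smallest coordinate on string }h\ <\ \text{smallest coordinate on string }h-1\}$. $\mathcal{W}^{(n)}_{k,\ell}\subset[0,1)^{nk}$ is the set of arrays $(t_{h,j})$ ($t_{h,j}$ the $j$-th smallest coordinate on string $h$) of bead configurations with $k$ beads per string and occupation number $\ell$; $\mathrm{Vol}^{(n)}_{k,\ell}$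 is its $nk$-dimensional Lebesgue measure for $k\ge1$, and $\mathrm{Vol}^{(n)}_{0,\ell}:=\binom n\ell$, $0\le\ell\le n$. $Z(\lambda,T):=\sum_{k\ge0}\sum_{0\le\ell\le n}T^{nk}e^{-\lambda\ell}\mathrm{Vol}^{(n)}_{k,\ell}$. Occupation processes: an occupation process on $\mathbb{T}_n$ is a right-continuous map $t\mapsto X_t\subseteq\mathbb{Z}_n$ on the circle $[0,1)$ with finitely many discontinuities, where $(t,h)$ is a bead iff $X_t=(X_{t-}\setminus\{h\})\cup\{h+1\}$ at a discontinuity $t$. A nonempty bead configuration determines a nonconstant occupation process: for $t$ not the coordinate of a bead, $h\in X_t$ iff, moving right cyclically from $t$, the first bead on string $h$ is met before the first bead on string $h-1$; $X$ is extended right-continuously. Then $\#X_t=\ell$ for all $t$. The empty bead configuration corresponds to the $2^n$ constant processes $X_t\equiv A$, $A\subseteq\mathbb{Z}_n$. A point $(t,h)$ is occupied if $h\in X_t$, and unoccupied otherwise. $\mathbf{P}_n^{\lambda,T}$: choose $(K,L)=(k,\ell)$ with probability $T^{nk}e^{-\lambda\ell}\mathrm{Vol}^{(n)}_{k,\ell}/Z(\lambda,T)$; if $k\ge1$, choose a bead configuration uniformly from $\mathcal{W}^{(n)}_{k,\ell}$ and take its occupation process; if $k=0$, choose $A\subseteq\mathbb{Z}_n$ with $\#A=\ell$ uniformly and set $X_t\equiv A$. $\mathbf{P}_n^{\beta,\theta_2,T}$: let $\mathbf{Q}$ be the complex measure on occupation processes with, for bounded measurable $F$, $$\mathbf{Q}(F)=\sum_{k\ge1}\sum_{\ell}\tfrac12(-1)^{(k+1)(\theta_2+n+\ell+1)}e^{-\beta\ell}T^{nk}\int_{\mathcal{W}^{(n)}_{k,\ell}}F(X^{\mathbf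 t})\,\mathrm{d}\mathbf t+\sum_{A\subseteq\mathbb{Z}_n}\tfrac12(-1)^{\theta_2+n+\#A+1}e^{-\beta\#A}F(X\equiv A),$$ where $X^{\mathbf t}$ is the occupation process of the bead configuration $\mathbf t$. Then $\mathbf{P}_n^{\beta,\theta_2,T}:=\mathbf{Q}/\mathbf{Q}(1)$ (the total mass $\mathbf{Q}(1)$ is nonzero when $\beta+Tz\notin2\pi\iota\mathbb{Z}$ for all $z^n=(-1)^{\theta_2}$). Mixed correlation functions of a complex measure $\mathbf{P}$ on occupation processes: for $w_i=(\alpha_i,y_i)$, $\alpha_i\in\{b,o,u\}$ (bead, occupied, unoccupied), let $\mathcal{B},\mathcal{O},\mathcal{U}$ be the sets of $i$ with $\alpha_i=b,o,u$ respectively. Then $p_N$ is defined via $$p_N(w_1,\ldots,w_N)\prod_{i\in\mathcal{B}}\mathrm{d}y_i=\mathbf{P}\big(\text{each }\mathrm{d}y_i,\ i\in\mathcal{B},\text{ contains a bead; each }y_i,\ i\in\mathcal{O},\text{ is occupied; each }y_i,\ i\in\mathcal{U},\text{ is unoccupied}\big).$$ Finally $c_\theta^{\lambda,n}:=\frac12(-1)^{(\theta_1+1)(\theta_2+n+1)}(1-(-1)^{\theta_1}e^{-\lambda})^n$; $C^{\beta,\theta_2}((t,h),(t',h')):=e^{\theta_2\pi\iota/n}\mathbf{1}_{\{h'=h+1\}}\frac{e^{-\beta(t'-t+\mathbf{1}_{\{t'<t\}})}}{1-e^{-\beta}}$; and $\det(I+TC):=\sum_{N\ge0}\frac{T^N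}{N!}\int_{\mathbb{T}_n^N}\det_{i,j=1}^NC(y_i,y_j)\,\mathrm{d}y_1\cdots\mathrm{d}y_N$.
   Formalization: Correlation formula: n ≥ 2 (at n=1 no jump is a bead, yet H_b(0) ≠ 0), distinct occupied/unoccupied points (a repeat makes the determinant 0), density a.e. in beads. Affine part: T ≥ 0, λ ≠ 0 (C undefined at λ=0) and the non-degeneracy condition for all four θ. *)

theory Defs
  imports "HOL-Probability.Probability" "Jordan_Normal_Form.Determinant"
begin

text \<open>String labels in \<open>\<int>\<^sub>n\<close> are the natural numbers below \<open>n\<close>; the neighbours of \<open>h\<close> are
  \<open>Suc h mod n\<close> and \<open>(h + n - 1) mod n\<close>.\<close>

section \<open>Bead configurations\<close>

definition torus :: "nat \<Rightarrow> (real \<times> nat) measure" where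
  "torus n = restrict_space lborel {0..<1} \<Otimes>\<^sub>M count_space {..<n}"

definition array_lebesgue :: "nat \<Rightarrow> nat \<Rightarrow> (nat \<times> nat \<Rightarrow> real) measure" where
  "array_lebesgue n k = (\<Pi>\<^sub>M hj \<in> {..<n} \<times> {..<k}. lborel)"

text \<open>The two interlacing patterns of the coordinates \<open>s\<close> on a string and \<open>s'\<close> on the next one:
  either \<open>s\<^sub>0 \<le> s'\<^sub>0 < s\<^sub>1 \<le> s'\<^sub>1 < \<dots>\<close> or \<open>s'\<^sub>0 < s\<^sub>0 \<le> s'\<^sub>1 < s\<^sub>1 \<le> \<dots>\<close>.\<close>

definition interlacing :: "nat \<Rightarrow> (nat \<Rightarrow> real) \<Rightarrow> (nat \<Rightarrow> real) \<Rightarrow> bool" where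
  "interlacing k s s' \<longleftrightarrow>
     (\<forall>j<k. s j \<le> s' j) \<and> (\<forall>j. Suc j < k \<longrightarrow> s' j < s (Suc j)) \<or>
     (\<forall>j<k. s' j < s j) \<and> (\<forall>j. Suc j < k \<longrightarrow> s j \<le> s' (Suc j))"

text \<open>A configuration is identified with its array: \<open>t (h, j)\<close> is the \<open>j\<close>-th smallest coordinate
  on string \<open>h\<close>, counting \<open>j\<close> from \<open>0\<close>.\<close>

definition bead_arrays :: "nat \<Rightarrow> nat \<Rightarrow> (nat \<times> nat \<Rightarrow> real) set" where
  "bead_arrays n k =
     {t \<in> {..<n} \<times> {..<k} \<rightarrow>\<^sub>E {0..<1}.
        (\<forall>h<n. (\<forall>j. Suc j < k \<longrightarrow> t (h, j) < t (h, Suc j)) \<and>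
               interlacing k (\<lambda>j. t (h, j)) (\<lambda>j. t (Suc h mod n, j)))}"

definition occupation_number :: "nat \<Rightarrow> (nat \<times> nat \<Rightarrow> real) \<Rightarrow> nat" where
  "occupation_number n t = card {h. h < n \<and> t (h, 0) < t ((h + n - 1) mod n, 0)}"

definition W :: "nat \<Rightarrow> nat \<Rightarrow> nat \<Rightarrow> (nat \<times> nat \<Rightarrow> real) set" where
  "W n k l = {t \<in> bead_arrays n k. occupation_number n t = l}"

definition Vol :: "nat \<Rightarrow> nat \<Rightarrow> nat \<Rightarrow> real" where
  "Vol n k l = (if k = 0 then real (n choose l) else measure (array_lebesgue n k) (W n k l))"

definition Z :: "nat \<Rightarrow> real \<Rightarrow> real \<Rightarrow> real" where
  "Z n lam T = (\<Sum>k. \<Sum>l\<le>n. T ^ (n * k) * exp (- lam * real l) * Vol n k l)"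

section \<open>Occupation processes\<close>

text \<open>The argument \<open>frac (t + s)\<close> makes continuity and left limits refer to the circle \<open>[0,1)\<close>,
  so that the left limit at \<open>0\<close> is taken at \<open>1-\<close>.\<close>

definition discontinuity :: "(real \<Rightarrow> nat set) \<Rightarrow> real \<Rightarrow> bool" where
  "discontinuity X t \<longleftrightarrow> \<not> (\<forall>\<^sub>F s in at 0. X (frac (t + s)) = X t)"

definition left_limit :: "(real \<Rightarrow> nat set) \<Rightarrow> real \<Rightarrow> nat set" where
  "left_limit X t = (THE A. \<forall>\<^sub>F s in at_left 0. X (frac (t + s)) = A)"

definition occupation_processes :: "nat \<Rightarrow> (real \<Rightarrow> nat set) set" where
  "occupation_processes n =
     {X \<in> {0..<1} \<rightarrow>\<^sub>E Pow {..<n}.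
        (\<forall>t\<in>{0..<1}. \<forall>\<^sub>F s in at_right 0. X (frac (t + s)) = X t) \<and>
        finite {t \<in> {0..<1}. discontinuity X t}}"

text \<open>The sigma algebra is the one generated by the evaluations \<open>X \<mapsto> X t\<close>; only the underlying
  space and sigma algebra of this measure are used.\<close>

definition process_space :: "nat \<Rightarrow> (real \<Rightarrow> nat set) measure" where
  "process_space n =
     restrict_space (\<Pi>\<^sub>M t \<in> {0..<1}. count_space (Pow {..<n})) (occupation_processes n)"

definition beads :: "nat \<Rightarrow> (real \<Rightarrow> nat set) \<Rightarrow> (real \<times> nat) set" where
  "beads n X = {(t, h). t \<in> {0..<1} \<and> h < n \<and> discontinuity X t \<and>
                        X t = (left_limit X t - {h}) \<union> {Suc h mod n}}"

text \<open>Distance moving right cyclically from \<open>t\<close> to the first bead met on string \<open>h\<close>. A bead at \<open>t\<close>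
  itself counts as being at distance \<open>1\<close>; away from the coordinates of the beads this changes
  nothing, and at these coordinates it yields the right-continuous extension.\<close>

definition first_bead :: "nat \<Rightarrow> (nat \<times> nat \<Rightarrow> real) \<Rightarrow> real \<Rightarrow> nat \<Rightarrow> real" where
  "first_bead k b t h = Min ((\<lambda>j. b (h, j) - t + of_bool (b (h, j) \<le> t)) ` {..<k})"

definition occupation_process :: "nat \<Rightarrow> nat \<Rightarrow> (nat \<times> nat \<Rightarrow> real) \<Rightarrow> real \<Rightarrow> nat set" where
  "occupation_process n k b =
     (\<lambda>t\<in>{0..<1}. {h. h < n \<and> first_bead k b t h < first_bead k b t ((h + n - 1) mod n)})"

definition constant_process :: "nat set \<Rightarrow> real \<Rightarrow> nat set" where
  "constant_process A = (\<lambda>t\<in>{0..<1}. A)"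

section \<open>The probability measure\<close>

definition conditional_law :: "nat \<Rightarrow> nat \<Rightarrow> nat \<Rightarrow> (real \<Rightarrow> nat set) measure" where
  "conditional_law n k l =
     (if k = 0
      then distr (uniform_count_measure {A. A \<subseteq> {..<n} \<and> card A = l})
             (process_space n) constant_process
      else distr (uniform_measure (array_lebesgue n k) (W n k l))
             (process_space n) (occupation_process n k))"

definition bead_law :: "nat \<Rightarrow> real \<Rightarrow> real \<Rightarrow> (real \<Rightarrow> nat set) measure" where
  "bead_law n lam T =
     measure_of (space (process_space n)) (sets (process_space n))
       (\<lambda>E. \<Sum>k. \<Sum>l\<le>n. ennreal (T ^ (n * k) * exp (- lam * real l) * Vol n k l / Z n lam T)
                        * emeasure (conditional_law n k l) E)"

section \<open>Complex measures\<close>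

definition complex_prob :: "'a measure \<Rightarrow> ('a set \<Rightarrow> complex) \<Rightarrow> bool" where
  "complex_prob M \<mu> \<longleftrightarrow>
     (\<forall>A :: nat \<Rightarrow> 'a set. range A \<subseteq> sets M \<longrightarrow> disjoint_family A \<longrightarrow>
        (\<lambda>i. \<mu> (A i)) sums \<mu> (\<Union>i. A i)) \<and>
     \<mu> (space M) = 1"

definition signed_prob :: "'a measure \<Rightarrow> ('a set \<Rightarrow> complex) \<Rightarrow> bool" where
  "signed_prob M \<mu> \<longleftrightarrow> complex_prob M \<mu> \<and> (\<forall>E\<in>sets M. \<mu> E \<in> \<real>)"

definition Q :: "nat \<Rightarrow> complex \<Rightarrow> nat \<Rightarrow> complex \<Rightarrow> ((real \<Rightarrow> nat set) \<Rightarrow> complex) \<Rightarrow> complex" where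
  "Q n \<beta> \<theta>2 T F =
     (\<Sum>i. let k = Suc i in \<Sum>l\<le>n.
        1 / 2 * (-1) ^ ((k + 1) * (\<theta>2 + n + l + 1)) * exp (- \<beta> * of_nat l) * T ^ (n * k) *
        (LINT b:W n k l|array_lebesgue n k. F (occupation_process n k b))) +
     (\<Sum>A\<in>Pow {..<n}.
        1 / 2 * (-1) ^ (\<theta>2 + n + card A + 1) * exp (- \<beta> * of_nat (card A)) *
        F (constant_process A))"

definition P :: "nat \<Rightarrow> complex \<Rightarrow> nat \<Rightarrow> complex \<Rightarrow> (real \<Rightarrow> nat set) set \<Rightarrow> complex" where
  "P n \<beta> \<theta>2 T E = Q n \<beta> \<theta>2 T (indicator E) / Q n \<beta> \<theta>2 T (\<lambda>X. 1)"

definition nondegenerate :: "nat \<Rightarrow> complex \<Rightarrow> nat \<Rightarrow> complex \<Rightarrow> bool" where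
  "nondegenerate n \<beta> \<theta>2 T \<longleftrightarrow>
     (\<forall>z. z ^ n = (-1) ^ \<theta>2 \<longrightarrow> \<beta> + T * z \<notin> range (\<lambda>m::int. 2 * of_real pi * \<i> * of_int m))"

section \<open>Mixed correlation functions\<close>

datatype kind = Bead | Occupied | Unoccupied

definition has_expectation ::
    "'a measure \<Rightarrow> ('a set \<Rightarrow> complex) \<Rightarrow> ('a \<Rightarrow> nat) \<Rightarrow> complex \<Rightarrow> bool" where
  "has_expectation M \<mu> F e \<longleftrightarrow> (\<lambda>m. of_nat m * \<mu> {X \<in> space M. F X = m}) sums e"

text \<open>\<open>p\<close> is a density in the bead variables, as usual for correlation functions: for fixed
  (pairwise distinct) points required to be occupied or unoccupied, the measure on \<open>B\<close>-indexed
  families of points whose mass on \<open>D\<close> is the expected number of families of distinct beads lying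
  in \<open>D\<close>, on the event prescribed at the fixed points, has density \<open>p\<close>. Distinctness of the fixed
  points is needed for determinantal formulas, since repeating an occupied point produces two
  equal rows without changing the event.\<close>

definition mixed_correlation ::
    "nat \<Rightarrow> ((real \<Rightarrow> nat set) set \<Rightarrow> complex) \<Rightarrow> nat \<Rightarrow>
     ((nat \<Rightarrow> kind \<times> (real \<times> nat)) \<Rightarrow> complex) \<Rightarrow> bool" where
  "mixed_correlation n \<mu> N p \<longleftrightarrow>
     (\<forall>\<alpha> :: nat \<Rightarrow> kind. \<forall>y :: nat \<Rightarrow> real \<times> nat.
        let B = {i. i < N \<and> \<alpha> i = Bead};
            event = {X. \<forall>i<N. (\<alpha> i = Occupied \<longrightarrow> snd (y i) \<in> X (fst (y i))) \<and>
                              (\<alpha> i = Unoccupied \<longrightarrow> snd (y i) \<notin> X (fst (y i)))};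
            density = (\<lambda>x. p (\<lambda>i. (\<alpha> i, if i \<in> B then x i else y i)))
        in y ` ({..<N} - B) \<subseteq> {0..<1} \<times> {..<n} \<longrightarrow> inj_on y ({..<N} - B) \<longrightarrow>
           integrable (\<Pi>\<^sub>M i \<in> B. torus n) density \<and>
           (\<forall>D \<in> sets (\<Pi>\<^sub>M i \<in> B. torus n).
              has_expectation (process_space n) \<mu>
                (\<lambda>X. if X \<in> event
                     then card {x \<in> B \<rightarrow>\<^sub>E beads n X. inj_on x B \<and> x \<in> D} else 0)
                (LINT x:D|(\<Pi>\<^sub>M i \<in> B. torus n). density x)))"

definition bracket :: "kind \<Rightarrow> real \<Rightarrow> real" where
  "bracket \<alpha> t = t + of_bool (t < 0) + of_bool (\<alpha> = Occupied) * of_bool (t = 0)"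

definition H :: "nat \<Rightarrow> complex \<Rightarrow> nat \<Rightarrow> complex \<Rightarrow> kind \<Rightarrow> real \<times> int \<Rightarrow> complex" where
  "H n \<beta> \<theta>2 T \<alpha> = (\<lambda>(t, h).
     (-1) ^ of_bool (\<alpha> = Occupied) * T ^ of_bool (\<alpha> = Bead) / of_nat n *
     (\<Sum>z | z ^ n = (-1) ^ \<theta>2.
        z powi (of_bool (\<alpha> = Bead) - h) *
        (exp (- (\<beta> + T * z) * of_real (bracket \<alpha> t)) / (1 - exp (- (\<beta> + T * z))))))"

definition difference :: "real \<times> nat \<Rightarrow> real \<times> nat \<Rightarrow> real \<times> int" where
  "difference y' y = (fst y' - fst y, int (snd y') - int (snd y))"

section \<open>Partition functions as Fredholm determinants\<close>

definition C :: "nat \<Rightarrow> complex \<Rightarrow> nat \<Rightarrow> real \<times> nat \<Rightarrow> real \<times> nat \<Rightarrow> complex" where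
  "C n \<beta> \<theta>2 = (\<lambda>(t, h) (t', h').
     exp (of_nat \<theta>2 * of_real pi * \<i> / of_nat n) * of_bool (h' = Suc h mod n) *
     (exp (- \<beta> * of_real (t' - t + of_bool (t' < t))) / (1 - exp (- \<beta>))))"

definition fredholm_det ::
    "nat \<Rightarrow> complex \<Rightarrow> (real \<times> nat \<Rightarrow> real \<times> nat \<Rightarrow> complex) \<Rightarrow> complex" where
  "fredholm_det n T K =
     (\<Sum>N. T ^ N / fact N *
        (LINT y|(\<Pi>\<^sub>M i \<in> {..<N}. torus n). Determinant.det (Matrix.mat N N (\<lambda>(i, j). K (y i) (y j)))))"

definition Z_theta :: "nat \<Rightarrow> nat \<Rightarrow> nat \<Rightarrow> real \<Rightarrow> real \<Rightarrow> complex" where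
  "Z_theta n \<theta>1 \<theta>2 lam T =
     1 / 2 * (-1) ^ ((\<theta>1 + 1) * (\<theta>2 + n + 1)) * of_real ((1 - (-1) ^ \<theta>1 * exp (- lam)) ^ n) *
     fredholm_det n (of_real T) (C n (of_real lam + of_nat \<theta>1 * of_real pi * \<i>) \<theta>2)"

end

theory Submission
  imports Defs "HOL-Complex_Analysis.Conformal_Mappings"
begin

text \<open>For \<open>T = 0\<close> the determinant of the kernel matrix of a sorted array of beads is explicit: row
  operations reduce it to a block-diagonal staircase determinant, which vanishes unless the array
  is a bead configuration and otherwise equals the weight of that configuration in \<open>Q\<close>; rows of
  occupied and unoccupied points multiply it by the indicator of the prescribed event. Let \<open>g\<^sub>m(T)\<close>
  be the integral, over \<open>m\<close> extra bead variables, of the determinant of the kernel at \<open>T\<close> times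
  \<open>\<Prod>\<^sub>z (e\<^bsup>Tz\<^esup> - e\<^bsup>-\<beta>\<^esup>)\<close>. Expanding along the new row and column gives \<open>g\<^sub>m' = g\<^sub>m\<^sub>+\<^sub>1\<close>, so the Taylor
  coefficients of \<open>g\<^sub>0\<close> at \<open>0\<close> are integrals of determinants at \<open>T = 0\<close>, that is, the
  coefficients of the \<open>Q\<close>-expectation as a power series in \<open>T\<close>. Analytic continuation within the
  connected set of nondegenerate \<open>T\<close> identifies the two, without any Fredholm theory. The affine
  combination holds coefficientwise, because half the sum of \<open>(-1)\<^bsup>ab\<^esup>\<close> over the parities of
  \<open>a\<close> and \<open>b\<close> is \<open>1\<close>.\<close>

section \<open>Determinants over finite index sets\<close>

text \<open>Write K_T for the bead kernel without the factor T. It is the resolvent K_0 (I + T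
  K_0)^(-1), and \<open>partition_det\<close> is the Fredholm determinant of K_0 cleared of its
  denominator (1 - exp (- \<beta>)) ^ n. So the derivative of K_T in T is minus its square, and the
  logarithmic derivative of the determinant is its trace. Both are finite computations, since the
  kernels are diagonal in the roots z, and the recursion for the g's needs nothing else. K_0 is
  sparse: a bead row meets only the next string. This forces the signs of \<open>Q\<close>: (-1) ^
  (k * \<theta>) is the twist at the seam between the last and the first string, (-1) ^ (k * (n -
  1)) the sign of the cyclic shift of the strings, and (-1) ^ (k - 1) the price of each string whose
  first bead precedes that of the previous string. The continuation in T needs an entire series,
  which follows from the bound n^(nk) / (nk)! for the volumes. Where bead times coincide, the
  process can lose beads of its array; counts are therefore computed from array positions first and
  transferred to the process almost everywhere. For n = 1 the process does not see beads at all,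
  whence 2 \<le> n for correlations.\<close>

definition fdet :: "'i set \<Rightarrow> ('i \<Rightarrow> 'i \<Rightarrow> 'a::comm_ring_1) \<Rightarrow> 'a" where
  "fdet I A = (\<Sum>p | p permutes I. of_int (sign p) * (\<Prod>i\<in>I. A i (p i)))"

text \<open>Numbered matrices occur only in the statements to be proved. Inside, rows are indexed by
  pairs of string and rank, by a sum of such pairs and marks, or by a union of bead variables and
  marks, and no numbering has to be chosen.\<close>

lemma det_mat_eq_fdet:
  "Determinant.det (Matrix.mat N N (\<lambda>(i, j). A i j)) = fdet {..<N} A"
proof -
  have "Determinant.det (Matrix.mat N N (\<lambda>(i, j). A i j)) =
     (\<Sum>p | p permutes {0..<N}. signof p * (\<Prod>i=0..<N. Matrix.mat N N (\<lambda>(i, j). A i j) $$ (i, p i)))"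
    by (simp add: Determinant.det_def)
  also have "\<dots> = (\<Sum>p | p permutes {0..<N}. of_int (sign p) * (\<Prod>i=0..<N. A i (p i)))"
  proof (intro sum.cong refl arg_cong2[where f="(*)"] prod.cong)
    fix p i assume "p \<in> {p. p permutes {0..<N}}" "i \<in> {0..<N}"
    then show "Matrix.mat N N (\<lambda>(i, j). A i j) $$ (i, p i) = A i (p i)"
      using permutes_in_image[of p "{0..<N}" i] by simp
  qed
  finally show ?thesis by (simp add: fdet_def atLeast0LessThan)
qed

lemma fdet_cong:
  assumes "I = J" "\<And>i j. i \<in> J \<Longrightarrow> j \<in> J \<Longrightarrow> A i j = B i j"
  shows "fdet I A = fdet J B"
  unfolding fdet_def using assms by (auto intro!: sum.cong prod.cong simp: permutes_in_image)

lemma fdet_empty [simp]: "fdet {} A = 1"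
  by (simp add: fdet_def)

lemma fdet_reindex:
  fixes f :: "'i \<Rightarrow> 'j" and A :: "'j \<Rightarrow> 'j \<Rightarrow> 'a::comm_ring_1"
  assumes "bij_betw f I J" "finite I"
  shows "fdet J A = fdet I (\<lambda>i j. A (f i) (f j))"
proof -
  have inj: "inj_on f I" and J: "J = f ` I" using assms(1) by (auto simp: bij_betw_def)
  let ?\<Phi> = "map_permutation I f"
  have \<Phi>: "?\<Phi> p = (\<lambda>x. if x \<in> J then f (p (inv_into I f x)) else x)" for p
    by (auto simp: map_permutation_def restrict_id_def J)
  have "bij_betw ?\<Phi> {p. p permutes I} {p. p permutes J}"
    unfolding \<Phi> by (rule bij_betw_permutations[OF assms(1)])
  then have "fdet J A = (\<Sum>p | p permutes I. of_int (sign (?\<Phi> p)) * (\<Prod>j\<in>J. A j (?\<Phi> p j)))"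
    unfolding fdet_def by (rule sum.reindex_bij_betw[symmetric])
  also have "\<dots> = (\<Sum>p | p permutes I. of_int (sign p) * (\<Prod>i\<in>I. A (f i) (f (p i))))"
  proof (intro sum.cong refl arg_cong2[where f="(*)"])
    fix p assume "p \<in> {p. p permutes I}"
    then have p: "p permutes I" by simp
    show "of_int (sign (?\<Phi> p)) = (of_int (sign p) :: 'a)"
      using sign_map_permutation[OF inj p assms(2)] by simp
    have "(\<Prod>j\<in>J. A j (?\<Phi> p j)) = (\<Prod>i\<in>I. A (f i) (?\<Phi> p (f i)))"
      using assms(1) by (rule prod.reindex_bij_betw[symmetric])
    also have "\<dots> = (\<Prod>i\<in>I. A (f i) (f (p i)))"
      by (intro prod.cong refl) (simp add: \<Phi> J inj)
    finally show "(\<Prod>j\<in>J. A j (?\<Phi> p j)) = (\<Prod>i\<in>I. A (f i) (f (p i)))" .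
  qed
  finally show ?thesis by (simp add: fdet_def)
qed

lemma fdet_transpose:
  fixes A :: "'i \<Rightarrow> 'i \<Rightarrow> 'a::comm_ring_1"
  assumes "finite I"
  shows "fdet I (\<lambda>i j. A j i) = fdet I A"
proof -
  have "fdet I (\<lambda>i j. A j i) = (\<Sum>p | p permutes I. of_int (sign (inv_into UNIV p)) * (\<Prod>i\<in>I. A (inv_into UNIV p i) i))"
    unfolding fdet_def by (rule sum_permutations_inverse)
  also have "\<dots> = (\<Sum>p | p permutes I. of_int (sign p) * (\<Prod>i\<in>I. A i (p i)))"
  proof (intro sum.cong refl arg_cong2[where f="(*)"])
    fix p assume "p \<in> {p. p permutes I}"
    then have p: "p permutes I" by simp
    then show "of_int (sign (inv_into UNIV p)) = (of_int (sign p) :: 'a)"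
      using assms by (metis permutation_permutes sign_inverse)
    show "(\<Prod>i\<in>I. A (inv_into UNIV p i) i) = (\<Prod>i\<in>I. A i (p i))"
      using p by (subst prod.permute[OF p]) (auto simp: permutes_inverses o_def)
  qed
  finally show ?thesis by (simp add: fdet_def)
qed

lemma fdet_permute_rows:
  assumes "finite I" "q permutes I"
  shows "fdet I (\<lambda>i. A (q i)) = of_int (sign q) * fdet I A"
proof -
  have "fdet I (\<lambda>i. A (q i)) = (\<Sum>p | p permutes I. of_int (sign (p \<circ> q)) * (\<Prod>i\<in>I. A (q i) ((p \<circ> q) i)))"
    unfolding fdet_def by (rule sum_permutations_compose_right[OF assms(2)])
  also have "\<dots> = (\<Sum>p | p permutes I. of_int (sign q) * (of_int (sign p) * (\<Prod>i\<in>I. A i (p i))))"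
  proof (intro sum.cong refl)
    fix p assume "p \<in> {p. p permutes I}"
    then have p: "p permutes I" by simp
    have "sign (p \<circ> q) = sign p * sign q"
      using assms p by (metis permutation_permutes sign_compose)
    moreover have "(\<Prod>i\<in>I. A (q i) ((p \<circ> q) i)) = (\<Prod>i\<in>I. A i (p i))"
      by (subst prod.permute[OF assms(2), of "\<lambda>i. A i (p i)"]) (simp add: o_def)
    ultimately show "of_int (sign (p \<circ> q)) * (\<Prod>i\<in>I. A (q i) ((p \<circ> q) i)) =
       of_int (sign q) * (of_int (sign p) * (\<Prod>i\<in>I. A i (p i)))" by simp
  qed
  finally show ?thesis by (simp add: fdet_def sum_distrib_left)
qed

lemma fdet_row_add:
  assumes "finite I" "i \<in> I"
  shows "fdet I (A(i := \<lambda>j. u j + c * v j)) = fdet I (A(i := u)) + c * fdet I (A(i := v))"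
proof -
  have *: "(\<Prod>k\<in>I. (A(i := w)) k (p k)) = w (p i) * (\<Prod>k\<in>I - {i}. A k (p k))" for w p
    using assms by (subst prod.remove[of I i]) (auto intro!: prod.cong)
  show ?thesis
    unfolding fdet_def * by (simp add: algebra_simps sum.distrib sum_distrib_left)
qed

lemma fdet_row_sum:
  assumes "finite I" "i \<in> I" "finite S"
  shows "fdet I (A(i := \<lambda>j. \<Sum>s\<in>S. c s * v s j)) = (\<Sum>s\<in>S. c s * fdet I (A(i := v s)))"
proof -
  have *: "(\<Prod>k\<in>I. (A(i := w)) k (p k)) = w (p i) * (\<Prod>k\<in>I - {i}. A k (p k))" for w p
    using assms by (subst prod.remove[of I i]) (auto intro!: prod.cong)
  show ?thesis
    unfolding fdet_def * sum_distrib_left sum_distrib_right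
    by (subst sum.swap) (simp add: algebra_simps)
qed

lemma fdet_row_scale:
  assumes "finite I" "i \<in> I"
  shows "fdet I (A(i := \<lambda>j. c * v j)) = c * fdet I (A(i := v))"
  using fdet_row_sum[OF assms, of "{()}" A "\<lambda>_. c" "\<lambda>_. v"] by simp

lemma fdet_scale_rows:
  assumes "finite I"
  shows "fdet I (\<lambda>i j. c i * A i j) = (\<Prod>i\<in>I. c i) * fdet I A"
  unfolding fdet_def by (simp add: prod.distrib sum_distrib_left mult_ac)

lemma fdet_scale_cols:
  assumes "finite I"
  shows "fdet I (\<lambda>i j. c j * A i j) = (\<Prod>i\<in>I. c i) * fdet I A"
  using fdet_scale_rows[OF assms, of c "\<lambda>i j. A j i"] fdet_transpose[OF assms, of A]
    fdet_transpose[OF assms, of "\<lambda>i j. c j * A i j"] by simp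

lemma fdet_eq_rows:
  fixes A :: "'i \<Rightarrow> 'i \<Rightarrow> 'a::{comm_ring_1,ring_char_0,ring_no_zero_divisors}"
  assumes "finite I" "i \<in> I" "k \<in> I" "i \<noteq> k" "\<And>j. j \<in> I \<Longrightarrow> A i j = A k j"
  shows "fdet I A = 0"
proof -
  let ?q = "Transposition.transpose i k"
  have q: "?q permutes I" using assms by (simp add: permutes_swap_id)
  have "fdet I (\<lambda>i. A (?q i)) = - fdet I A"
    using fdet_permute_rows[OF assms(1) q, of A] assms(4) by (simp add: sign_swap_id)
  moreover have "fdet I (\<lambda>i. A (?q i)) = fdet I A"
    using assms by (intro fdet_cong) (auto simp: Transposition.transpose_def)
  ultimately have eq: "fdet I A = - fdet I A" by metis
  have "2 * fdet I A = fdet I A + fdet I A" by (rule mult_2)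
  also have "\<dots> = - fdet I A + fdet I A" using eq by (rule arg_cong)
  also have "\<dots> = 0" by (rule left_minus)
  finally have "2 * fdet I A = 0" .
  then have "(2::'a) = 0 \<or> fdet I A = 0" by (rule mult_eq_0_iff[THEN iffD1])
  then show ?thesis using zero_neq_numeral[of "num.Bit0 num.One", where 'a='a] by metis
qed

lemma fdet_prop_rows:
  fixes A :: "'i \<Rightarrow> 'i \<Rightarrow> 'a::{comm_ring_1,ring_char_0,ring_no_zero_divisors}"
  assumes "finite I" "i \<in> I" "k \<in> I" "i \<noteq> k" "\<And>j. j \<in> I \<Longrightarrow> A i j = c * A k j"
  shows "fdet I A = 0"
proof -
  have "fdet I A = fdet I (A(i := \<lambda>j. c * A k j))"
    using assms by (intro fdet_cong) auto
  also have "\<dots> = c * fdet I (A(i := A k))" by (rule fdet_row_scale) fact+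
  also have "fdet I (A(i := A k)) = 0"
    by (rule fdet_eq_rows[OF assms(1-4)]) (use assms(4) in auto)
  finally show ?thesis by simp
qed

lemma fdet_row_op:
  fixes A :: "'i \<Rightarrow> 'i \<Rightarrow> 'a::{comm_ring_1,ring_char_0,ring_no_zero_divisors}"
  assumes "finite I" "i \<in> I" "k \<in> I" "i \<noteq> k"
  shows "fdet I (A(i := \<lambda>j. A i j + c * A k j)) = fdet I A"
proof -
  have "fdet I (A(i := A k)) = 0"
    by (rule fdet_eq_rows[OF assms(1-4)]) (use assms(4) in auto)
  then show ?thesis using fdet_row_add[OF assms(1,2), of A "A i" c "A k"] by simp
qed

lemma fdet_zero_row:
  assumes "finite I" "i \<in> I" "\<And>j. j \<in> I \<Longrightarrow> A i j = 0"
  shows "fdet I A = 0"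
  unfolding fdet_def
proof (intro sum.neutral ballI)
  fix p assume "p \<in> {p. p permutes I}"
  then have "p i \<in> I" using assms(2) by (simp add: permutes_in_image)
  then have "(\<Prod>i\<in>I. A i (p i)) = 0" using assms by (intro prod_zero) auto
  then show "of_int (sign p) * (\<Prod>i\<in>I. A i (p i)) = 0" by simp
qed

text \<open>A permutation of \<open>insert x I\<close> is a permutation of I combined with a
  transposition of x and some b. Expressing the minors as determinants with one row replaced,
  instead of cofactors, makes the terms comparable with the derivative of a determinant taken row by
  row.\<close>

lemma fdet_insert:
  assumes "finite I" "x \<notin> I"
  shows "fdet (insert x I) A = A x x * fdet I A - (\<Sum>i\<in>I. A i x * fdet I (A(i := A x)))"
proof -
  let ?P = "{p. p permutes I}"
  \<comment> \<open>The decomposition of permutations puts the transposition on the left. Passing to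
    inverses, here and once more for q, makes it act on the row index.\<close>
  define g where "g p = of_int (sign (inv_into UNIV p)) * (\<Prod>i\<in>insert x I. A i (inv_into UNIV p i))" for p
  have "fdet (insert x I) A = (\<Sum>p | p permutes insert x I. g p)"
    unfolding fdet_def g_def by (rule sum_permutations_inverse)
  also have "\<dots> = (\<Sum>b\<in>insert x I. \<Sum>q\<in>?P. g (Transposition.transpose x b \<circ> q))"
    by (rule sum_over_permutations_insert[OF assms, of g])
  also have "\<dots> = (\<Sum>b\<in>insert x I. \<Sum>q\<in>?P. g (Transposition.transpose x b \<circ> inv_into UNIV q))"
  proof (rule sum.cong[OF refl])
    fix b
    show "(\<Sum>q\<in>?P. g (Transposition.transpose x b \<circ> q)) = (\<Sum>q\<in>?P. g (Transposition.transpose x b \<circ> inv_into UNIV q))"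
      by (rule sum_permutations_inverse[of "\<lambda>q. g (Transposition.transpose x b \<circ> q)"])
  qed
  also have "\<dots> = (\<Sum>b\<in>insert x I. \<Sum>q\<in>?P. of_int (sign (Transposition.transpose x b) * sign q) *
       (\<Prod>i\<in>insert x I. A i (q (Transposition.transpose x b i))))"
  proof (intro sum.cong refl)
    fix b q assume b: "b \<in> insert x I" and "q \<in> ?P"
    then have q: "q permutes I" by simp
    have t: "Transposition.transpose x b permutes insert x I"
      using b by (intro permutes_swap_id) auto
    have iq: "inv_into UNIV q permutes I" using q by (rule permutes_inv)
    have "bij (Transposition.transpose x b)" "bij (inv_into UNIV q)"
      using t iq by (auto intro: permutes_bij)
    then have "inv_into UNIV (Transposition.transpose x b \<circ> inv_into UNIV q) =
        inv_into UNIV (inv_into UNIV q) \<circ> inv_into UNIV (Transposition.transpose x b)"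
      by (rule o_inv_distrib)
    then have 1: "inv_into UNIV (Transposition.transpose x b \<circ> inv_into UNIV q) = q \<circ> Transposition.transpose x b"
      by (simp add: permutes_inv_inv[OF q] inv_transpose_eq)
    have "permutation q" "permutation (Transposition.transpose x b)"
      using assms(1) q t by (auto simp: permutation_permutes)
    then have "sign (q \<circ> Transposition.transpose x b) = sign (Transposition.transpose x b) * sign q"
      by (simp only: sign_compose mult.commute)
    then show "g (Transposition.transpose x b \<circ> inv_into UNIV q) =
      of_int (sign (Transposition.transpose x b) * sign q) *
       (\<Prod>i\<in>insert x I. A i (q (Transposition.transpose x b i)))"
      by (simp only: g_def 1 o_apply)
  qed
  also have "\<dots> = (\<Sum>q\<in>?P. of_int (sign q) * (A x x * (\<Prod>i\<in>I. A i (q i)))) +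
     (\<Sum>b\<in>I. \<Sum>q\<in>?P. - of_int (sign q) * (A b x * (\<Prod>i\<in>I. (A(b := A x)) i (q i))))"
  proof -
    have 1: "(\<Prod>i\<in>insert x I. A i (q (Transposition.transpose x x i))) = A x x * (\<Prod>i\<in>I. A i (q i))"
      if "q \<in> ?P" for q
      using that assms by (simp add: permutes_def)
    have 2: "(\<Prod>i\<in>insert x I. A i (q (Transposition.transpose x b i))) = A b x * (\<Prod>i\<in>I. (A(b := A x)) i (q i))"
      if "q \<in> ?P" "b \<in> I" for q b
    proof -
      have "b \<noteq> x" using that assms by auto
      have "(\<Prod>i\<in>insert x I. A i (q (Transposition.transpose x b i))) = A x (q b) * (\<Prod>i\<in>I. A i (q (Transposition.transpose x b i)))"
        using assms by simp
      also have "(\<Prod>i\<in>I. A i (q (Transposition.transpose x b i))) =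
          A b (q x) * (\<Prod>i\<in>I-{b}. A i (q (Transposition.transpose x b i)))"
        using assms that by (subst prod.remove[of I b]) auto
      also have "(\<Prod>i\<in>I-{b}. A i (q (Transposition.transpose x b i))) = (\<Prod>i\<in>I-{b}. A i (q i))"
        using assms by (intro prod.cong refl) (auto simp: Transposition.transpose_def)
      also have "q x = x" using that assms by (simp add: permutes_def)
      also have "(\<Prod>i\<in>I-{b}. A i (q i)) = (\<Prod>i\<in>I-{b}. (A(b := A x)) i (q i))"
        by (intro prod.cong) auto
      finally have "(\<Prod>i\<in>insert x I. A i (q (Transposition.transpose x b i))) =
          A x (q b) * (A b x * (\<Prod>i\<in>I-{b}. (A(b := A x)) i (q i)))" .
      also have "\<dots> = A b x * ((A(b := A x)) b (q b) * (\<Prod>i\<in>I-{b}. (A(b := A x)) i (q i)))"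
        by simp
      also have "\<dots> = A b x * (\<Prod>i\<in>I. (A(b := A x)) i (q i))"
        using assms that by (subst prod.remove[of I b]) auto
      finally show ?thesis .
    qed
    show ?thesis
      unfolding sum.insert[OF assms]
    proof (intro arg_cong2[where f="(+)"] sum.cong refl)
      fix q assume "q \<in> ?P"
      then show "of_int (sign (Transposition.transpose x x) * sign q) *
          (\<Prod>i\<in>insert x I. A i (q (Transposition.transpose x x i))) =
        of_int (sign q) * (A x x * (\<Prod>i\<in>I. A i (q i)))"
        by (simp only: 1) (simp add: sign_id)
    next
      fix b q assume "b \<in> I" "q \<in> ?P"
      moreover from this have "b \<noteq> x" using assms by auto
      ultimately show "of_int (sign (Transposition.transpose x b) * sign q) *
          (\<Prod>i\<in>insert x I. A i (q (Transposition.transpose x b i))) =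
        - of_int (sign q) * (A b x * (\<Prod>i\<in>I. (A(b := A x)) i (q i)))"
        by (simp only: 2) (simp add: sign_swap_id)
    qed
  qed
  also have "\<dots> = A x x * fdet I A - (\<Sum>i\<in>I. A i x * fdet I (A(i := A x)))"
    by (simp add: fdet_def sum_distrib_left sum_negf mult_ac)
  finally show ?thesis .
qed

lemma fdet_insert_unit_row:
  assumes "finite I" "x \<notin> I" "\<And>j. j \<in> I \<Longrightarrow> A x j = 0"
  shows "fdet (insert x I) A = A x x * fdet I A"
proof -
  have "fdet I (A(i := A x)) = 0" if "i \<in> I" for i
    using assms that by (intro fdet_zero_row[of _ i]) auto
  then show ?thesis using fdet_insert[OF assms(1,2), of A] by simp
qed

text \<open>Replacing a row of I by the row of x keeps the zero block, so the expansion along x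
  closes the induction with A arbitrary.\<close>

lemma fdet_Un_block:
  assumes "finite I" "finite J" "I \<inter> J = {}" "\<And>i j. j \<in> J \<Longrightarrow> i \<in> I \<Longrightarrow> A j i = 0"
  shows "fdet (I \<union> J) A = fdet I A * fdet J A"
  using assms
proof (induction I arbitrary: A rule: finite_induct)
  case empty
  then show ?case by simp
next
  case (insert x I)
  have xJ: "x \<notin> I \<union> J" using insert by auto
  have "fdet (insert x I \<union> J) A = A x x * fdet (I \<union> J) A - (\<Sum>i\<in>I \<union> J. A i x * fdet (I \<union> J) (A(i := A x)))"
    using fdet_insert[of "I \<union> J" x A] insert xJ by simp
  also have "(\<Sum>i\<in>I \<union> J. A i x * fdet (I \<union> J) (A(i := A x))) = (\<Sum>i\<in>I. A i x * fdet (I \<union> J) (A(i := A x)))"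
    using insert by (intro sum.mono_neutral_right) auto
  also have "\<dots> = (\<Sum>i\<in>I. A i x * (fdet I (A(i := A x)) * fdet J A))"
  proof (intro sum.cong refl arg_cong2[where f="(*)"])
    fix i assume i: "i \<in> I"
    have "fdet (I \<union> J) (A(i := A x)) = fdet I (A(i := A x)) * fdet J (A(i := A x))"
      using insert i by (intro insert.IH) auto
    also have "fdet J (A(i := A x)) = fdet J A"
      using insert i by (intro fdet_cong) auto
    finally show "fdet (I \<union> J) (A(i := A x)) = fdet I (A(i := A x)) * fdet J A" .
  qed
  also have "fdet (I \<union> J) A = fdet I A * fdet J A" using insert by auto
  also have "(\<Sum>i\<in>I. A i x * (fdet I (A(i := A x)) * fdet J A)) = (\<Sum>i\<in>I. A i x * fdet I (A(i := A x))) * fdet J A"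
    by (simp add: sum_distrib_right mult.assoc)
  also have "A x x * (fdet I A * fdet J A) - \<dots> = fdet (insert x I) A * fdet J A"
    using fdet_insert[of I x A] insert by (simp add: left_diff_distrib)
  finally show ?case .
qed

section \<open>Vanishing, bounds, measurability and derivatives of determinants\<close>

lemma fdet_zero_if_no_perm:
  assumes "finite I" "\<And>p. p permutes I \<Longrightarrow> \<exists>i\<in>I. A i (p i) = 0"
  shows "fdet I A = 0"
  unfolding fdet_def
proof (intro sum.neutral ballI)
  fix p assume "p \<in> {p. p permutes I}"
  then have "(\<Prod>i\<in>I. A i (p i)) = 0" using assms by (intro prod_zero) auto
  then show "of_int (sign p) * (\<Prod>i\<in>I. A i (p i)) = 0" by simp
qed

lemma norm_fdet_le:
  fixes A :: "'i \<Rightarrow> 'i \<Rightarrow> complex"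
  assumes "finite I" "\<And>i j. i \<in> I \<Longrightarrow> j \<in> I \<Longrightarrow> norm (A i j) \<le> M"
  shows "norm (fdet I A) \<le> fact (card I) * M ^ card I"
proof -
  have "norm (fdet I A) \<le> (\<Sum>p | p permutes I. norm (of_int (sign p) * (\<Prod>i\<in>I. A i (p i))))"
    unfolding fdet_def by (rule norm_sum)
  also have "\<dots> \<le> (\<Sum>p | p permutes I. M ^ card I)"
  proof (intro sum_mono)
    fix p assume "p \<in> {p. p permutes I}"
    then have p: "p i \<in> I" if "i \<in> I" for i using that by (simp add: permutes_in_image)
    have "norm (\<Prod>i\<in>I. A i (p i)) \<le> (\<Prod>i\<in>I. M)"
      unfolding prod_norm[symmetric] using assms p by (intro prod_mono) auto
    then show "norm (of_int (sign p) * (\<Prod>i\<in>I. A i (p i))) \<le> M ^ card I"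
      by (simp add: norm_mult sign_def)
  qed
  also have "\<dots> = fact (card I) * M ^ card I"
    using assms(1) by (simp add: card_permutations)
  finally show ?thesis .
qed

lemma measurable_fdet:
  fixes A :: "'x \<Rightarrow> 'i \<Rightarrow> 'i \<Rightarrow> complex"
  assumes "\<And>i j. i \<in> I \<Longrightarrow> j \<in> I \<Longrightarrow> (\<lambda>x. A x i j) \<in> borel_measurable M"
  shows "(\<lambda>x. fdet I (A x)) \<in> borel_measurable M"
  unfolding fdet_def
  by (intro borel_measurable_sum borel_measurable_times borel_measurable_const borel_measurable_prod)
     (auto intro!: assms simp: permutes_in_image)

lemma has_field_derivative_fdet:
  fixes A :: "complex \<Rightarrow> 'i \<Rightarrow> 'i \<Rightarrow> complex"
  assumes "finite I" "\<And>i j. i \<in> I \<Longrightarrow> j \<in> I \<Longrightarrow> ((\<lambda>T. A T i j) has_field_derivative A' i j) (at T)"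
  shows "((\<lambda>T. fdet I (A T)) has_field_derivative (\<Sum>i\<in>I. fdet I ((A T)(i := A' i)))) (at T)"
proof -
  have "((\<lambda>T. fdet I (A T)) has_field_derivative
     (\<Sum>p | p permutes I. of_int (sign p) * (\<Sum>i\<in>I. A' i (p i) * (\<Prod>k\<in>I - {i}. A T k (p k))))) (at T)"
    unfolding fdet_def
    by (intro DERIV_sum DERIV_cmult has_field_derivative_prod assms) (auto simp: permutes_in_image)
  also have "(\<Sum>p | p permutes I. of_int (sign p) * (\<Sum>i\<in>I. A' i (p i) * (\<Prod>k\<in>I - {i}. A T k (p k))))
     = (\<Sum>i\<in>I. fdet I ((A T)(i := A' i)))"
  proof -
    have *: "(\<Prod>k\<in>I. ((A T)(i := A' i)) k (p k)) = A' i (p i) * (\<Prod>k\<in>I - {i}. A T k (p k))" if "i \<in> I" for i p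
      using assms(1) that by (subst prod.remove[of I i]) (auto intro!: prod.cong)
    have "(\<Sum>i\<in>I. fdet I ((A T)(i := A' i))) =
        (\<Sum>i\<in>I. \<Sum>p | p permutes I. of_int (sign p) * (A' i (p i) * (\<Prod>k\<in>I - {i}. A T k (p k))))"
      unfolding fdet_def by (intro sum.cong refl arg_cong2[where f="(*)"] *)
    then show ?thesis unfolding sum_distrib_left by (subst sum.swap) simp
  qed
  finally show ?thesis .
qed

section \<open>Determinants of interlacing sequences\<close>

text \<open>For the transposed matrix, subtracting a row from the next one leaves a unit vector on
  the diagonal; only the corner 1 + a survives.\<close>

lemma fdet_staircase:
  fixes a :: complex
  shows "fdet {..<Suc k} (\<lambda>i j. a + of_bool (i \<le> j)) = 1 + a"
proof -
  have "fdet {..<Suc k} (\<lambda>i j. a + of_bool (j \<le> i)) = 1 + a"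
  proof (induction k)
    case 0
    show ?case using fdet_insert_unit_row[of "{}" 0 "\<lambda>i j. a + of_bool (j \<le> (i::nat))"]
      by (simp add: lessThan_Suc)
  next
    case (Suc k)
    let ?B = "\<lambda>i j. a + of_bool (j \<le> (i::nat))"
    let ?B' = "?B(Suc k := \<lambda>j. ?B (Suc k) j + (-1) * ?B k j)"
    have "fdet {..<Suc (Suc k)} ?B = fdet {..<Suc (Suc k)} ?B'"
      by (rule fdet_row_op[symmetric]) auto
    also have "\<dots> = fdet (insert (Suc k) {..<Suc k}) ?B'"
      by (simp only: lessThan_Suc)
    also have "\<dots> = ?B' (Suc k) (Suc k) * fdet {..<Suc k} ?B'"
      by (rule fdet_insert_unit_row) auto
    also have "fdet {..<Suc k} ?B' = fdet {..<Suc k} ?B"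
      by (rule fdet_cong) auto
    finally show ?case using Suc by simp
  qed
  then show ?thesis using fdet_transpose[of "{..<Suc k}" "\<lambda>i j. a + of_bool (j \<le> i)"] by simp
qed

lemma fdet_strict_staircase:
  fixes a :: complex
  shows "fdet {..<Suc k} (\<lambda>i j. a + of_bool (i < j)) = (-1) ^ k * a"
proof -
  have "fdet {..<Suc k} (\<lambda>i j. a + of_bool (j < i)) = (-1) ^ k * a"
  proof (induction k)
    case 0
    show ?case using fdet_insert_unit_row[of "{}" 0 "\<lambda>i j. a + of_bool (j < (i::nat))"]
      by (simp add: lessThan_Suc)
  next
    case (Suc k)
    let ?B = "\<lambda>i j. a + of_bool (j < (i::nat))"
    let ?I = "insert (Suc k) {..<k}"
    have S: "{..<Suc (Suc k)} = insert k ?I" by auto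
    \<comment> \<open>The difference of rows \<open>Suc k\<close> and \<open>k\<close> is the unit
      vector at column \<open>k\<close>. Swapping the two rows brings it to the diagonal, and this
      swap is the factor -1 of the induction step.\<close>
    let ?t = "Transposition.transpose k (Suc k)"
    let ?C = "\<lambda>i. ?B (?t i)"
    let ?C' = "?C(k := \<lambda>j. ?C k j + (-1) * ?C (Suc k) j)"
    have "?t permutes {..<Suc (Suc k)}" by (intro permutes_swap_id) auto
    then have "fdet {..<Suc (Suc k)} ?C = - fdet {..<Suc (Suc k)} ?B"
      using fdet_permute_rows[of "{..<Suc (Suc k)}" ?t ?B] by (simp add: sign_swap_id)
    then have "fdet {..<Suc (Suc k)} ?B = - fdet {..<Suc (Suc k)} ?C" by simp
    also have "fdet {..<Suc (Suc k)} ?C = fdet {..<Suc (Suc k)} ?C'"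
      by (rule fdet_row_op[symmetric]) auto
    also have "\<dots> = ?C' k k * fdet ?I ?C'"
      unfolding S by (rule fdet_insert_unit_row) auto
    \<comment> \<open>With index \<open>k\<close> removed, \<open>Suc k\<close> takes its place: its
      row is the old row \<open>k\<close>, and its column agrees with column \<open>k\<close> on the
      remaining rows.\<close>
    also have "fdet ?I ?C' = fdet {..<Suc k} (\<lambda>i j. ?C' (if i = k then Suc k else i) (if j = k then Suc k else j))"
      by (rule fdet_reindex) (auto simp: bij_betw_def inj_on_def image_def)
    also have "\<dots> = fdet {..<Suc k} ?B"
      by (rule fdet_cong) (auto simp: Transposition.transpose_def)
    finally show ?case using Suc by simp
  qed
  then show ?thesis using fdet_transpose[of "{..<Suc k}" "\<lambda>i j. a + of_bool (j < i)"] by simp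
qed

lemma strict_on_nat_less:
  fixes x :: "nat \<Rightarrow> real"
  assumes "\<And>j. Suc j < k \<Longrightarrow> x j < x (Suc j)" "i < j" "j < k"
  shows "x i < x j"
  using assms(2,3)
proof (induction j)
  case (Suc j)
  then show ?case using assms(1)[of j] by (cases "i = j") (auto intro: less_trans)
qed simp

lemma strict_on_nat_iff:
  fixes x :: "nat \<Rightarrow> real"
  assumes "\<And>j. Suc j < k \<Longrightarrow> x j < x (Suc j)" "i < k" "j < k"
  shows "x i < x j \<longleftrightarrow> i < j"
  using strict_on_nat_less[of k x i j, OF assms(1)] strict_on_nat_less[of k x j i, OF assms(1)] assms(2,3)
  by (metis less_asym linorder_less_linear)

text \<open>A step without any \<open>y\<close> between consecutive \<open>x\<close>'s produces two equal rows, and one without any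
  \<open>x\<close> between consecutive \<open>y\<close>'s two equal columns.\<close>

lemma fdet_interlacing:
  fixes x y :: "nat \<Rightarrow> real" and a :: complex
  assumes x: "\<And>j. Suc j < k \<Longrightarrow> x j < x (Suc j)" and y: "\<And>j. Suc j < k \<Longrightarrow> y j < y (Suc j)"
    and k: "0 < k"
  shows "fdet {..<k} (\<lambda>i j. a + of_bool (x i \<le> y j)) =
    (if interlacing k x y then if y 0 < x 0 then (-1) ^ (k - 1) * a else 1 + a else 0)"
proof -
  note xm = strict_on_nat_iff[of k x, OF x] and ym = strict_on_nat_iff[of k y, OF y]
  obtain k' where k': "k = Suc k'" using k by (cases k) auto
  let ?A = "\<lambda>i j. a + of_bool (x i \<le> y j)"
  have case1: "fdet {..<k} ?A = 1 + a"
    if 1: "\<forall>j<k. x j \<le> y j" "\<forall>j. Suc j < k \<longrightarrow> y j < x (Suc j)"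
  proof -
    have "x i \<le> y j \<longleftrightarrow> i \<le> j" if ij: "i < k" "j < k" for i j
    proof
      assume "x i \<le> y j"
      show "i \<le> j"
      proof (rule ccontr)
        assume "\<not> i \<le> j"
        then have "x (Suc j) \<le> x i" using xm[of i "Suc j"] ij by (cases "i = Suc j") auto
        moreover have "y j < x (Suc j)" using 1 ij \<open>\<not> i \<le> j\<close> by simp
        ultimately show False using \<open>x i \<le> y j\<close> by simp
      qed
    next
      assume "i \<le> j"
      then have "x i \<le> x j" using xm[of i j] ij by (cases "i = j") auto
      also have "\<dots> \<le> y j" using 1 ij by simp
      finally show "x i \<le> y j" .
    qed
    then have "fdet {..<k} ?A = fdet {..<Suc k'} (\<lambda>i j. a + of_bool (i \<le> j))"
      unfolding k' by (intro fdet_cong) auto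
    then show ?thesis by (simp add: fdet_staircase)
  qed
  have case2: "fdet {..<k} ?A = (-1) ^ (k - 1) * a"
    if 2: "\<forall>j<k. y j < x j" "\<forall>j. Suc j < k \<longrightarrow> x j \<le> y (Suc j)"
  proof -
    have "x i \<le> y j \<longleftrightarrow> i < j" if ij: "i < k" "j < k" for i j
    proof
      assume xy: "x i \<le> y j"
      show "i < j"
      proof (rule ccontr)
        assume "\<not> i < j"
        then have "y j \<le> y i" using ym[of j i] ij by (cases "i = j") auto
        also have "\<dots> < x i" using 2 ij by simp
        finally show False using xy by simp
      qed
    next
      assume ji: "i < j"
      then have "x i \<le> y (Suc i)" using 2 ij by simp
      also have "y (Suc i) \<le> y j" using ym[of "Suc i" j] ij ji by (cases "j = Suc i") auto
      finally show "x i \<le> y j" .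
    qed
    then have "fdet {..<k} ?A = fdet {..<Suc k'} (\<lambda>i j. a + of_bool (i < j))"
      unfolding k' by (intro fdet_cong) auto
    then show ?thesis by (simp add: fdet_strict_staircase k')
  qed
  have case3: "fdet {..<k} ?A = 0" if "\<not> interlacing k x y"
  proof (rule ccontr)
    assume nz: "fdet {..<k} ?A \<noteq> 0"
    have gx: "\<exists>j<k. x i \<le> y j \<and> y j < x (Suc i)" if "Suc i < k" for i
    proof (rule ccontr)
      assume no: "\<not> ?thesis"
      have "fdet {..<k} ?A = 0"
      proof (rule fdet_eq_rows[of _ i "Suc i"])
        fix j assume "j \<in> {..<k}"
        then have "\<not> (x i \<le> y j \<and> y j < x (Suc i))" using no by auto
        then have "x i \<le> y j \<longleftrightarrow> x (Suc i) \<le> y j" using x[OF \<open>Suc i < k\<close>] by linarith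
        then show "?A i j = ?A (Suc i) j" by simp
      qed (use that in auto)
      with nz show False by simp
    qed
    have gy: "\<exists>i<k. y j < x i \<and> x i \<le> y (Suc j)" if "Suc j < k" for j
    proof (rule ccontr)
      assume no: "\<not> ?thesis"
      have "fdet {..<k} (\<lambda>j i. ?A i j) = 0"
      proof (rule fdet_eq_rows[of _ j "Suc j"])
        fix i assume "i \<in> {..<k}"
        then have "\<not> (y j < x i \<and> x i \<le> y (Suc j))" using no by auto
        then have "x i \<le> y j \<longleftrightarrow> x i \<le> y (Suc j)" using y[OF \<open>Suc j < k\<close>] by linarith
        then show "?A i j = ?A i (Suc j)" by simp
      qed (use that in auto)
      with nz show False using fdet_transpose[of "{..<k}" ?A] by simp
    qed
    have "interlacing k x y"
    proof (cases "x 0 \<le> y 0")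
      case True
      \<comment> \<open>Induction along the zigzag: \<open>gy\<close> puts some x between y i and y
        (Suc i), so x (Suc i) is at most y (Suc i); then \<open>gx\<close> puts some y between x
        (Suc i) and x (Suc (Suc i)), which bounds y (Suc i).\<close>
      have 1: "x i \<le> y i \<and> (Suc i < k \<longrightarrow> y i < x (Suc i))" if "i < k" for i
        using that
      proof (induction i)
        case 0
        have "y 0 < x (Suc 0)" if s: "Suc 0 < k"
        proof -
          obtain j where j: "j < k" "y j < x (Suc 0)" using gx[OF s] by auto
          have "y 0 \<le> y j" using ym[of 0 j] j k by (cases "j = 0") auto
          then show ?thesis using j by simp
        qed
        then show ?case using True by simp
      next
        case (Suc i)
        then have IH: "x i \<le> y i" "y i < x (Suc i)" by auto
        obtain i' where i': "i' < k" "y i < x i'" "x i' \<le> y (Suc i)" using gy Suc.prems by auto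
        have "i < i'" using IH i' xm[of i i'] Suc.prems by simp
        then have "x (Suc i) \<le> x i'" using xm[of "Suc i" i'] i' Suc.prems by (cases "i' = Suc i") auto
        then have a1: "x (Suc i) \<le> y (Suc i)" using i' by simp
        have "y (Suc i) < x (Suc (Suc i))" if s: "Suc (Suc i) < k"
        proof -
          obtain j where j: "j < k" "x (Suc i) \<le> y j" "y j < x (Suc (Suc i))" using gx[OF s] by auto
          have "i < j" using IH j ym[of i j] Suc.prems by simp
          then have "y (Suc i) \<le> y j" using ym[of "Suc i" j] j Suc.prems by (cases "j = Suc i") auto
          then show ?thesis using j by simp
        qed
        then show ?case using a1 by simp
      qed
      then show ?thesis unfolding interlacing_def by auto
    next
      case False
      have 1: "y i < x i \<and> (Suc i < k \<longrightarrow> x i \<le> y (Suc i))" if "i < k" for i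
        using that
      proof (induction i)
        case 0
        have "x 0 \<le> y (Suc 0)" if s: "Suc 0 < k"
        proof -
          obtain j where j: "j < k" "x j \<le> y (Suc 0)" using gy[OF s] by auto
          have "x 0 \<le> x j" using xm[of 0 j] j k by (cases "j = 0") auto
          then show ?thesis using j by simp
        qed
        then show ?case using False by simp
      next
        case (Suc i)
        then have IH: "y i < x i" "x i \<le> y (Suc i)" by auto
        obtain i' where i': "i' < k" "x i \<le> y i'" "y i' < x (Suc i)" using gx Suc.prems by auto
        have "i < i'" using IH i' ym[of i i'] Suc.prems by simp
        then have "y (Suc i) \<le> y i'" using ym[of "Suc i" i'] i' Suc.prems by (cases "i' = Suc i") auto
        then have a1: "y (Suc i) < x (Suc i)" using i' by simp
        have "x (Suc i) \<le> y (Suc (Suc i))" if s: "Suc (Suc i) < k"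
        proof -
          obtain j where j: "j < k" "y (Suc i) < x j" "x j \<le> y (Suc (Suc i))" using gy[OF s] by auto
          have "i < j" using IH j xm[of i j] Suc.prems by simp
          then have "x (Suc i) \<le> x j" using xm[of "Suc i" j] j Suc.prems by (cases "j = Suc i") auto
          then show ?thesis using j by simp
        qed
        then show ?case using a1 by simp
      qed
      then show ?thesis unfolding interlacing_def by auto
    qed
    with that show False by simp
  qed
  show ?thesis
  proof (cases "interlacing k x y")
    case True
    then consider "\<forall>j<k. x j \<le> y j" "\<forall>j. Suc j < k \<longrightarrow> y j < x (Suc j)"
      | "\<forall>j<k. y j < x j" "\<forall>j. Suc j < k \<longrightarrow> x j \<le> y (Suc j)"
      unfolding interlacing_def by blast
    then show ?thesis
    proof cases
      case 1
      then have "\<not> y 0 < x 0" using k by (simp add: not_less)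
      then show ?thesis using case1[OF 1] True by simp
    next
      case 2
      then have "y 0 < x 0" using k by simp
      then show ?thesis using case2[OF 2] True by simp
    qed
  qed (simp add: case3)
qed

text \<open>The value of \<open>kernel\<close> at T = 0, see \<open>kernel_at_0\<close>: averaging
  over the roots leaves only the next string for a bead and the same string for a mark. The sign
  (-1)^\<theta> is picked up on passing from string n - 1 to string 0.\<close>

definition kernel0 :: "nat \<Rightarrow> complex \<Rightarrow> nat \<Rightarrow> kind \<times> real \<times> nat \<Rightarrow> kind \<times> real \<times> nat \<Rightarrow> complex" where
  "kernel0 n \<beta> \<theta> w v =
     (case w of (\<alpha>, t, h) \<Rightarrow> case v of (_, t', h') \<Rightarrow>
        (case \<alpha> of Bead \<Rightarrow> of_bool (h' = Suc h mod n) * (if Suc h = n then (-1) ^ \<theta> else 1)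
           | Occupied \<Rightarrow> - of_bool (h' = h) | Unoccupied \<Rightarrow> of_bool (h' = h)) *
        (exp (- \<beta> * of_real (bracket \<alpha> (t' - t))) / (1 - exp (- \<beta>))))"

section \<open>The kernel at T = 0 on sorted arrays of beads\<close>

definition sorted_arrays :: "nat \<Rightarrow> nat \<Rightarrow> (nat \<times> nat \<Rightarrow> real) set" where
  "sorted_arrays n k = {b \<in> {..<n} \<times> {..<k} \<rightarrow>\<^sub>E {0..<1}. \<forall>h<n. \<forall>j. Suc j < k \<longrightarrow> b (h, j) < b (h, Suc j)}"

text \<open>The cycle 0, 1, ..., m of strings at the fixed rank j, written as a product of
  transpositions so that its sign can be read off.\<close>

primrec shift_first :: "nat \<Rightarrow> nat \<Rightarrow> nat \<times> nat \<Rightarrow> nat \<times> nat" where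
  "shift_first 0 j = id"
| "shift_first (Suc m) j = Transposition.transpose (0, j) (Suc m, j) \<circ> shift_first m j"

lemma shift_first_eq:
  "shift_first m j (h, i) = (if i = j \<and> h \<le> m then (if h = m then 0 else Suc h, i) else (h, i))"
  by (induction m) (auto simp: Transposition.transpose_def)

lemma shift_first_permutes: "shift_first m j permutes {..m} \<times> {j}"
proof (induction m)
  case (Suc m)
  have "shift_first m j permutes {..Suc m} \<times> {j}"
    by (rule permutes_subset[OF Suc]) auto
  then show ?case
    unfolding shift_first.simps by (rule permutes_compose) (auto intro!: permutes_swap_id)
qed (simp add: permutes_id id_def[symmetric])

lemma permutation_shift_first: "permutation (shift_first m j)"
  using shift_first_permutes[of m j] finite_cartesian_product[of "{..m}" "{j}"]
  by (auto simp only: permutation_permutes finite_atMost finite.intros)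

lemma sign_shift_first: "sign (shift_first m j) = (-1) ^ m"
proof (induction m)
  case (Suc m)
  show ?case
    unfolding shift_first.simps sign_compose[OF permutation_swap_id permutation_shift_first] Suc
    by (simp add: sign_swap_id)
qed (simp add: sign_id id_def[symmetric])

text \<open>One full cycle for each rank below k. As a permutation of rows it makes the bead matrix,
  which links each string to the next, block diagonal.\<close>

primrec shift_strings :: "nat \<Rightarrow> nat \<Rightarrow> nat \<times> nat \<Rightarrow> nat \<times> nat" where
  "shift_strings n 0 = id"
| "shift_strings n (Suc k) = shift_first (n - 1) k \<circ> shift_strings n k"

lemma shift_strings_eq:
  assumes "0 < n"
  shows "shift_strings n k (h, i) = (if i < k \<and> h < n then (Suc h mod n, i) else (h, i))"
  using assms by (induction k) (auto simp: shift_first_eq mod_Suc)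

lemma shift_strings_permutes:
  assumes "0 < n"
  shows "shift_strings n k permutes {..<n} \<times> {..<k}"
proof (induction k)
  case (Suc k)
  have "shift_strings n k permutes {..<n} \<times> {..<Suc k}"
    by (rule permutes_subset[OF Suc]) auto
  moreover have "shift_first (n - 1) k permutes {..<n} \<times> {..<Suc k}"
    by (rule permutes_subset[OF shift_first_permutes]) (use assms in auto)
  ultimately show ?case unfolding shift_strings.simps by (rule permutes_compose)
qed (simp add: permutes_id id_def[symmetric])

lemma sign_shift_strings:
  assumes "0 < n"
  shows "sign (shift_strings n k) = (-1) ^ (k * (n - 1))"
proof (induction k)
  case (Suc k)
  have "finite ({..<n} \<times> {..<k})" by simp
  then have "permutation (shift_strings n k)"
    using shift_strings_permutes[OF assms, of k] permutation_permutes by blast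
  then show ?case
    unfolding shift_strings.simps sign_compose[OF permutation_shift_first \<open>permutation _\<close>] Suc
    by (simp add: sign_shift_first power_add)
qed (simp add: sign_id id_def[symmetric])

lemma pred_Suc_mod: "h < n \<Longrightarrow> (Suc h mod n + n - 1) mod n = h"
  by (cases "Suc h = n") auto

lemma Suc_pred_mod: "h < n \<Longrightarrow> Suc ((h + n - 1) mod n) mod n = h"
  by (cases h) (auto simp: mod_Suc)

lemma fdet_block_diagonal:
  fixes G :: "nat \<Rightarrow> nat \<Rightarrow> nat \<Rightarrow> complex"
  shows "fdet ({..<m} \<times> {..<k}) (\<lambda>(h, j) (h', j'). of_bool (h' = h) * G h j j') =
    (\<Prod>h<m. fdet {..<k} (G h))"
proof (induction m)
  case (Suc m)
  let ?A = "\<lambda>(h, j) (h', j'). of_bool (h' = h) * G h j j'"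
  have "fdet ({..<Suc m} \<times> {..<k}) ?A = fdet ({m} \<times> {..<k} \<union> {..<m} \<times> {..<k}) ?A"
    by (rule arg_cong2[where f=fdet]) (auto simp: less_Suc_eq)
  also have "\<dots> = fdet ({m} \<times> {..<k}) ?A * fdet ({..<m} \<times> {..<k}) ?A"
    by (rule fdet_Un_block) auto
  also have "fdet ({m} \<times> {..<k}) ?A = fdet {..<k} (\<lambda>j j'. ?A (m, j) (m, j'))"
    by (rule fdet_reindex) (auto simp: bij_betw_def inj_on_def)
  finally show ?case using Suc by (simp add: mult.commute)
qed simp

text \<open>Scaling rows by exp (\<beta> t) and columns by exp (- \<beta> t) cancels over the array
  and leaves entries that depend only on the order of the times. After the cyclic shift of the rows
  the matrix splits into one interlacing determinant per string, and exp (- \<beta>) is collected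
  once for each string counted by the occupation number.\<close>

lemma fdet_bead_array:
  assumes n: "0 < n" and k: "0 < k" and b: "b \<in> sorted_arrays n k" and q: "exp (- \<beta>) \<noteq> (1::complex)"
  defines "l \<equiv> occupation_number n b"
  shows "fdet ({..<n} \<times> {..<k}) (\<lambda>p p'. kernel0 n \<beta> \<theta> (Bead, b p, fst p) (Bead, b p', fst p')) =
    (if b \<in> bead_arrays n k
     then (-1) ^ (l + k * (\<theta> + n + l + 1)) * exp (- \<beta>) ^ l / (1 - exp (- \<beta>)) ^ n else 0)"
proof -
  define Q where "Q = exp (- \<beta>)"
  \<comment> \<open>With this a, 1 / (1 - Q) = 1 + a is the entry for t \<le> t', and Q / (1 - Q) =
    a the entry for a passage through time 0; this is the staircase form.\<close>
  define a where "a = Q / (1 - Q)"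
  have Q1: "1 - Q \<noteq> 0" using q by (simp add: Q_def)
  have a1: "1 + a = 1 / (1 - Q)" using Q1 by (simp add: a_def field_simps)
  have aQ: "c * a = c * Q / (1 - Q)" for c by (simp add: a_def)
  let ?I = "{..<n} \<times> {..<k}"
  define pr where "pr h = (h + n - 1) mod n" for h
  define tw :: "nat \<Rightarrow> complex" where "tw h = (if Suc h = n then (-1) ^ \<theta> else 1)" for h
  define G where "G h j j' = a + of_bool (b (pr h, j) \<le> b (h, j'))" for h j j'
  define r where "r p = (case p of (h, j) \<Rightarrow> tw h * exp (\<beta> * of_real (b (h, j))))" for p
  define c where "c p = exp (- \<beta> * of_real (b p))" for p
  define A0 where "A0 = (\<lambda>(h, j) (h', j'). of_bool (h' = h) * G h j j')"
  have entry: "exp (- \<beta> * of_real (bracket Bead (t' - t))) / (1 - Q) =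
      exp (\<beta> * of_real t) * (exp (- \<beta> * of_real t') * (a + of_bool (t \<le> t')))" for t t'
  proof (cases "t \<le> t'")
    case True
    then have "exp (- \<beta> * of_real (bracket Bead (t' - t))) = exp (\<beta> * of_real t) * exp (- \<beta> * of_real t')"
      by (simp add: bracket_def exp_add[symmetric] algebra_simps)
    then show ?thesis using True a1 by (simp add: add.commute)
  next
    case False
    then have "exp (- \<beta> * of_real (bracket Bead (t' - t))) = exp (\<beta> * of_real t) * exp (- \<beta> * of_real t') * Q"
      by (simp add: bracket_def exp_add[symmetric] algebra_simps Q_def)
    then show ?thesis using False by (simp add: a_def)
  qed
  have "fdet ?I (\<lambda>p p'. kernel0 n \<beta> \<theta> (Bead, b p, fst p) (Bead, b p', fst p')) =
    fdet ?I (\<lambda>p p'. r p * (c p' * A0 (shift_strings n k p) p'))"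
  proof (rule fdet_cong[OF refl])
    fix p p' assume "p \<in> ?I" "p' \<in> ?I"
    moreover obtain h j h' j' where p: "p = (h, j)" "p' = (h', j')" by (cases p, cases p')
    ultimately have hj: "h < n" "j < k" "h' < n" "j' < k" by auto
    have "A0 (shift_strings n k p) p' = of_bool (h' = Suc h mod n) * (a + of_bool (b (h, j) \<le> b (h', j')))"
      using hj n pred_Suc_mod[of h n] by (auto simp: p A0_def shift_strings_eq G_def pr_def)
    moreover have "kernel0 n \<beta> \<theta> (Bead, b p, fst p) (Bead, b p', fst p') =
        of_bool (h' = Suc h mod n) * tw h * (exp (- \<beta> * of_real (bracket Bead (b (h', j') - b (h, j)))) / (1 - Q))"
      by (simp add: kernel0_def p tw_def Q_def)
    ultimately show "kernel0 n \<beta> \<theta> (Bead, b p, fst p) (Bead, b p', fst p') = r p * (c p' * A0 (shift_strings n k p) p')"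
      unfolding entry by (simp only: r_def c_def p case_prod_conv mult_ac)
  qed
  also have "\<dots> = (\<Prod>p\<in>?I. r p) * ((\<Prod>p\<in>?I. c p) * (of_int (sign (shift_strings n k)) * fdet ?I A0))"
    by (simp only: fdet_scale_rows[of ?I r] fdet_scale_cols[of ?I c] finite_cartesian_product finite_lessThan
        fdet_permute_rows[OF _ shift_strings_permutes[OF n]])
  also have "\<dots> = (\<Prod>p\<in>?I. tw (fst p)) * (of_int (sign (shift_strings n k)) * fdet ?I A0)"
  proof -
    have "(\<Prod>p\<in>?I. r p) * (\<Prod>p\<in>?I. c p) = (\<Prod>p\<in>?I. tw (fst p))"
      unfolding prod.distrib[symmetric] r_def c_def
    proof (intro prod.cong refl)
      fix p assume "p \<in> ?I"
      have "exp (\<beta> * of_real (b p)) * exp (- \<beta> * of_real (b p)) = 1"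
        using exp_minus_inverse[of "\<beta> * of_real (b p)"] by simp
      then show "(case p of (h, j) \<Rightarrow> tw h * exp (\<beta> * of_real (b (h, j)))) * exp (- \<beta> * of_real (b p)) = tw (fst p)"
        by (cases p) (simp add: mult.assoc)
    qed
    then show ?thesis by (simp only: mult.assoc[symmetric])
  qed
  also have "(\<Prod>p\<in>?I. tw (fst p)) = (-1) ^ (\<theta> * k)"
  proof -
    have "(\<Prod>p\<in>?I. tw (fst p)) = (\<Prod>h<n. tw h ^ k)"
      using prod.cartesian_product[of "\<lambda>h j. tw h" "{..<k}" "{..<n}"] by (simp add: case_prod_unfold)
    also have "\<dots> = tw (n - 1) ^ k * (\<Prod>h\<in>{..<n} - {n - 1}. tw h ^ k)"
      using n by (subst prod.remove[of _ "n - 1"]) auto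
    also have "(\<Prod>h\<in>{..<n} - {n - 1}. tw h ^ k) = 1"
      by (intro prod.neutral) (auto simp: tw_def)
    finally show ?thesis using n by (simp add: tw_def power_mult)
  qed
  also have "fdet ?I A0 = (\<Prod>h<n. fdet {..<k} (G h))"
    unfolding A0_def by (rule fdet_block_diagonal)
  also have "\<dots> = (\<Prod>h<n. if interlacing k (\<lambda>j. b (pr h, j)) (\<lambda>j. b (h, j))
      then if b (h, 0) < b (pr h, 0) then (-1) ^ (k - 1) * a else 1 + a else 0)"
  proof (intro prod.cong refl)
    fix h assume "h \<in> {..<n}"
    then have h: "h < n" "pr h < n" using n by (auto simp: pr_def)
    show "fdet {..<k} (G h) = (if interlacing k (\<lambda>j. b (pr h, j)) (\<lambda>j. b (h, j))
      then if b (h, 0) < b (pr h, 0) then (-1) ^ (k - 1) * a else 1 + a else 0)"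
      unfolding G_def by (rule fdet_interlacing) (use b h k in \<open>auto simp: sorted_arrays_def\<close>)
  qed
  also have "\<dots> = (if b \<in> bead_arrays n k then ((-1) ^ (k - 1) * Q) ^ l / (1 - Q) ^ n else 0)"
  proof (cases "b \<in> bead_arrays n k")
    case True
    have il: "interlacing k (\<lambda>j. b (pr h, j)) (\<lambda>j. b (h, j))" if "h < n" for h
    proof -
      have "pr h < n" using n by (simp add: pr_def)
      then have "interlacing k (\<lambda>j. b (pr h, j)) (\<lambda>j. b (Suc (pr h) mod n, j))"
        using True by (auto simp: bead_arrays_def)
      then show ?thesis using Suc_pred_mod[OF that] by (simp add: pr_def)
    qed
    have "(\<Prod>h<n. if interlacing k (\<lambda>j. b (pr h, j)) (\<lambda>j. b (h, j))
      then if b (h, 0) < b (pr h, 0) then (-1) ^ (k - 1) * a else 1 + a else 0) =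
      (\<Prod>h<n. (if b (h, 0) < b (pr h, 0) then (-1) ^ (k - 1) * Q else 1) / (1 - Q))"
      by (intro prod.cong refl) (simp add: il a1 aQ)
    also have "\<dots> = (\<Prod>h<n. if b (h, 0) < b (pr h, 0) then (-1) ^ (k - 1) * Q else 1) / (1 - Q) ^ n"
      by (simp add: prod_dividef)
    also have "(\<Prod>h<n. if b (h, 0) < b (pr h, 0) then (-1) ^ (k - 1) * Q else 1) =
       (\<Prod>h | h < n \<and> b (h, 0) < b (pr h, 0). (-1) ^ (k - 1) * Q)"
      by (subst prod.inter_filter[symmetric]) (auto intro!: prod.cong)
    also have "\<dots> = ((-1) ^ (k - 1) * Q) ^ l"
      by (simp add: l_def occupation_number_def pr_def)
    finally show ?thesis using True by simp
  next
    case False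
    then obtain h where h: "h < n" "\<not> interlacing k (\<lambda>j. b (h, j)) (\<lambda>j. b (Suc h mod n, j))"
      using b by (auto simp: bead_arrays_def sorted_arrays_def)
    have "(\<Prod>h<n. if interlacing k (\<lambda>j. b (pr h, j)) (\<lambda>j. b (h, j))
      then if b (h, 0) < b (pr h, 0) then (-1) ^ (k - 1) * a else 1 + a else 0) = 0"
      by (rule prod_zero) (use h n pred_Suc_mod[of h n] in \<open>auto simp: pr_def intro!: bexI[of _ "Suc h mod n"]\<close>)
    then show ?thesis using False by simp
  qed
  also have "(-1) ^ (\<theta> * k) * (of_int (sign (shift_strings n k)) *
      (if b \<in> bead_arrays n k then ((-1) ^ (k - 1) * Q) ^ l / (1 - Q) ^ n else 0)) =
      (if b \<in> bead_arrays n k then (-1) ^ (l + k * (\<theta> + n + l + 1)) * Q ^ l / (1 - Q) ^ n else 0)"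
  proof -
    \<comment> \<open>The signs are \<theta> * k from the twist, k * (n - 1) from the k cycles of
      length n, and (k - 1) * l from the l strict staircases.\<close>
    have "\<theta> * k + k * (n - 1) + (k - 1) * l + (l + k * (\<theta> + n + l + 1)) = 2 * (\<theta> * k + k * n + k * l)"
      using n k by (cases n; cases k) (simp_all add: algebra_simps)
    then have "even (\<theta> * k + k * (n - 1) + (k - 1) * l + (l + k * (\<theta> + n + l + 1)))"
      by (metis dvd_triv_left)
    then have 1: "(-1) ^ (\<theta> * k + k * (n - 1) + (k - 1) * l) = (-1 :: complex) ^ (l + k * (\<theta> + n + l + 1))"
      unfolding minus_one_power_iff by (metis even_add)
    have "((-1) ^ (k - 1) * Q) ^ l = (-1) ^ ((k - 1) * l) * Q ^ l"
      by (simp only: power_mult_distrib power_mult)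
    then have "(-1) ^ (\<theta> * k) * ((-1) ^ (k * (n - 1)) * ((-1) ^ (k - 1) * Q) ^ l) =
        (-1 :: complex) ^ (l + k * (\<theta> + n + l + 1)) * Q ^ l"
      unfolding 1[symmetric] by (simp only: power_add mult.assoc)
    then show ?thesis by (simp add: sign_shift_strings[OF n])
  qed
  finally show ?thesis by (simp add: Q_def)
qed

section \<open>Occupied and unoccupied points\<close>

text \<open>Distance from t to t' moving right on the circle. \<open>bracket\<close> differs from it
  only for an occupied point and a column at the same time, where it counts a full turn.\<close>

definition cdist :: "real \<Rightarrow> real \<Rightarrow> real" where
  "cdist t t' = t' - t + of_bool (t' < t)"

lemma bracket_eq_cdist: "bracket \<alpha> (t' - t) = cdist t t' + of_bool (\<alpha> = Occupied \<and> t' = t)"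
  by (auto simp: bracket_def cdist_def)

lemma cdist_self [simp]: "cdist t t = 0"
  by (simp add: cdist_def)

lemma cdist_add:
  assumes "t \<in> {0..<1}" "s \<in> {0..<1}" "t' \<in> {0..<1}" "cdist t s \<le> cdist t t'"
  shows "cdist t t' = cdist t s + cdist s t'"
  using assms by (auto simp: cdist_def of_bool_def split: if_splits)

text \<open>If s is met from t strictly before r, then t lies on the way from r to s.\<close>

lemma cdist_add':
  assumes "t \<in> {0..<1}" "s \<in> {0..<1}" "r \<in> {0..<1}" "cdist t s < cdist t r"
  shows "cdist r s = cdist r t + cdist t s"
  using assms by (auto simp: cdist_def of_bool_def split: if_splits)

lemma cdist_swap:
  assumes "t \<noteq> s"
  shows "cdist t s + cdist s t = 1"
  using assms by (auto simp: cdist_def)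

lemma kernel0_Bead:
  "kernel0 n \<beta> \<theta> (Bead, t, h) (\<alpha>', t', h') =
     of_bool (h' = Suc h mod n) * (if Suc h = n then (-1) ^ \<theta> else 1) * (exp (- \<beta> * of_real (cdist t t')) / (1 - exp (- \<beta>)))"
  by (simp add: kernel0_def bracket_eq_cdist)

lemma kernel0_Unoccupied:
  "kernel0 n \<beta> \<theta> (Unoccupied, t, h) (\<alpha>', t', h') =
     of_bool (h' = h) * (exp (- \<beta> * of_real (cdist t t')) / (1 - exp (- \<beta>)))"
  by (simp add: kernel0_def bracket_eq_cdist)

text \<open>Here the full turn that \<open>bracket\<close> assigns to an occupied point at its own
  time pays off: with Q = exp (- \<beta>), the diagonal entry is -Q / (1 - Q) = 1 - 1 / (1 -
  Q).\<close>

lemma kernel0_Occupied: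
  assumes q: "exp (- \<beta>) \<noteq> (1::complex)"
  shows "kernel0 n \<beta> \<theta> (Occupied, t, h) (\<alpha>', t', h') =
     of_bool (t' = t \<and> h' = h) - kernel0 n \<beta> \<theta> (Unoccupied, t, h) (\<alpha>', t', h')"
proof -
  have "- (exp (- \<beta>) / (1 - exp (- \<beta>))) = 1 - 1 / (1 - exp (- \<beta>))"
    using q by (simp add: field_simps)
  then show ?thesis
    by (auto simp: kernel0_def bracket_eq_cdist)
qed

lemma mod_pred_neq: "2 \<le> (n::nat) \<Longrightarrow> h < n \<Longrightarrow> (h + n - 1) mod n \<noteq> h"
  by (cases h) auto

lemma mod_Suc_neq: "2 \<le> n \<Longrightarrow> h < n \<Longrightarrow> Suc h mod n \<noteq> h"
  by (auto simp: mod_Suc)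

text \<open>The row of an unoccupied point is a multiple of the next row on the same circle, up to a unit
  vector, as long as no column is met in between.\<close>

lemma fdet_remove_unoccupied_row:
  fixes w :: "'i \<Rightarrow> kind \<times> real \<times> nat"
  assumes q: "exp (- \<beta>) \<noteq> (1::complex)" and n: "2 \<le> n"
    and J: "finite J" "f \<notin> J" and times: "\<And>i. i \<in> insert f J \<Longrightarrow> fst (snd (w i)) \<in> {0..<1}"
    and f: "w f = (Unoccupied, t, h)" "h < n"
    and r: "r \<in> J" "w r = (Bead, s, (h + n - 1) mod n) \<or> w r = (Unoccupied, s, h)" "s \<noteq> t"
    and near: "\<And>c. c \<in> J \<Longrightarrow> snd (snd (w c)) = h \<Longrightarrow> cdist t s \<le> cdist t (fst (snd (w c)))"
  shows "fdet (insert f J) (\<lambda>i j. kernel0 n \<beta> \<theta> (w i) (w j)) = fdet J (\<lambda>i j. kernel0 n \<beta> \<theta> (w i) (w j))"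
proof -
  let ?K = "\<lambda>i j. kernel0 n \<beta> \<theta> (w i) (w j)"
  define Q where "Q = exp (- \<beta>)"
  have Q: "1 - Q \<noteq> 0" using q by (simp add: Q_def)
  define tw :: complex where "tw = (if w r = (Unoccupied, s, h) then 1 else if Suc ((h + n - 1) mod n) = n then (-1) ^ \<theta> else 1)"
  have tw: "tw \<noteq> 0" by (simp add: tw_def)
  \<comment> \<open>Starting at t instead of s multiplies the row by exp (- \<beta> * cdist t s);
    \<open>tw\<close> removes the twist that a bead row carries.\<close>
  define c where "c = exp (- \<beta> * of_real (cdist t s)) / tw"
  have Kr: "?K r j = of_bool (snd (snd (w j)) = h) * tw * (exp (- \<beta> * of_real (cdist s (fst (snd (w j))))) / (1 - Q))" for j
    using r(2) Suc_pred_mod[OF f(2)] by (cases "w j") (auto simp: kernel0_Bead kernel0_Unoccupied tw_def Q_def)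
  have Kf: "?K f j = of_bool (snd (snd (w j)) = h) * (exp (- \<beta> * of_real (cdist t (fst (snd (w j))))) / (1 - Q))" for j
    by (cases "w j") (auto simp: kernel0_Unoccupied f Q_def)
  have st: "s \<in> {0..<1}" "t \<in> {0..<1}" using times[of r] times[of f] r f by auto
  have cK: "c * ?K r j = of_bool (snd (snd (w j)) = h) * (exp (- \<beta> * of_real (cdist t s + cdist s (fst (snd (w j))))) / (1 - Q))" for j
    unfolding Kr c_def using tw by (simp add: distrib_left exp_add exp_diff exp_minus field_simps)
  let ?A = "?K(f := \<lambda>j. ?K f j + (- c) * ?K r j)"
  have "fdet (insert f J) ?K = fdet (insert f J) ?A"
    by (rule fdet_row_op[symmetric]) (use J r in auto)
  also have "\<dots> = ?A f f * fdet J ?A"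
  proof (rule fdet_insert_unit_row[OF J])
    fix j assume j: "j \<in> J"
    show "?A f j = 0"
    proof (cases "snd (snd (w j)) = h")
      case True
      have "cdist t (fst (snd (w j))) = cdist t s + cdist s (fst (snd (w j)))"
        by (rule cdist_add) (use st times[of j] near[OF j True] j in auto)
      then have "?K f j = c * ?K r j" unfolding cK Kf by simp
      then show ?thesis by simp
    next
      case False
      then show ?thesis by (simp add: Kf Kr)
    qed
  qed
  \<comment> \<open>In the column of f itself the two rows differ: reaching t by way of s takes a
    full turn, which leaves 1 / (1 - Q) - Q / (1 - Q) = 1.\<close>
  also have "?A f f = 1"
  proof -
    have "c * ?K r f = Q / (1 - Q)"
      unfolding cK using f cdist_swap[of t s] r(3) by (simp add: Q_def)
    moreover have "?K f f = 1 / (1 - Q)" unfolding Kf using f by simp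
    ultimately show ?thesis using Q by (simp add: diff_divide_distrib[symmetric])
  qed
  also have "fdet J ?A = fdet J ?K"
    using J by (intro fdet_cong) auto
  finally show ?thesis by simp
qed

text \<open>From every row that sees string h, the time t is passed before s, so the column of the
  bead c is a multiple of the column of f. In the application this is the case in which the point is
  occupied and the determinant has to vanish.\<close>

lemma fdet_remove_unoccupied_col:
  fixes w :: "'i \<Rightarrow> kind \<times> real \<times> nat"
  assumes n: "2 \<le> n"
    and J: "finite J" "f \<notin> J" and times: "\<And>i. i \<in> insert f J \<Longrightarrow> fst (snd (w i)) \<in> {0..<1}"
    and f: "w f = (Unoccupied, t, h)" "h < n"
    and kinds: "\<And>i. i \<in> J \<Longrightarrow> fst (w i) \<noteq> Occupied" "\<And>i. i \<in> J \<Longrightarrow> snd (snd (w i)) < n"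
    and c: "c \<in> J" "w c = (Bead, s, h)"
    and near: "\<And>r. r \<in> J \<Longrightarrow> fst (w r) = Bead \<Longrightarrow> snd (snd (w r)) = (h + n - 1) mod n \<Longrightarrow> cdist t s < cdist t (fst (snd (w r)))"
      "\<And>r. r \<in> J \<Longrightarrow> fst (w r) = Unoccupied \<Longrightarrow> snd (snd (w r)) = h \<Longrightarrow> cdist t s < cdist t (fst (snd (w r)))"
  shows "fdet (insert f J) (\<lambda>i j. kernel0 n \<beta> \<theta> (w i) (w j)) = 0"
proof -
  let ?K = "\<lambda>i j. kernel0 n \<beta> \<theta> (w i) (w j)"
  let ?c = "exp (- \<beta> * of_real (cdist t s))"
  have st: "s \<in> {0..<1}" "t \<in> {0..<1}" using times[of c] times[of f] c f by auto
  have "fdet (insert f J) (\<lambda>j i. ?K i j) = 0"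
  proof (rule fdet_prop_rows[where i=c and k=f and c="?c"])
    fix i assume i: "i \<in> insert f J"
    obtain \<alpha> u g where wi: "w i = (\<alpha>, u, g)" by (cases "w i")
    have E: "exp (- \<beta> * of_real (cdist u s)) = ?c * exp (- \<beta> * of_real (cdist u t))"
      if "cdist u s = cdist u t + cdist t s"
      unfolding that by (simp add: exp_add[symmetric] algebra_simps)
    show "?K i c = ?c * ?K i f"
    proof (cases "i = f")
      case True
      then show ?thesis by (simp add: c f kernel0_Unoccupied)
    next
      case False
      then have iJ: "i \<in> J" using i by simp
      have u: "u \<in> {0..<1}" using times[OF i] wi by simp
      consider "\<alpha> = Bead" | "\<alpha> = Unoccupied" using kinds(1)[OF iJ] wi by (cases \<alpha>) auto
      then show ?thesis
      proof cases
        case 1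
        show ?thesis
        proof (cases "h = Suc g mod n")
          case True
          then have "g = (h + n - 1) mod n" using pred_Suc_mod[of g n] kinds(2)[OF iJ] wi by simp
          then have "cdist t s < cdist t u" using near(1)[OF iJ] wi 1 by simp
          then have "cdist u s = cdist u t + cdist t s" by (rule cdist_add'[OF st(2,1) u])
          then show ?thesis using E by (simp add: wi 1 c f kernel0_Bead)
        qed (simp add: wi 1 c f kernel0_Bead)
      next
        case 2
        show ?thesis
        proof (cases "h = g")
          case True
          then have "cdist t s < cdist t u" using near(2)[OF iJ] wi 2 by simp
          then have "cdist u s = cdist u t + cdist t s" by (rule cdist_add'[OF st(2,1) u])
          then show ?thesis using E by (simp add: wi 2 c f kernel0_Unoccupied)
        qed (simp add: wi 2 c f kernel0_Unoccupied)
      qed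
    qed
  qed (use J c in auto)
  then show ?thesis using fdet_transpose[of "insert f J" ?K] J by simp
qed

lemma fdet_lone_unoccupied:
  fixes w :: "'i \<Rightarrow> kind \<times> real \<times> nat"
  assumes J: "finite J" "f \<notin> J" and f: "w f = (Unoccupied, t, h)"
    and no: "\<And>i. i \<in> J \<Longrightarrow> snd (snd (w i)) \<noteq> h"
  shows "fdet (insert f J) (\<lambda>i j. kernel0 n \<beta> \<theta> (w i) (w j)) =
     fdet J (\<lambda>i j. kernel0 n \<beta> \<theta> (w i) (w j)) / (1 - exp (- \<beta>))"
proof -
  let ?K = "\<lambda>i j. kernel0 n \<beta> \<theta> (w i) (w j)"
  have "fdet (insert f J) ?K = ?K f f * fdet J ?K"
  proof (rule fdet_insert_unit_row[OF J])
    fix j assume "j \<in> J"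
    then show "?K f j = 0" using no[of j] by (cases "w j") (simp add: f kernel0_Unoccupied)
  qed
  then show ?thesis by (simp add: f kernel0_Unoccupied)
qed

section \<open>Marks added to an array of beads\<close>

definition marked_points ::
    "(nat \<times> nat \<Rightarrow> real) \<Rightarrow> (nat \<Rightarrow> kind) \<Rightarrow> (nat \<Rightarrow> real \<times> nat) \<Rightarrow> (nat \<times> nat) + nat \<Rightarrow> kind \<times> real \<times> nat" where
  "marked_points b \<alpha> y = case_sum (\<lambda>p. (Bead, b p, fst p)) (\<lambda>f. (\<alpha> f, y f))"

lemma marked_points_simps [simp]:
  "marked_points b \<alpha> y (Inl p) = (Bead, b p, fst p)"
  "marked_points b \<alpha> y (Inr f) = (\<alpha> f, y f)"
  by (simp_all add: marked_points_def)

definition marked_event :: "(nat \<Rightarrow> kind) \<Rightarrow> (nat \<Rightarrow> real \<times> nat) \<Rightarrow> nat set \<Rightarrow> (real \<Rightarrow> nat set) \<Rightarrow> bool" where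
  "marked_event \<alpha> y F X \<longleftrightarrow> (\<forall>i\<in>F. (\<alpha> i = Occupied \<longrightarrow> snd (y i) \<in> X (fst (y i))) \<and>
                              (\<alpha> i = Unoccupied \<longrightarrow> snd (y i) \<notin> X (fst (y i))))"

text \<open>Off the diagonal the rows of an occupied and of an unoccupied point are opposite, and the
  diagonal entries add up to 1, so inclusion and exclusion reduces everything to unoccupied points.\<close>

lemma fdet_occupied_induct:
  assumes q: "exp (- \<beta>) \<noteq> (1::complex)" and A: "finite A"
    and F: "finite F" "inj_on y F" "\<And>f. f \<in> F \<Longrightarrow> \<alpha> f \<noteq> Bead"
    and sep: "\<And>p f. p \<in> A \<Longrightarrow> f \<in> F \<Longrightarrow> b p \<noteq> fst (y f)"
    and base: "\<And>F' \<alpha>'. F' \<subseteq> F \<Longrightarrow> (\<And>f. f \<in> F' \<Longrightarrow> \<alpha>' f = Unoccupied) \<Longrightarrow>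
       fdet (Inl ` A \<union> Inr ` F') (\<lambda>i j. kernel0 n \<beta> \<theta> (marked_points b \<alpha>' y i) (marked_points b \<alpha>' y j)) =
       (\<Sum>X\<in>S. c X * of_bool (marked_event \<alpha>' y F' X))"
  shows "fdet (Inl ` A \<union> Inr ` F) (\<lambda>i j. kernel0 n \<beta> \<theta> (marked_points b \<alpha> y i) (marked_points b \<alpha> y j)) =
       (\<Sum>X\<in>S. c X * of_bool (marked_event \<alpha> y F X))"
proof -
  let ?K = "\<lambda>\<alpha> i j. kernel0 n \<beta> \<theta> (marked_points b \<alpha> y i) (marked_points b \<alpha> y j)"
  \<comment> \<open>Every weighted sum of event indicators obeys the same inclusion and exclusion.
    Below, S is either the process of one array or the set of all constant processes.\<close>
  let ?V = "\<lambda>F \<alpha>. \<Sum>X\<in>S. c X * of_bool (marked_event \<alpha> y F X)"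
  have "fdet (Inl ` A \<union> Inr ` F') (?K \<alpha>') = ?V F' \<alpha>'"
    if "F' \<subseteq> F" "\<And>f. f \<in> F' \<Longrightarrow> \<alpha>' f \<noteq> Bead" "card {f \<in> F'. \<alpha>' f = Occupied} = m" for F' \<alpha>' m
    using that
  proof (induction m arbitrary: F' \<alpha>')
    case 0
    have "finite F'" using 0(1) F(1) by (rule finite_subset)
    then have "\<alpha>' f = Unoccupied" if "f \<in> F'" for f
      using 0 that by (cases "\<alpha>' f") auto
    then show ?case by (rule base[OF \<open>F' \<subseteq> F\<close>])
  next
    case (Suc m)
    have fin: "finite F'" using Suc.prems(1) F(1) by (rule finite_subset)
    obtain f where f: "f \<in> F'" "\<alpha>' f = Occupied"
    proof -
      have "{f \<in> F'. \<alpha>' f = Occupied} \<noteq> {}" using Suc.prems(3) by (metis card.empty nat.distinct(1))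
      then show ?thesis using that by auto
    qed
    define G where "G = F' - {f}"
    define \<alpha>u where "\<alpha>u = \<alpha>'(f := Unoccupied)"
    have G: "G \<subseteq> F" "F' = insert f G" "f \<notin> G" using Suc.prems f by (auto simp: G_def)
    have occ: "{g \<in> F'. \<alpha>' g = Occupied} = insert f {g \<in> G. \<alpha>' g = Occupied}" "{g \<in> F'. \<alpha>u g = Occupied} = {g \<in> G. \<alpha>' g = Occupied}"
      using f by (auto simp: G_def \<alpha>u_def)
    have m: "card {g \<in> G. \<alpha>' g = Occupied} = m"
      using Suc.prems(3)[unfolded occ(1)] G(3) fin by (simp add: G_def)
    have IH1: "fdet (Inl ` A \<union> Inr ` G) (?K \<alpha>') = ?V G \<alpha>'"
      by (rule Suc.IH[OF G(1) _ m]) (use Suc.prems(2) G(2) in auto)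
    have IH2: "fdet (Inl ` A \<union> Inr ` F') (?K \<alpha>u) = ?V F' \<alpha>u"
    proof (rule Suc.IH[OF Suc.prems(1)])
      show "\<alpha>u g \<noteq> Bead" if "g \<in> F'" for g using Suc.prems(2)[OF that] by (simp add: \<alpha>u_def)
    qed (simp add: occ m)
    let ?J = "Inl ` A \<union> Inr ` G :: (nat \<times> nat + nat) set"
    have JF: "Inl ` A \<union> Inr ` F' = insert (Inr f) ?J" using G by auto
    have J: "finite ?J" "Inr f \<notin> ?J" using A fin G by (auto dest: finite_subset)
    let ?e = "\<lambda>j. if j = Inr f then 1 else 0 :: complex"
    have "fdet (insert (Inr f) ?J) (?K \<alpha>') =
        fdet (insert (Inr f) ?J) ((?K \<alpha>')(Inr f := \<lambda>j. ?e j + (-1) * ?K \<alpha>u (Inr f) j))"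
    proof (rule fdet_cong[OF refl])
      fix i j assume ij: "i \<in> insert (Inr f) ?J" "j \<in> insert (Inr f) ?J"
      show "?K \<alpha>' i j = ((?K \<alpha>')(Inr f := \<lambda>j. ?e j + (-1) * ?K \<alpha>u (Inr f) j)) i j"
      proof (cases "i = Inr f")
        case True
        obtain t h where y: "y f = (t, h)" by (cases "y f")
        obtain \<gamma> t' h' where j: "marked_points b \<alpha>' y j = (\<gamma>, t', h')" by (cases "marked_points b \<alpha>' y j")
        obtain \<gamma>' where j': "marked_points b \<alpha>u y j = (\<gamma>', t', h')"
          using j by (cases j) (auto simp: marked_points_def)
        \<comment> \<open>Another column at the same point would also receive the entry 1;
          \<open>sep\<close> and the injectivity of y exclude this.\<close>
        have "(t' = t \<and> h' = h) \<longleftrightarrow> j = Inr f"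
        proof (cases j)
          case (Inl p)
          then show ?thesis using sep[of p f] ij j y f Suc.prems(1) by (auto simp: marked_points_def)
        next
          case (Inr g)
          then have "g \<in> F" "f \<in> F" using ij G f Suc.prems(1) by auto
          then show ?thesis using inj_onD[OF F(2), of g f] j y Inr by (auto simp: marked_points_def)
        qed
        then show ?thesis
          using True f y j j' kernel0_Occupied[OF q, of n \<theta> t h \<gamma> t' h']
          by (simp add: \<alpha>u_def kernel0_Unoccupied)
      qed simp
    qed
    also have "\<dots> = fdet (insert (Inr f) ?J) ((?K \<alpha>')(Inr f := ?e)) +
        (-1) * fdet (insert (Inr f) ?J) ((?K \<alpha>')(Inr f := ?K \<alpha>u (Inr f)))"
      by (rule fdet_row_add) (use J in auto)
    also have "fdet (insert (Inr f) ?J) ((?K \<alpha>')(Inr f := ?e)) = fdet ?J ((?K \<alpha>')(Inr f := ?e))"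
    proof -
      have "fdet (insert (Inr f) ?J) ((?K \<alpha>')(Inr f := ?e)) = ((?K \<alpha>')(Inr f := ?e)) (Inr f) (Inr f) * fdet ?J ((?K \<alpha>')(Inr f := ?e))"
        by (rule fdet_insert_unit_row[OF J]) (use J(2) in auto)
      then show ?thesis by simp
    qed
    also have "fdet ?J ((?K \<alpha>')(Inr f := ?e)) = fdet ?J (?K \<alpha>')"
      using J by (intro fdet_cong) auto
    also have "fdet (insert (Inr f) ?J) ((?K \<alpha>')(Inr f := ?K \<alpha>u (Inr f))) = fdet (insert (Inr f) ?J) (?K \<alpha>u)"
      using G by (intro fdet_cong) (auto simp: \<alpha>u_def marked_points_def kernel0_def split: sum.splits)
    finally have "fdet (Inl ` A \<union> Inr ` F') (?K \<alpha>') = ?V G \<alpha>' - ?V F' \<alpha>u"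
      using IH1 IH2 JF by simp
    also have "\<dots> = ?V F' \<alpha>'"
      unfolding sum_subtractf[symmetric]
    proof (intro sum.cong refl)
      fix X assume "X \<in> S"
      have "marked_event \<alpha>' y F' X \<longleftrightarrow> marked_event \<alpha>' y G X \<and> snd (y f) \<in> X (fst (y f))"
        "marked_event \<alpha>u y F' X \<longleftrightarrow> marked_event \<alpha>' y G X \<and> snd (y f) \<notin> X (fst (y f))"
        using f G by (auto simp: marked_event_def \<alpha>u_def)
      then show "c X * of_bool (marked_event \<alpha>' y G X) - c X * of_bool (marked_event \<alpha>u y F' X) =
          c X * of_bool (marked_event \<alpha>' y F' X)" by auto
    qed
    finally show ?case .
  qed
  from this[OF order_refl F(3) refl] show ?thesis .
qed

lemma mem_occupation_process:
  assumes "h < n" "0 < k" "t \<in> {0..<1}" "\<And>p. p \<in> {..<n} \<times> {..<k} \<Longrightarrow> b p \<noteq> t"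
  shows "h \<in> occupation_process n k b t \<longleftrightarrow>
    (\<exists>j<k. \<forall>i<k. cdist t (b (h, j)) < cdist t (b ((h + n - 1) mod n, i)))"
proof -
  have fb: "first_bead k b t g = Min ((\<lambda>j. cdist t (b (g, j))) ` {..<k})" if "g < n" for g
  proof -
    have "(\<lambda>j. b (g, j) - t + of_bool (b (g, j) \<le> t)) ` {..<k} = (\<lambda>j. cdist t (b (g, j))) ` {..<k}"
      using assms(4) that by (intro image_cong refl) (auto simp: cdist_def le_less)
    then show ?thesis by (simp add: first_bead_def)
  qed
  have nk: "{..<k} \<noteq> {}" using assms(2) by (metis empty_iff lessThan_iff)
  have "(h + n - 1) mod n < n" using assms by simp
  then have "h \<in> occupation_process n k b t \<longleftrightarrow>
      Min ((\<lambda>j. cdist t (b (h, j))) ` {..<k}) < Min ((\<lambda>j. cdist t (b ((h + n - 1) mod n, j))) ` {..<k})"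
    using assms(1-3) fb by (simp add: occupation_process_def)
  also have "\<dots> \<longleftrightarrow> (\<exists>j<k. cdist t (b (h, j)) < Min ((\<lambda>j. cdist t (b ((h + n - 1) mod n, j))) ` {..<k}))"
    by (subst Min_less_iff) (auto simp: nk)
  also have "\<dots> \<longleftrightarrow> (\<exists>j<k. \<forall>i<k. cdist t (b (h, j)) < cdist t (b ((h + n - 1) mod n, i)))"
    by (subst Min_gr_iff) (auto simp: nk)
  finally show ?thesis .
qed

lemma fdet_unoccupied_array:
  assumes q: "exp (- \<beta>) \<noteq> (1::complex)" and n: "2 \<le> n" and k: "0 < k" and b: "b \<in> sorted_arrays n k"
    and F: "finite F" "inj_on y F" "y ` F \<subseteq> {0..<1} \<times> {..<n}" "\<And>f. f \<in> F \<Longrightarrow> \<alpha> f = Unoccupied"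
    and sep: "\<And>p f. p \<in> {..<n} \<times> {..<k} \<Longrightarrow> f \<in> F \<Longrightarrow> b p \<noteq> fst (y f)"
  shows "fdet (Inl ` ({..<n} \<times> {..<k}) \<union> Inr ` F) (\<lambda>i j. kernel0 n \<beta> \<theta> (marked_points b \<alpha> y i) (marked_points b \<alpha> y j)) =
    of_bool (marked_event \<alpha> y F (occupation_process n k b)) *
    fdet ({..<n} \<times> {..<k}) (\<lambda>p p'. kernel0 n \<beta> \<theta> (Bead, b p, fst p) (Bead, b p', fst p'))"
proof -
  let ?A = "{..<n} \<times> {..<k}" and ?w = "marked_points b \<alpha> y"
  let ?K = "\<lambda>i j. kernel0 n \<beta> \<theta> (?w i) (?w j)"
  let ?X = "occupation_process n k b"
  have b01: "b p \<in> {0..<1}" if "p \<in> ?A" for p using b that by (auto simp: sorted_arrays_def)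
  have "fdet (Inl ` ?A \<union> Inr ` F) ?K = of_bool (marked_event \<alpha> y F ?X) * fdet (Inl ` ?A) ?K"
    using F sep
  proof (induction F rule: finite_induct)
    case empty
    then show ?case by (simp add: marked_event_def)
  next
    case (insert f F)
    let ?J = "Inl ` ?A \<union> Inr ` F :: (nat \<times> nat + nat) set"
    have IH: "fdet ?J ?K = of_bool (marked_event \<alpha> y F ?X) * fdet (Inl ` ?A) ?K"
      using insert by (intro insert.IH) (auto simp: inj_on_def)
    obtain t h where y: "y f = (t, h)" by (cases "y f")
    have th: "t \<in> {0..<1}" "h < n" using insert.prems(2) y by auto
    have bt: "b p \<noteq> t" if "p \<in> ?A" for p using insert.prems(4)[OF that, of f] y by simp
    have wf: "?w (Inr f) = (Unoccupied, t, h)" using insert.prems(3)[of f] y by (simp add: marked_points_def)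
    define pr where "pr = (h + n - 1) mod n"
    have pr: "pr < n" "pr \<noteq> h" using mod_pred_neq[OF n th(2)] th by (auto simp: pr_def)
    have J: "finite ?J" "Inr f \<notin> ?J" using insert by auto
    have JF: "Inl ` ?A \<union> Inr ` insert f F = insert (Inr f) ?J" by auto
    have yg: "y g \<noteq> (t, h)" if "g \<in> F" for g
      using insert.prems(1) that insert.hyps y by (auto simp: inj_on_def)
    have yF: "fst (y g) \<in> {0..<1} \<and> snd (y g) < n" if "g \<in> F" for g
    proof -
      have "y g \<in> {0..<1} \<times> {..<n}" using insert.prems(2) that by blast
      then show ?thesis by (simp add: mem_Times_iff)
    qed
    have times: "fst (snd (?w i)) \<in> {0..<1}" "snd (snd (?w i)) < n" if "i \<in> insert (Inr f) ?J" for i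
      using that b01 th wf yF by (auto simp: marked_points_def)
    \<comment> \<open>The rows that see string h: beads on the previous string and the other
      unoccupied marks on h.\<close>
    define R where "R = {i \<in> ?J. (\<exists>s. ?w i = (Bead, s, pr)) \<or> (\<exists>s. ?w i = (Unoccupied, s, h))}"
    have "Inl (pr, 0) \<in> R" using pr k by (auto simp: R_def marked_points_def)
    moreover have "finite R" using J by (simp add: R_def)
    ultimately obtain r where r: "r \<in> R" and rmin: "\<And>i. i \<in> R \<Longrightarrow> cdist t (fst (snd (?w r))) \<le> cdist t (fst (snd (?w i)))"
      using ex_is_arg_min_if_finite[of R "\<lambda>i. cdist t (fst (snd (?w i)))"]
      by (force simp: is_arg_min_linorder)
    define s where "s = fst (snd (?w r))"
    have beadR: "Inl (pr, i) \<in> R" if "i < k" for i using pr that by (auto simp: R_def marked_points_def)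
    have markR: "Inr g \<in> R" if "g \<in> F" "snd (y g) = h" for g
      using that insert.prems(3)[of g] by (cases "y g") (auto simp: R_def marked_points_def)
    have ev: "marked_event \<alpha> y (insert f F) ?X \<longleftrightarrow> marked_event \<alpha> y F ?X \<and> h \<notin> ?X t"
      using insert.prems(3)[of f] y by (auto simp: marked_event_def)
    have mem: "h \<in> ?X u \<longleftrightarrow> (\<exists>j<k. \<forall>i<k. cdist u (b (h, j)) < cdist u (b (pr, i)))"
      if "u \<in> {0..<1}" "\<And>p. p \<in> ?A \<Longrightarrow> b p \<noteq> u" for u
      unfolding pr_def using that by (intro mem_occupation_process th(2) k) auto
    have memX: "h \<in> ?X t \<longleftrightarrow> (\<exists>j<k. \<forall>i<k. cdist t (b (h, j)) < cdist t (b (pr, i)))"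
      by (rule mem[OF th(1)]) (rule bt)
    show ?case
    proof (cases "\<forall>c\<in>?J. snd (snd (?w c)) = h \<longrightarrow> cdist t s \<le> cdist t (fst (snd (?w c)))")
      case True
      have wr: "?w r = (Bead, s, (h + n - 1) mod n) \<or> ?w r = (Unoccupied, s, h)"
        using r by (auto simp: R_def s_def pr_def)
      have rJ: "r \<in> ?J" using r by (simp add: R_def)
      have near: "cdist t s \<le> cdist t (b (h, j))" if "j < k" for j
        using True[rule_format, of "Inl (h, j)"] th that by auto
      have "s \<noteq> t"
      proof (cases r)
        case (Inl p)
        then show ?thesis using bt[of p] rJ by (auto simp: s_def marked_points_def)
      next
        case (Inr g)
        then have "y g = (s, h)" using wr insert.prems(3)[of g] rJ by (auto simp: marked_points_def)
        then show ?thesis using yg[of g] Inr rJ by auto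
      qed
      have "fdet (insert (Inr f) ?J) ?K = fdet ?J ?K"
        by (rule fdet_remove_unoccupied_row[OF q n J times(1) wf th(2) rJ wr \<open>s \<noteq> t\<close>]) (use True in auto)
      \<comment> \<open>If the nearest row is a bead on the previous string, it precedes all beads
        on h. If it is a mark at time s, no bead of either string lies before s, so the state of h
        at t is its state at s.\<close>
      moreover have "marked_event \<alpha> y F ?X \<Longrightarrow> h \<notin> ?X t"
      proof (cases r)
        case (Inl p)
        then obtain i where i: "p = (pr, i)" "i < k" "s = b (pr, i)"
          using wr rJ by (cases p) (auto simp: marked_points_def pr_def)
        then show ?thesis unfolding memX using near by (auto simp: not_less intro!: exI[of _ i])
      next
        case (Inr g)
        assume E: "marked_event \<alpha> y F ?X"
        have g: "g \<in> F" "y g = (s, h)" using Inr wr insert.prems(3)[of g] rJ by (auto simp: marked_points_def)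
        have s01: "s \<in> {0..<1}" using insert.prems(2) g by force
        have bs: "b p \<noteq> s" if "p \<in> ?A" for p using insert.prems(4)[OF that, of g] g by simp
        have "h \<notin> ?X s" using E g insert.prems(3)[of g] by (auto simp: marked_event_def)
        moreover have "cdist t (b (h, j)) = cdist t s + cdist s (b (h, j))" if "j < k" for j
          using near th that b01 s01 by (intro cdist_add) auto
        moreover have "cdist t (b (pr, j)) = cdist t s + cdist s (b (pr, j))" if "j < k" for j
          using rmin[OF beadR[OF that]] pr th that b01 s01 by (intro cdist_add) (auto simp: marked_points_def s_def)
        moreover have "h \<in> ?X s \<longleftrightarrow> (\<exists>j<k. \<forall>i<k. cdist s (b (h, j)) < cdist s (b (pr, i)))"
          by (rule mem[OF s01]) (rule bs)
        ultimately show ?thesis unfolding memX by auto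
      qed
      ultimately show ?thesis unfolding JF IH ev by auto
    next
      case False
      then obtain c where c: "c \<in> ?J" "snd (snd (?w c)) = h" "\<not> cdist t s \<le> cdist t (fst (snd (?w c)))" by blast
      \<comment> \<open>Marks on string h belong to R, hence the column that comes first is a
        bead.\<close>
      obtain j where j: "c = Inl (h, j)" "j < k"
      proof (cases c)
        case (Inl p)
        then show ?thesis using c that by (cases p) auto
      next
        case (Inr g)
        then have "Inr g \<in> R" using c by (intro markR) auto
        then show ?thesis using rmin[of "Inr g"] c Inr by (simp add: s_def)
      qed
      define u where "u = b (h, j)"
      have u: "cdist t u < cdist t s" using c j by (simp add: u_def not_le)
      have less: "cdist t u < cdist t (fst (snd (?w i)))" if "i \<in> R" for i
        using u rmin[OF that] by (simp add: s_def)
      have "\<forall>i<k. cdist t (b (h, j)) < cdist t (b (pr, i))"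
        using less[OF beadR] by (simp add: u_def)
      then have "h \<in> ?X t"
        unfolding memX using j by blast
      moreover have "fdet (insert (Inr f) ?J) ?K = 0"
      proof (rule fdet_remove_unoccupied_col[where w="?w" and s=u, OF n J times(1) wf th(2) _ _ c(1)])
        show "?w c = (Bead, u, h)" by (simp add: j u_def marked_points_def)
        show "snd (snd (?w i)) < n" if "i \<in> ?J" for i using times(2)[of i] that by blast
        show "fst (?w i) \<noteq> Occupied" if "i \<in> ?J" for i
          using that insert.prems(3) by (auto simp: marked_points_def)
        fix i assume i: "i \<in> ?J"
        show "cdist t u < cdist t (fst (snd (?w i)))" if "fst (?w i) = Bead" "snd (snd (?w i)) = (h + n - 1) mod n"
        proof -
          have "i \<in> R" using i that by (cases "?w i") (auto simp: R_def pr_def)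
          then show ?thesis by (rule less)
        qed
        show "cdist t u < cdist t (fst (snd (?w i)))" if "fst (?w i) = Unoccupied" "snd (snd (?w i)) = h"
        proof -
          have "i \<in> R" using i that by (cases "?w i") (auto simp: R_def pr_def)
          then show ?thesis by (rule less)
        qed
      qed
      ultimately show ?thesis unfolding JF ev by simp
    qed
  qed
  also have "fdet (Inl ` ?A) ?K = fdet ?A (\<lambda>p p'. ?K (Inl p) (Inl p'))"
    by (rule fdet_reindex) (auto simp: bij_betw_def)
  finally show ?thesis by (simp add: marked_points_def)
qed

lemma fdet_marked_array:
  assumes q: "exp (- \<beta>) \<noteq> (1::complex)" and n: "0 < n" "F = {} \<or> 2 \<le> n" and k: "0 < k" and b: "b \<in> sorted_arrays n k"
    and F: "finite F" "inj_on y F" "y ` F \<subseteq> {0..<1} \<times> {..<n}" "\<And>f. f \<in> F \<Longrightarrow> \<alpha> f \<noteq> Bead"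
    and sep: "\<And>p f. p \<in> {..<n} \<times> {..<k} \<Longrightarrow> f \<in> F \<Longrightarrow> b p \<noteq> fst (y f)"
  defines "l \<equiv> occupation_number n b"
  shows "fdet (Inl ` ({..<n} \<times> {..<k}) \<union> Inr ` F) (\<lambda>i j. kernel0 n \<beta> \<theta> (marked_points b \<alpha> y i) (marked_points b \<alpha> y j)) =
    (if b \<in> bead_arrays n k \<and> marked_event \<alpha> y F (occupation_process n k b)
     then (-1) ^ (l + k * (\<theta> + n + l + 1)) * exp (- \<beta>) ^ l / (1 - exp (- \<beta>)) ^ n else 0)"
proof -
  let ?A = "{..<n} \<times> {..<k}"
  let ?D = "fdet ?A (\<lambda>p p'. kernel0 n \<beta> \<theta> (Bead, b p, fst p) (Bead, b p', fst p'))"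
  have "fdet (Inl ` ?A \<union> Inr ` F) (\<lambda>i j. kernel0 n \<beta> \<theta> (marked_points b \<alpha> y i) (marked_points b \<alpha> y j)) =
     ?D * of_bool (marked_event \<alpha> y F (occupation_process n k b))"
  proof (cases "F = {}")
    case True
    have "fdet (Inl ` ?A) (\<lambda>i j. kernel0 n \<beta> \<theta> (marked_points b \<alpha> y i) (marked_points b \<alpha> y j)) = ?D"
      by (subst fdet_reindex[of Inl ?A]) (auto simp: bij_betw_def marked_points_def)
    then show ?thesis by (simp add: True marked_event_def)
  next
    case False
    then have n2: "2 \<le> n" using n by auto
    have "fdet (Inl ` ?A \<union> Inr ` F) (\<lambda>i j. kernel0 n \<beta> \<theta> (marked_points b \<alpha> y i) (marked_points b \<alpha> y j)) =
       (\<Sum>X\<in>{occupation_process n k b}. ?D * of_bool (marked_event \<alpha> y F X))"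
    proof (rule fdet_occupied_induct[OF q])
      fix F' \<alpha>' assume F': "F' \<subseteq> F" "\<And>f. f \<in> F' \<Longrightarrow> \<alpha>' f = Unoccupied"
      have "fdet (Inl ` ?A \<union> Inr ` F') (\<lambda>i j. kernel0 n \<beta> \<theta> (marked_points b \<alpha>' y i) (marked_points b \<alpha>' y j)) =
        of_bool (marked_event \<alpha>' y F' (occupation_process n k b)) * ?D"
        by (rule fdet_unoccupied_array[OF q n2 k b]) (use F F' sep in \<open>auto intro: finite_subset inj_on_subset\<close>)
      then show "fdet (Inl ` ?A \<union> Inr ` F') (\<lambda>i j. kernel0 n \<beta> \<theta> (marked_points b \<alpha>' y i) (marked_points b \<alpha>' y j)) =
        (\<Sum>X\<in>{occupation_process n k b}. ?D * of_bool (marked_event \<alpha>' y F' X))" by simp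
    qed (use F sep in auto)
    then show ?thesis by simp
  qed
  also have "?D = (if b \<in> bead_arrays n k
     then (-1) ^ (l + k * (\<theta> + n + l + 1)) * exp (- \<beta>) ^ l / (1 - exp (- \<beta>)) ^ n else 0)"
    unfolding l_def by (rule fdet_bead_array[OF n(1) k b q])
  finally show ?thesis by simp
qed

section \<open>Configurations without beads\<close>

lemma sum_Pow_card_power:
  fixes x :: "'a::comm_semiring_1"
  assumes "finite S"
  shows "(\<Sum>A\<in>Pow S. x ^ card A) = (1 + x) ^ card S"
  using assms
proof (induction S rule: finite_induct)
  case (insert s S)
  have "(\<Sum>A\<in>Pow (insert s S). x ^ card A) = (\<Sum>A\<in>Pow S. x ^ card A) + (\<Sum>A\<in>insert s ` Pow S. x ^ card A)"
    using insert by (subst Pow_insert, subst sum.union_disjoint) auto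
  also have "(\<Sum>A\<in>insert s ` Pow S. x ^ card A) = (\<Sum>A\<in>Pow S. x ^ card (insert s A))"
    using insert by (subst sum.reindex) (auto simp: inj_on_def)
  also have "\<dots> = (\<Sum>A\<in>Pow S. x * x ^ card A)"
  proof (intro sum.cong refl)
    fix A assume "A \<in> Pow S"
    then have "finite A" "s \<notin> A" using insert finite_subset by auto
    then show "x ^ card (insert s A) = x * x ^ card A" by simp
  qed
  finally show ?case using insert by (simp add: sum_distrib_left[symmetric] algebra_simps)
qed simp

lemma fdet_unoccupied_constant:
  assumes q: "exp (- \<beta>) \<noteq> (1::complex)" and n: "F = {} \<or> 2 \<le> n"
    and F: "finite F" "inj_on y F" "y ` F \<subseteq> {0..<1} \<times> {..<n}" "\<And>f. f \<in> F \<Longrightarrow> \<alpha> f = Unoccupied"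
  shows "fdet (Inr ` F) (\<lambda>i j. kernel0 n \<beta> \<theta> (marked_points b \<alpha> y i) (marked_points b \<alpha> y j)) =
    1 / (1 - exp (- \<beta>)) ^ card (snd ` y ` F)"
  using F n
proof (induction F rule: finite_induct)
  case (insert f F)
  let ?w = "marked_points b \<alpha> y" and ?J = "Inr ` F :: (nat \<times> nat + nat) set"
  let ?K = "\<lambda>i j. kernel0 n \<beta> \<theta> (?w i) (?w j)"
  have n2: "2 \<le> n" using insert by auto
  have IH: "fdet ?J ?K = 1 / (1 - exp (- \<beta>)) ^ card (snd ` y ` F)"
    using insert by (intro insert.IH) (auto simp: inj_on_def)
  obtain t h where y: "y f = (t, h)" by (cases "y f")
  have th: "t \<in> {0..<1}" "h < n" using insert.prems(2) y by auto
  have wf: "?w (Inr f) = (Unoccupied, t, h)" using insert.prems(3)[of f] y by (simp add: marked_points_def)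
  have J: "finite ?J" "Inr f \<notin> ?J" using insert by auto
  show ?case
  proof (cases "h \<in> snd ` y ` F")
    case True
    define R where "R = {g \<in> F. snd (y g) = h}"
    have "R \<noteq> {}" "finite R" using True insert by (auto simp: R_def)
    then obtain g where g: "g \<in> R" and gmin: "\<And>i. i \<in> R \<Longrightarrow> cdist t (fst (y g)) \<le> cdist t (fst (y i))"
      using ex_is_arg_min_if_finite[of R "\<lambda>i. cdist t (fst (y i))"]
      by (force simp: is_arg_min_linorder)
    have wg: "?w (Inr g) = (Unoccupied, fst (y g), h)"
      using g insert.prems(3)[of g] by (cases "y g") (auto simp: R_def marked_points_def)
    have "fst (y g) \<noteq> t"
    proof
      assume "fst (y g) = t"
      then have "y g = y f" using g y by (auto simp: R_def prod_eq_iff)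
      then show False using g insert.prems(1) insert.hyps by (auto simp: R_def inj_on_def)
    qed
    have "fdet (insert (Inr f) ?J) ?K = fdet ?J ?K"
    proof (rule fdet_remove_unoccupied_row[where r="Inr g" and s="fst (y g)" and w="?w", OF q n2 J _ wf th(2) _ _ \<open>fst (y g) \<noteq> t\<close>])
      show "Inr g \<in> ?J" using g by (simp add: R_def)
      show "?w (Inr g) = (Bead, fst (y g), (h + n - 1) mod n) \<or> ?w (Inr g) = (Unoccupied, fst (y g), h)"
        using wg by simp
      show "fst (snd (?w i)) \<in> {0..<1}" if "i \<in> insert (Inr f) ?J" for i
        using that insert.prems(2) y by (force simp: marked_points_def)
      show "cdist t (fst (y g)) \<le> cdist t (fst (snd (?w c)))" if "c \<in> ?J" "snd (snd (?w c)) = h" for c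
        using that gmin by (auto simp: marked_points_def R_def)
    qed
    moreover have "snd ` y ` insert f F = snd ` y ` F" using True y by auto
    ultimately show ?thesis using IH by simp
  next
    case False
    have "fdet (insert (Inr f) ?J) ?K = fdet ?J ?K / (1 - exp (- \<beta>))"
      by (rule fdet_lone_unoccupied[where w="?w", OF J wf]) (use False in \<open>auto simp: marked_points_def\<close>)
    moreover have "card (snd ` y ` insert f F) = Suc (card (snd ` y ` F))" using False y insert by simp
    ultimately show ?thesis using IH by simp
  qed
qed simp

text \<open>With Q = exp (- \<beta>) and all marks unoccupied on a set S of strings, clearing the
  denominator leaves (1 - Q) ^ (n - card S), which is the sum of (- Q) ^ card A over the subsets A
  that avoid S. Occupied marks follow by inclusion and exclusion.\<close>

lemma fdet_marked_constant:
  assumes q: "exp (- \<beta>) \<noteq> (1::complex)" and n: "F = {} \<or> 2 \<le> n"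
    and F: "finite F" "inj_on y F" "y ` F \<subseteq> {0..<1} \<times> {..<n}" "\<And>f. f \<in> F \<Longrightarrow> \<alpha> f \<noteq> Bead"
  shows "(1 - exp (- \<beta>)) ^ n * fdet (Inr ` F) (\<lambda>i j. kernel0 n \<beta> \<theta> (marked_points b \<alpha> y i) (marked_points b \<alpha> y j)) =
    (\<Sum>A\<in>Pow {..<n}. (- exp (- \<beta>)) ^ card A * of_bool (marked_event \<alpha> y F (constant_process A)))"
proof -
  define Q where "Q = exp (- \<beta>)"
  have Q: "1 - Q \<noteq> 0" using q by (simp add: Q_def)
  let ?c = "\<lambda>A. (- Q) ^ card A / (1 - Q) ^ n"
  \<comment> \<open>The induction sums over processes; the set A, and with it the weight, is
    recovered from the value at time 0.\<close>
  let ?c' = "\<lambda>X. ?c (X (0::real))"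
  have inj: "inj_on constant_process (Pow {..<n})"
    by (auto simp: inj_on_def constant_process_def fun_eq_iff restrict_def dest: spec[of _ 0])
  have c0: "constant_process A 0 = A" for A by (simp add: constant_process_def)
  have "fdet (Inl ` {} \<union> Inr ` F) (\<lambda>i j. kernel0 n \<beta> \<theta> (marked_points b \<alpha> y i) (marked_points b \<alpha> y j)) =
    (\<Sum>X\<in>constant_process ` Pow {..<n}. ?c' X * of_bool (marked_event \<alpha> y F X))"
  proof (rule fdet_occupied_induct[OF q])
    fix F' \<alpha>' assume F': "F' \<subseteq> F" "\<And>f. f \<in> F' \<Longrightarrow> \<alpha>' f = Unoccupied"
    let ?S = "snd ` y ` F'"
    have S: "?S \<subseteq> {..<n}" using F F' by force
    have fS: "finite ?S" using S finite_subset by blast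
    have ev: "marked_event \<alpha>' y F' (constant_process A) \<longleftrightarrow> A \<subseteq> - ?S" for A
    proof -
      have "constant_process A (fst (y f)) = A" if "f \<in> F'" for f
        using that F F' by (auto simp: constant_process_def subset_iff image_iff) (metis mem_Sigma_iff prod.collapse atLeastLessThan_iff)+
      then show ?thesis using F'(2) by (auto simp: marked_event_def)
    qed
    have "fdet (Inl ` {} \<union> Inr ` F') (\<lambda>i j. kernel0 n \<beta> \<theta> (marked_points b \<alpha>' y i) (marked_points b \<alpha>' y j)) =
      1 / (1 - Q) ^ card ?S"
      using fdet_unoccupied_constant[OF q, of F' n y \<alpha>' \<theta> b] F F' n
      by (auto simp: Q_def intro: finite_subset inj_on_subset)
    also have "\<dots> = (1 + (- Q)) ^ card ({..<n} - ?S) / (1 - Q) ^ n"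
    proof -
      have "(1 - Q) ^ n = (1 - Q) ^ card ({..<n} - ?S) * (1 - Q) ^ card ?S"
        using S fS card_mono[of "{..<n}" ?S] by (simp add: card_Diff_subset power_add[symmetric])
      then show ?thesis using Q by simp
    qed
    also have "\<dots> = (\<Sum>A\<in>Pow ({..<n} - ?S). ?c A)"
      by (subst sum_Pow_card_power[symmetric]) (auto simp: sum_divide_distrib)
    also have "\<dots> = (\<Sum>A\<in>Pow {..<n}. ?c A * of_bool (marked_event \<alpha>' y F' (constant_process A)))"
      by (rule sum.mono_neutral_cong_left) (auto simp: ev)
    also have "\<dots> = (\<Sum>X\<in>constant_process ` Pow {..<n}. ?c' X * of_bool (marked_event \<alpha>' y F' X))"
      by (simp add: sum.reindex[OF inj] c0)
    finally show "fdet (Inl ` {} \<union> Inr ` F') (\<lambda>i j. kernel0 n \<beta> \<theta> (marked_points b \<alpha>' y i) (marked_points b \<alpha>' y j)) =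
      (\<Sum>X\<in>constant_process ` Pow {..<n}. ?c' X * of_bool (marked_event \<alpha>' y F' X))" .
  qed (use F in auto)
  then have "fdet (Inr ` F) (\<lambda>i j. kernel0 n \<beta> \<theta> (marked_points b \<alpha> y i) (marked_points b \<alpha> y j)) =
     (\<Sum>A\<in>Pow {..<n}. ?c A * of_bool (marked_event \<alpha> y F (constant_process A)))"
    by (simp add: sum.reindex[OF inj] c0)
  then show ?thesis using Q by (simp add: sum_distrib_left Q_def[symmetric])
qed

section \<open>Dependence of the kernel on \<open>T\<close>\<close>

definition sign_roots :: "nat \<Rightarrow> nat \<Rightarrow> complex set" where
  "sign_roots n \<theta> = {z. z ^ n = (-1) ^ \<theta>}"

text \<open>\<open>nondegenerate\<close> expressed as the nonvanishing of the denominators of the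
  kernel.\<close>

definition regular :: "nat \<Rightarrow> complex \<Rightarrow> nat \<Rightarrow> complex \<Rightarrow> bool" where
  "regular n \<beta> \<theta> T \<longleftrightarrow> (\<forall>z\<in>sign_roots n \<theta>. exp (- (\<beta> + T * z)) \<noteq> 1)"

text \<open>\<open>H\<close> without its factor T in bead rows, see \<open>H_eq_kernel\<close>. Only
  in this normalization is the T-derivative minus the composition of the kernel with itself.\<close>

definition kernel :: "nat \<Rightarrow> complex \<Rightarrow> nat \<Rightarrow> complex \<Rightarrow> kind \<times> real \<times> nat \<Rightarrow> kind \<times> real \<times> nat \<Rightarrow> complex" where
  "kernel n \<beta> \<theta> T w v = (-1) ^ of_bool (fst w = Occupied) / of_nat n *
     (\<Sum>z\<in>sign_roots n \<theta>. z powi (of_bool (fst w = Bead) - (int (snd (snd v)) - int (snd (snd w)))) *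
        (exp (- (\<beta> + T * z) * of_real (bracket (fst w) (fst (snd v) - fst (snd w)))) / (1 - exp (- (\<beta> + T * z)))))"

text \<open>The Fredholm determinant of \<open>C\<close> times (1 - exp (- \<beta>)) ^ n, see
  \<open>fredholm_det_C\<close>. In this form it is entire in T and in \<beta>.\<close>

definition partition_det :: "nat \<Rightarrow> complex \<Rightarrow> nat \<Rightarrow> complex \<Rightarrow> complex" where
  "partition_det n \<beta> \<theta> T = (\<Prod>z\<in>sign_roots n \<theta>. exp (T * z) - exp (- \<beta>))"

section \<open>Roots of (-1)^\<theta> and the kernel at T = 0\<close>

lemma H_eq_kernel:
  "H n \<beta> \<theta> T (fst w) (difference (snd v) (snd w)) = T ^ of_bool (fst w = Bead) * kernel n \<beta> \<theta> T w v"
  by (cases w; cases v) (auto simp: H_def difference_def kernel_def sign_roots_def)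

lemma finite_sign_roots: "0 < n \<Longrightarrow> finite (sign_roots n \<theta>)"
  unfolding sign_roots_def by (rule finite_nth_roots)

lemma card_sign_roots: "0 < n \<Longrightarrow> card (sign_roots n \<theta>) = n"
  unfolding sign_roots_def by (rule card_nth_roots) auto

lemma norm_sign_roots:
  assumes "0 < n" "z \<in> sign_roots n \<theta>"
  shows "norm z = 1"
proof -
  have "norm z ^ n = norm ((-1) ^ \<theta> :: complex)"
    using assms(2) by (simp add: sign_roots_def norm_power[symmetric])
  then have "norm z ^ n = 1 ^ n" by (simp add: norm_power)
  then show ?thesis using power_eq_iff_eq_base[OF assms(1), of "norm z" 1] by simp
qed

lemma sign_roots_nonzero: "0 < n \<Longrightarrow> z \<in> sign_roots n \<theta> \<Longrightarrow> z \<noteq> 0"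
  using norm_sign_roots[of n z \<theta>] by auto

lemma nondegenerate_iff_regular: "nondegenerate n \<beta> \<theta> T \<longleftrightarrow> regular n \<beta> \<theta> T"
proof -
  have "exp (- w) = 1 \<longleftrightarrow> w \<in> range (\<lambda>m::int. 2 * of_real pi * \<i> * of_int m)" for w :: complex
  proof
    assume "exp (- w) = 1"
    then obtain m :: int where m: "Re w = 0" "Im (- w) = of_int (2 * m) * pi" by (auto simp: exp_eq_1)
    then have "Im w = - (2 * pi * real_of_int m)" by (simp add: minus_equation_iff[of "Im w"] mult_ac)
    then have "w = 2 * of_real pi * \<i> * of_int (- m)" using m(1) by (simp add: complex_eq_iff)
    then show "w \<in> range (\<lambda>m::int. 2 * of_real pi * \<i> * of_int m)" by blast
  next
    assume "w \<in> range (\<lambda>m::int. 2 * of_real pi * \<i> * of_int m)"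
    then obtain m :: int where "w = 2 * of_real pi * \<i> * of_int m" by blast
    then show "exp (- w) = 1" by (auto simp: exp_eq_1 intro!: exI[of _ "- m"])
  qed
  then show ?thesis
    unfolding nondegenerate_def regular_def sign_roots_def by (simp only: Ball_def mem_Collect_eq)
qed

text \<open>Multiplication by a primitive n-th root of unity permutes the roots and multiplies the
  sum by a factor that is 1 only if n divides m.\<close>

lemma sum_powi_sign_roots:
  assumes n: "0 < n"
  shows "(\<Sum>z\<in>sign_roots n \<theta>. z powi m) =
    (if int n dvd m then of_nat n * ((-1) ^ \<theta>) powi (m div int n) else 0)"
proof (cases "int n dvd m")
  case True
  then obtain q where q: "m = int n * q" by blast
  have "z powi m = ((-1) ^ \<theta>) powi q" if "z \<in> sign_roots n \<theta>" for z
    using that unfolding q by (simp add: power_int_mult sign_roots_def)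
  then show ?thesis using n q by (simp add: card_sign_roots)
next
  case False
  define \<omega> where "\<omega> = cis (2 * pi / real n)"
  have "\<omega> ^ n = cis (real n * (2 * pi / real n))" unfolding \<omega>_def by (rule Complex.DeMoivre)
  also have "\<dots> = 1" using n by (simp add: complex_eq_iff)
  finally have \<omega>n: "\<omega> ^ n = 1" .
  have \<omega>0: "\<omega> \<noteq> 0" by (simp add: \<omega>_def)
  have \<omega>m: "\<omega> powi m \<noteq> 1"
  proof
    assume "\<omega> powi m = 1"
    then have "cis (of_int m * (2 * pi / real n)) = 1" by (simp add: \<omega>_def cis_power_int)
    then have "cos (of_int m * (2 * pi / real n)) = 1" by (simp add: complex_eq_iff)
    then obtain k :: int where "of_int m * (2 * pi / real n) = of_int k * 2 * pi"
      by (auto simp: cos_one_2pi_int)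
    then have "real_of_int m = of_int (k * int n)" using n by (simp add: field_simps)
    then have "m = k * int n" by linarith
    then show False using False by simp
  qed
  have "bij_betw (\<lambda>z. \<omega> * z) (sign_roots n \<theta>) (sign_roots n \<theta>)"
    by (rule bij_betw_byWitness[where f'="\<lambda>z. z / \<omega>"])
       (auto simp: sign_roots_def power_mult_distrib power_divide \<omega>n \<omega>0)
  then have "(\<Sum>z\<in>sign_roots n \<theta>. z powi m) = (\<Sum>z\<in>sign_roots n \<theta>. (\<omega> * z) powi m)"
    by (rule sum.reindex_bij_betw[symmetric])
  also have "\<dots> = \<omega> powi m * (\<Sum>z\<in>sign_roots n \<theta>. z powi m)"
    by (simp add: power_int_mult_distrib sum_distrib_left)
  finally have "(1 - \<omega> powi m) * (\<Sum>z\<in>sign_roots n \<theta>. z powi m) = 0" by (simp add: algebra_simps)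
  then show ?thesis using \<omega>m False by simp
qed

lemma kernel_at_0:
  assumes n: "0 < n" and h: "snd (snd w) < n" "snd (snd v) < n"
  shows "kernel n \<beta> \<theta> 0 w v = kernel0 n \<beta> \<theta> w v"
proof -
  obtain \<alpha> t h where w: "w = (\<alpha>, t, h)" by (cases w)
  obtain \<alpha>' t' h' where v: "v = (\<alpha>', t', h')" by (cases v)
  have hn: "h < n" "h' < n" using h w v by auto
  define e where "e = exp (- \<beta> * of_real (bracket \<alpha> (t' - t))) / (1 - exp (- \<beta>))"
  define m where "m = of_bool (\<alpha> = Bead) - (int h' - int h)"
  have "kernel n \<beta> \<theta> 0 w v = (-1) ^ of_bool (\<alpha> = Occupied) / of_nat n * (\<Sum>z\<in>sign_roots n \<theta>. z powi m * e)"
    by (simp add: kernel_def w v e_def m_def)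
  also have "\<dots> = (-1) ^ of_bool (\<alpha> = Occupied) / of_nat n * (\<Sum>z\<in>sign_roots n \<theta>. z powi m) * e"
    by (simp only: sum_distrib_right mult.assoc)
  also have "\<dots> = (-1) ^ of_bool (\<alpha> = Occupied) * (if int n dvd m then ((-1) ^ \<theta>) powi (m div int n) else 0) * e"
    unfolding sum_powi_sign_roots[OF n] using n by simp
  also have "\<dots> = kernel0 n \<beta> \<theta> w v"
  proof (cases "\<alpha> = Bead")
    case True
    have "int n dvd m \<longleftrightarrow> h' = Suc h mod n"
    proof
      assume "int n dvd m"
      then obtain q where q: "m = int n * q" by blast
      \<comment> \<open>With m = 1 - (h' - h), the quotient q can only be 0 or 1; the value 1 is the
        step from string n - 1 to string 0 and produces the twist.\<close>
      have "m \<le> int n" "- int n < m" using hn True by (auto simp: m_def)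
      then have "int n * q \<le> int n * 1" "int n * (-1) < int n * q" unfolding q by auto
      then have "q \<le> 1" "-1 < q" using n by (auto simp only: mult_le_cancel_left mult_less_cancel_left)
      then have "q = 0 \<or> q = 1" by auto
      then show "h' = Suc h mod n" using q hn True by (auto simp: m_def mod_Suc)
    next
      assume "h' = Suc h mod n"
      then show "int n dvd m" using hn True by (auto simp: m_def mod_Suc split: if_splits)
    qed
    moreover have "m div int n = (if Suc h = n then 1 else 0)" if "h' = Suc h mod n"
      using that hn True n by (auto simp: m_def mod_Suc)
    ultimately show ?thesis using True by (auto simp: kernel0_def w v e_def)
  next
    case False
    have "int n dvd m \<longleftrightarrow> h' = h"
    proof
      assume "int n dvd m"
      moreover have "\<bar>m\<bar> < int n" using hn False by (auto simp: m_def)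
      ultimately have "m = 0" using dvd_imp_le_int[of m "int n"] by linarith
      then show "h' = h" using False by (simp add: m_def)
    qed (use False in \<open>simp add: m_def\<close>)
    then show ?thesis using False by (cases \<alpha>) (auto simp: kernel0_def w v e_def m_def)
  qed
  finally show ?thesis .
qed

text \<open>Orthogonality over the strings: z' / z is an n-th root of unity.\<close>

lemma sum_string_ratio:
  assumes n: "0 < n" and z: "z \<in> sign_roots n \<theta>" "z' \<in> sign_roots n \<theta>"
  shows "(\<Sum>s<n. (z' / z) ^ s) = of_nat n * of_bool (z' = z)"
proof (cases "z' = z")
  case True
  then show ?thesis using sign_roots_nonzero[OF n z(1)] by simp
next
  case False
  have z0: "z \<noteq> 0" using sign_roots_nonzero[OF n z(1)] .
  then have "z' / z \<noteq> 1" using False by simp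
  moreover have "(z' / z) ^ n = 1" using z z0 by (simp add: power_divide sign_roots_def)
  ultimately show ?thesis using False by (simp add: geometric_sum)
qed

text \<open>The integrand takes two values: on the arc from t to t', of length d, the detour through
  x costs nothing, and on the complementary arc it costs one full turn.\<close>

lemma integral_bracket_convolution:
  fixes \<gamma> :: complex and \<alpha> :: kind
  assumes t: "t \<in> {0..<1}" "t' \<in> {0..<1}"
  defines "f \<equiv> \<lambda>x. exp (- \<gamma> * of_real (bracket \<alpha> (x - t))) * exp (- \<gamma> * of_real (bracket Bead (t' - x)))"
    and "d \<equiv> cdist t t'"
  shows "(LINT x:{0..<1}|lborel. f x) = exp (- \<gamma> * of_real d) * (of_real d + of_real (1 - d) * exp (- \<gamma>))"
proof -
  define c1 where "c1 = exp (- \<gamma> * of_real d)"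
  define c2 where "c2 = c1 * exp (- \<gamma>)"
  \<comment> \<open>The point x = t is left out because there \<open>bracket\<close> may exceed
    \<open>cdist\<close>; it is a null set.\<close>
  have val: "f x = (if cdist t x \<le> d then c1 else c2)" if "x \<noteq> t" "x \<in> {0..<1}" for x
  proof -
    have "f x = exp (- \<gamma> * of_real (cdist t x + cdist x t'))"
      unfolding f_def using that by (simp add: bracket_eq_cdist exp_add[symmetric] algebra_simps)
    moreover have "cdist t x + cdist x t' = (if cdist t x \<le> d then d else d + 1)"
      using that t by (auto simp: cdist_def d_def)
    ultimately show ?thesis by (auto simp: c1_def c2_def exp_add[symmetric] algebra_simps)
  qed
  have ae: "AE x in lborel. x \<noteq> t" by (rule AE_lborel_singleton)
  have m: "f \<in> borel_measurable lborel" unfolding f_def bracket_def by measurable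
  show ?thesis
  proof (cases "t \<le> t'")
    case True
    have "(LINT x:{0..<1}|lborel. f x) = (\<integral>x. indicator {0..<1} x *\<^sub>R c2 + indicator {t..t'} x *\<^sub>R (c1 - c2) \<partial>lborel)"
      unfolding set_lebesgue_integral_def
    proof (intro integral_cong_AE)
      show "AE x in lborel. indicator {0..<1} x *\<^sub>R f x = indicator {0..<1} x *\<^sub>R c2 + indicator {t..t'} x *\<^sub>R (c1 - c2)"
        using ae
      proof eventually_elim
        case (elim x)
        show ?case
        proof (cases "x \<in> {0..<1}")
          case x: True
          have "cdist t x \<le> d \<longleftrightarrow> x \<in> {t..t'}" using True t x by (auto simp: cdist_def d_def)
          then show ?thesis using x val[OF elim x] by auto
        qed (use t in auto)
      qed
    qed (use m in measurable)
    also have "\<dots> = c2 + of_real d * (c1 - c2)"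
      using True t by (subst Bochner_Integration.integral_add) (auto simp: d_def cdist_def scaleR_conv_of_real)
    finally show ?thesis unfolding c2_def c1_def by (simp add: algebra_simps)
  next
    case False
    have "(LINT x:{0..<1}|lborel. f x) = (\<integral>x. indicator {0..<1} x *\<^sub>R c1 + indicator {t'<..<t} x *\<^sub>R (c2 - c1) \<partial>lborel)"
      unfolding set_lebesgue_integral_def
    proof (intro integral_cong_AE)
      show "AE x in lborel. indicator {0..<1} x *\<^sub>R f x = indicator {0..<1} x *\<^sub>R c1 + indicator {t'<..<t} x *\<^sub>R (c2 - c1)"
        using ae
      proof eventually_elim
        case (elim x)
        show ?case
        proof (cases "x \<in> {0..<1}")
          case x: True
          have "cdist t x \<le> d \<longleftrightarrow> x \<notin> {t'<..<t}" using False t x elim by (auto simp: cdist_def d_def)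
          then show ?thesis using x val[OF elim x] by auto
        qed (use t in auto)
      qed
    qed (use m in measurable)
    also have "\<dots> = c1 + of_real (t - t') * (c2 - c1)"
      using False t by (subst Bochner_Integration.integral_add) (auto simp: scaleR_conv_of_real)
    also have "t - t' = 1 - d" using False by (simp add: d_def cdist_def)
    finally show ?thesis unfolding c2_def c1_def by (simp add: algebra_simps)
  qed
qed

section \<open>Integration over the torus and bounds for the kernel\<close>

lemma space_torus: "space (torus n) = {0..<1} \<times> {..<n}"
  by (simp add: torus_def space_pair_measure space_restrict_space)

lemma finite_measure_torus: "finite_measure (torus n)"
proof -
  let ?U = "restrict_space lborel {0..<1::real}" and ?C = "count_space {..<n}"
  have U: "finite_measure ?U"
    by (rule finite_measureI) (simp add: emeasure_restrict_space space_restrict_space)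
  have C: "finite_measure ?C" by (rule finite_measure_count_space) simp
  show ?thesis unfolding torus_def by (rule finite_measure_pair_measure[OF C U])
qed

lemma integral_torus:
  fixes f :: "_ \<Rightarrow> complex"
  assumes "integrable (torus n) f"
  shows "(LINT x|torus n. f x) = (\<Sum>h<n. LINT t:{0..<1}|lborel. f (t, h))"
proof -
  let ?U = "restrict_space lborel {0..<1::real}" and ?C = "count_space {..<n}"
  interpret U: finite_measure ?U
    by (rule finite_measureI) (simp add: emeasure_restrict_space space_restrict_space)
  interpret C: finite_measure ?C by (rule finite_measure_count_space) simp
  interpret P: pair_sigma_finite ?U ?C ..
  have "(LINT x|torus n. f x) = (LINT h|?C. LINT t|?U. f (t, h))"
    using P.integral_snd[of "\<lambda>t h. f (t, h)"] assms by (simp add: torus_def split_def)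
  also have "\<dots> = (\<Sum>h<n. LINT t|?U. f (t, h))"
    by (rule lebesgue_integral_count_space_finite) simp
  also have "\<dots> = (\<Sum>h<n. LINT t:{0..<1}|lborel. f (t, h))"
    by (intro sum.cong refl) (simp add: integral_restrict_space set_lebesgue_integral_def)
  finally show ?thesis .
qed

lemma integrable_torus_bounded:
  fixes f :: "_ \<Rightarrow> complex"
  assumes "f \<in> borel_measurable (torus n)" "\<And>x. x \<in> space (torus n) \<Longrightarrow> norm (f x) \<le> B"
  shows "integrable (torus n) f"
  by (rule finite_measure.integrable_const_bound[OF finite_measure_torus, of _ B])
     (use assms in \<open>auto intro: AE_I2\<close>)

lemma measurable_torus_fst [measurable]: "fst \<in> borel_measurable (torus n)"
  unfolding torus_def by (rule measurable_compose[OF measurable_fst]) (auto intro: measurable_restrict_space1)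

lemma measurable_torus_snd [measurable]: "snd \<in> torus n \<rightarrow>\<^sub>M count_space UNIV"
  unfolding torus_def by (rule measurable_compose[OF measurable_snd]) simp

lemma measurable_kernel:
  assumes [measurable]: "f \<in> borel_measurable M" "f' \<in> borel_measurable M"
    "g \<in> M \<rightarrow>\<^sub>M count_space UNIV" "g' \<in> M \<rightarrow>\<^sub>M count_space UNIV"
  shows "(\<lambda>x. kernel n \<beta> \<theta> T (\<alpha>, f x, g x) (\<alpha>', f' x, g' x)) \<in> borel_measurable M"
proof -
  have [measurable]: "(\<lambda>x. z powi (c - (int (g' x) - int (g x)))) \<in> borel_measurable M" for z :: complex and c
    by (rule measurable_compose_countable[OF _ assms(3)], rule measurable_compose_countable[OF _ assms(4)]) simp
  show ?thesis unfolding kernel_def bracket_def by simp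
qed

text \<open>A bound for the kernel that is uniform in the points and continuous in \<beta> and T at
  regular parameters, so that the determinants are locally bounded there.\<close>

definition kernel_bound :: "nat \<Rightarrow> complex \<Rightarrow> nat \<Rightarrow> complex \<Rightarrow> real" where
  "kernel_bound n \<beta> \<theta> T = (\<Sum>z\<in>sign_roots n \<theta>. exp (norm (\<beta> + T * z)) / norm (1 - exp (- (\<beta> + T * z))))"

lemma norm_kernel_le:
  assumes n: "0 < n" and t: "fst (snd w) \<in> {0..<1}" "fst (snd v) \<in> {0..<1}"
  shows "norm (kernel n \<beta> \<theta> T w v) \<le> kernel_bound n \<beta> \<theta> T"
proof -
  obtain \<alpha> t h where w: "w = (\<alpha>, t, h)" by (cases w)
  obtain \<alpha>' t' h' where v: "v = (\<alpha>', t', h')" by (cases v)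
  define \<tau> where "\<tau> = bracket \<alpha> (t' - t)"
  have \<tau>: "\<bar>\<tau>\<bar> \<le> 1"
    using t by (auto simp: w v \<tau>_def bracket_def)
  have "norm (kernel n \<beta> \<theta> T w v) = (1 / n) * norm (\<Sum>z\<in>sign_roots n \<theta>. z powi (of_bool (\<alpha> = Bead) - (int h' - int h)) *
        (exp (- (\<beta> + T * z) * of_real \<tau>) / (1 - exp (- (\<beta> + T * z)))))"
    by (simp add: kernel_def w v \<tau>_def norm_mult norm_divide norm_power)
  also have "\<dots> \<le> 1 * norm (\<Sum>z\<in>sign_roots n \<theta>. z powi (of_bool (\<alpha> = Bead) - (int h' - int h)) *
        (exp (- (\<beta> + T * z) * of_real \<tau>) / (1 - exp (- (\<beta> + T * z)))))"
    by (rule mult_right_mono) (use n in auto)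
  also have "\<dots> \<le> (\<Sum>z\<in>sign_roots n \<theta>. exp (norm (\<beta> + T * z)) / norm (1 - exp (- (\<beta> + T * z))))"
    unfolding mult_1
  proof (rule sum_norm_le)
    fix z assume z: "z \<in> sign_roots n \<theta>"
    have "norm (exp (- (\<beta> + T * z) * of_real \<tau>)) \<le> exp (norm (- (\<beta> + T * z) * of_real \<tau>))"
      by (rule norm_exp)
    also have "\<dots> \<le> exp (norm (\<beta> + T * z))"
      using mult_left_mono[OF \<tau>, of "norm (\<beta> + T * z)"]
      by (simp only: norm_mult norm_minus_cancel norm_of_real norm_ge_zero mult_1_right exp_le_cancel_iff)
    finally have e: "norm (exp (- (\<beta> + T * z) * of_real \<tau>)) \<le> exp (norm (\<beta> + T * z))" .
    have "norm (z powi m) = 1" for m :: int by (simp add: norm_power_int norm_sign_roots[OF n z])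
    then show "norm (z powi (of_bool (\<alpha> = Bead) - (int h' - int h)) *
        (exp (- (\<beta> + T * z) * of_real \<tau>) / (1 - exp (- (\<beta> + T * z))))) \<le>
        exp (norm (\<beta> + T * z)) / norm (1 - exp (- (\<beta> + T * z)))"
      using e by (simp add: norm_mult norm_divide divide_right_mono)
  qed
  finally show ?thesis by (simp add: kernel_bound_def)
qed

lemma sum_of_bool_eq:
  fixes X :: "'a \<Rightarrow> 'b::semiring_1"
  assumes "finite S" "z \<in> S"
  shows "(\<Sum>z'\<in>S. of_bool (z' = z) * X z') = X z"
  using assms by (subst sum.remove[of S z]) (auto intro!: sum.neutral)

text \<open>The roots diagonalize the composition of kernels: summing over the intermediate string
  removes the pairs z' \<noteq> z, and what remains of the time integral is a convolution.\<close>

lemma integral_kernel_mult: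
  fixes \<beta> T :: complex
  assumes n: "0 < n" and t: "fst (snd w) \<in> {0..<1}" "fst (snd v) \<in> {0..<1}"
  defines "d \<equiv> cdist (fst (snd w)) (fst (snd v))" and "\<gamma> \<equiv> \<lambda>z. \<beta> + T * z"
  shows "(LINT x|torus n. kernel n \<beta> \<theta> T w (Bead, x) * kernel n \<beta> \<theta> T (Bead, x) v) =
    (-1) ^ of_bool (fst w = Occupied) / of_nat n *
     (\<Sum>z\<in>sign_roots n \<theta>. z powi (of_bool (fst w = Bead) + 1 - (int (snd (snd v)) - int (snd (snd w)))) *
        (exp (- \<gamma> z * of_real d) * (of_real d + of_real (1 - d) * exp (- \<gamma> z)) / (1 - exp (- \<gamma> z)) ^ 2))"
proof -
  obtain \<alpha> t h where w: "w = (\<alpha>, t, h)" by (cases w)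
  obtain \<alpha>' t' h' where v: "v = (\<alpha>', t', h')" by (cases v)
  let ?R = "sign_roots n \<theta>"
  define c where "c = ((-1) ^ of_bool (\<alpha> = Occupied) :: complex)"
  define a where "a = (of_bool (\<alpha> = Bead) :: int)"
  define D where "D z = 1 - exp (- \<gamma> z)" for z
  define \<phi> where "\<phi> z z' x = exp (- \<gamma> z * of_real (bracket \<alpha> (x - t))) * exp (- \<gamma> z' * of_real (bracket Bead (t' - x)))" for z z' x
  have tt: "t \<in> {0..<1}" "t' \<in> {0..<1}" using t w v by auto
  have \<phi>_meas: "\<phi> z z' \<in> borel_measurable lborel" for z z' unfolding \<phi>_def bracket_def by measurable
  have \<phi>_int: "set_integrable lborel {0..<1} (\<phi> z z')" for z z'
    unfolding set_integrable_def
  proof (rule integrableI_bounded_set_indicator[where B="exp (norm (\<gamma> z)) * exp (norm (\<gamma> z'))"])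
    show "AE x in lborel. x \<in> {0..<1} \<longrightarrow> norm (\<phi> z z' x) \<le> exp (norm (\<gamma> z)) * exp (norm (\<gamma> z'))"
    proof (intro AE_I2 impI)
      fix x :: real assume x: "x \<in> {0..<1}"
      have 1: "norm (exp (- g * of_real \<tau>)) \<le> exp (norm g)" if "\<bar>\<tau>\<bar> \<le> 1" for g :: complex and \<tau>
      proof -
        have "norm (exp (- g * of_real \<tau>)) \<le> exp (norm (- g * of_real \<tau>))" by (rule norm_exp)
        also have "\<dots> \<le> exp (norm g)" using mult_left_mono[OF that, of "norm g"] by (simp add: norm_mult)
        finally show ?thesis .
      qed
      have "\<bar>bracket \<alpha> (x - t)\<bar> \<le> 1" "\<bar>bracket Bead (t' - x)\<bar> \<le> 1"
        using x tt by (auto simp: bracket_def)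
      then show "norm (\<phi> z z' x) \<le> exp (norm (\<gamma> z)) * exp (norm (\<gamma> z'))"
        unfolding \<phi>_def norm_mult by (intro mult_mono 1) auto
    qed
  qed (use \<phi>_meas in auto)
  have prod: "kernel n \<beta> \<theta> T w (Bead, x, s) * kernel n \<beta> \<theta> T (Bead, x, s) v =
      (\<Sum>z\<in>?R. \<Sum>z'\<in>?R. c / of_nat n ^ 2 * (z powi (a - (int s - int h)) * z' powi (1 - (int h' - int s)) / (D z * D z')) * \<phi> z z' x)" for x s
  proof -
    define A where "A z = z powi (a - (int s - int h)) * (exp (- \<gamma> z * of_real (bracket \<alpha> (x - t))) / D z)" for z
    define B where "B z = z powi (1 - (int h' - int s)) * (exp (- \<gamma> z * of_real (bracket Bead (t' - x))) / D z)" for z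
    have 1: "kernel n \<beta> \<theta> T w (Bead, x, s) = c / of_nat n * (\<Sum>z\<in>?R. A z)"
      by (simp only: kernel_def w A_def c_def a_def D_def \<gamma>_def fst_conv snd_conv)
    have 2: "kernel n \<beta> \<theta> T (Bead, x, s) v = 1 / of_nat n * (\<Sum>z\<in>?R. B z)"
      by (simp add: kernel_def v B_def D_def \<gamma>_def)
    have "kernel n \<beta> \<theta> T w (Bead, x, s) * kernel n \<beta> \<theta> T (Bead, x, s) v = c / of_nat n ^ 2 * ((\<Sum>z\<in>?R. A z) * (\<Sum>z\<in>?R. B z))"
      unfolding 1 2 by (simp add: power2_eq_square)
    also have "\<dots> = (\<Sum>z\<in>?R. \<Sum>z'\<in>?R. c / of_nat n ^ 2 * (A z * B z'))"
      unfolding sum_product by (simp only: sum_distrib_left)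
    also have "\<dots> = (\<Sum>z\<in>?R. \<Sum>z'\<in>?R. c / of_nat n ^ 2 * (z powi (a - (int s - int h)) * z' powi (1 - (int h' - int s)) / (D z * D z')) * \<phi> z z' x)"
      by (intro sum.cong refl) (simp add: A_def B_def \<phi>_def)
    finally show ?thesis .
  qed
  have m: "(\<lambda>x. kernel n \<beta> \<theta> T w (Bead, x) * kernel n \<beta> \<theta> T (Bead, x) v) \<in> borel_measurable (torus n)"
  proof -
    have "(\<lambda>x. kernel n \<beta> \<theta> T (\<alpha>, t, h) (Bead, fst x, snd x) * kernel n \<beta> \<theta> T (Bead, fst x, snd x) (\<alpha>', t', h')) \<in> borel_measurable (torus n)"
      by (intro borel_measurable_times measurable_kernel) measurable
    then show ?thesis by (simp add: w v)
  qed
  have int: "integrable (torus n) (\<lambda>x. kernel n \<beta> \<theta> T w (Bead, x) * kernel n \<beta> \<theta> T (Bead, x) v)"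
  proof (rule integrable_torus_bounded[OF m])
    fix x assume "x \<in> space (torus n)"
    then have "fst (snd (Bead, x)) \<in> {0..<1}" by (auto simp: space_torus)
    then show "norm (kernel n \<beta> \<theta> T w (Bead, x) * kernel n \<beta> \<theta> T (Bead, x) v) \<le> kernel_bound n \<beta> \<theta> T * kernel_bound n \<beta> \<theta> T"
      unfolding norm_mult using n t by (intro mult_mono norm_kernel_le order_trans[OF norm_ge_zero norm_kernel_le]) auto
  qed
  have "(LINT x|torus n. kernel n \<beta> \<theta> T w (Bead, x) * kernel n \<beta> \<theta> T (Bead, x) v) =
     (\<Sum>s<n. LINT x:{0..<1}|lborel. kernel n \<beta> \<theta> T w (Bead, x, s) * kernel n \<beta> \<theta> T (Bead, x, s) v)"
    by (rule integral_torus[OF int])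
  also have "\<dots> = (\<Sum>s<n. \<Sum>z\<in>?R. \<Sum>z'\<in>?R. c / of_nat n ^ 2 * (z powi (a - (int s - int h)) * z' powi (1 - (int h' - int s)) / (D z * D z')) *
        (LINT x:{0..<1}|lborel. \<phi> z z' x))"
    unfolding prod
  proof (intro sum.cong refl)
    fix s
    let ?c = "\<lambda>z z'. c / of_nat n ^ 2 * (z powi (a - (int s - int h)) * z' powi (1 - (int h' - int s)) / (D z * D z'))"
    have i: "integrable lborel (\<lambda>x. indicator {0..<1} x *\<^sub>R \<phi> z z' x)" for z z'
      using \<phi>_int by (simp add: set_integrable_def)
    have "(LINT x:{0..<1}|lborel. (\<Sum>z\<in>?R. \<Sum>z'\<in>?R. ?c z z' * \<phi> z z' x)) =
        (LINT x|lborel. (\<Sum>z\<in>?R. \<Sum>z'\<in>?R. ?c z z' * (indicator {0..<1} x *\<^sub>R \<phi> z z' x)))"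
      unfolding set_lebesgue_integral_def by (simp add: scaleR_sum_right)
    also have "\<dots> = (\<Sum>z\<in>?R. \<Sum>z'\<in>?R. ?c z z' * (LINT x|lborel. indicator {0..<1} x *\<^sub>R \<phi> z z' x))"
      by (simp only: Bochner_Integration.integral_sum Bochner_Integration.integrable_sum integrable_mult_right i
          integral_mult_right_zero)
    finally show "(LINT x:{0..<1}|lborel. (\<Sum>z\<in>?R. \<Sum>z'\<in>?R. ?c z z' * \<phi> z z' x)) =
      (\<Sum>z\<in>?R. \<Sum>z'\<in>?R. ?c z z' * (LINT x:{0..<1}|lborel. \<phi> z z' x))"
      by (simp only: set_lebesgue_integral_def)
  qed
  also have "\<dots> = (\<Sum>z\<in>?R. \<Sum>z'\<in>?R. \<Sum>s<n. c / of_nat n ^ 2 * (z powi (a - (int s - int h)) * z' powi (1 - (int h' - int s)) / (D z * D z')) *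
        (LINT x:{0..<1}|lborel. \<phi> z z' x))"
    by (subst sum.swap, rule sum.cong[OF refl], rule sum.swap)
  also have "\<dots> = (\<Sum>z\<in>?R. \<Sum>z'\<in>?R. c / of_nat n ^ 2 * (z powi (a + int h) * z' powi (1 - int h') / (D z * D z')) *
        (LINT x:{0..<1}|lborel. \<phi> z z' x) * (\<Sum>s<n. (z' / z) ^ s))"
  proof (intro sum.cong refl)
    fix z z' assume z: "z \<in> ?R" "z' \<in> ?R"
    then have z0: "z \<noteq> 0" "z' \<noteq> 0" using sign_roots_nonzero[OF n] by auto
    have "z powi (a - (int s - int h)) * z' powi (1 - (int h' - int s)) = z powi (a + int h) * z' powi (1 - int h') * (z' / z) ^ s" for s
    proof -
      have "z powi (a - (int s - int h)) = z powi ((a + int h) - int s)" by (simp add: algebra_simps)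
      also have "\<dots> = z powi (a + int h) / z ^ s" using z0 by (simp add: power_int_diff)
      finally have 1: "z powi (a - (int s - int h)) = z powi (a + int h) / z ^ s" .
      have "z' powi (1 - (int h' - int s)) = z' powi ((1 - int h') + int s)" by (simp add: algebra_simps)
      also have "\<dots> = z' powi (1 - int h') * z' ^ s" using z0 by (subst power_int_add) auto
      finally show ?thesis unfolding 1 by (simp add: power_divide)
    qed
    then show "(\<Sum>s<n. c / of_nat n ^ 2 * (z powi (a - (int s - int h)) * z' powi (1 - (int h' - int s)) / (D z * D z')) *
        (LINT x:{0..<1}|lborel. \<phi> z z' x)) =
       c / of_nat n ^ 2 * (z powi (a + int h) * z' powi (1 - int h') / (D z * D z')) *
        (LINT x:{0..<1}|lborel. \<phi> z z' x) * (\<Sum>s<n. (z' / z) ^ s)"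
      unfolding sum_distrib_left by (intro sum.cong refl) (simp add: mult_ac)
  qed
  also have "\<dots> = (\<Sum>z\<in>?R. \<Sum>z'\<in>?R. of_bool (z' = z) * (c / of_nat n * (z powi (a + int h) * z' powi (1 - int h') / (D z * D z')) *
        (LINT x:{0..<1}|lborel. \<phi> z z' x)))"
    by (intro sum.cong refl) (use n in \<open>simp add: sum_string_ratio[OF n] power2_eq_square\<close>)
  also have "\<dots> = (\<Sum>z\<in>?R. c / of_nat n * (z powi (a + int h) * z powi (1 - int h') / (D z * D z)) *
        (LINT x:{0..<1}|lborel. \<phi> z z x))"
    by (intro sum.cong refl) (subst sum_of_bool_eq, use finite_sign_roots[OF n] in auto)
  also have "\<dots> = (\<Sum>z\<in>?R. c / of_nat n * (z powi (a + 1 - (int h' - int h)) *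
        (exp (- \<gamma> z * of_real d) * (of_real d + of_real (1 - d) * exp (- \<gamma> z)) / D z ^ 2)))"
  proof (intro sum.cong refl)
    fix z assume z: "z \<in> ?R"
    then have z0: "z \<noteq> 0" using sign_roots_nonzero[OF n] by auto
    have "z powi (a + int h) * z powi (1 - int h') = z powi ((a + int h) + (1 - int h'))"
      using z0 by (simp add: power_int_add)
    also have "(a + int h) + (1 - int h') = a + 1 - (int h' - int h)" by simp
    finally have 1: "z powi (a + int h) * z powi (1 - int h') = z powi (a + 1 - (int h' - int h))" .
    have 2: "(LINT x:{0..<1}|lborel. \<phi> z z x) = exp (- \<gamma> z * of_real d) * (of_real d + of_real (1 - d) * exp (- \<gamma> z))"
      unfolding \<phi>_def using integral_bracket_convolution[OF tt, of "\<gamma> z" \<alpha>] by (simp add: d_def w v)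
    show "c / of_nat n * (z powi (a + int h) * z powi (1 - int h') / (D z * D z)) * (LINT x:{0..<1}|lborel. \<phi> z z x) =
      c / of_nat n * (z powi (a + 1 - (int h' - int h)) *
        (exp (- \<gamma> z * of_real d) * (of_real d + of_real (1 - d) * exp (- \<gamma> z)) / D z ^ 2))"
      unfolding 1 2 by (simp add: power2_eq_square)
  qed
  finally show ?thesis
    by (simp add: w v c_def a_def D_def sum_distrib_left)
qed

text \<open>The resolvent identity in differential form. For each root, with \<gamma> = \<beta> + T
  z, the derivative of exp (- \<gamma> \<tau>) / (1 - exp (- \<gamma>)) with respect to \<gamma> is
  minus the convolution computed above, and the inner derivative z is the power of z that a bead row
  adds.\<close>

lemma has_field_derivative_kernel:
  assumes n: "0 < n" and t: "fst (snd w) \<in> {0..<1}" "fst (snd v) \<in> {0..<1}" and reg: "regular n \<beta> \<theta> T"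
  shows "((\<lambda>T. kernel n \<beta> \<theta> T w v) has_field_derivative
     - (LINT x|torus n. kernel n \<beta> \<theta> T w (Bead, x) * kernel n \<beta> \<theta> T (Bead, x) v)) (at T)"
proof -
  obtain \<alpha> t h where w: "w = (\<alpha>, t, h)" by (cases w)
  obtain \<alpha>' t' h' where v: "v = (\<alpha>', t', h')" by (cases v)
  let ?R = "sign_roots n \<theta>"
  define d where "d = cdist t t'"
  define \<tau> where "\<tau> = bracket \<alpha> (t' - t)"
  define m where "m = of_bool (\<alpha> = Bead) - (int h' - int h)"
  have \<tau>: "\<tau> = d \<or> \<tau> = 1 \<and> d = 0"
    by (auto simp: \<tau>_def d_def bracket_eq_cdist)
  have "((\<lambda>T. z powi m * (exp (- (\<beta> + T * z) * of_real \<tau>) / (1 - exp (- (\<beta> + T * z))))) has_field_derivative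
     - (z powi (m + 1) * (exp (- (\<beta> + T * z) * of_real d) * (of_real d + of_real (1 - d) * exp (- (\<beta> + T * z))) / (1 - exp (- (\<beta> + T * z))) ^ 2))) (at T)"
    if z: "z \<in> ?R" for z
  proof -
    define g where "g = \<beta> + T * z"
    have D: "1 - exp (- g) \<noteq> 0" using reg z by (auto simp: regular_def g_def)
    have z0: "z \<noteq> 0" using sign_roots_nonzero[OF n z] .
    have "((\<lambda>T. z powi m * (exp (- (\<beta> + T * z) * of_real \<tau>) / (1 - exp (- (\<beta> + T * z))))) has_field_derivative
      z powi m * ((- z * of_real \<tau> * exp (- g * of_real \<tau>) * (1 - exp (- g)) - exp (- g * of_real \<tau>) * (z * exp (- g))) / (1 - exp (- g)) ^ 2)) (at T)"
      using D unfolding g_def by (auto intro!: derivative_eq_intros simp: power2_eq_square algebra_simps)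
    also have "z powi m * ((- z * of_real \<tau> * exp (- g * of_real \<tau>) * (1 - exp (- g)) - exp (- g * of_real \<tau>) * (z * exp (- g))) / (1 - exp (- g)) ^ 2)
      = - (z powi m * z * (exp (- g * of_real \<tau>) * (of_real \<tau> + of_real (1 - \<tau>) * exp (- g)) / (1 - exp (- g)) ^ 2))"
      by (simp add: algebra_simps diff_divide_distrib add_divide_distrib minus_divide_left[symmetric] del: minus_divide_left)
    \<comment> \<open>For an occupied point at its own time \<tau> = 1 while d = 0; the expression
      has the value exp (- g) for both.\<close>
    also have "exp (- g * of_real \<tau>) * (of_real \<tau> + of_real (1 - \<tau>) * exp (- g)) = exp (- g * of_real d) * (of_real d + of_real (1 - d) * exp (- g))"
      using \<tau> by auto
    also have "z powi m * z = z powi (m + 1)" using z0 by (simp add: power_int_add)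
    finally show ?thesis by (simp only: g_def)
  qed
  then have "((\<lambda>T. (-1) ^ of_bool (\<alpha> = Occupied) / of_nat n * (\<Sum>z\<in>?R. z powi m * (exp (- (\<beta> + T * z) * of_real \<tau>) / (1 - exp (- (\<beta> + T * z)))))) has_field_derivative
     (-1) ^ of_bool (\<alpha> = Occupied) / of_nat n * (\<Sum>z\<in>?R. - (z powi (m + 1) * (exp (- (\<beta> + T * z) * of_real d) * (of_real d + of_real (1 - d) * exp (- (\<beta> + T * z))) / (1 - exp (- (\<beta> + T * z))) ^ 2)))) (at T)"
    by (intro DERIV_cmult DERIV_sum) auto
  moreover have "(\<lambda>T. kernel n \<beta> \<theta> T w v) = (\<lambda>T. (-1) ^ of_bool (\<alpha> = Occupied) / of_nat n *
      (\<Sum>z\<in>?R. z powi m * (exp (- (\<beta> + T * z) * of_real \<tau>) / (1 - exp (- (\<beta> + T * z))))))"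
    by (simp only: kernel_def w v \<tau>_def m_def fst_conv snd_conv)
  moreover have "- (LINT x|torus n. kernel n \<beta> \<theta> T w (Bead, x) * kernel n \<beta> \<theta> T (Bead, x) v) =
     (-1) ^ of_bool (\<alpha> = Occupied) / of_nat n * (\<Sum>z\<in>?R. - (z powi (m + 1) * (exp (- (\<beta> + T * z) * of_real d) * (of_real d + of_real (1 - d) * exp (- (\<beta> + T * z))) / (1 - exp (- (\<beta> + T * z))) ^ 2)))"
  proof -
    have "of_bool (\<alpha> = Bead) + 1 - (int h' - int h) = m + 1" by (simp add: m_def)
    then show ?thesis
      unfolding integral_kernel_mult[OF n t] sum_negf mult_minus_right
      by (simp only: w v d_def fst_conv snd_conv)
  qed
  ultimately show ?thesis by simp
qed

text \<open>The logarithmic derivative is the trace of the bead kernel. That kernel is constant on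
  the diagonal, and the torus has mass n.\<close>

lemma has_field_derivative_partition_det:
  assumes n: "0 < n" and reg: "regular n \<beta> \<theta> T"
  shows "((\<lambda>T. partition_det n \<beta> \<theta> T) has_field_derivative
     partition_det n \<beta> \<theta> T * (LINT x|torus n. kernel n \<beta> \<theta> T (Bead, x) (Bead, x))) (at T)"
proof -
  let ?R = "sign_roots n \<theta>"
  define S where "S = (\<Sum>z\<in>?R. z / (1 - exp (- (\<beta> + T * z))))"
  have K: "kernel n \<beta> \<theta> T (Bead, x) (Bead, x) = S / of_nat n" for x
    by (simp add: kernel_def S_def bracket_def)
  have "measure (torus n) (space (torus n)) = n"
  proof -
    let ?U = "restrict_space lborel {0..<1::real}" and ?C = "count_space {..<n}"
    interpret C: finite_measure ?C by (rule finite_measure_count_space) simp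
    have "emeasure (torus n) ({0..<1} \<times> {..<n}) = emeasure ?U {0..<1} * emeasure ?C {..<n}"
      unfolding torus_def by (rule C.emeasure_pair_measure_Times) (auto simp: sets_restrict_space)
    then show ?thesis unfolding space_torus by (simp add: measure_def emeasure_restrict_space)
  qed
  then have int: "(LINT x|torus n. kernel n \<beta> \<theta> T (Bead, x) (Bead, x)) = S"
    unfolding K using n by (simp add: scaleR_conv_of_real)
  have nz: "exp (T * z) - exp (- \<beta>) = exp (T * z) * (1 - exp (- (\<beta> + T * z)))" for z
    by (simp add: algebra_simps exp_add[symmetric])
  have "((\<lambda>T. partition_det n \<beta> \<theta> T) has_field_derivative
      (\<Sum>z\<in>?R. z * exp (T * z) * (\<Prod>z'\<in>?R - {z}. exp (T * z') - exp (- \<beta>)))) (at T)"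
    unfolding partition_det_def
    by (rule has_field_derivative_prod) (auto intro!: derivative_eq_intros)
  also have "(\<Sum>z\<in>?R. z * exp (T * z) * (\<Prod>z'\<in>?R - {z}. exp (T * z') - exp (- \<beta>))) = partition_det n \<beta> \<theta> T * S"
    unfolding S_def sum_distrib_left
  proof (intro sum.cong refl)
    fix z assume z: "z \<in> ?R"
    define D where "D = 1 - exp (- (\<beta> + T * z))"
    define R where "R = (\<Prod>z'\<in>?R - {z}. exp (T * z') - exp (- \<beta>))"
    have D: "D \<noteq> 0" using reg z by (auto simp: regular_def D_def)
    have "partition_det n \<beta> \<theta> T = exp (T * z) * D * R"
      unfolding partition_det_def R_def D_def nz[symmetric] by (rule prod.remove[OF finite_sign_roots[OF n] z])
    then have "z * exp (T * z) * R = partition_det n \<beta> \<theta> T * (z / D)" using D by simp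
    then show "z * exp (T * z) * (\<Prod>z'\<in>?R - {z}. exp (T * z') - exp (- \<beta>)) =
      partition_det n \<beta> \<theta> T * (z / (1 - exp (- (\<beta> + T * z))))" by (simp only: D_def R_def)
  qed
  finally show ?thesis unfolding int .
qed

lemma partition_det_0:
  assumes "0 < n"
  shows "partition_det n \<beta> \<theta> 0 = (1 - exp (- \<beta>)) ^ n"
  using card_sign_roots[OF assms] by (simp add: partition_det_def)

lemma partition_det_nonzero:
  assumes "0 < n" "regular n \<beta> \<theta> T"
  shows "partition_det n \<beta> \<theta> T \<noteq> 0"
proof -
  have "exp (T * z) - exp (- \<beta>) = exp (T * z) * (1 - exp (- (\<beta> + T * z)))" for z
    by (simp add: algebra_simps exp_add[symmetric])
  then show ?thesis using assms finite_sign_roots[OF assms(1)]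
    by (auto simp: partition_det_def regular_def)
qed

lemma fdet_row_integral:
  fixes A :: "'i \<Rightarrow> 'i \<Rightarrow> complex"
  assumes "finite J" "i \<in> J" "\<And>j. j \<in> J \<Longrightarrow> integrable M (\<lambda>a. u a j)"
  shows "integrable M (\<lambda>a. fdet J (A(i := u a)))"
    and "(LINT a|M. fdet J (A(i := u a))) = fdet J (A(i := \<lambda>j. LINT a|M. u a j))"
proof -
  have *: "(\<Prod>k\<in>J. (A(i := w)) k (p k)) = w (p i) * (\<Prod>k\<in>J - {i}. A k (p k))" for w p
    using assms by (subst prod.remove[of J i]) (auto intro!: prod.cong)
  have int: "integrable M (\<lambda>a. of_int (sign p) * (u a (p i) * (\<Prod>k\<in>J - {i}. A k (p k))))" if "p permutes J" for p
    using assms that by (intro integrable_mult_right integrable_mult_left) (auto simp: permutes_in_image)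
  show "integrable M (\<lambda>a. fdet J (A(i := u a)))"
    unfolding fdet_def * by (intro Bochner_Integration.integrable_sum int) auto
  show "(LINT a|M. fdet J (A(i := u a))) = fdet J (A(i := \<lambda>j. LINT a|M. u a j))"
    unfolding fdet_def *
    by (subst Bochner_Integration.integral_sum) (auto intro!: int sum.cong)
qed

text \<open>The recursion of the g's before integration over J. Expanding along the new bead a, the
  diagonal entry integrates to the logarithmic derivative of \<open>partition_det\<close>. Replacing
  row i contributes K(w i, a) K(a, w j), whose integral is minus the derivative of K(w i, w j); so
  these terms are the row-by-row derivative of the determinant.\<close>

lemma has_field_derivative_fdet_kernel:
  assumes n: "0 < n" and J: "finite J" "x \<notin> J" and w: "\<And>j. j \<in> J \<Longrightarrow> fst (snd (w j)) \<in> {0..<1}"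
    and reg: "regular n \<beta> \<theta> T"
  shows "((\<lambda>T. partition_det n \<beta> \<theta> T * fdet J (\<lambda>i j. kernel n \<beta> \<theta> T (w i) (w j))) has_field_derivative
    (LINT a|torus n. partition_det n \<beta> \<theta> T *
       fdet (insert x J) (\<lambda>i j. kernel n \<beta> \<theta> T ((w(x := (Bead, a))) i) ((w(x := (Bead, a))) j)))) (at T)"
proof -
  let ?K = "kernel n \<beta> \<theta> T" and ?B = "kernel_bound n \<beta> \<theta> T"
  let ?A = "\<lambda>i j. ?K (w i) (w j)"
  have B0: "0 \<le> ?B" by (auto simp: kernel_bound_def intro!: sum_nonneg)
  have m1: "(\<lambda>a. ?K v (Bead, a)) \<in> borel_measurable (torus n)" and m2: "(\<lambda>a. ?K (Bead, a) v) \<in> borel_measurable (torus n)"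
    and m3: "(\<lambda>a. ?K (Bead, a) (Bead, a)) \<in> borel_measurable (torus n)" for v
  proof -
    obtain \<alpha> t h where v: "v = (\<alpha>, t, h)" by (cases v)
    have "(\<lambda>a. ?K (\<alpha>, t, h) (Bead, fst a, snd a)) \<in> borel_measurable (torus n)"
      "(\<lambda>a. ?K (Bead, fst a, snd a) (\<alpha>, t, h)) \<in> borel_measurable (torus n)"
      "(\<lambda>a. ?K (Bead, fst a, snd a) (Bead, fst a, snd a)) \<in> borel_measurable (torus n)"
      by (intro measurable_kernel; measurable)+
    then show "(\<lambda>a. ?K v (Bead, a)) \<in> borel_measurable (torus n)" "(\<lambda>a. ?K (Bead, a) v) \<in> borel_measurable (torus n)"
      "(\<lambda>a. ?K (Bead, a) (Bead, a)) \<in> borel_measurable (torus n)" by (simp_all add: v)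
  qed
  have sp: "fst a \<in> {0..<1}" if "a \<in> space (torus n)" for a using that by (auto simp: space_torus)
  have intd: "integrable (torus n) (\<lambda>a. ?K (Bead, a) (Bead, a))"
    by (rule integrable_torus_bounded[OF m3, of ?B]) (auto intro!: norm_kernel_le n sp)
  have intp: "integrable (torus n) (\<lambda>a. ?K (w i) (Bead, a) * ?K (Bead, a) (w j))" if "i \<in> J" "j \<in> J" for i j
  proof (rule integrable_torus_bounded[where B="?B * ?B"])
    fix a assume "a \<in> space (torus n)"
    then show "norm (?K (w i) (Bead, a) * ?K (Bead, a) (w j)) \<le> ?B * ?B"
      unfolding norm_mult using w that B0 sp by (intro mult_mono norm_kernel_le n) auto
  qed (intro borel_measurable_times m1 m2)
  have exp: "fdet (insert x J) (\<lambda>i j. ?K ((w(x := (Bead, a))) i) ((w(x := (Bead, a))) j)) =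
     ?K (Bead, a) (Bead, a) * fdet J ?A - (\<Sum>i\<in>J. fdet J (?A(i := \<lambda>j. ?K (w i) (Bead, a) * ?K (Bead, a) (w j))))" for a
  proof -
    let ?w = "w(x := (Bead, a))"
    let ?A' = "\<lambda>i j. ?K (?w i) (?w j)"
    have 1: "fdet J ?A' = fdet J ?A" using J by (intro fdet_cong) auto
    have 2: "?A' i x * fdet J (?A'(i := ?A' x)) = fdet J (?A(i := \<lambda>j. ?K (w i) (Bead, a) * ?K (Bead, a) (w j)))" if i: "i \<in> J" for i
    proof -
      have "fdet J (?A'(i := ?A' x)) = fdet J (?A(i := \<lambda>j. ?K (Bead, a) (w j)))"
        using J by (intro fdet_cong) auto
      moreover have "i \<noteq> x" using i J by auto
      ultimately show ?thesis using fdet_row_scale[OF J(1) i, of ?A "?K (w i) (Bead, a)" "\<lambda>j. ?K (Bead, a) (w j)"] by simp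
    qed
    show ?thesis unfolding fdet_insert[OF J, of ?A'] 1 using 2 by simp
  qed
  have "(LINT a|torus n. partition_det n \<beta> \<theta> T *
       fdet (insert x J) (\<lambda>i j. ?K ((w(x := (Bead, a))) i) ((w(x := (Bead, a))) j))) =
     partition_det n \<beta> \<theta> T * ((LINT a|torus n. ?K (Bead, a) (Bead, a)) * fdet J ?A -
       (\<Sum>i\<in>J. fdet J (?A(i := \<lambda>j. LINT a|torus n. ?K (w i) (Bead, a) * ?K (Bead, a) (w j)))))"
  proof -
    have i1: "integrable (torus n) (\<lambda>a. fdet J (?A(i := \<lambda>j. ?K (w i) (Bead, a) * ?K (Bead, a) (w j))))"
      and i2: "(LINT a|torus n. fdet J (?A(i := \<lambda>j. ?K (w i) (Bead, a) * ?K (Bead, a) (w j)))) =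
         fdet J (?A(i := \<lambda>j. LINT a|torus n. ?K (w i) (Bead, a) * ?K (Bead, a) (w j)))" if "i \<in> J" for i
      using fdet_row_integral[where M="torus n" and A="?A" and u="\<lambda>a j. ?K (w i) (Bead, a) * ?K (Bead, a) (w j)", OF J(1) that intp] that by auto
    show ?thesis unfolding exp
      using intd i1 by (simp add: i2 Bochner_Integration.integral_sum)
  qed
  also have "\<dots> = partition_det n \<beta> \<theta> T * (LINT a|torus n. ?K (Bead, a) (Bead, a)) * fdet J ?A +
      partition_det n \<beta> \<theta> T * (\<Sum>i\<in>J. fdet J (?A(i := \<lambda>j. - (LINT a|torus n. ?K (w i) (Bead, a) * ?K (Bead, a) (w j)))))"
  proof -
    have "fdet J (?A(i := \<lambda>j. - f j)) = - fdet J (?A(i := f))" if "i \<in> J" for i f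
      using fdet_row_scale[OF J(1) that, of ?A "-1" f] by simp
    then show ?thesis by (simp add: algebra_simps sum_negf)
  qed
  finally have eq: "(LINT a|torus n. partition_det n \<beta> \<theta> T *
       fdet (insert x J) (\<lambda>i j. ?K ((w(x := (Bead, a))) i) ((w(x := (Bead, a))) j))) =
     partition_det n \<beta> \<theta> T * (LINT a|torus n. ?K (Bead, a) (Bead, a)) * fdet J ?A +
      partition_det n \<beta> \<theta> T * (\<Sum>i\<in>J. fdet J (?A(i := \<lambda>j. - (LINT a|torus n. ?K (w i) (Bead, a) * ?K (Bead, a) (w j)))))" .
  have "((\<lambda>T. fdet J (\<lambda>i j. kernel n \<beta> \<theta> T (w i) (w j))) has_field_derivative
     (\<Sum>i\<in>J. fdet J (?A(i := \<lambda>j. - (LINT a|torus n. ?K (w i) (Bead, a) * ?K (Bead, a) (w j)))))) (at T)"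
    by (rule has_field_derivative_fdet[OF J(1)]) (intro has_field_derivative_kernel n w reg)
  from DERIV_mult[OF has_field_derivative_partition_det[OF n reg] this]
  show ?thesis unfolding eq by (simp add: algebra_simps)
qed

section \<open>Symmetrization over labelled points\<close>

lemma sigma_finite_torus: "sigma_finite_measure (torus n)"
  using finite_measure_torus finite_measure.axioms(1) by blast

lemma product_sigma_finite_torus: "product_sigma_finite (\<lambda>_. torus n)"
  by (simp add: product_sigma_finite_def sigma_finite_torus)

lemma product_sigma_finite_lborel: "product_sigma_finite (\<lambda>_. lborel :: real measure)"
  by (simp add: product_sigma_finite_def sigma_finite_lborel)

section \<open>Products of tori in terms of strings and times\<close>

lemma emeasure_torus_slices:
  assumes "A \<in> sets (torus n)"
  shows "emeasure (torus n) A = (\<Sum>h<n. emeasure lborel {u \<in> {0..<1}. (u, h) \<in> A})"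
    and "h < n \<Longrightarrow> {u \<in> {0..<1}. (u, h) \<in> A} \<in> sets lborel"
proof -
  let ?U = "restrict_space lborel {0..<1::real}" and ?C = "count_space {..<n}"
  interpret U: finite_measure ?U
    by (rule finite_measureI) (simp add: emeasure_restrict_space space_restrict_space)
  interpret C: finite_measure ?C by (rule finite_measure_count_space) simp
  interpret P: pair_sigma_finite ?U ?C ..
  have A: "A \<in> sets (?U \<Otimes>\<^sub>M ?C)" using assms by (simp add: torus_def)
  have A01: "fst a \<in> {0..<1}" if "a \<in> A" for a
    using sets.sets_into_space[OF assms] that by (auto simp: space_torus)
  have slice: "(\<lambda>x. (x, h)) -` A = {u \<in> {0..<1}. (u, h) \<in> A}" for h using A01 by force
  have m: "(\<lambda>x. (x, h)) -` A \<in> sets ?U" for h by (rule sets_Pair2[OF A])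
  then show "{u \<in> {0..<1}. (u, h) \<in> A} \<in> sets lborel"
    unfolding slice by (auto simp: sets_restrict_space_iff)
  have "emeasure (torus n) A = (\<integral>\<^sup>+h. emeasure ?U ((\<lambda>x. (x, h)) -` A) \<partial>?C)"
    unfolding torus_def by (rule P.emeasure_pair_measure_alt2[OF A])
  also have "\<dots> = (\<Sum>h<n. emeasure ?U ((\<lambda>x. (x, h)) -` A))"
    by (rule nn_integral_count_space_finite) simp
  also have "\<dots> = (\<Sum>h<n. emeasure lborel {u \<in> {0..<1}. (u, h) \<in> A})"
    unfolding slice by (intro sum.cong refl emeasure_restrict_space) auto
  finally show "emeasure (torus n) A = (\<Sum>h<n. emeasure lborel {u \<in> {0..<1}. (u, h) \<in> A})" .
qed

abbreviation "unit_box I \<equiv> (I \<rightarrow>\<^sub>E {0..<1::real})"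

lemma unit_box_measurable: "finite I \<Longrightarrow> unit_box I \<in> sets (\<Pi>\<^sub>M i\<in>I. lborel)"
  by (rule sets_PiM_I_finite) auto

text \<open>Separates the strings of a family of points from their times, so that an integral over
  tori becomes a finite sum, over assignments of strings, of Lebesgue integrals over the unit
  box.\<close>

lemma PiM_torus_eq_distr:
  assumes I: "finite I"
  shows "distr (count_space (I \<rightarrow>\<^sub>E {..<n}) \<Otimes>\<^sub>M restrict_space (\<Pi>\<^sub>M i\<in>I. lborel) (unit_box I)) (\<Pi>\<^sub>M i\<in>I. torus n)
     (\<lambda>(s, t). \<lambda>i\<in>I. (t i, s i)) = (\<Pi>\<^sub>M i\<in>I. torus n)" (is "distr (?S \<Otimes>\<^sub>M ?N) ?P ?f = ?P")
    and "(\<lambda>(s, t). \<lambda>i\<in>I. (t i, s i)) \<in> count_space (I \<rightarrow>\<^sub>E {..<n}) \<Otimes>\<^sub>M restrict_space (\<Pi>\<^sub>M i\<in>I. lborel) (unit_box I) \<rightarrow>\<^sub>M (\<Pi>\<^sub>M i\<in>I. torus n)"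
proof -
  interpret T: product_sigma_finite "\<lambda>_. torus n" by (rule product_sigma_finite_torus)
  interpret L: product_sigma_finite "\<lambda>_. lborel :: real measure" by (rule product_sigma_finite_lborel)
  have box: "unit_box I \<inter> space (\<Pi>\<^sub>M i\<in>I. lborel) \<in> sets (\<Pi>\<^sub>M i\<in>I. lborel)"
    using unit_box_measurable[OF I] by auto
  have spN: "space ?N = unit_box I" by (auto simp: space_restrict_space space_PiM)
  have eN: "emeasure ?N X = emeasure (\<Pi>\<^sub>M i\<in>I. lborel) X" if "X \<subseteq> unit_box I" for X
    using that box by (intro emeasure_restrict_space) auto
  have N: "sigma_finite_measure ?N"
  proof -
    have "emeasure ?N (space ?N) = (\<Prod>i\<in>I. emeasure lborel {0..<1::real})"
      unfolding spN eN[OF order_refl] by (rule L.emeasure_PiM) (use I in auto)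
    then have "finite_measure ?N" by (intro finite_measureI) simp
    then show ?thesis using finite_measure.axioms(1) by blast
  qed
  interpret N: sigma_finite_measure ?N by (rule N)
  show meas: "?f \<in> ?S \<Otimes>\<^sub>M ?N \<rightarrow>\<^sub>M ?P"
  proof -
    have "(\<lambda>x. \<lambda>i\<in>I. (snd x i, fst x i)) \<in> ?S \<Otimes>\<^sub>M ?N \<rightarrow>\<^sub>M ?P"
    proof (rule measurable_restrict)
      fix i assume i: "i \<in> I"
      have "(\<lambda>t. t i) \<in> ?N \<rightarrow>\<^sub>M restrict_space lborel {0..<1}"
      proof (rule measurable_restrict_space2)
        show "(\<lambda>t. t i) \<in> ?N \<rightarrow>\<^sub>M lborel"
          by (rule measurable_restrict_space1) (use i in measurable)
        show "(\<lambda>t. t i) \<in> space ?N \<rightarrow> {0..<1}" unfolding spN using i by (auto simp: PiE_mem)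
      qed
      moreover have "(\<lambda>s. s i) \<in> ?S \<rightarrow>\<^sub>M count_space {..<n}" using i by (auto simp: PiE_mem)
      ultimately show "(\<lambda>x. (snd x i, fst x i)) \<in> ?S \<Otimes>\<^sub>M ?N \<rightarrow>\<^sub>M torus n"
        unfolding torus_def
        by (intro measurable_Pair measurable_compose[OF measurable_snd] measurable_compose[OF measurable_fst])
    qed
    then show ?thesis by (simp add: split_def)
  qed
  show "distr (?S \<Otimes>\<^sub>M ?N) ?P ?f = ?P"
  proof (rule T.PiM_eqI[OF I])
    fix A assume A: "\<And>i. i \<in> I \<Longrightarrow> A i \<in> sets (torus n)"
    have PA: "Pi\<^sub>E I A \<in> sets ?P" using A I by (intro sets_PiM_I_finite) auto
    have fin: "finite (I \<rightarrow>\<^sub>E {..<n})" using I by (intro finite_PiE) auto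
    have "emeasure (distr (?S \<Otimes>\<^sub>M ?N) ?P ?f) (Pi\<^sub>E I A) = emeasure (?S \<Otimes>\<^sub>M ?N) (?f -` Pi\<^sub>E I A \<inter> space (?S \<Otimes>\<^sub>M ?N))"
      by (rule emeasure_distr[OF meas PA])
    also have "\<dots> = (\<integral>\<^sup>+s. emeasure ?N (Pair s -` (?f -` Pi\<^sub>E I A \<inter> space (?S \<Otimes>\<^sub>M ?N))) \<partial>?S)"
      by (rule N.emeasure_pair_measure_alt) (rule measurable_sets[OF meas PA])
    also have "\<dots> = (\<Sum>s\<in>I \<rightarrow>\<^sub>E {..<n}. emeasure ?N (Pair s -` (?f -` Pi\<^sub>E I A \<inter> space (?S \<Otimes>\<^sub>M ?N))))"
      by (rule nn_integral_count_space_finite[OF fin])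
    also have "\<dots> = (\<Sum>s\<in>I \<rightarrow>\<^sub>E {..<n}. \<Prod>i\<in>I. emeasure lborel {u \<in> {0..<1}. (u, s i) \<in> A i})"
    proof (intro sum.cong refl)
      fix s assume s: "s \<in> I \<rightarrow>\<^sub>E {..<n}"
      have "Pair s -` (?f -` Pi\<^sub>E I A \<inter> space (?S \<Otimes>\<^sub>M ?N)) = (\<Pi>\<^sub>E i\<in>I. {u \<in> {0..<1}. (u, s i) \<in> A i})"
        using s by (auto simp: space_pair_measure spN PiE_iff)
      moreover have "emeasure ?N \<dots> = emeasure (\<Pi>\<^sub>M i\<in>I. lborel) \<dots>" by (rule eN) (auto simp: PiE_iff)
      moreover have "emeasure (\<Pi>\<^sub>M i\<in>I. lborel) (\<Pi>\<^sub>E i\<in>I. {u \<in> {0..<1}. (u, s i) \<in> A i}) = (\<Prod>i\<in>I. emeasure lborel {u \<in> {0..<1}. (u, s i) \<in> A i})"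
      proof (rule L.emeasure_PiM[OF I])
        fix i assume i: "i \<in> I"
        then have "s i < n" using s by (auto simp: PiE_iff)
        then show "{u \<in> {0..<1}. (u, s i) \<in> A i} \<in> sets lborel" by (rule emeasure_torus_slices(2)[OF A[OF i]])
      qed
      ultimately show "emeasure ?N (Pair s -` (?f -` Pi\<^sub>E I A \<inter> space (?S \<Otimes>\<^sub>M ?N))) = (\<Prod>i\<in>I. emeasure lborel {u \<in> {0..<1}. (u, s i) \<in> A i})"
        by simp
    qed
    also have "\<dots> = (\<Prod>i\<in>I. \<Sum>h<n. emeasure lborel {u \<in> {0..<1}. (u, h) \<in> A i})"
      using I by (subst prod_sum_PiE) auto
    also have "\<dots> = (\<Prod>i\<in>I. emeasure (torus n) (A i))"
      by (intro prod.cong refl emeasure_torus_slices(1)[symmetric] A)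
    finally show "emeasure (distr (?S \<Otimes>\<^sub>M ?N) ?P ?f) (Pi\<^sub>E I A) = (\<Prod>i\<in>I. emeasure (torus n) (A i))" .
  qed simp
qed

lemma finite_measure_PiM_torus: "finite I \<Longrightarrow> finite_measure (\<Pi>\<^sub>M i\<in>I. torus n)"
  and measure_PiM_torus: "finite I \<Longrightarrow> measure (\<Pi>\<^sub>M i\<in>I. torus n) (space (\<Pi>\<^sub>M i\<in>I. torus n)) = real n ^ card I"
proof -
  assume I: "finite I"
  interpret T: product_sigma_finite "\<lambda>_. torus n" by (rule product_sigma_finite_torus)
  have "emeasure (torus n) (space (torus n)) = (\<Sum>h<n. emeasure lborel {u \<in> {0..<1::real}. (u, h) \<in> space (torus n)})"
    by (rule emeasure_torus_slices) simp
  also have "\<dots> = (\<Sum>h<n. 1)"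
  proof (intro sum.cong refl)
    fix h assume "h \<in> {..<n}"
    then have "{u \<in> {0..<1::real}. (u, h) \<in> space (torus n)} = {0..<1}" by (auto simp: space_torus)
    then show "emeasure lborel {u \<in> {0..<1::real}. (u, h) \<in> space (torus n)} = 1" by simp
  qed
  finally have t: "emeasure (torus n) (space (torus n)) = ennreal n" by (simp add: ennreal_of_nat_eq_real_of_nat)
  have e: "emeasure (\<Pi>\<^sub>M i\<in>I. torus n) (space (\<Pi>\<^sub>M i\<in>I. torus n)) = ennreal (real n ^ card I)"
    unfolding space_PiM by (subst T.emeasure_PiM[OF I]) (auto simp: t ennreal_power)
  show "finite_measure (\<Pi>\<^sub>M i\<in>I. torus n)" by (rule finite_measureI) (simp add: e)
  show "measure (\<Pi>\<^sub>M i\<in>I. torus n) (space (\<Pi>\<^sub>M i\<in>I. torus n)) = real n ^ card I"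
    by (simp add: measure_def e)
qed

lemma integrable_PiM_torus_bounded:
  fixes f :: "_ \<Rightarrow> complex"
  assumes "finite I" "f \<in> borel_measurable (\<Pi>\<^sub>M i\<in>I. torus n)" "\<And>x. x \<in> space (\<Pi>\<^sub>M i\<in>I. torus n) \<Longrightarrow> norm (f x) \<le> B"
  shows "integrable (\<Pi>\<^sub>M i\<in>I. torus n) f"
  by (rule finite_measure.integrable_const_bound[OF finite_measure_PiM_torus[OF assms(1)], of _ B])
     (use assms in \<open>auto intro: AE_I2\<close>)

lemma integral_PiM_torus:
  fixes \<psi> :: "_ \<Rightarrow> complex"
  assumes I: "finite I" and \<psi>: "\<psi> \<in> borel_measurable (\<Pi>\<^sub>M i\<in>I. torus n)"
    "\<And>x. x \<in> space (\<Pi>\<^sub>M i\<in>I. torus n) \<Longrightarrow> norm (\<psi> x) \<le> B"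
  shows "(LINT x|(\<Pi>\<^sub>M i\<in>I. torus n). \<psi> x) = (\<Sum>s\<in>I \<rightarrow>\<^sub>E {..<n}. LINT t:unit_box I|(\<Pi>\<^sub>M i\<in>I. lborel). \<psi> (\<lambda>i\<in>I. (t i, s i)))"
    and "s \<in> I \<rightarrow>\<^sub>E {..<n} \<Longrightarrow> set_integrable (\<Pi>\<^sub>M i\<in>I. lborel) (unit_box I) (\<lambda>t. \<psi> (\<lambda>i\<in>I. (t i, s i)))"
proof -
  let ?S = "count_space (I \<rightarrow>\<^sub>E {..<n})" and ?N = "restrict_space (\<Pi>\<^sub>M i\<in>I. lborel) (unit_box I)"
  let ?P = "\<Pi>\<^sub>M i\<in>I. torus n" and ?f = "\<lambda>(s, t). \<lambda>i\<in>I. (t i, s i)"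
  interpret L: product_sigma_finite "\<lambda>_. lborel :: real measure" by (rule product_sigma_finite_lborel)
  note meas = PiM_torus_eq_distr(2)[OF I, of n]
  have box: "unit_box I \<inter> space (\<Pi>\<^sub>M i\<in>I. lborel) \<in> sets (\<Pi>\<^sub>M i\<in>I. lborel)"
    using unit_box_measurable[OF I] by auto
  have spN: "space ?N = unit_box I" by (auto simp: space_restrict_space space_PiM)
  have "emeasure ?N (space ?N) = (\<Prod>i\<in>I. emeasure lborel {0..<1::real})"
    unfolding spN emeasure_restrict_space[OF box order_refl] by (rule L.emeasure_PiM[OF I]) simp
  then interpret N: finite_measure ?N by (intro finite_measureI) simp
  have fin: "finite (I \<rightarrow>\<^sub>E {..<n})" using I by (intro finite_PiE) auto
  interpret S: finite_measure ?S by (rule finite_measure_count_space[OF fin])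
  interpret P: pair_sigma_finite ?S ?N ..
  have int: "integrable ?P \<psi>" by (rule integrable_PiM_torus_bounded[OF I \<psi>])
  have "integrable (?S \<Otimes>\<^sub>M ?N) (\<lambda>x. \<psi> (?f x))"
    by (rule integrable_distr[OF meas]) (simp add: PiM_torus_eq_distr(1)[OF I] int)
  then have int2: "integrable (?S \<Otimes>\<^sub>M ?N) (\<lambda>(s, t). \<psi> (?f (s, t)))" by (simp add: split_def)
  have "(LINT x|?P. \<psi> x) = (LINT x|distr (?S \<Otimes>\<^sub>M ?N) ?P ?f. \<psi> x)"
    by (simp add: PiM_torus_eq_distr(1)[OF I])
  also have "\<dots> = (LINT x|(?S \<Otimes>\<^sub>M ?N). \<psi> (?f x))" by (rule integral_distr[OF meas \<psi>(1)])
  also have "\<dots> = (LINT s|?S. LINT t|?N. \<psi> (?f (s, t)))"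
    using P.integral_fst[OF int2] by (simp add: split_def)
  also have "\<dots> = (\<Sum>s\<in>I \<rightarrow>\<^sub>E {..<n}. LINT t|?N. \<psi> (?f (s, t)))"
    by (rule lebesgue_integral_count_space_finite[OF fin])
  also have "\<dots> = (\<Sum>s\<in>I \<rightarrow>\<^sub>E {..<n}. LINT t:unit_box I|(\<Pi>\<^sub>M i\<in>I. lborel). \<psi> (\<lambda>i\<in>I. (t i, s i)))"
    by (intro sum.cong refl) (simp add: integral_restrict_space[OF box] set_lebesgue_integral_def)
  finally show "(LINT x|(\<Pi>\<^sub>M i\<in>I. torus n). \<psi> x) = (\<Sum>s\<in>I \<rightarrow>\<^sub>E {..<n}. LINT t:unit_box I|(\<Pi>\<^sub>M i\<in>I. lborel). \<psi> (\<lambda>i\<in>I. (t i, s i)))" .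
  assume s: "s \<in> I \<rightarrow>\<^sub>E {..<n}"
  have "(\<lambda>t. \<psi> (?f (s, t))) \<in> borel_measurable ?N"
    by (rule measurable_compose[OF measurable_Pair1' measurable_compose[OF meas \<psi>(1)]]) (use s in simp)
  moreover have "norm (\<psi> (?f (s, t))) \<le> B" if "t \<in> space ?N" for t
    using that s unfolding spN by (intro \<psi>(2)) (auto simp: space_PiM space_torus PiE_iff)
  ultimately have "integrable ?N (\<lambda>t. \<psi> (?f (s, t)))"
    by (intro N.integrable_const_bound[of _ B]) (auto intro: AE_I2)
  then show "set_integrable (\<Pi>\<^sub>M i\<in>I. lborel) (unit_box I) (\<lambda>t. \<psi> (\<lambda>i\<in>I. (t i, s i)))"
    by (simp add: integrable_restrict_space[OF box] set_integrable_def)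
qed

lemma PiM_lborel_reindex:
  assumes \<sigma>: "bij_betw \<sigma> I A" and I: "finite I"
  shows "distr (\<Pi>\<^sub>M a\<in>A. lborel) (\<Pi>\<^sub>M i\<in>I. lborel) (\<lambda>b. \<lambda>i\<in>I. b (\<sigma> i)) = (\<Pi>\<^sub>M i\<in>I. lborel :: real measure)"
    and "(\<lambda>b. \<lambda>i\<in>I. b (\<sigma> i)) \<in> (\<Pi>\<^sub>M a\<in>A. lborel :: real measure) \<rightarrow>\<^sub>M (\<Pi>\<^sub>M i\<in>I. lborel :: real measure)"
proof -
  interpret L: product_sigma_finite "\<lambda>_. lborel :: real measure" by (rule product_sigma_finite_lborel)
  have A: "finite A" using \<sigma> I bij_betw_finite by blast
  have \<sigma>A: "\<sigma> i \<in> A" if "i \<in> I" for i using \<sigma> that by (auto simp: bij_betw_def)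
  show m: "(\<lambda>b. \<lambda>i\<in>I. b (\<sigma> i)) \<in> (\<Pi>\<^sub>M a\<in>A. lborel :: real measure) \<rightarrow>\<^sub>M (\<Pi>\<^sub>M i\<in>I. lborel :: real measure)"
    by (rule measurable_restrict) (use \<sigma>A in measurable)
  show "distr (\<Pi>\<^sub>M a\<in>A. lborel) (\<Pi>\<^sub>M i\<in>I. lborel) (\<lambda>b. \<lambda>i\<in>I. b (\<sigma> i)) = (\<Pi>\<^sub>M i\<in>I. lborel :: real measure)"
  proof (rule L.PiM_eqI[OF I])
    fix X :: "_ \<Rightarrow> real set" assume X: "\<And>i. i \<in> I \<Longrightarrow> X i \<in> sets lborel"
    let ?g = "inv_into I \<sigma>"
    have g: "?g (\<sigma> i) = i" if "i \<in> I" for i using \<sigma> that by (simp add: bij_betw_def)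
    have g': "\<sigma> (?g a) = a" "?g a \<in> I" if "a \<in> A" for a
      using \<sigma> that by (auto simp: bij_betw_def f_inv_into_f inv_into_into)
    have "emeasure (distr (\<Pi>\<^sub>M a\<in>A. lborel) (\<Pi>\<^sub>M i\<in>I. lborel) (\<lambda>b. \<lambda>i\<in>I. b (\<sigma> i))) (Pi\<^sub>E I X) =
      emeasure (\<Pi>\<^sub>M a\<in>A. lborel) ((\<lambda>b. \<lambda>i\<in>I. b (\<sigma> i)) -` (Pi\<^sub>E I X) \<inter> space (\<Pi>\<^sub>M a\<in>A. lborel))"
      by (rule emeasure_distr[OF m]) (use X I in \<open>auto intro!: sets_PiM_I_finite\<close>)
    also have "(\<lambda>b. \<lambda>i\<in>I. b (\<sigma> i)) -` (Pi\<^sub>E I X) \<inter> space (\<Pi>\<^sub>M a\<in>A. lborel) = (\<Pi>\<^sub>E a\<in>A. X (?g a))"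
    proof (intro equalityI subsetI)
      fix b assume "b \<in> (\<lambda>b. \<lambda>i\<in>I. b (\<sigma> i)) -` (Pi\<^sub>E I X) \<inter> space (\<Pi>\<^sub>M a\<in>A. lborel)"
      then have b: "\<And>i. i \<in> I \<Longrightarrow> b (\<sigma> i) \<in> X i" "b \<in> extensional A" by (auto simp: PiE_iff space_PiM)
      show "b \<in> (\<Pi>\<^sub>E a\<in>A. X (?g a))" using b(1)[OF g'(2)] b(2) g'(1) by (simp add: PiE_iff)
    next
      fix b assume b: "b \<in> (\<Pi>\<^sub>E a\<in>A. X (?g a))"
      have "b (\<sigma> i) \<in> X i" if "i \<in> I" for i using PiE_mem[OF b \<sigma>A[OF that]] g[OF that] by simp
      then show "b \<in> (\<lambda>b. \<lambda>i\<in>I. b (\<sigma> i)) -` (Pi\<^sub>E I X) \<inter> space (\<Pi>\<^sub>M a\<in>A. lborel)"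
        using b by (auto simp: PiE_iff space_PiM)
    qed
    also have "emeasure (\<Pi>\<^sub>M a\<in>A. lborel) (\<Pi>\<^sub>E a\<in>A. X (?g a)) = (\<Prod>a\<in>A. emeasure lborel (X (?g a)))"
      by (rule L.emeasure_PiM[OF A]) (use X g' in auto)
    also have "\<dots> = (\<Prod>i\<in>I. emeasure lborel (X i))"
      by (subst prod.reindex_bij_betw[OF \<sigma>, symmetric]) (auto intro!: prod.cong simp: g)
    finally show "emeasure (distr (\<Pi>\<^sub>M a\<in>A. lborel) (\<Pi>\<^sub>M i\<in>I. lborel) (\<lambda>b. \<lambda>i\<in>I. b (\<sigma> i))) (Pi\<^sub>E I X) = (\<Prod>i\<in>I. emeasure lborel (X i))" .
  qed simp
qed

text \<open>Fubini in coordinate i: as f does not depend on it, every fibre of the exceptional set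
  has at most one point.\<close>

lemma AE_PiM_lborel_neq:
  fixes f :: "_ \<Rightarrow> real"
  assumes I: "finite I" "i \<in> I" and f: "f \<in> borel_measurable (\<Pi>\<^sub>M i\<in>I. lborel)"
    and fi: "\<And>x y. f (x(i := y)) = f x"
  shows "AE t in (\<Pi>\<^sub>M i\<in>I. lborel). t i \<noteq> f t"
proof -
  interpret L: product_sigma_finite "\<lambda>_. lborel :: real measure" by (rule product_sigma_finite_lborel)
  define J where "J = I - {i}"
  have J: "finite J" "i \<notin> J" "I = insert i J" using I by (auto simp: J_def)
  let ?M = "\<Pi>\<^sub>M i\<in>I. lborel :: real measure"
  let ?E = "{t \<in> space ?M. t i = f t}"
  have E: "?E \<in> sets ?M" using f I by measurable
  have "emeasure ?M ?E = (\<integral>\<^sup>+t. indicator ?E t \<partial>?M)" using E by simp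
  also have "\<dots> = (\<integral>\<^sup>+x. (\<integral>\<^sup>+y. indicator ?E (x(i := y)) \<partial>lborel) \<partial>(\<Pi>\<^sub>M i\<in>J. lborel :: real measure))"
    unfolding J(3) by (rule L.product_nn_integral_insert[OF J(1,2)]) (use E J in auto)
  also have "\<dots> = (\<integral>\<^sup>+x. 0 \<partial>(\<Pi>\<^sub>M i\<in>J. lborel :: real measure))"
  proof (rule nn_integral_cong)
    fix x assume "x \<in> space (\<Pi>\<^sub>M i\<in>J. lborel :: real measure)"
    have "(\<integral>\<^sup>+y. indicator ?E (x(i := y)) \<partial>lborel) \<le> (\<integral>\<^sup>+y. indicator {f x} y \<partial>lborel)"
      by (rule nn_integral_mono) (auto simp: indicator_def fi)
    also have "\<dots> = 0" by simp
    finally show "(\<integral>\<^sup>+y. indicator ?E (x(i := y)) \<partial>lborel) = 0" by simp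
  qed
  finally have "?E \<in> null_sets ?M" using E by auto
  then show ?thesis by (rule AE_I') auto
qed

lemma AE_PiM_lborel_inj:
  assumes "finite I"
  shows "AE t in (\<Pi>\<^sub>M i\<in>I. lborel :: real measure). inj_on t I"
proof -
  have "AE t in (\<Pi>\<^sub>M i\<in>I. lborel :: real measure). \<forall>i\<in>I. \<forall>j\<in>I - {i}. t i \<noteq> t j"
    using assms
    by (intro AE_finite_allI finite_Diff) (auto intro!: AE_PiM_lborel_neq)
  then show ?thesis by eventually_elim (auto simp: inj_on_def)
qed

lemma AE_PiM_lborel_const:
  assumes "finite I" "i \<in> I"
  shows "AE t in (\<Pi>\<^sub>M i\<in>I. lborel :: real measure). t i \<noteq> c"
  by (rule AE_PiM_lborel_neq[OF assms]) auto

section \<open>Folding integrals over the torus onto sorted arrays\<close>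

definition balanced :: "nat \<Rightarrow> nat \<Rightarrow> 'i set \<Rightarrow> ('i \<Rightarrow> nat) \<Rightarrow> bool" where
  "balanced n k I s \<longleftrightarrow> (\<forall>h<n. card {i \<in> I. s i = h} = k)"

definition sorted_by :: "'i set \<Rightarrow> ('i \<Rightarrow> nat \<times> nat) \<Rightarrow> ('i \<Rightarrow> real) \<Rightarrow> bool" where
  "sorted_by I \<sigma> t \<longleftrightarrow> (\<forall>i\<in>I. \<forall>i'\<in>I. fst (\<sigma> i) = fst (\<sigma> i') \<longrightarrow> snd (\<sigma> i) < snd (\<sigma> i') \<longrightarrow> t i < t i')"

definition labellings :: "nat \<Rightarrow> nat \<Rightarrow> 'i set \<Rightarrow> ('i \<Rightarrow> nat \<times> nat) set" where
  "labellings n k I = {\<sigma> \<in> I \<rightarrow>\<^sub>E {..<n} \<times> {..<k}. bij_betw \<sigma> I ({..<n} \<times> {..<k})}"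

lemma finite_labellings: "finite I \<Longrightarrow> finite (labellings n k I)"
  unfolding labellings_def by (rule finite_subset[of _ "I \<rightarrow>\<^sub>E {..<n} \<times> {..<k}"]) (auto intro: finite_PiE)

text \<open>A balanced assignment of strings extends to exactly one sorted labelling: the second component
  of a label is the rank among the points of the same string.\<close>

lemma sum_sorted_labellings:
  fixes t :: "'i \<Rightarrow> real" and \<psi> :: "('i \<Rightarrow> nat) \<Rightarrow> complex"
  assumes I: "finite I" "card I = n * k" and t: "inj_on t I"
    and zero: "\<And>s. s \<in> I \<rightarrow>\<^sub>E {..<n} \<Longrightarrow> \<not> balanced n k I s \<Longrightarrow> \<psi> s = 0"
  shows "(\<Sum>\<sigma>\<in>labellings n k I. of_bool (sorted_by I \<sigma> t) * \<psi> (\<lambda>i\<in>I. fst (\<sigma> i))) = (\<Sum>s\<in>I \<rightarrow>\<^sub>E {..<n}. \<psi> s)"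
proof -
  let ?A = "{..<n} \<times> {..<k}"
  define rank where "rank s i = card {i' \<in> I. s i' = s i \<and> t i' < t i}" for s :: "'i \<Rightarrow> nat" and i
  have rank_less: "rank s i < rank s i' \<longleftrightarrow> t i < t i'" if "i \<in> I" "i' \<in> I" "s i = s i'" for s i i'
  proof
    assume "t i < t i'"
    then have "{j \<in> I. s j = s i \<and> t j < t i} \<subset> {j \<in> I. s j = s i' \<and> t j < t i'}"
      using that by (auto simp: psubset_eq)
    then show "rank s i < rank s i'" unfolding rank_def using I by (intro psubset_card_mono) auto
  next
    assume l: "rank s i < rank s i'"
    show "t i < t i'"
    proof (rule ccontr)
      assume "\<not> t i < t i'"
      then have "{j \<in> I. s j = s i' \<and> t j < t i'} \<subseteq> {j \<in> I. s j = s i \<and> t j < t i}" using that by auto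
      then have "rank s i' \<le> rank s i" unfolding rank_def using I by (intro card_mono) auto
      with l show False by simp
    qed
  qed
  have "(\<Sum>s\<in>I \<rightarrow>\<^sub>E {..<n}. \<psi> s) = (\<Sum>s\<in>{s \<in> I \<rightarrow>\<^sub>E {..<n}. balanced n k I s}. \<psi> s)"
    using I zero by (intro sum.mono_neutral_right) (auto intro: finite_PiE)
  also have "\<dots> = (\<Sum>\<sigma>\<in>{\<sigma> \<in> labellings n k I. sorted_by I \<sigma> t}. \<psi> (\<lambda>i\<in>I. fst (\<sigma> i)))"
  proof (rule sum.reindex_bij_witness[where i="\<lambda>\<sigma>. \<lambda>i\<in>I. fst (\<sigma> i)" and j="\<lambda>s. \<lambda>i\<in>I. (s i, rank s i)"])
    fix s assume "s \<in> {s \<in> I \<rightarrow>\<^sub>E {..<n}. balanced n k I s}"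
    then have s: "s \<in> I \<rightarrow>\<^sub>E {..<n}" "balanced n k I s" by auto
    show eq: "(\<lambda>i\<in>I. fst ((\<lambda>i\<in>I. (s i, rank s i)) i)) = s" using s(1) by (auto simp: fun_eq_iff PiE_iff extensional_def)
    show "\<psi> (\<lambda>i\<in>I. fst ((\<lambda>i\<in>I. (s i, rank s i)) i)) = \<psi> s" unfolding eq ..
    have rk: "rank s i < k" if i: "i \<in> I" for i
    proof -
      have "s i < n" using s(1) i by (auto simp: PiE_iff)
      then have "card {i' \<in> I. s i' = s i} = k" using s(2) by (simp add: balanced_def)
      moreover have "{i' \<in> I. s i' = s i \<and> t i' < t i} \<subset> {i' \<in> I. s i' = s i}" using i by (auto simp: psubset_eq)
      then have "rank s i < card {i' \<in> I. s i' = s i}" unfolding rank_def using I by (intro psubset_card_mono) auto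
      ultimately show ?thesis by simp
    qed
    have sub: "(\<lambda>i\<in>I. (s i, rank s i)) ` I \<subseteq> ?A" using rk s(1) by (auto simp: PiE_iff)
    have inj: "inj_on (\<lambda>i\<in>I. (s i, rank s i)) I"
    proof (rule inj_onI)
      fix i i' assume ii: "i \<in> I" "i' \<in> I" and "(\<lambda>i\<in>I. (s i, rank s i)) i = (\<lambda>i\<in>I. (s i, rank s i)) i'"
      then have "s i = s i'" "rank s i = rank s i'" by auto
      then have "t i = t i'" using rank_less[of i i' s] rank_less[of i' i s] ii by (metis less_irrefl linorder_neqE)
      then show "i = i'" using t ii by (auto dest: inj_onD)
    qed
    have "(\<lambda>i\<in>I. (s i, rank s i)) ` I = ?A"
      by (rule card_subset_eq[OF _ sub]) (use I inj in \<open>auto simp: card_image\<close>)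
    then have "bij_betw (\<lambda>i\<in>I. (s i, rank s i)) I ?A" using inj by (simp add: bij_betw_def)
    moreover have "sorted_by I (\<lambda>i\<in>I. (s i, rank s i)) t" using rank_less by (auto simp: sorted_by_def)
    moreover have "(\<lambda>i\<in>I. (s i, rank s i)) \<in> I \<rightarrow>\<^sub>E ?A" using sub by (auto simp: PiE_iff)
    ultimately show "(\<lambda>i\<in>I. (s i, rank s i)) \<in> {\<sigma> \<in> labellings n k I. sorted_by I \<sigma> t}" by (simp add: labellings_def)
  next
    fix \<sigma> assume "\<sigma> \<in> {\<sigma> \<in> labellings n k I. sorted_by I \<sigma> t}"
    then have \<sigma>: "\<sigma> \<in> I \<rightarrow>\<^sub>E ?A" "bij_betw \<sigma> I ?A" "sorted_by I \<sigma> t" by (auto simp: labellings_def)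
    have iff: "t i' < t i \<longleftrightarrow> snd (\<sigma> i') < snd (\<sigma> i)" if ii: "i \<in> I" "i' \<in> I" "fst (\<sigma> i') = fst (\<sigma> i)" for i i'
    proof
      assume "t i' < t i"
      show "snd (\<sigma> i') < snd (\<sigma> i)"
      proof (rule ccontr)
        assume "\<not> snd (\<sigma> i') < snd (\<sigma> i)"
        then consider "snd (\<sigma> i) < snd (\<sigma> i')" | "\<sigma> i = \<sigma> i'" using ii(3) by (metis linorder_neqE prod_eqI)
        then show False
        proof cases
          case 1
          then have "t i < t i'" using \<sigma>(3) ii by (auto simp: sorted_by_def)
          then show False using \<open>t i' < t i\<close> by simp
        next
          case 2
          then have "i = i'" using \<sigma>(2) ii by (auto simp: bij_betw_def dest: inj_onD)
          then show False using \<open>t i' < t i\<close> by simp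
        qed
      qed
    qed (use \<sigma>(3) ii in \<open>auto simp: sorted_by_def\<close>)
    have rk: "rank (\<lambda>i\<in>I. fst (\<sigma> i)) i = snd (\<sigma> i)" if i: "i \<in> I" for i
    proof -
      have "rank (\<lambda>i\<in>I. fst (\<sigma> i)) i = card {i' \<in> I. fst (\<sigma> i') = fst (\<sigma> i) \<and> snd (\<sigma> i') < snd (\<sigma> i)}"
        unfolding rank_def using iff[OF i] i by (intro arg_cong[where f=card]) auto
      also have "\<dots> = card (\<sigma> ` {i' \<in> I. fst (\<sigma> i') = fst (\<sigma> i) \<and> snd (\<sigma> i') < snd (\<sigma> i)})"
        using \<sigma>(2) by (intro card_image[symmetric]) (auto simp: bij_betw_def intro: inj_on_subset)
      also have "\<sigma> ` {i' \<in> I. fst (\<sigma> i') = fst (\<sigma> i) \<and> snd (\<sigma> i') < snd (\<sigma> i)} = {fst (\<sigma> i)} \<times> {..<snd (\<sigma> i)}"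
      proof -
        have \<sigma>i: "\<sigma> i \<in> ?A" using \<sigma>(1) i by (auto simp: PiE_iff)
        have "p \<in> \<sigma> ` {i' \<in> I. fst (\<sigma> i') = fst (\<sigma> i) \<and> snd (\<sigma> i') < snd (\<sigma> i)}"
          if "p \<in> {fst (\<sigma> i)} \<times> {..<snd (\<sigma> i)}" for p
        proof -
          have "p \<in> ?A" using that \<sigma>i by (auto simp: mem_Times_iff)
          then obtain i' where "i' \<in> I" "\<sigma> i' = p" using \<sigma>(2) unfolding bij_betw_def by (metis imageE)
          then show ?thesis using that by auto
        qed
        moreover have "\<sigma> ` {i' \<in> I. fst (\<sigma> i') = fst (\<sigma> i) \<and> snd (\<sigma> i') < snd (\<sigma> i)} \<subseteq> {fst (\<sigma> i)} \<times> {..<snd (\<sigma> i)}"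
          by (rule image_subsetI) (simp add: mem_Times_iff)
        ultimately show ?thesis by blast
      qed
      also have "card ({fst (\<sigma> i)} \<times> {..<snd (\<sigma> i)}) = snd (\<sigma> i)" by (simp add: card_cartesian_product)
      finally show ?thesis .
    qed
    show "(\<lambda>i\<in>I. ((\<lambda>i\<in>I. fst (\<sigma> i)) i, rank (\<lambda>i\<in>I. fst (\<sigma> i)) i)) = \<sigma>"
    proof (rule ext)
      fix i
      show "(\<lambda>i\<in>I. ((\<lambda>i\<in>I. fst (\<sigma> i)) i, rank (\<lambda>i\<in>I. fst (\<sigma> i)) i)) i = \<sigma> i"
      proof (cases "i \<in> I")
        case True
        then show ?thesis using rk[OF True] by simp
      next
        case False
        then show ?thesis using \<sigma>(1) by (simp add: PiE_iff extensional_def)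
      qed
    qed
    have "balanced n k I (\<lambda>i\<in>I. fst (\<sigma> i))"
      unfolding balanced_def
    proof (intro allI impI)
      fix h assume h: "h < n"
      have "card {i \<in> I. (\<lambda>i\<in>I. fst (\<sigma> i)) i = h} = card (\<sigma> ` {i \<in> I. fst (\<sigma> i) = h})"
        using \<sigma>(2) by (subst card_image) (auto simp: bij_betw_def intro: inj_on_subset intro!: arg_cong[where f=card])
      also have "\<sigma> ` {i \<in> I. fst (\<sigma> i) = h} = {h} \<times> {..<k}"
      proof -
        have "p \<in> \<sigma> ` {i \<in> I. fst (\<sigma> i) = h}" if "p \<in> {h} \<times> {..<k}" for p
        proof -
          have "p \<in> ?A" using that h by (auto simp: mem_Times_iff)
          then obtain i' where "i' \<in> I" "\<sigma> i' = p" using \<sigma>(2) unfolding bij_betw_def by (metis imageE)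
          then show ?thesis using that by auto
        qed
        moreover have "\<sigma> ` {i \<in> I. fst (\<sigma> i) = h} \<subseteq> {h} \<times> {..<k}"
          using \<sigma>(1) by (intro image_subsetI) (auto simp: mem_Times_iff PiE_iff)
        ultimately show ?thesis by blast
      qed
      finally show "card {i \<in> I. (\<lambda>i\<in>I. fst (\<sigma> i)) i = h} = k" by simp
    qed
    moreover have "(\<lambda>i\<in>I. fst (\<sigma> i)) \<in> I \<rightarrow>\<^sub>E {..<n}" using \<sigma>(1) by (auto simp: PiE_iff)
    ultimately show "(\<lambda>i\<in>I. fst (\<sigma> i)) \<in> {s \<in> I \<rightarrow>\<^sub>E {..<n}. balanced n k I s}" by simp
  qed
  also have "\<dots> = (\<Sum>\<sigma>\<in>labellings n k I. of_bool (sorted_by I \<sigma> t) * \<psi> (\<lambda>i\<in>I. fst (\<sigma> i)))"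
    using finite_labellings[OF I(1)] by (intro sum.mono_neutral_cong_left) auto
  finally show ?thesis by simp
qed

lemma sorted_arrays_measurable: "sorted_arrays n k \<in> sets (array_lebesgue n k)"
proof -
  let ?A = "{..<n} \<times> {..<k}"
  let ?M = "\<Pi>\<^sub>M p\<in>?A. lborel :: real measure"
  have box: "unit_box ?A \<in> sets ?M" by (rule unit_box_measurable) auto
  have "{b \<in> space ?M. \<forall>h\<in>{..<n}. \<forall>j\<in>{j. Suc j < k}. b (h, j) < b (h, Suc j)} \<in> sets ?M"
  proof (intro sets.sets_Collect_finite_All)
    fix h j assume "h \<in> {..<n}" "j \<in> {j. Suc j < k}"
    then have "(h, j) \<in> ?A" "(h, Suc j) \<in> ?A" by auto
    then show "{b \<in> space ?M. b (h, j) < b (h, Suc j)} \<in> sets ?M" by measurable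
  next
    have "{j. Suc j < k} \<subseteq> {..<k}" by auto
    then show "finite {j. Suc j < k}" by (rule finite_subset) simp
  qed simp
  then have "unit_box ?A \<inter> {b \<in> space ?M. \<forall>h\<in>{..<n}. \<forall>j\<in>{j. Suc j < k}. b (h, j) < b (h, Suc j)} \<in> sets ?M"
    using box by blast
  also have "unit_box ?A \<inter> {b \<in> space ?M. \<forall>h\<in>{..<n}. \<forall>j\<in>{j. Suc j < k}. b (h, j) < b (h, Suc j)} = sorted_arrays n k"
    by (auto simp: sorted_arrays_def space_PiM PiE_iff extensional_def)
  finally show ?thesis by (simp add: array_lebesgue_def)
qed

lemma sorted_arrays_iff_sorted_by:
  assumes \<sigma>: "\<sigma> \<in> labellings n k I" and b: "b \<in> extensional ({..<n} \<times> {..<k})"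
  shows "b \<in> sorted_arrays n k \<longleftrightarrow> (\<lambda>i\<in>I. b (\<sigma> i)) \<in> unit_box I \<and> sorted_by I \<sigma> (\<lambda>i\<in>I. b (\<sigma> i))"
proof -
  let ?A = "{..<n} \<times> {..<k}"
  have bij: "bij_betw \<sigma> I ?A" using \<sigma> by (simp add: labellings_def)
  have \<sigma>A: "\<sigma> i \<in> ?A" if "i \<in> I" for i using bij that by (auto simp: bij_betw_def)
  have ex: "\<exists>i\<in>I. \<sigma> i = p" if "p \<in> ?A" for p
    using bij that unfolding bij_betw_def by (metis imageE)
  show ?thesis
  proof
    assume s: "b \<in> sorted_arrays n k"
    have "b (h, j) < b (h, j')" if "h < n" "j < j'" "j' < k" for h j j'
      by (rule strict_on_nat_less[of k "\<lambda>j. b (h, j)"]) (use s that in \<open>auto simp: sorted_arrays_def\<close>)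
    then have "sorted_by I \<sigma> (\<lambda>i\<in>I. b (\<sigma> i))"
      using \<sigma>A by (auto simp: sorted_by_def) (metis SigmaE fst_conv lessThan_iff snd_conv)
    moreover have "(\<lambda>i\<in>I. b (\<sigma> i)) \<in> unit_box I"
    proof -
      have "b \<in> ?A \<rightarrow>\<^sub>E {0..<1}" using s by (simp add: sorted_arrays_def)
      then have "b (\<sigma> i) \<in> {0..<1}" if "i \<in> I" for i using \<sigma>A[OF that] by (rule PiE_mem)
      then show ?thesis by (auto simp: PiE_iff)
    qed
    ultimately show "(\<lambda>i\<in>I. b (\<sigma> i)) \<in> unit_box I \<and> sorted_by I \<sigma> (\<lambda>i\<in>I. b (\<sigma> i))" by simp
  next
    assume R: "(\<lambda>i\<in>I. b (\<sigma> i)) \<in> unit_box I \<and> sorted_by I \<sigma> (\<lambda>i\<in>I. b (\<sigma> i))"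
    have "b p \<in> {0..<1}" if p: "p \<in> ?A" for p
    proof -
      obtain i where i: "i \<in> I" "\<sigma> i = p" using ex[OF p] by blast
      have "(\<lambda>i\<in>I. b (\<sigma> i)) i \<in> {0..<1}" using PiE_mem[OF conjunct1[OF R] i(1)] .
      then show ?thesis using i by simp
    qed
    moreover have "b (h, j) < b (h, Suc j)" if hj: "h < n" "Suc j < k" for h j
    proof -
      have "(h, j) \<in> ?A" "(h, Suc j) \<in> ?A" using hj by auto
      then obtain i i' where i: "i \<in> I" "\<sigma> i = (h, j)" "i' \<in> I" "\<sigma> i' = (h, Suc j)" using ex by metis
      then have "(\<lambda>i\<in>I. b (\<sigma> i)) i < (\<lambda>i\<in>I. b (\<sigma> i)) i'"
        using R unfolding sorted_by_def by (metis fst_conv snd_conv lessI)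
      then show ?thesis using i by simp
    qed
    ultimately show "b \<in> sorted_arrays n k" using b by (auto simp: sorted_arrays_def PiE_iff)
  qed
qed

text \<open>Off the null set of coinciding times, every balanced assignment of strings has exactly
  one sorted labelling. The integrand vanishes on the unbalanced assignments, so the sum over
  assignments becomes a sum over labellings, each of which carries the times to a sorted
  array.\<close>

lemma integral_torus_symmetrize:
  fixes \<psi> :: "('i \<Rightarrow> real \<times> nat) \<Rightarrow> complex"
  assumes I: "finite I" "card I = n * k" and \<psi>: "\<psi> \<in> borel_measurable (\<Pi>\<^sub>M i\<in>I. torus n)"
    "\<And>x. x \<in> space (\<Pi>\<^sub>M i\<in>I. torus n) \<Longrightarrow> norm (\<psi> x) \<le> B"
    and zero: "\<And>x. x \<in> space (\<Pi>\<^sub>M i\<in>I. torus n) \<Longrightarrow> \<not> balanced n k I (\<lambda>i. snd (x i)) \<Longrightarrow> \<psi> x = 0"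
  shows "(LINT x|(\<Pi>\<^sub>M i\<in>I. torus n). \<psi> x) =
    (\<Sum>\<sigma>\<in>labellings n k I. LINT b:sorted_arrays n k|array_lebesgue n k. \<psi> (\<lambda>i\<in>I. (b (\<sigma> i), fst (\<sigma> i))))"
    and "\<sigma> \<in> labellings n k I \<Longrightarrow> set_integrable (array_lebesgue n k) (sorted_arrays n k) (\<lambda>b. \<psi> (\<lambda>i\<in>I. (b (\<sigma> i), fst (\<sigma> i))))"
proof -
  let ?A = "{..<n} \<times> {..<k}"
  let ?L = "\<Pi>\<^sub>M i\<in>I. lborel :: real measure"
  define \<phi> where "\<phi> s t = indicator (unit_box I) t *\<^sub>R \<psi> (\<lambda>i\<in>I. (t i, s i))" for s t
  have \<phi>: "integrable ?L (\<phi> s)" if "s \<in> I \<rightarrow>\<^sub>E {..<n}" for s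
    using integral_PiM_torus(2)[OF I(1) \<psi> that] by (simp add: \<phi>_def[abs_def] set_integrable_def)
  have finE: "finite (I \<rightarrow>\<^sub>E {..<n})" using I by (intro finite_PiE) auto
  have fst\<sigma>: "(\<lambda>i\<in>I. fst (\<sigma> i)) \<in> I \<rightarrow>\<^sub>E {..<n}" if "\<sigma> \<in> labellings n k I" for \<sigma>
    using that by (auto simp: labellings_def PiE_iff mem_Times_iff)
  have sm: "{t \<in> space ?L. sorted_by I \<sigma> t} \<in> sets ?L" for \<sigma>
  proof -
    have "{t \<in> space ?L. \<forall>i\<in>I. \<forall>i'\<in>I. fst (\<sigma> i) = fst (\<sigma> i') \<longrightarrow> snd (\<sigma> i) < snd (\<sigma> i') \<longrightarrow> t i < t i'} \<in> sets ?L"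
      by (intro sets.sets_Collect_finite_All I) measurable
    then show ?thesis by (simp add: sorted_by_def)
  qed
  define \<eta> where "\<eta> \<sigma> t = (of_bool (sorted_by I \<sigma> t) :: complex) * \<phi> (\<lambda>i\<in>I. fst (\<sigma> i)) t" for \<sigma> t
  have \<eta>: "integrable ?L (\<eta> \<sigma>)" if "\<sigma> \<in> labellings n k I" for \<sigma>
  proof (rule Bochner_Integration.integrable_bound[OF \<phi>[OF fst\<sigma>[OF that]]])
    have [measurable]: "{t \<in> space ?L. sorted_by I \<sigma> t} \<in> sets ?L" by (rule sm)
    have [measurable]: "\<phi> (\<lambda>i\<in>I. fst (\<sigma> i)) \<in> borel_measurable ?L" using \<phi>[OF fst\<sigma>[OF that]] by auto
    have "(\<lambda>t. indicator {t \<in> space ?L. sorted_by I \<sigma> t} t * \<phi> (\<lambda>i\<in>I. fst (\<sigma> i)) t) \<in> borel_measurable ?L" by measurable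
    then show "\<eta> \<sigma> \<in> borel_measurable ?L"
      by (rule measurable_cong[THEN iffD1, rotated]) (auto simp: \<eta>_def)
  qed (auto simp: \<eta>_def norm_mult intro!: AE_I2)
  have array: "(LINT b:sorted_arrays n k|array_lebesgue n k. \<psi> (\<lambda>i\<in>I. (b (\<sigma> i), fst (\<sigma> i)))) = (LINT t|?L. \<eta> \<sigma> t)"
    and array_int: "set_integrable (array_lebesgue n k) (sorted_arrays n k) (\<lambda>b. \<psi> (\<lambda>i\<in>I. (b (\<sigma> i), fst (\<sigma> i))))"
    if \<sigma>: "\<sigma> \<in> labellings n k I" for \<sigma>
  proof -
    have bij: "bij_betw \<sigma> I ?A" using \<sigma> by (simp add: labellings_def)
    note re = PiM_lborel_reindex[OF bij I(1)]
    have eq: "indicator (sorted_arrays n k) b *\<^sub>R \<psi> (\<lambda>i\<in>I. (b (\<sigma> i), fst (\<sigma> i))) = \<eta> \<sigma> (\<lambda>i\<in>I. b (\<sigma> i))"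
      if "b \<in> space (array_lebesgue n k)" for b
    proof -
      have b: "b \<in> extensional ?A" using that by (auto simp: array_lebesgue_def space_PiM PiE_iff)
      have "(\<lambda>i\<in>I. ((\<lambda>i\<in>I. b (\<sigma> i)) i, (\<lambda>i\<in>I. fst (\<sigma> i)) i)) = (\<lambda>i\<in>I. (b (\<sigma> i), fst (\<sigma> i)))" by auto
      then show ?thesis
        using sorted_arrays_iff_sorted_by[OF \<sigma> b] by (simp add: \<eta>_def \<phi>_def indicator_def)
    qed
    have "(LINT t|?L. \<eta> \<sigma> t) = (LINT t|distr (\<Pi>\<^sub>M a\<in>?A. lborel) ?L (\<lambda>b. \<lambda>i\<in>I. b (\<sigma> i)). \<eta> \<sigma> t)"
      unfolding re(1) ..
    also have "\<dots> = (LINT b|array_lebesgue n k. \<eta> \<sigma> (\<lambda>i\<in>I. b (\<sigma> i)))"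
      unfolding array_lebesgue_def using \<eta>[OF \<sigma>] by (intro integral_distr[OF re(2)]) auto
    also have "\<dots> = (LINT b|array_lebesgue n k. indicator (sorted_arrays n k) b *\<^sub>R \<psi> (\<lambda>i\<in>I. (b (\<sigma> i), fst (\<sigma> i))))"
      by (intro Bochner_Integration.integral_cong refl) (simp add: eq)
    finally show "(LINT b:sorted_arrays n k|array_lebesgue n k. \<psi> (\<lambda>i\<in>I. (b (\<sigma> i), fst (\<sigma> i)))) = (LINT t|?L. \<eta> \<sigma> t)"
      by (simp add: set_lebesgue_integral_def)
    have "integrable (array_lebesgue n k) (\<lambda>b. \<eta> \<sigma> (\<lambda>i\<in>I. b (\<sigma> i)))"
      unfolding array_lebesgue_def by (rule integrable_distr[OF re(2)]) (simp add: re(1) \<eta>[OF \<sigma>])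
    then show "set_integrable (array_lebesgue n k) (sorted_arrays n k) (\<lambda>b. \<psi> (\<lambda>i\<in>I. (b (\<sigma> i), fst (\<sigma> i))))"
      unfolding set_integrable_def by (rule Bochner_Integration.integrable_cong[OF refl, THEN iffD1, rotated]) (simp add: eq)
  qed
  have "(LINT x|(\<Pi>\<^sub>M i\<in>I. torus n). \<psi> x) = (\<Sum>s\<in>I \<rightarrow>\<^sub>E {..<n}. LINT t|?L. \<phi> s t)"
    using integral_PiM_torus(1)[OF I(1) \<psi>] by (simp add: \<phi>_def set_lebesgue_integral_def)
  also have "\<dots> = (LINT t|?L. (\<Sum>s\<in>I \<rightarrow>\<^sub>E {..<n}. \<phi> s t))"
    by (rule Bochner_Integration.integral_sum[symmetric]) (rule \<phi>)
  also have "\<dots> = (LINT t|?L. (\<Sum>\<sigma>\<in>labellings n k I. \<eta> \<sigma> t))"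
  proof (rule integral_cong_AE)
    show "(\<lambda>t. \<Sum>s\<in>I \<rightarrow>\<^sub>E {..<n}. \<phi> s t) \<in> borel_measurable ?L"
      by (rule borel_measurable_sum) (use \<phi> in auto)
    show "(\<lambda>t. \<Sum>\<sigma>\<in>labellings n k I. \<eta> \<sigma> t) \<in> borel_measurable ?L"
      by (rule borel_measurable_sum) (use \<eta> in auto)
    show "AE t in ?L. (\<Sum>s\<in>I \<rightarrow>\<^sub>E {..<n}. \<phi> s t) = (\<Sum>\<sigma>\<in>labellings n k I. \<eta> \<sigma> t)"
      using AE_PiM_lborel_inj[OF I(1)]
    proof eventually_elim
      case (elim t)
      show ?case
        unfolding \<eta>_def
      proof (rule sum_sorted_labellings[OF I elim, symmetric])
        fix s assume s: "s \<in> I \<rightarrow>\<^sub>E {..<n}" "\<not> balanced n k I s"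
        show "\<phi> s t = 0"
        proof (cases "t \<in> unit_box I")
          case True
          have "{i \<in> I. s i = h} = {i \<in> I. snd ((\<lambda>i\<in>I. (t i, s i)) i) = h}" for h by auto
          then have "\<not> balanced n k I (\<lambda>i. snd ((\<lambda>i\<in>I. (t i, s i)) i))" using s(2) by (simp add: balanced_def)
          moreover have "(\<lambda>i\<in>I. (t i, s i)) \<in> space (\<Pi>\<^sub>M i\<in>I. torus n)"
            using True s(1) by (auto simp: space_PiM space_torus PiE_iff)
          ultimately show ?thesis using zero by (simp add: \<phi>_def)
        qed (simp add: \<phi>_def)
      qed
    qed
  qed
  also have "\<dots> = (\<Sum>\<sigma>\<in>labellings n k I. LINT t|?L. \<eta> \<sigma> t)"
    by (rule Bochner_Integration.integral_sum) (rule \<eta>)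
  finally show "(LINT x|(\<Pi>\<^sub>M i\<in>I. torus n). \<psi> x) =
    (\<Sum>\<sigma>\<in>labellings n k I. LINT b:sorted_arrays n k|array_lebesgue n k. \<psi> (\<lambda>i\<in>I. (b (\<sigma> i), fst (\<sigma> i))))"
    using array by simp
  show "\<sigma> \<in> labellings n k I \<Longrightarrow> set_integrable (array_lebesgue n k) (sorted_arrays n k) (\<lambda>b. \<psi> (\<lambda>i\<in>I. (b (\<sigma> i), fst (\<sigma> i))))"
    by (rule array_int)
qed

section \<open>Power series from iterated derivatives\<close>

text \<open>Only F is assumed to be bounded. Holomorphy provides the bound for F' by the Cauchy
  inequality, and this bound dominates the difference quotients.\<close>

lemma has_field_derivative_lebesgue_integral:
  fixes F :: "complex \<Rightarrow> 'a \<Rightarrow> complex"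
  assumes fin: "finite_measure M" and S: "open S" "T \<in> S"
    and meas: "\<And>s. s \<in> S \<Longrightarrow> F s \<in> borel_measurable M"
    and bound: "\<And>s x. s \<in> S \<Longrightarrow> x \<in> space M \<Longrightarrow> norm (F s x) \<le> B"
    and deriv: "\<And>s x. s \<in> S \<Longrightarrow> x \<in> space M \<Longrightarrow> ((\<lambda>s. F s x) has_field_derivative F' s x) (at s)"
  shows "((\<lambda>s. LINT x|M. F s x) has_field_derivative (LINT x|M. F' T x)) (at T)"
proof -
  interpret finite_measure M by fact
  \<comment> \<open>The radius 2 r leaves room for a disc of radius r around every point of
    \<open>ball T r\<close>, on which the Cauchy inequality is applied.\<close>
  obtain r where r: "0 < r" "cball T (2 * r) \<subseteq> S"
  proof -
    obtain e where e: "0 < e" "cball T e \<subseteq> S" using S open_contains_cball by blast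
    show ?thesis by (rule that[of "e / 2"]) (use e in auto)
  qed
  have ballS: "ball T r \<subseteq> S" "T \<in> ball T r" using r by (auto simp: subset_iff)
  have int: "integrable M (F s)" if "s \<in> S" for s
    by (rule integrable_const_bound[of _ B]) (use that meas bound in \<open>auto intro: AE_I2\<close>)
  have F'_le: "norm (F' s x) \<le> B / r" if s: "s \<in> ball T r" and x: "x \<in> space M" for s x
  proof -
    have sub: "cball s r \<subseteq> S"
    proof
      fix u assume "u \<in> cball s r"
      then have "dist T u \<le> 2 * r" using s dist_triangle[of T u s] by simp
      then show "u \<in> S" using r by auto
    qed
    have hol: "(\<lambda>s. F s x) holomorphic_on S"
      using deriv x by (auto simp: holomorphic_on_open S(1))
    have "norm ((deriv ^^ 1) (\<lambda>s. F s x) s) \<le> fact 1 * B / r ^ 1"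
    proof (rule Cauchy_inequality)
      show "(\<lambda>s. F s x) holomorphic_on ball s r"
        using hol sub by (meson ball_subset_cball holomorphic_on_subset subset_trans)
      show "continuous_on (cball s r) (\<lambda>s. F s x)"
        using hol sub by (meson holomorphic_on_imp_continuous_on holomorphic_on_subset)
      show "norm (F u x) \<le> B" if "norm (s - u) = r" for u
        using that sub x by (intro bound) (auto simp: dist_norm)
    qed (use r in auto)
    moreover have "deriv (\<lambda>s. F s x) s = F' s x"
      using deriv[of s x] s x ballS by (intro DERIV_imp_deriv) auto
    ultimately show ?thesis by simp
  qed
  have lip: "norm (F s x - F T x) \<le> B / r * norm (s - T)" if s: "s \<in> ball T r" and x: "x \<in> space M" for s x
  proof (rule field_differentiable_bound[of "ball T r" "\<lambda>s. F s x" "\<lambda>s. F' s x"])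
    show "((\<lambda>s. F s x) has_field_derivative F' u x) (at u within ball T r)" if "u \<in> ball T r" for u
      by (rule has_field_derivative_at_within, rule deriv[OF _ x]) (use that ballS in blast)
    show "norm (F' u x) \<le> B / r" if "u \<in> ball T r" for u by (rule F'_le[OF that x])
  qed (rule convex_ball, rule s, rule ballS(2))
  show ?thesis
    unfolding has_field_derivative_iff
  proof (rule tendsto_at_iff_sequentially[THEN iffD2], intro allI impI)
    fix X :: "nat \<Rightarrow> complex" assume X: "\<forall>i. X i \<in> UNIV - {T}" "X \<longlonglongrightarrow> T"
    have evS: "\<forall>\<^sub>F i in sequentially. X i \<in> ball T r"
      using X(2) r(1) by (simp add: tendsto_iff dist_commute)
    define q where "q i x = (F (X i) x - F T x) / (X i - T)" for i x
    obtain N where N: "\<And>i. N \<le> i \<Longrightarrow> X i \<in> ball T r" using evS by (auto simp: eventually_sequentially)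
    have "(\<lambda>i. LINT x|M. q (i + N) x) \<longlonglongrightarrow> (LINT x|M. F' T x)"
    proof (rule integral_dominated_convergence[where w="\<lambda>_. B / r"])
      have FX: "F (X (i + N)) \<in> borel_measurable M" "F T \<in> borel_measurable M" for i
        using N[of "i + N"] ballS by (auto intro!: meas)
      then show mq: "q (i + N) \<in> borel_measurable M" for i unfolding q_def by measurable
      have lim: "(\<lambda>i. q (i + N) x) \<longlonglongrightarrow> F' T x" if x: "x \<in> space M" for x
      proof -
        have "((\<lambda>s. (F s x - F T x) / (s - T)) \<longlongrightarrow> F' T x) (at T)"
          using deriv[OF S(2) x] by (simp add: has_field_derivative_iff)
        then have "((\<lambda>s. (F s x - F T x) / (s - T)) \<circ> X) \<longlonglongrightarrow> F' T x"
          using X tendsto_at_iff_sequentially by blast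
        then have "(\<lambda>i. q i x) \<longlonglongrightarrow> F' T x" by (simp add: q_def comp_def)
        then show ?thesis by (rule LIMSEQ_ignore_initial_segment)
      qed
      then show "AE x in M. (\<lambda>i. q (i + N) x) \<longlonglongrightarrow> F' T x" by (auto intro: AE_I2)
      show "F' T \<in> borel_measurable M"
        by (rule borel_measurable_LIMSEQ_metric[OF mq lim])
      show "AE x in M. norm (q (i + N) x) \<le> B / r" for i
      proof (rule AE_I2)
        fix x assume x: "x \<in> space M"
        have "X (i + N) - T \<noteq> 0" using X(1) by auto
        then show "norm (q (i + N) x) \<le> B / r"
          using lip[OF N[of "i + N"] x] by (simp add: q_def norm_divide divide_le_eq)
      qed
    qed simp
    then have "(\<lambda>i. LINT x|M. q i x) \<longlonglongrightarrow> (LINT x|M. F' T x)" by (rule LIMSEQ_offset)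
    moreover have "\<forall>\<^sub>F i in sequentially. (LINT x|M. q i x) = ((LINT x|M. F (X i) x) - (LINT x|M. F T x)) / (X i - T)"
      using evS
    proof eventually_elim
      case (elim i)
      then show ?case unfolding q_def using ballS int S(2)
        by (subst integral_divide_zero, subst Bochner_Integration.integral_diff) auto
    qed
    ultimately show "((\<lambda>s. ((LINT x|M. F s x) - (LINT x|M. F T x)) / (s - T)) \<circ> X) \<longlonglongrightarrow> (LINT x|M. F' T x)"
      unfolding comp_def by (rule Lim_transform_eventually)
  qed
qed

text \<open>The m-th derivative of G 0 is G m, so f is the sum of the Taylor series of G 0 at 0.
  Convergence for every s makes f entire; the identity theorem then reaches all of S, which may
  extend beyond any disc around 0 on which G 0 is holomorphic.\<close>

lemma iterated_derivatives_power_series: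
  fixes G :: "nat \<Rightarrow> complex \<Rightarrow> complex"
  assumes S: "open S" "connected S" "0 \<in> S"
    and G: "\<And>m s. s \<in> S \<Longrightarrow> (G m has_field_derivative G (Suc m) s) (at s)"
    and f: "\<And>s. (\<lambda>m. G m 0 / fact m * s ^ m) sums f s"
    and T: "T \<in> S"
  shows "G 0 T = f T"
proof -
  have hol: "G m holomorphic_on S" for m
    using G by (auto simp: holomorphic_on_open S(1))
  have der: "(deriv ^^ m) (G 0) s = G m s" if "s \<in> S" for m s
    using that
  proof (induction m arbitrary: s)
    case (Suc m)
    have "(deriv ^^ Suc m) (G 0) s = deriv ((deriv ^^ m) (G 0)) s" by simp
    also have "\<dots> = deriv (G m) s"
    proof (rule deriv_cong_ev)
      show "\<forall>\<^sub>F x in nhds s. (deriv ^^ m) (G 0) x = G m x"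
        using eventually_nhds_in_open[OF S(1) Suc.prems] by eventually_elim (rule Suc.IH)
    qed simp
    also have "\<dots> = G (Suc m) s" by (rule DERIV_imp_deriv) (rule G[OF Suc.prems])
    finally show ?case .
  qed simp
  obtain r where r: "0 < r" "ball 0 r \<subseteq> S" using S open_contains_ball by blast
  have near: "G 0 s = f s" if "s \<in> ball 0 r" for s
  proof -
    have "(\<lambda>m. (deriv ^^ m) (G 0) 0 / fact m * (s - 0) ^ m) sums G 0 s"
      by (rule holomorphic_power_series[OF holomorphic_on_subset[OF hol r(2)] that])
    then have "(\<lambda>m. G m 0 / fact m * s ^ m) sums G 0 s" by (simp add: der[OF S(3)])
    then show ?thesis using f sums_unique2 by blast
  qed
  have "f holomorphic_on UNIV"
  proof -
    have "summable (\<lambda>m. G m 0 / fact m * s ^ m)" for s using f sums_summable by blast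
    then have "((\<lambda>s. \<Sum>m. G m 0 / fact m * s ^ m) has_field_derivative (\<Sum>m. diffs (\<lambda>m. G m 0 / fact m) m * s ^ m)) (at s)" for s
      by (intro termdiffs_strong_converges_everywhere)
    moreover have "f = (\<lambda>s. \<Sum>m. G m 0 / fact m * s ^ m)" using f by (auto simp: sums_iff)
    ultimately show ?thesis by (auto simp: holomorphic_on_open)
  qed
  then have "f holomorphic_on S" by (rule holomorphic_on_subset) simp
  show ?thesis
    by (rule analytic_continuation_open[of "ball 0 r" S "G 0" f])
       (use S r hol near T \<open>f holomorphic_on S\<close> in auto)
qed

section \<open>Occupation processes of bead arrays\<close>

text \<open>Time enters only through the predicate that tells which beads have been passed; these
  are moved one turn ahead. With \<open>u \<le> t\<close> this is the state at t, with
  \<open>u < t\<close> the state just before t, and both are compared without limits.\<close>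

definition bead_ahead :: "nat \<Rightarrow> nat \<Rightarrow> (real \<Rightarrow> bool) \<Rightarrow> (nat \<times> nat \<Rightarrow> real) \<Rightarrow> nat \<Rightarrow> bool" where
  "bead_ahead n k past b h \<longleftrightarrow> (\<exists>j<k. \<forall>i<k. b (h, j) + of_bool (past (b (h, j))) <
     b ((h + n - 1) mod n, i) + of_bool (past (b ((h + n - 1) mod n, i))))"

lemma bead_ahead_cong:
  assumes "0 < n" "h < n" "\<And>p. p \<in> {..<n} \<times> {..<k} \<Longrightarrow> past (b p) \<longleftrightarrow> past' (b p)"
  shows "bead_ahead n k past b h \<longleftrightarrow> bead_ahead n k past' b h"
proof -
  have "(h + n - 1) mod n < n" using assms(1) by simp
  then show ?thesis using assms(2,3) unfolding bead_ahead_def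
    by (intro ex_cong1 conj_cong all_cong1 imp_cong refl) auto
qed

lemma bead_ahead_cong_strings:
  assumes "\<And>i. i < k \<Longrightarrow> past (b (h, i)) \<longleftrightarrow> past' (b (h, i))"
    "\<And>i. i < k \<Longrightarrow> past (b ((h + n - 1) mod n, i)) \<longleftrightarrow> past' (b ((h + n - 1) mod n, i))"
  shows "bead_ahead n k past b h \<longleftrightarrow> bead_ahead n k past' b h"
  unfolding bead_ahead_def using assms by (intro ex_cong1 conj_cong all_cong1 imp_cong refl) auto

lemma occupation_process_eq:
  assumes "0 < k" "t \<in> {0..<1}"
  shows "occupation_process n k b t = {h. h < n \<and> bead_ahead n k (\<lambda>u. u \<le> t) b h}"
proof -
  have nk: "{..<k} \<noteq> {}" using assms(1) by (metis empty_iff lessThan_iff)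
  have "first_bead k b t h < first_bead k b t g \<longleftrightarrow>
    (\<exists>j<k. \<forall>i<k. b (h, j) + of_bool (b (h, j) \<le> t) < b (g, i) + of_bool (b (g, i) \<le> t))" for h g
  proof -
    have "first_bead k b t h < first_bead k b t g \<longleftrightarrow> (\<exists>j<k. b (h, j) - t + of_bool (b (h, j) \<le> t) < first_bead k b t g)"
      unfolding first_bead_def[of k b t h] by (subst Min_less_iff) (auto simp: nk)
    also have "\<dots> \<longleftrightarrow> (\<exists>j<k. \<forall>i<k. b (h, j) - t + of_bool (b (h, j) \<le> t) < b (g, i) - t + of_bool (b (g, i) \<le> t))"
      unfolding first_bead_def[of k b t g] by (subst Min_gr_iff) (auto simp: nk)
    also have "\<dots> \<longleftrightarrow> (\<exists>j<k. \<forall>i<k. b (h, j) + of_bool (b (h, j) \<le> t) < b (g, i) + of_bool (b (g, i) \<le> t))"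
      by (intro ex_cong1 conj_cong all_cong1 imp_cong refl) linarith
    finally show ?thesis .
  qed
  then show ?thesis using assms(2) by (simp add: occupation_process_def bead_ahead_def)
qed

lemma occupation_process_cong:
  assumes "0 < k" "t \<in> {0..<1}" "t' \<in> {0..<1}" "\<And>p. p \<in> {..<n} \<times> {..<k} \<Longrightarrow> b p \<le> t \<longleftrightarrow> b p \<le> t'"
  shows "occupation_process n k b t = occupation_process n k b t'"
  unfolding occupation_process_eq[OF assms(1,2)] occupation_process_eq[OF assms(1,3)]
  using bead_ahead_cong[of n _ k "\<lambda>u. u \<le> t" b "\<lambda>u. u \<le> t'"] assms(4) by force

lemma frac_eq_self: "u \<in> {0..<1::real} \<Longrightarrow> frac u = u"
  by (simp add: frac_eq)

lemma eventually_occupation_process_right: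
  assumes k: "0 < k" and t: "t \<in> {0..<1}"
  shows "\<forall>\<^sub>F s in at_right 0. occupation_process n k b (frac (t + s)) = occupation_process n k b t"
proof -
  have "\<forall>\<^sub>F s in at_right 0. \<forall>p\<in>{..<n} \<times> {..<k}. b p \<le> t + s \<longleftrightarrow> b p \<le> t"
  proof (rule eventually_ball_finite, simp, rule ballI)
    fix p
    show "\<forall>\<^sub>F s in at_right 0. b p \<le> t + s \<longleftrightarrow> b p \<le> t"
    proof (cases "b p \<le> t")
      case True
      show ?thesis by (rule eventually_at_rightI[of 0 1]) (use True in auto)
    next
      case False
      show ?thesis by (rule eventually_at_rightI[of 0 "b p - t"]) (use False in auto)
    qed
  qed
  moreover have "\<forall>\<^sub>F s in at_right 0. t + s \<in> {0..<1}"
    by (rule eventually_at_rightI[of 0 "1 - t"]) (use t in auto)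
  ultimately show ?thesis
    by eventually_elim (use k t in \<open>simp add: frac_eq_self, intro occupation_process_cong, auto\<close>)
qed

text \<open>The left limit of the process at t, also at t = 0, see
  \<open>left_limit_occupation_process\<close>.\<close>

definition left_occupied :: "nat \<Rightarrow> nat \<Rightarrow> (nat \<times> nat \<Rightarrow> real) \<Rightarrow> real \<Rightarrow> nat set" where
  "left_occupied n k b t = {h. h < n \<and> bead_ahead n k (\<lambda>u. u < t) b h}"

lemma eventually_occupation_process_left_pos:
  assumes k: "0 < k" and t: "t \<in> {0<..<1}"
  shows "\<forall>\<^sub>F s in at_left 0. occupation_process n k b (frac (t + s)) = left_occupied n k b t"
proof -
  have "\<forall>\<^sub>F s in at_left 0. \<forall>p\<in>{..<n} \<times> {..<k}. b p \<le> t + s \<longleftrightarrow> b p < t"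
  proof (rule eventually_ball_finite, simp, rule ballI)
    fix p
    show "\<forall>\<^sub>F s in at_left 0. b p \<le> t + s \<longleftrightarrow> b p < t"
    proof (cases "b p < t")
      case True
      show ?thesis by (rule eventually_at_leftI[of "b p - t" 0]) (use True in auto)
    next
      case False
      show ?thesis by (rule eventually_at_leftI[of "-1" 0]) (use False in auto)
    qed
  qed
  moreover have "\<forall>\<^sub>F s in at_left 0. t + s \<in> {0..<1}"
    by (rule eventually_at_leftI[of "- t" 0]) (use t in auto)
  ultimately show ?thesis
  proof eventually_elim
    case (elim s)
    have "bead_ahead n k (\<lambda>u. u \<le> t + s) b h \<longleftrightarrow> bead_ahead n k (\<lambda>u. u < t) b h" if "h < n" for h
      by (rule bead_ahead_cong) (use elim that in auto)
    then show ?case using elim(2) k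
      by (auto simp: frac_eq_self occupation_process_eq left_occupied_def)
  qed
qed

lemma eventually_occupation_process_left:
  assumes k: "0 < k" and t: "t \<in> {0..<1}" and b: "b \<in> unit_box ({..<n} \<times> {..<k})"
  shows "\<forall>\<^sub>F s in at_left 0. occupation_process n k b (frac (t + s)) = left_occupied n k b t"
proof (cases "t = 0")
  case False
  then show ?thesis using eventually_occupation_process_left_pos[OF k] t by auto
next
  case True
  have b01: "b p \<in> {0..<1}" if "p \<in> {..<n} \<times> {..<k}" for p by (rule PiE_mem[OF b that])
  have "\<forall>\<^sub>F s in at_left 0. \<forall>p\<in>{..<n} \<times> {..<k}. b p \<le> 1 + s"
  proof (rule eventually_ball_finite, simp, rule ballI)
    fix p assume p: "p \<in> {..<n} \<times> {..<k}"
    show "\<forall>\<^sub>F s in at_left 0. b p \<le> 1 + s"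
      by (rule eventually_at_leftI[of "b p - 1" 0]) (use b01[OF p] in auto)
  qed
  moreover have "\<forall>\<^sub>F s in at_left 0. -1 < s \<and> s < (0::real)"
    by (rule eventually_at_leftI[of "- 1" 0]) auto
  ultimately show ?thesis
  proof eventually_elim
    case (elim s)
    have f: "frac (t + s) = 1 + s" using elim(2) True by (simp add: frac_unique_iff)
    have "bead_ahead n k (\<lambda>u. u \<le> 1 + s) b h \<longleftrightarrow> bead_ahead n k (\<lambda>u. u < t) b h" if h: "h < n" for h
    proof -
      have "bead_ahead n k (\<lambda>u. u \<le> 1 + s) b h \<longleftrightarrow> bead_ahead n k (\<lambda>u. True) b h"
        by (rule bead_ahead_cong) (use elim h in auto)
      \<comment> \<open>Just before time 1 all beads have been passed, just before time 0 none; one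
        turn added to both sides does not change a comparison.\<close>
      also have "\<dots> \<longleftrightarrow> bead_ahead n k (\<lambda>u. False) b h" by (simp add: bead_ahead_def)
      also have "\<dots> \<longleftrightarrow> bead_ahead n k (\<lambda>u. u < t) b h"
        by (rule bead_ahead_cong) (use b01 h True in \<open>force+\<close>)
      finally show ?thesis .
    qed
    moreover have "1 + s \<in> {0..<1}" using elim(2) by auto
    ultimately show ?case unfolding f using k
      by (auto simp: occupation_process_eq left_occupied_def)
  qed
qed

lemma occupation_process_in_processes:
  assumes k: "0 < k"
  shows "occupation_process n k b \<in> occupation_processes n"
proof -
  let ?X = "occupation_process n k b"
  \<comment> \<open>The array b is arbitrary here. Outside the unit box the process may also jump at
    time 0, so 0 is added. The measurability of the map from arrays to processes needs the claim for
    every b.\<close>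
  have sub: "{t \<in> {0..<1}. discontinuity ?X t} \<subseteq> insert 0 (b ` ({..<n} \<times> {..<k}))"
  proof
    fix t assume t: "t \<in> {t \<in> {0..<1}. discontinuity ?X t}"
    show "t \<in> insert 0 (b ` ({..<n} \<times> {..<k}))"
    proof (rule ccontr)
      assume no: "t \<notin> insert 0 (b ` ({..<n} \<times> {..<k}))"
      then have t01: "t \<in> {0<..<1}" "t \<in> {0..<1}" using t by auto
      have "bead_ahead n k (\<lambda>u. u < t) b h \<longleftrightarrow> bead_ahead n k (\<lambda>u. u \<le> t) b h" if "h < n" for h
        by (rule bead_ahead_cong) (use no that in \<open>force+\<close>)
      then have "left_occupied n k b t = ?X t"
        using occupation_process_eq[OF k t01(2)] by (auto simp: left_occupied_def)
      then have "\<forall>\<^sub>F s in at 0. ?X (frac (t + s)) = ?X t"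
        using eventually_occupation_process_left_pos[OF k t01(1), of n b]
          eventually_occupation_process_right[OF k t01(2), of n b] by (simp add: eventually_at_split)
      then show False using t by (simp add: discontinuity_def)
    qed
  qed
  have "finite {t \<in> {0..<1}. discontinuity ?X t}" by (rule finite_subset[OF sub]) simp
  moreover have "?X \<in> {0..<1} \<rightarrow>\<^sub>E Pow {..<n}" by (auto simp: occupation_process_def)
  ultimately show ?thesis
    using eventually_occupation_process_right[OF k] by (auto simp: occupation_processes_def)
qed

section \<open>Constant processes, left limits and discontinuities\<close>

lemma space_process_space: "space (process_space n) = occupation_processes n"
  by (auto simp: process_space_def space_restrict_space space_PiM occupation_processes_def)

lemma constant_process_in_processes:
  assumes "A \<subseteq> {..<n}"
  shows "constant_process A \<in> occupation_processes n" and "t \<in> {0..<1} \<Longrightarrow> \<not> discontinuity (constant_process A) t"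
proof -
  have "constant_process A (frac u) = A" for u by (simp add: constant_process_def frac_lt_1)
  moreover have "constant_process A t = A" if "t \<in> {0..<1}" for t using that by (simp add: constant_process_def)
  ultimately have d: "\<not> discontinuity (constant_process A) t" if "t \<in> {0..<1}" for t using that by (simp add: discontinuity_def)
  then have e: "{t \<in> {0..<1}. discontinuity (constant_process A) t} = {}" by auto
  have "constant_process A \<in> {0..<1} \<rightarrow>\<^sub>E Pow {..<n}" using assms by (auto simp: constant_process_def)
  moreover have "\<forall>t\<in>{0..<1}. \<forall>\<^sub>F s in at_right 0. constant_process A (frac (t + s)) = constant_process A t"
    by (simp add: constant_process_def frac_lt_1)
  moreover have "finite {t \<in> {0..<1}. discontinuity (constant_process A) t}" unfolding e by simp
  ultimately show "constant_process A \<in> occupation_processes n" unfolding occupation_processes_def by blast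
  show "t \<in> {0..<1} \<Longrightarrow> \<not> discontinuity (constant_process A) t" by (rule d)
qed

lemma beads_constant_process: "A \<subseteq> {..<n} \<Longrightarrow> beads n (constant_process A) = {}"
  using constant_process_in_processes(2) by (auto simp: beads_def)

lemma left_limit_occupation_process:
  assumes k: "0 < k" and t: "t \<in> {0..<1}" and b: "b \<in> unit_box ({..<n} \<times> {..<k})"
  shows "left_limit (occupation_process n k b) t = left_occupied n k b t"
  unfolding left_limit_def
proof (rule the_equality)
  note L = eventually_occupation_process_left[OF assms]
  show "\<forall>\<^sub>F s in at_left 0. occupation_process n k b (frac (t + s)) = left_occupied n k b t" by (rule L)
  fix A assume "\<forall>\<^sub>F s in at_left 0. occupation_process n k b (frac (t + s)) = A"
  with L have "\<forall>\<^sub>F s in at_left (0::real). A = left_occupied n k b t" by eventually_elim auto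
  then show "A = left_occupied n k b t" using trivial_limit_at_left_real[of 0] by (simp add: eventually_const_iff)
qed

lemma discontinuity_occupation_process:
  assumes k: "0 < k" and t: "t \<in> {0..<1}" and b: "b \<in> unit_box ({..<n} \<times> {..<k})"
  shows "discontinuity (occupation_process n k b) t \<longleftrightarrow> left_occupied n k b t \<noteq> occupation_process n k b t"
proof -
  let ?X = "occupation_process n k b"
  note L = eventually_occupation_process_left[OF assms]
  have "(\<forall>\<^sub>F s in at 0. ?X (frac (t + s)) = ?X t) \<longleftrightarrow> (\<forall>\<^sub>F s in at_left 0. ?X (frac (t + s)) = ?X t)"
    using eventually_occupation_process_right[OF k t, of n b] by (simp add: eventually_at_split)
  also have "\<dots> \<longleftrightarrow> left_occupied n k b t = ?X t"
  proof
    assume "\<forall>\<^sub>F s in at_left 0. ?X (frac (t + s)) = ?X t"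
    with L have "\<forall>\<^sub>F s in at_left (0::real). left_occupied n k b t = ?X t" by eventually_elim auto
    then show "left_occupied n k b t = ?X t" using trivial_limit_at_left_real[of 0] by (simp add: eventually_const_iff)
  qed (use L in simp)
  finally show ?thesis by (simp add: discontinuity_def)
qed

text \<open>The condition of \<open>beads\<close> in terms of \<open>bead_ahead\<close>: the first
  conjunct says that the process jumps, the second that the jump moves a particle from h to the next
  string. In this form it is visibly measurable in b.\<close>

definition jump_at :: "nat \<Rightarrow> nat \<Rightarrow> (nat \<times> nat \<Rightarrow> real) \<Rightarrow> real \<Rightarrow> nat \<Rightarrow> bool" where
  "jump_at n k b t h \<longleftrightarrow> (\<exists>g<n. bead_ahead n k (\<lambda>u. u < t) b g \<noteq> bead_ahead n k (\<lambda>u. u \<le> t) b g) \<and>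
     (\<forall>g<n. bead_ahead n k (\<lambda>u. u \<le> t) b g \<longleftrightarrow> bead_ahead n k (\<lambda>u. u < t) b g \<and> g \<noteq> h \<or> g = Suc h mod n)"

lemma beads_occupation_process:
  assumes k: "0 < k" and b: "b \<in> unit_box ({..<n} \<times> {..<k})"
  shows "beads n (occupation_process n k b) = {(t, h). t \<in> b ` ({..<n} \<times> {..<k}) \<and> h < n \<and> jump_at n k b t h}"
proof (intro Set.set_eqI iffI)
  fix x assume x: "x \<in> beads n (occupation_process n k b)"
  obtain t h where th: "x = (t, h)" by (cases x)
  have t: "t \<in> {0..<1}" "h < n" "discontinuity (occupation_process n k b) t"
    "occupation_process n k b t = left_limit (occupation_process n k b) t - {h} \<union> {Suc h mod n}"
    using x by (auto simp: beads_def th)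
  have d: "left_occupied n k b t \<noteq> occupation_process n k b t"
    using discontinuity_occupation_process[OF k t(1) b] t(3) by simp
  then have j1: "\<exists>g<n. bead_ahead n k (\<lambda>u. u < t) b g \<noteq> bead_ahead n k (\<lambda>u. u \<le> t) b g"
    by (auto simp: left_occupied_def occupation_process_eq[OF k t(1)])
  have "t \<in> b ` ({..<n} \<times> {..<k})"
  proof (rule ccontr)
    assume no: "t \<notin> b ` ({..<n} \<times> {..<k})"
    have "bead_ahead n k (\<lambda>u. u < t) b g \<longleftrightarrow> bead_ahead n k (\<lambda>u. u \<le> t) b g" if "g < n" for g
      by (rule bead_ahead_cong) (use no that in \<open>force+\<close>)
    then show False using j1 by auto
  qed
  moreover have "\<forall>g<n. bead_ahead n k (\<lambda>u. u \<le> t) b g \<longleftrightarrow> bead_ahead n k (\<lambda>u. u < t) b g \<and> g \<noteq> h \<or> g = Suc h mod n"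
    using t(4) unfolding left_limit_occupation_process[OF k t(1) b] left_occupied_def occupation_process_eq[OF k t(1)]
    by (auto simp: set_eq_iff)
  ultimately show "x \<in> {(t, h). t \<in> b ` ({..<n} \<times> {..<k}) \<and> h < n \<and> jump_at n k b t h}"
    using j1 t(2) by (auto simp: th jump_at_def)
next
  fix x assume "x \<in> {(t, h). t \<in> b ` ({..<n} \<times> {..<k}) \<and> h < n \<and> jump_at n k b t h}"
  then obtain t h p where x: "x = (t, h)" "p \<in> {..<n} \<times> {..<k}" "t = b p" "h < n" "jump_at n k b t h" by auto
  have t: "t \<in> {0..<1}" using PiE_mem[OF b x(2)] x(3) by simp
  have n: "Suc h mod n < n" using x(4) by simp
  have X: "occupation_process n k b t = left_occupied n k b t - {h} \<union> {Suc h mod n}"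
    using x(5) n by (auto simp: jump_at_def left_occupied_def occupation_process_eq[OF k t])
  have "left_occupied n k b t \<noteq> occupation_process n k b t"
    using x(5) by (auto simp: jump_at_def left_occupied_def occupation_process_eq[OF k t] set_eq_iff)
  then show "x \<in> beads n (occupation_process n k b)"
    unfolding beads_def using X t x discontinuity_occupation_process[OF k t b] left_limit_occupation_process[OF k t b]
    by simp
qed

text \<open>Recovers the configuration from the process when no two times coincide. At the time of a
  bead on string h only comparisons that involve h can change, so h and its successor are the only
  strings affected. For n = 1 these are the same string, the process is constantly empty, and the
  beads are invisible.\<close>

lemma beads_occupation_process_generic:
  assumes n: "2 \<le> n" and k: "0 < k" and b: "b \<in> bead_arrays n k" and inj: "inj_on b ({..<n} \<times> {..<k})"
  shows "beads n (occupation_process n k b) = (\<lambda>p. (b p, fst p)) ` ({..<n} \<times> {..<k})"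
proof -
  let ?A = "{..<n} \<times> {..<k}"
  have box: "b \<in> unit_box ?A" using b by (simp add: bead_arrays_def)
  have b01: "b p \<in> {0..<1}" if "p \<in> ?A" for p by (rule PiE_mem[OF box that])
  have mono: "b (h, i) < b (h, j) \<longleftrightarrow> i < j" if "h < n" "i < k" "j < k" for h i j
    by (rule strict_on_nat_iff[of k "\<lambda>j. b (h, j)"]) (use b that in \<open>auto simp: bead_arrays_def\<close>)
  have mono': "b (h, i) \<le> b (h, j) \<longleftrightarrow> i \<le> j" if "h < n" "i < k" "j < k" for h i j
    using mono[of h j i] that by (simp add: not_less[symmetric])
  \<comment> \<open>Orders the beads as they are met when moving right from t, a bead at t itself
    coming a full turn later.\<close>
  define val where "val t p = b p + of_bool (b p \<le> t)" for t p
  \<comment> \<open>At the time of a bead on h: h is occupied before and free after, the next string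
    is occupied after, and the other strings keep their state.\<close>
  have key: "bead_ahead n k (\<lambda>u. u < t) b h" "\<not> bead_ahead n k (\<lambda>u. u \<le> t) b h"
      "bead_ahead n k (\<lambda>u. u \<le> t) b (Suc h mod n)"
      "\<And>g. g < n \<Longrightarrow> g \<noteq> h \<Longrightarrow> g \<noteq> Suc h mod n \<Longrightarrow> bead_ahead n k (\<lambda>u. u \<le> t) b g \<longleftrightarrow> bead_ahead n k (\<lambda>u. u < t) b g"
    if hj: "h < n" "j < k" and t: "t = b (h, j)" for h j t
  proof -
    define pr where "pr = (h + n - 1) mod n"
    define nx where "nx = Suc h mod n"
    have pr: "pr < n" "pr \<noteq> h" "Suc pr mod n = h" and nx: "nx < n" "nx \<noteq> h" "(nx + n - 1) mod n = h"
      using n hj mod_pred_neq[OF n hj(1)] mod_Suc_neq[OF n hj(1)] Suc_pred_mod[OF hj(1)] pred_Suc_mod[OF hj(1)]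
      by (auto simp: pr_def nx_def)
    have neq: "b (g, i) \<noteq> t" if "g < n" "i < k" "g \<noteq> h" for g i
      using inj_onD[OF inj, of "(g, i)" "(h, j)"] that hj t by auto
    have t01: "0 \<le> t" "t < 1" using b01[of "(h, j)"] hj t by auto
    have bb: "0 \<le> b (g, i)" "b (g, i) < 1" if "g < n" "i < k" for g i using b01[of "(g, i)"] that by auto
    show "bead_ahead n k (\<lambda>u. u < t) b h"
      unfolding bead_ahead_def pr_def[symmetric]
    proof (intro exI[of _ j] conjI allI impI)
      fix i assume i: "i < k"
      show "b (h, j) + of_bool (b (h, j) < t) < b (pr, i) + of_bool (b (pr, i) < t)"
        using neq[OF pr(1) i pr(2)] bb[OF pr(1) i] t01 t by (cases "b (pr, i) < t") auto
    qed (rule hj)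
    show "\<not> bead_ahead n k (\<lambda>u. u \<le> t) b h"
    proof
      assume "bead_ahead n k (\<lambda>u. u \<le> t) b h"
      then obtain j' where j': "j' < k" and lt: "\<And>i. i < k \<Longrightarrow> val t (h, j') < val t (pr, i)"
        unfolding bead_ahead_def pr_def[symmetric] val_def by auto
      have "interlacing k (\<lambda>j. b (pr, j)) (\<lambda>j. b (h, j))"
        using b pr by (auto simp: bead_arrays_def)
      then consider "\<forall>j<k. b (pr, j) \<le> b (h, j)" "\<forall>j. Suc j < k \<longrightarrow> b (h, j) < b (pr, Suc j)"
        | "\<forall>j<k. b (h, j) < b (pr, j)" "\<forall>j. Suc j < k \<longrightarrow> b (pr, j) \<le> b (h, Suc j)"
        unfolding interlacing_def by blast
      then have "\<exists>i<k. val t (pr, i) \<le> val t (h, j')"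
      proof cases
        case 1
        show ?thesis
        proof (intro exI[of _ j'] conjI j')
          show "val t (pr, j') \<le> val t (h, j')"
          proof (cases "b (h, j') \<le> t")
            case True
            then show ?thesis using 1(1) j' by (auto simp: val_def)
          next
            case False
            then have "j < j'" using mono[of h j j'] hj j' t by auto
            then obtain m where m: "j' = Suc m" "j \<le> m" by (cases j') auto
            then have "t \<le> b (h, m)" using mono'[of h j m] hj j' t by auto
            also have "b (h, m) < b (pr, j')" using 1(2) m j' by simp
            finally show ?thesis using 1(1) j' False by (auto simp: val_def)
          qed
        qed
      next
        case 2
        show ?thesis
        proof (cases j')
          \<comment> \<open>Wrap-around: the first bead on h has been passed, whereas the last bead
            on the previous string is still ahead of t.\<close>
          case 0
          have "b (h, j') \<le> t" using mono'[of h 0 j] hj t 0 by auto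
          moreover have "t \<le> b (h, k - 1)" using mono'[of h j "k - 1"] hj t by auto
          moreover have "b (h, k - 1) < b (pr, k - 1)" using 2(1) k by simp
          ultimately have "val t (pr, k - 1) \<le> val t (h, j')"
            using bb[OF pr(1), of "k - 1"] bb[OF hj(1) j'] k by (auto simp: val_def)
          then show ?thesis using k by (intro exI[of _ "k - 1"]) auto
        next
          case (Suc m)
          have le: "b (pr, m) \<le> b (h, j')" using 2(2) Suc j' by simp
          have "val t (pr, m) \<le> val t (h, j')"
          proof (cases "b (h, j') \<le> t")
            case True
            then show ?thesis using le by (auto simp: val_def)
          next
            case False
            then have "j \<le> m" using mono[of h j j'] hj j' t Suc by auto
            then have "t \<le> b (h, m)" using mono'[of h j m] hj j' t Suc by auto
            also have "b (h, m) < b (pr, m)" using 2(1) j' Suc by simp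
            finally show ?thesis using le False by (auto simp: val_def)
          qed
          then show ?thesis using Suc j' by (intro exI[of _ m]) auto
        qed
      qed
      then show False using lt by (auto simp: not_le[symmetric])
    qed
    \<comment> \<open>From t on, each bead of h has a bead of the next string strictly before it,
      since the bead at t counts as a full turn away; interlacing provides it, with a wrap-around
      for the first bead of h.\<close>
    have next_before: "\<exists>i<k. val t (nx, i) < val t (h, j')" if j': "j' < k" for j'
    proof -
      have "interlacing k (\<lambda>j. b (h, j)) (\<lambda>j. b (nx, j))"
        using b hj by (auto simp: bead_arrays_def nx_def)
      then consider "\<forall>j<k. b (h, j) \<le> b (nx, j)" "\<forall>j. Suc j < k \<longrightarrow> b (nx, j) < b (h, Suc j)"
        | "\<forall>j<k. b (nx, j) < b (h, j)" "\<forall>j. Suc j < k \<longrightarrow> b (h, j) \<le> b (nx, Suc j)"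
        unfolding interlacing_def by blast
      then show ?thesis
      proof cases
        case 1
        show ?thesis
        proof (cases j')
          case 0
          have "b (h, j') \<le> t" using mono'[of h 0 j] hj t 0 by auto
          moreover have "t \<le> b (h, k - 1)" using mono'[of h j "k - 1"] hj t by auto
          moreover have "b (h, k - 1) \<le> b (nx, k - 1)" using 1(1) k by simp
          ultimately have "val t (nx, k - 1) < val t (h, j')"
            using bb[OF nx(1), of "k - 1"] bb[OF hj(1) j'] neq[OF nx(1) _ nx(2), of "k - 1"] k by (auto simp: val_def)
          then show ?thesis using k by (intro exI[of _ "k - 1"]) auto
        next
          case (Suc m)
          have lt: "b (nx, m) < b (h, j')" using 1(2) Suc j' by simp
          have "val t (nx, m) < val t (h, j')"
          proof (cases "b (h, j') \<le> t")
            case True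
            then show ?thesis using lt by (auto simp: val_def)
          next
            case False
            then have "j \<le> m" using mono[of h j j'] hj j' t Suc by auto
            then have "t \<le> b (h, m)" using mono'[of h j m] hj j' t Suc by auto
            also have "b (h, m) \<le> b (nx, m)" using 1(1) j' Suc by simp
            finally show ?thesis using lt False neq[OF nx(1) _ nx(2), of m] j' Suc by (auto simp: val_def)
          qed
          then show ?thesis using Suc j' by (intro exI[of _ m]) auto
        qed
      next
        case 2
        have lt: "b (nx, j') < b (h, j')" using 2(1) j' by simp
        have "val t (nx, j') < val t (h, j')"
        proof (cases "b (h, j') \<le> t")
          case True
          then show ?thesis using lt by (auto simp: val_def)
        next
          case False
          then have "j < j'" using mono[of h j j'] hj j' t by auto
          then obtain m where m: "j' = Suc m" "j \<le> m" by (cases j') auto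
          then have "t \<le> b (h, m)" using mono'[of h j m] hj j' t by auto
          also have "b (h, m) \<le> b (nx, j')" using 2(2) m j' by simp
          finally show ?thesis using lt False neq[OF nx(1) j' nx(2)] by (auto simp: val_def)
        qed
        then show ?thesis using j' by blast
      qed
    qed
    have "\<exists>j0\<in>{..<k}. \<forall>j'\<in>{..<k}. val t (h, j0) \<le> val t (h, j')"
    proof -
      have "{..<k} \<noteq> {}" using k by (metis empty_iff lessThan_iff)
      then show ?thesis
        using ex_is_arg_min_if_finite[of "{..<k}" "\<lambda>j. val t (h, j)"] by (auto simp: is_arg_min_linorder)
    qed
    then obtain j0 where j0: "j0 < k" "\<And>j'. j' < k \<Longrightarrow> val t (h, j0) \<le> val t (h, j')" by auto
    obtain i0 where "i0 < k" "val t (nx, i0) < val t (h, j0)" using next_before[OF j0(1)] by blast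
    then have "bead_ahead n k (\<lambda>u. u \<le> t) b nx"
      unfolding bead_ahead_def nx(3) using j0(2) unfolding val_def
      by (intro exI[of _ i0]) (meson less_le_trans)
    then show "bead_ahead n k (\<lambda>u. u \<le> t) b (Suc h mod n)" by (simp add: nx_def)
    show "bead_ahead n k (\<lambda>u. u \<le> t) b g \<longleftrightarrow> bead_ahead n k (\<lambda>u. u < t) b g" if g: "g < n" "g \<noteq> h" "g \<noteq> Suc h mod n" for g
    proof (rule bead_ahead_cong_strings)
      have "(g + n - 1) mod n \<noteq> h" using g Suc_pred_mod[OF g(1)] by auto
      moreover have "(g + n - 1) mod n < n" using g by simp
      ultimately show "b ((g + n - 1) mod n, i) \<le> t \<longleftrightarrow> b ((g + n - 1) mod n, i) < t" if "i < k" for i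
        using neq[OF _ that] by (metis le_less)
      show "b (g, i) \<le> t \<longleftrightarrow> b (g, i) < t" if "i < k" for i
        using neq[OF g(1) that g(2)] by auto
    qed
  qed
  show ?thesis
    unfolding beads_occupation_process[OF k box]
  proof (intro Set.set_eqI iffI)
    fix x assume "x \<in> {(t, h). t \<in> b ` ?A \<and> h < n \<and> jump_at n k b t h}"
    then obtain t h h0 j where x: "x = (t, h)" "h < n" "jump_at n k b t h" "h0 < n" "j < k" "t = b (h0, j)" by auto
    note K = key[OF x(4,5,6)]
    have "h = h0"
    proof (rule ccontr)
      assume "h \<noteq> h0"
      then show False using x(3,4) K(1,2) unfolding jump_at_def by blast
    qed
    then show "x \<in> (\<lambda>p. (b p, fst p)) ` ?A" using x by force
  next
    fix x assume "x \<in> (\<lambda>p. (b p, fst p)) ` ?A"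
    then obtain h j where x: "h < n" "j < k" "x = (b (h, j), h)" by auto
    note K = key[OF x(1,2) refl]
    have "jump_at n k b (b (h, j)) h"
      unfolding jump_at_def
    proof (intro conjI allI impI exI[of _ h])
      show "bead_ahead n k (\<lambda>u. u < b (h, j)) b h \<noteq> bead_ahead n k (\<lambda>u. u \<le> b (h, j)) b h" using K(1,2) by simp
      fix g assume g: "g < n"
      show "bead_ahead n k (\<lambda>u. u \<le> b (h, j)) b g \<longleftrightarrow> bead_ahead n k (\<lambda>u. u < b (h, j)) b g \<and> g \<noteq> h \<or> g = Suc h mod n"
      proof (cases "g = h")
        case True
        then show ?thesis using K(2) mod_Suc_neq[OF n x(1)] by auto
      next
        case False
        then show ?thesis using K(3) K(4)[OF g False] by blast
      qed
    qed (rule x)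
    then show "x \<in> {(t, h). t \<in> b ` ?A \<and> h < n \<and> jump_at n k b t h}" using x by auto
  qed
qed

section \<open>Measurability of processes, bead counts, events and sets of configurations\<close>

lemma measurable_array_coord: "p \<in> {..<n} \<times> {..<k} \<Longrightarrow> (\<lambda>b. b p) \<in> borel_measurable (array_lebesgue n k)"
  unfolding array_lebesgue_def by measurable

lemma pred_bead_ahead:
  assumes f: "f \<in> borel_measurable (array_lebesgue n k)" and h: "h < n"
  shows "Measurable.pred (array_lebesgue n k) (\<lambda>b. bead_ahead n k (\<lambda>u. u \<le> f b) b h)"
    and "Measurable.pred (array_lebesgue n k) (\<lambda>b. bead_ahead n k (\<lambda>u. u < f b) b h)"
proof -
  let ?M = "array_lebesgue n k"
  have pr: "(h + n - 1) mod n < n" using h by simp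
  have le: "Measurable.pred ?M (\<lambda>b. b p + (if b p \<le> f b then 1 else 0) < b p' + (if b p' \<le> f b then 1 else 0))"
    and lt: "Measurable.pred ?M (\<lambda>b. b p + (if b p < f b then 1 else 0) < b p' + (if b p' < f b then 1 else 0))"
    if "p \<in> {..<n} \<times> {..<k}" "p' \<in> {..<n} \<times> {..<k}" for p p'
  proof -
    note [measurable] = f measurable_array_coord[OF that(1)] measurable_array_coord[OF that(2)]
    show "Measurable.pred ?M (\<lambda>b. b p + (if b p \<le> f b then 1 else 0) < b p' + (if b p' \<le> f b then 1 else 0))"
      "Measurable.pred ?M (\<lambda>b. b p + (if b p < f b then 1 else 0) < b p' + (if b p' < f b then 1 else 0))"
      by measurable
  qed
  have "Measurable.pred ?M (\<lambda>b. \<exists>j\<in>{..<k}. \<forall>i\<in>{..<k}. b (h, j) + (if b (h, j) \<le> f b then 1 else 0) <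
     b ((h + n - 1) mod n, i) + (if b ((h + n - 1) mod n, i) \<le> f b then 1 else 0))"
    "Measurable.pred ?M (\<lambda>b. \<exists>j\<in>{..<k}. \<forall>i\<in>{..<k}. b (h, j) + (if b (h, j) < f b then 1 else 0) <
     b ((h + n - 1) mod n, i) + (if b ((h + n - 1) mod n, i) < f b then 1 else 0))"
    by (intro pred_intros_finite finite_lessThan le lt; use h pr in auto)+
  moreover have "bead_ahead n k past b h \<longleftrightarrow> (\<exists>j\<in>{..<k}. \<forall>i\<in>{..<k}. b (h, j) + (if past (b (h, j)) then 1 else 0) <
     b ((h + n - 1) mod n, i) + (if past (b ((h + n - 1) mod n, i)) then 1 else 0))" for b past
    by (auto simp: bead_ahead_def of_bool_def)
  ultimately show "Measurable.pred ?M (\<lambda>b. bead_ahead n k (\<lambda>u. u \<le> f b) b h)"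
    "Measurable.pred ?M (\<lambda>b. bead_ahead n k (\<lambda>u. u < f b) b h)"
    by (simp_all only:)
qed

lemma measurable_occupation_process:
  assumes k: "0 < k"
  shows "occupation_process n k \<in> array_lebesgue n k \<rightarrow>\<^sub>M process_space n"
  unfolding process_space_def
proof (rule measurable_restrict_space2)
  show "occupation_process n k \<in> space (array_lebesgue n k) \<rightarrow> occupation_processes n"
    using occupation_process_in_processes[OF k] by auto
  show "occupation_process n k \<in> array_lebesgue n k \<rightarrow>\<^sub>M (\<Pi>\<^sub>M t\<in>{0..<1}. count_space (Pow {..<n}))"
  proof (rule measurable_PiM_single')
    fix t :: real assume t: "t \<in> {0..<1}"
    have "{b \<in> space (array_lebesgue n k). occupation_process n k b t = a} \<in> sets (array_lebesgue n k)" if "a \<in> Pow {..<n}" for a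
    proof -
      have "Measurable.pred (array_lebesgue n k) (\<lambda>b. \<forall>g\<in>{..<n}. bead_ahead n k (\<lambda>u. u \<le> t) b g \<longleftrightarrow> g \<in> a)"
        by (intro pred_intros_finite finite_lessThan pred_intros_logic pred_bead_ahead) auto
      then have "{b \<in> space (array_lebesgue n k). \<forall>g\<in>{..<n}. bead_ahead n k (\<lambda>u. u \<le> t) b g \<longleftrightarrow> g \<in> a} \<in> sets (array_lebesgue n k)"
        by (rule predE)
      also have "{b \<in> space (array_lebesgue n k). \<forall>g\<in>{..<n}. bead_ahead n k (\<lambda>u. u \<le> t) b g \<longleftrightarrow> g \<in> a} =
          {b \<in> space (array_lebesgue n k). occupation_process n k b t = a}"
        using that by (auto simp: occupation_process_eq[OF k t])
      finally show ?thesis .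
    qed
    moreover have "(\<lambda>b. occupation_process n k b t) \<in> space (array_lebesgue n k) \<rightarrow> Pow {..<n}"
      using t by (auto simp: occupation_process_def)
    moreover have "(\<lambda>b. occupation_process n k b t) -` {a} \<inter> space (array_lebesgue n k) =
        {b \<in> space (array_lebesgue n k). occupation_process n k b t = a}" for a by auto
    ultimately show "(\<lambda>b. occupation_process n k b t) \<in> array_lebesgue n k \<rightarrow>\<^sub>M count_space (Pow {..<n})"
      by (subst measurable_count_space_eq2) auto
  next
    show "occupation_process n k \<in> space (array_lebesgue n k) \<rightarrow> {0..<1} \<rightarrow>\<^sub>E space (count_space (Pow {..<n}))"
      by (auto simp: occupation_process_def)
  qed
qed

text \<open>Beads are enumerated through the first index carrying their coordinate. This also covers
  coinciding coordinates, a null set on which the count has to be measurable nevertheless.\<close>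

lemma measurable_bead_count:
  assumes B: "finite B" and n: "0 < n" and k: "0 < k" and D: "D \<in> sets (\<Pi>\<^sub>M i\<in>B. torus n)"
  obtains g :: "(nat \<times> nat \<Rightarrow> real) \<Rightarrow> nat" where "g \<in> array_lebesgue n k \<rightarrow>\<^sub>M count_space UNIV"
    and "\<And>b. b \<in> unit_box ({..<n} \<times> {..<k}) \<Longrightarrow>
      g b = card {x \<in> B \<rightarrow>\<^sub>E beads n (occupation_process n k b). inj_on x B \<and> x \<in> D}"
proof -
  let ?A = "{..<n} \<times> {..<k}" and ?M = "array_lebesgue n k"
  define first where "first b p \<longleftrightarrow> (\<forall>p'\<in>{p' \<in> ?A. prod_encode p' < prod_encode p}. b p' \<noteq> b p)" for b :: "nat \<times> nat \<Rightarrow> real" and p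
  \<comment> \<open>Makes the points lie in the torus for every b, as measurability of the map into
    the product requires; on the unit box nothing changes.\<close>
  define clip where "clip b p = (if 0 \<le> b p \<and> b p < 1 then b p else 0)" for b :: "nat \<times> nat \<Rightarrow> real" and p
  define pts where "pts b \<tau> = (\<lambda>i\<in>B. (clip b (fst (\<tau> i)), snd (\<tau> i)))" for b and \<tau> :: "_ \<Rightarrow> (nat \<times> nat) \<times> nat"
  define good where "good b \<tau> \<longleftrightarrow> (\<forall>i\<in>B. first b (fst (\<tau> i)) \<and> jump_at n k b (b (fst (\<tau> i))) (snd (\<tau> i))) \<and>
     (\<forall>i\<in>B. \<forall>i'\<in>B. i \<noteq> i' \<longrightarrow> b (fst (\<tau> i)) = b (fst (\<tau> i')) \<longrightarrow> snd (\<tau> i) \<noteq> snd (\<tau> i')) \<and> pts b \<tau> \<in> D" for b \<tau>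
  let ?T = "B \<rightarrow>\<^sub>E ?A \<times> {..<n}"
  define g where "g b = (\<Sum>\<tau>\<in>?T. if good b \<tau> then 1 else (0::nat))" for b
  have finT: "finite ?T" using B by (intro finite_PiE) auto
  have pgood: "Measurable.pred ?M (\<lambda>b. good b \<tau>)" if \<tau>: "\<tau> \<in> ?T" for \<tau>
  proof -
    have \<tau>A: "fst (\<tau> i) \<in> ?A" "snd (\<tau> i) < n" if "i \<in> B" for i using PiE_mem[OF \<tau> that] by (auto simp: mem_Times_iff)
    have p1: "Measurable.pred ?M (\<lambda>b. b p = b p')" if "p \<in> ?A" "p' \<in> ?A" for p p'
      using borel_measurable_eq[OF measurable_array_coord[OF that(1)] measurable_array_coord[OF that(2)]]
      by (simp add: Measurable.pred_def)
    have p2: "Measurable.pred ?M (\<lambda>b. first b p)" if "p \<in> ?A" for p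
      unfolding first_def by (intro pred_intros_finite pred_intros_logic p1) (use that in auto)
    have p3: "Measurable.pred ?M (\<lambda>b. jump_at n k b (b p) h)" if "p \<in> ?A" for p h
    proof -
      have "Measurable.pred ?M (\<lambda>b. (\<exists>g\<in>{..<n}. \<not> (bead_ahead n k (\<lambda>u. u < b p) b g \<longleftrightarrow> bead_ahead n k (\<lambda>u. u \<le> b p) b g)) \<and>
        (\<forall>g\<in>{..<n}. bead_ahead n k (\<lambda>u. u \<le> b p) b g \<longleftrightarrow> bead_ahead n k (\<lambda>u. u < b p) b g \<and> g \<noteq> h \<or> g = Suc h mod n))"
        by (intro pred_intros_finite pred_intros_logic pred_bead_ahead measurable_array_coord[OF that]) auto
      moreover have "jump_at n k b (b p) h \<longleftrightarrow> (\<exists>g\<in>{..<n}. \<not> (bead_ahead n k (\<lambda>u. u < b p) b g \<longleftrightarrow> bead_ahead n k (\<lambda>u. u \<le> b p) b g)) \<and>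
        (\<forall>g\<in>{..<n}. bead_ahead n k (\<lambda>u. u \<le> b p) b g \<longleftrightarrow> bead_ahead n k (\<lambda>u. u < b p) b g \<and> g \<noteq> h \<or> g = Suc h mod n)" for b
        unfolding jump_at_def by blast
      ultimately show ?thesis by (simp only:)
    qed
    have "(\<lambda>b. pts b \<tau>) \<in> ?M \<rightarrow>\<^sub>M (\<Pi>\<^sub>M i\<in>B. torus n)"
      unfolding pts_def
    proof (rule measurable_restrict)
      fix i assume i: "i \<in> B"
      note [measurable] = measurable_array_coord[OF \<tau>A(1)[OF i]]
      have "(\<lambda>b. clip b (fst (\<tau> i))) \<in> ?M \<rightarrow>\<^sub>M restrict_space lborel {0..<1}"
        unfolding clip_def by (rule measurable_restrict_space2) auto
      then show "(\<lambda>b. (clip b (fst (\<tau> i)), snd (\<tau> i))) \<in> ?M \<rightarrow>\<^sub>M torus n"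
        unfolding torus_def by (rule measurable_Pair) (use \<tau>A(2)[OF i] in simp)
    qed
    then have p4: "Measurable.pred ?M (\<lambda>b. pts b \<tau> \<in> D)" using D by (rule pred_sets2[rotated])
    show ?thesis
      unfolding good_def
      by (intro pred_intros_finite pred_intros_logic p1 p2 p3 p4 B \<tau>A) auto
  qed
  have "g \<in> ?M \<rightarrow>\<^sub>M count_space UNIV"
    unfolding g_def by (intro measurable_sum_nat measurable_If predE[OF pgood] measurable_const) auto
  moreover have "g b = card {x \<in> B \<rightarrow>\<^sub>E beads n (occupation_process n k b). inj_on x B \<and> x \<in> D}" if b: "b \<in> unit_box ?A" for b
  proof -
    have clip: "clip b p = b p" if "p \<in> ?A" for p using PiE_mem[OF b that] by (simp add: clip_def)
    have ex: "\<exists>p. p \<in> ?A \<and> b p = t \<and> first b p" if "t \<in> b ` ?A" for t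
    proof -
      have "\<exists>p. (p \<in> ?A \<and> b p = t) \<and> (\<forall>p'. p' \<in> ?A \<and> b p' = t \<longrightarrow> prod_encode p \<le> prod_encode p')"
        using that ex_has_least_nat[of "\<lambda>p. p \<in> ?A \<and> b p = t" _ prod_encode] by blast
      then show ?thesis unfolding first_def by (metis (no_types, lifting) mem_Collect_eq not_le)
    qed
    have uniq: "p = p'" if "p \<in> ?A" "p' \<in> ?A" "b p = b p'" "first b p" "first b p'" for p p'
    proof -
      have "\<not> prod_encode p < prod_encode p'" "\<not> prod_encode p' < prod_encode p"
        using that unfolding first_def by (metis (no_types, lifting) mem_Collect_eq)+
      then show ?thesis using inj_prod_encode[of UNIV] by (auto dest: injD)
    qed
    define rep where "rep t = (SOME p. p \<in> ?A \<and> b p = t \<and> first b p)" for t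
    have rep: "rep t \<in> ?A \<and> b (rep t) = t \<and> first b (rep t)" if "t \<in> b ` ?A" for t
      unfolding rep_def by (rule someI_ex) (rule ex[OF that])
    have "g b = card {\<tau> \<in> ?T. good b \<tau>}"
      unfolding g_def using finT by (simp add: sum.inter_filter[symmetric])
    also have "\<dots> = card {x \<in> B \<rightarrow>\<^sub>E beads n (occupation_process n k b). inj_on x B \<and> x \<in> D}"
    proof (rule bij_betw_same_card[of "pts b"], rule bij_betw_byWitness[where f'="\<lambda>x. \<lambda>i\<in>B. (rep (fst (x i)), snd (x i))"])
      show "\<forall>\<tau>\<in>{\<tau> \<in> ?T. good b \<tau>}. (\<lambda>i\<in>B. (rep (fst (pts b \<tau> i)), snd (pts b \<tau> i))) = \<tau>"
      proof
        fix \<tau> assume "\<tau> \<in> {\<tau> \<in> ?T. good b \<tau>}"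
        then have \<tau>: "\<tau> \<in> ?T" "good b \<tau>" by auto
        show "(\<lambda>i\<in>B. (rep (fst (pts b \<tau> i)), snd (pts b \<tau> i))) = \<tau>"
        proof (rule ext)
          fix i
          show "(\<lambda>i\<in>B. (rep (fst (pts b \<tau> i)), snd (pts b \<tau> i))) i = \<tau> i"
          proof (cases "i \<in> B")
            case True
            have \<tau>A: "fst (\<tau> i) \<in> ?A" using PiE_mem[OF \<tau>(1) True] by (auto simp: mem_Times_iff)
            have "rep (b (fst (\<tau> i))) = fst (\<tau> i)"
              using rep[of "b (fst (\<tau> i))"] \<tau>A \<tau>(2) True by (intro uniq) (auto simp: good_def)
            then show ?thesis using True clip[OF \<tau>A] by (simp add: pts_def)
          next
            case False
            then show ?thesis using \<tau>(1) by (simp add: PiE_iff extensional_def)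
          qed
        qed
      qed
      show "\<forall>x\<in>{x \<in> B \<rightarrow>\<^sub>E beads n (occupation_process n k b). inj_on x B \<and> x \<in> D}.
          pts b (\<lambda>i\<in>B. (rep (fst (x i)), snd (x i))) = x"
      proof
        fix x assume "x \<in> {x \<in> B \<rightarrow>\<^sub>E beads n (occupation_process n k b). inj_on x B \<and> x \<in> D}"
        then have x: "x \<in> B \<rightarrow>\<^sub>E beads n (occupation_process n k b)" by auto
        show "pts b (\<lambda>i\<in>B. (rep (fst (x i)), snd (x i))) = x"
        proof (rule ext)
          fix i
          show "pts b (\<lambda>i\<in>B. (rep (fst (x i)), snd (x i))) i = x i"
          proof (cases "i \<in> B")
            case True
            have "x i \<in> beads n (occupation_process n k b)" using x True by (rule PiE_mem)
            then have "fst (x i) \<in> b ` ?A" unfolding beads_occupation_process[OF k b] by (cases "x i") auto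
            from rep[OF this] show ?thesis using True clip by (simp add: pts_def)
          next
            case False
            then show ?thesis using x by (simp add: pts_def PiE_iff extensional_def)
          qed
        qed
      qed
      show "pts b ` {\<tau> \<in> ?T. good b \<tau>} \<subseteq> {x \<in> B \<rightarrow>\<^sub>E beads n (occupation_process n k b). inj_on x B \<and> x \<in> D}"
      proof (rule image_subsetI)
        fix \<tau> assume "\<tau> \<in> {\<tau> \<in> ?T. good b \<tau>}"
        then have \<tau>: "\<tau> \<in> ?T" "good b \<tau>" by auto
        have \<tau>A: "fst (\<tau> i) \<in> ?A" "snd (\<tau> i) < n" if "i \<in> B" for i using PiE_mem[OF \<tau>(1) that] by (auto simp: mem_Times_iff)
        have pi: "pts b \<tau> i = (b (fst (\<tau> i)), snd (\<tau> i))" if "i \<in> B" for i using that clip[OF \<tau>A(1)[OF that]] by (simp add: pts_def)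
        have "pts b \<tau> i \<in> beads n (occupation_process n k b)" if "i \<in> B" for i
          unfolding beads_occupation_process[OF k b] pi[OF that] using \<tau>A[OF that] \<tau>(2) that by (auto simp: good_def)
        then have "pts b \<tau> \<in> B \<rightarrow>\<^sub>E beads n (occupation_process n k b)" by (auto simp: PiE_iff pts_def)
        moreover have "inj_on (pts b \<tau>) B"
          using \<tau>(2) pi unfolding inj_on_def good_def by (metis prod.inject)
        ultimately show "pts b \<tau> \<in> {x \<in> B \<rightarrow>\<^sub>E beads n (occupation_process n k b). inj_on x B \<and> x \<in> D}"
          using \<tau>(2) by (simp add: good_def)
      qed
      show "(\<lambda>x. \<lambda>i\<in>B. (rep (fst (x i)), snd (x i))) ` {x \<in> B \<rightarrow>\<^sub>E beads n (occupation_process n k b). inj_on x B \<and> x \<in> D} \<subseteq> {\<tau> \<in> ?T. good b \<tau>}"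
      proof (rule image_subsetI)
        fix x assume "x \<in> {x \<in> B \<rightarrow>\<^sub>E beads n (occupation_process n k b). inj_on x B \<and> x \<in> D}"
        then have x: "x \<in> B \<rightarrow>\<^sub>E beads n (occupation_process n k b)" "inj_on x B" "x \<in> D" by auto
        let ?\<tau> = "\<lambda>i\<in>B. (rep (fst (x i)), snd (x i))"
        have xi: "fst (x i) \<in> b ` ?A" "snd (x i) < n" "jump_at n k b (fst (x i)) (snd (x i))" if "i \<in> B" for i
          using PiE_mem[OF x(1) that] unfolding beads_occupation_process[OF k b] by (cases "x i", auto)+
        have r: "rep (fst (x i)) \<in> ?A" "b (rep (fst (x i))) = fst (x i)" "first b (rep (fst (x i)))" if "i \<in> B" for i
          using rep[OF xi(1)[OF that]] by auto
        have "?\<tau> \<in> ?T" using r(1) xi(2) by (auto simp: PiE_iff)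
        moreover have "pts b ?\<tau> = x"
        proof (rule ext)
          fix i show "pts b ?\<tau> i = x i"
          proof (cases "i \<in> B")
            case True
            then show ?thesis using r[OF True] clip by (simp add: pts_def)
          next
            case False
            then show ?thesis using x by (simp add: pts_def PiE_iff extensional_def)
          qed
        qed
        moreover have "snd (x i) \<noteq> snd (x i')" if "i \<in> B" "i' \<in> B" "i \<noteq> i'" "fst (x i) = fst (x i')" for i i'
          using inj_onD[OF x(2), of i i'] that by (auto simp: prod_eq_iff)
        ultimately have "good b ?\<tau>" using x(3) r xi by (auto simp: good_def)
        then show "?\<tau> \<in> {\<tau> \<in> ?T. good b \<tau>}" using \<open>?\<tau> \<in> ?T\<close> by simp
      qed
    qed
    finally show ?thesis .
  qed
  ultimately show ?thesis by (rule that)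
qed

lemma pred_marked_event:
  assumes F: "finite F" and k: "0 < k" and y: "\<And>i. i \<in> F \<Longrightarrow> y i \<in> {0..<1} \<times> {..<n}"
  shows "Measurable.pred (array_lebesgue n k) (\<lambda>b. marked_event \<alpha> y F (occupation_process n k b))"
proof -
  have "Measurable.pred (array_lebesgue n k) (\<lambda>b. \<forall>i\<in>F.
      (\<alpha> i = Occupied \<longrightarrow> bead_ahead n k (\<lambda>u. u \<le> fst (y i)) b (snd (y i))) \<and>
      (\<alpha> i = Unoccupied \<longrightarrow> \<not> bead_ahead n k (\<lambda>u. u \<le> fst (y i)) b (snd (y i))))"
    using y by (intro pred_intros_finite pred_intros_logic pred_bead_ahead F) (auto simp: mem_Times_iff)
  moreover have "marked_event \<alpha> y F (occupation_process n k b) \<longleftrightarrow> (\<forall>i\<in>F.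
      (\<alpha> i = Occupied \<longrightarrow> bead_ahead n k (\<lambda>u. u \<le> fst (y i)) b (snd (y i))) \<and>
      (\<alpha> i = Unoccupied \<longrightarrow> \<not> bead_ahead n k (\<lambda>u. u \<le> fst (y i)) b (snd (y i))))" for b
    unfolding marked_event_def using y occupation_process_eq[OF k, of "fst (y _)" n b]
    by (intro ball_cong refl) (auto simp: mem_Times_iff)
  ultimately show ?thesis by simp
qed

lemma W_measurable:
  assumes "0 < n" "0 < k"
  shows "W n k l \<in> sets (array_lebesgue n k)"
proof -
  let ?M = "array_lebesgue n k"
  have c: "(\<lambda>b. b (h, j)) \<in> borel_measurable ?M" if "h < n" "j < k" for h j
    using that by (intro measurable_array_coord) auto
  have lt: "Measurable.pred ?M (\<lambda>b. b (h, j) < b (h', j'))" and le: "Measurable.pred ?M (\<lambda>b. b (h, j) \<le> b (h', j'))"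
    if "h < n" "j < k" "h' < n" "j' < k" for h j h' j'
    using borel_measurable_less[OF c[OF that(1,2)] c[OF that(3,4)]] borel_measurable_le[OF c[OF that(1,2)] c[OF that(3,4)]]
    by (simp_all add: Measurable.pred_def)
  have il: "Measurable.pred ?M (\<lambda>b. interlacing k (\<lambda>j. b (h, j)) (\<lambda>j. b (g, j)))" if "h < n" "g < n" for h g
  proof -
    have fin: "finite {j. Suc j < k}" by (rule finite_subset[of _ "{..<k}"]) auto
    have "Measurable.pred ?M (\<lambda>b. (\<forall>j\<in>{..<k}. b (h, j) \<le> b (g, j)) \<and> (\<forall>j\<in>{j. Suc j < k}. b (g, j) < b (h, Suc j)) \<or>
       (\<forall>j\<in>{..<k}. b (g, j) < b (h, j)) \<and> (\<forall>j\<in>{j. Suc j < k}. b (h, j) \<le> b (g, Suc j)))"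
      by (intro pred_intros_finite pred_intros_logic lt le fin) (use that in auto)
    moreover have "interlacing k (\<lambda>j. b (h, j)) (\<lambda>j. b (g, j)) \<longleftrightarrow>
       (\<forall>j\<in>{..<k}. b (h, j) \<le> b (g, j)) \<and> (\<forall>j\<in>{j. Suc j < k}. b (g, j) < b (h, Suc j)) \<or>
       (\<forall>j\<in>{..<k}. b (g, j) < b (h, j)) \<and> (\<forall>j\<in>{j. Suc j < k}. b (h, j) \<le> b (g, Suc j))" for b
      unfolding interlacing_def by blast
    ultimately show ?thesis by (simp only:)
  qed
  have "Measurable.pred ?M (\<lambda>b. \<forall>h\<in>{..<n}. interlacing k (\<lambda>j. b (h, j)) (\<lambda>j. b (Suc h mod n, j)))"
    by (intro pred_intros_finite il) (use assms in auto)
  then have 1: "{b \<in> space ?M. \<forall>h\<in>{..<n}. interlacing k (\<lambda>j. b (h, j)) (\<lambda>j. b (Suc h mod n, j))} \<in> sets ?M" by (rule predE)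
  have "(\<lambda>b. \<Sum>h<n. if b (h, 0) < b ((h + n - 1) mod n, 0) then 1 else (0::nat)) \<in> ?M \<rightarrow>\<^sub>M count_space UNIV"
    by (intro measurable_sum_nat measurable_If predE[OF lt] measurable_const) (use assms in auto)
  moreover have "(\<Sum>h<n. if b (h, 0) < b ((h + n - 1) mod n, 0) then 1 else (0::nat)) = occupation_number n b" for b :: "nat \<times> nat \<Rightarrow> real"
  proof -
    have "(\<Sum>h<n. if b (h, 0) < b ((h + n - 1) mod n, 0) then 1 else (0::nat)) = card {h \<in> {..<n}. b (h, 0) < b ((h + n - 1) mod n, 0)}"
      by (simp add: sum.inter_filter[symmetric])
    then show ?thesis by (simp add: occupation_number_def)
  qed
  ultimately have "(\<lambda>b. occupation_number n b) \<in> ?M \<rightarrow>\<^sub>M count_space UNIV" by simp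
  then have 2: "(\<lambda>b. occupation_number n b) -` {l} \<inter> space ?M \<in> sets ?M" by (rule measurable_sets) simp
  have "sorted_arrays n k \<inter> {b \<in> space ?M. \<forall>h\<in>{..<n}. interlacing k (\<lambda>j. b (h, j)) (\<lambda>j. b (Suc h mod n, j))} \<inter>
      ((\<lambda>b. occupation_number n b) -` {l} \<inter> space ?M) \<in> sets ?M"
    by (rule sets.Int[OF sets.Int[OF sorted_arrays_measurable 1] 2])
  also have "sorted_arrays n k \<inter> {b \<in> space ?M. \<forall>h\<in>{..<n}. interlacing k (\<lambda>j. b (h, j)) (\<lambda>j. b (Suc h mod n, j))} \<inter>
      ((\<lambda>b. occupation_number n b) -` {l} \<inter> space ?M) = W n k l"
    using sets.sets_into_space[OF sorted_arrays_measurable[of n k]]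
    by (auto simp: W_def bead_arrays_def sorted_arrays_def subset_iff)
  finally show ?thesis .
qed

section \<open>Integrated kernel determinants\<close>

definition with_marks :: "nat set \<Rightarrow> (nat \<Rightarrow> kind) \<Rightarrow> (nat \<Rightarrow> real \<times> nat) \<Rightarrow> (nat \<Rightarrow> real \<times> nat) \<Rightarrow> nat \<Rightarrow> kind \<times> real \<times> nat" where
  "with_marks F \<alpha> y x i = (if i \<in> F then (\<alpha> i, y i) else (Bead, x i))"

text \<open>Up to the factor 1/2 (-1)^(\<theta> + n + 1) T^(card J), the correlation density of the
  unnormalized \<open>Q\<close> for bead variables J and marks F, see \<open>Q_marked_count\<close>.
  The factor \<open>partition_det\<close> takes the place of the normalization.\<close>

definition kernel_density where
  "kernel_density n \<beta> \<theta> T F \<alpha> y J x = partition_det n \<beta> \<theta> T *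
     fdet (J \<union> F) (\<lambda>i j. kernel n \<beta> \<theta> T (with_marks F \<alpha> y x i) (with_marks F \<alpha> y x j))"

lemma with_marks_time:
  assumes "x \<in> space (\<Pi>\<^sub>M i\<in>J. torus n)" "y ` F \<subseteq> {0..<1} \<times> {..<n}" "i \<in> J \<union> F"
  shows "fst (snd (with_marks F \<alpha> y x i)) \<in> {0..<1}" "snd (snd (with_marks F \<alpha> y x i)) < n"
proof -
  have "snd (with_marks F \<alpha> y x i) \<in> {0..<1} \<times> {..<n}"
  proof (cases "i \<in> F")
    case False
    then have "x i \<in> space (torus n)" using assms(1,3) by (auto simp: space_PiM PiE_iff)
    then show ?thesis using False by (simp add: with_marks_def space_torus)
  qed (use assms(2) in \<open>auto simp: with_marks_def\<close>)
  then show "fst (snd (with_marks F \<alpha> y x i)) \<in> {0..<1}" "snd (snd (with_marks F \<alpha> y x i)) < n"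
    by (auto simp: mem_Times_iff)
qed

lemma measurable_kernel_density:
  "kernel_density n \<beta> \<theta> T F \<alpha> y J \<in> borel_measurable (\<Pi>\<^sub>M i\<in>J. torus n)"
proof -
  have [measurable]: "(\<lambda>x. fst (snd (with_marks F \<alpha> y x i))) \<in> borel_measurable (\<Pi>\<^sub>M i\<in>J. torus n)"
    "(\<lambda>x. snd (snd (with_marks F \<alpha> y x i))) \<in> (\<Pi>\<^sub>M i\<in>J. torus n) \<rightarrow>\<^sub>M count_space UNIV" if "i \<in> J \<union> F" for i
  proof -
    have J: "i \<in> J" if "i \<notin> F" using that \<open>i \<in> J \<union> F\<close> by auto
    have "(\<lambda>x. fst (x i)) \<in> borel_measurable (\<Pi>\<^sub>M i\<in>J. torus n)"
      "(\<lambda>x. snd (x i)) \<in> (\<Pi>\<^sub>M i\<in>J. torus n) \<rightarrow>\<^sub>M count_space UNIV" if "i \<notin> F"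
      using measurable_compose[OF measurable_component_singleton[OF J[OF that], of "\<lambda>_. torus n"] measurable_torus_fst]
        measurable_compose[OF measurable_component_singleton[OF J[OF that], of "\<lambda>_. torus n"] measurable_torus_snd] by auto
    then show "(\<lambda>x. fst (snd (with_marks F \<alpha> y x i))) \<in> borel_measurable (\<Pi>\<^sub>M i\<in>J. torus n)"
      "(\<lambda>x. snd (snd (with_marks F \<alpha> y x i))) \<in> (\<Pi>\<^sub>M i\<in>J. torus n) \<rightarrow>\<^sub>M count_space UNIV"
      by (cases "i \<in> F"; simp add: with_marks_def)+
  qed
  have k: "with_marks F \<alpha> y x i = (if i \<in> F then \<alpha> i else Bead, fst (snd (with_marks F \<alpha> y x i)), snd (snd (with_marks F \<alpha> y x i)))" for x i
    by (simp add: with_marks_def)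
  have "(\<lambda>x. kernel n \<beta> \<theta> T (with_marks F \<alpha> y x i) (with_marks F \<alpha> y x j)) \<in> borel_measurable (\<Pi>\<^sub>M i\<in>J. torus n)"
    if "i \<in> J \<union> F" "j \<in> J \<union> F" for i j
    by (subst k, subst (2) k, rule measurable_kernel) (use that in measurable)
  then show ?thesis
    unfolding kernel_density_def by (intro borel_measurable_times borel_measurable_const measurable_fdet)
qed

lemma norm_kernel_density_le:
  assumes "0 < n" "finite J" "finite F" "y ` F \<subseteq> {0..<1} \<times> {..<n}" "x \<in> space (\<Pi>\<^sub>M i\<in>J. torus n)"
  shows "norm (kernel_density n \<beta> \<theta> T F \<alpha> y J x) \<le>
    norm (partition_det n \<beta> \<theta> T) * (fact (card (J \<union> F)) * kernel_bound n \<beta> \<theta> T ^ card (J \<union> F))"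
  unfolding kernel_density_def norm_mult
  by (intro mult_left_mono norm_fdet_le norm_kernel_le with_marks_time[OF assms(5,4)]) (use assms in auto)

lemma continuous_kernel_bound:
  assumes "0 < n" "regular n \<beta> \<theta> T"
  shows "isCont (\<lambda>p. kernel_bound n (fst p) \<theta> (snd p)) (\<beta>, T)"
proof -
  have "1 - exp (- (\<beta> + T * z)) \<noteq> 0" if "z \<in> sign_roots n \<theta>" for z
    using assms(2) that by (auto simp: regular_def)
  then show ?thesis unfolding kernel_bound_def by (intro continuous_intros) auto
qed

lemma open_regular:
  assumes "0 < n"
  shows "open {p. regular n (fst p) \<theta> (snd p)}"
proof -
  have "{p. regular n (fst p) \<theta> (snd p)} = (\<Inter>z\<in>sign_roots n \<theta>. {p. exp (- (fst p + snd p * z)) \<noteq> 1})"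
    by (auto simp: regular_def)
  moreover have "open {p :: complex \<times> complex. exp (- (fst p + snd p * z)) \<noteq> 1}" for z
    by (intro open_Collect_neq continuous_intros)
  ultimately show ?thesis using finite_sign_roots[OF assms] by (auto intro!: open_INT)
qed

text \<open>Continuity in \<open>\<beta>\<close> serves to reach the values with
  \<open>exp (- \<beta>) = 1\<close>, where the kernel at \<open>T = 0\<close> is undefined.\<close>

lemma kernel_density_locally_bounded:
  assumes n: "0 < n" and reg: "regular n \<beta> \<theta> T" and J: "finite J" and F: "finite F" "y ` F \<subseteq> {0..<1} \<times> {..<n}"
  obtains r B where "0 < r" "\<And>\<beta>' T'. dist \<beta> \<beta>' < r \<Longrightarrow> dist T T' < r \<Longrightarrow> regular n \<beta>' \<theta> T'"
    "\<And>\<beta>' T' x. dist \<beta> \<beta>' < r \<Longrightarrow> dist T T' < r \<Longrightarrow> x \<in> space (\<Pi>\<^sub>M i\<in>J. torus n) \<Longrightarrow>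
       norm (kernel_density n \<beta>' \<theta> T' F \<alpha> y J x) \<le> B"
proof -
  define f where "f p = norm (partition_det n (fst p) \<theta> (snd p)) * (fact (card (J \<union> F)) * kernel_bound n (fst p) \<theta> (snd p) ^ card (J \<union> F))" for p
  have "isCont f (\<beta>, T)"
    unfolding f_def partition_det_def by (intro continuous_intros continuous_kernel_bound n reg)
  then have "\<forall>\<^sub>F p in nhds (\<beta>, T). f p < f (\<beta>, T) + 1"
    by (intro order_tendstoD(2)[of f "f (\<beta>, T)"]) (auto simp: isCont_def tendsto_nhds_iff)
  moreover have "\<forall>\<^sub>F p in nhds (\<beta>, T). regular n (fst p) \<theta> (snd p)"
    using eventually_nhds_in_open[OF open_regular[OF n, of \<theta>], of "(\<beta>, T)"] reg by simp
  ultimately have "\<forall>\<^sub>F p in nhds (\<beta>, T). f p < f (\<beta>, T) + 1 \<and> regular n (fst p) \<theta> (snd p)"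
    by (rule eventually_conj)
  then obtain e where e: "0 < e" "\<And>p. dist p (\<beta>, T) < e \<Longrightarrow> f p < f (\<beta>, T) + 1 \<and> regular n (fst p) \<theta> (snd p)"
    by (auto simp: eventually_nhds_metric)
  have d: "dist (\<beta>', T') (\<beta>, T) < e" if "dist \<beta> \<beta>' < e / 2" "dist T T' < e / 2" for \<beta>' T'
  proof -
    have "dist (\<beta>', T') (\<beta>, T) \<le> dist \<beta>' \<beta> + dist T' T"
      unfolding dist_Pair_Pair by (rule sqrt_sum_squares_le_sum) auto
    then show ?thesis using that by (simp add: dist_commute)
  qed
  show ?thesis
  proof (rule that[of "e / 2" "f (\<beta>, T) + 1"])
    show "0 < e / 2" using e by simp
    fix \<beta>' T' assume dd: "dist \<beta> \<beta>' < e / 2" "dist T T' < e / 2"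
    show "regular n \<beta>' \<theta> T'" using e(2)[OF d[OF dd]] by simp
    fix x assume "x \<in> space (\<Pi>\<^sub>M i\<in>J. torus n)"
    then have "norm (kernel_density n \<beta>' \<theta> T' F \<alpha> y J x) \<le> f (\<beta>', T')"
      unfolding f_def fst_conv snd_conv by (intro norm_kernel_density_le n J F)
    then show "norm (kernel_density n \<beta>' \<theta> T' F \<alpha> y J x) \<le> f (\<beta>, T) + 1"
      using e(2)[OF d[OF dd]] by simp
  qed
qed

lemma restrict_in_D_measurable:
  assumes "B \<subseteq> J" "D \<in> sets (\<Pi>\<^sub>M i\<in>B. torus n)"
  shows "(\<lambda>x. indicator D (restrict x B) :: complex) \<in> borel_measurable (\<Pi>\<^sub>M i\<in>J. torus n)"
proof -
  have "(\<lambda>x. restrict x B) \<in> (\<Pi>\<^sub>M i\<in>J. torus n) \<rightarrow>\<^sub>M (\<Pi>\<^sub>M i\<in>B. torus n)" by (rule measurable_restrict_subset[OF assms(1)])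
  from measurable_compose[OF this borel_measurable_indicator[OF assms(2)]] show ?thesis .
qed

text \<open>The pointwise recursion integrated over J; Fubini absorbs the new variable a. The set D
  restricts only the variables in B, which all belong to J, so its indicator passes through both the
  derivative and the inner integral.\<close>

lemma has_field_derivative_integral_kernel_density:
  assumes n: "0 < n" and reg: "regular n \<beta> \<theta> T" and J: "finite J" "a \<notin> J" "B \<subseteq> J" and F: "finite F" "y ` F \<subseteq> {0..<1} \<times> {..<n}" "a \<notin> F"
    and D: "D \<in> sets (\<Pi>\<^sub>M i\<in>B. torus n)"
  shows "((\<lambda>T. LINT x|(\<Pi>\<^sub>M i\<in>J. torus n). indicator D (restrict x B) * kernel_density n \<beta> \<theta> T F \<alpha> y J x) has_field_derivative
     (LINT x|(\<Pi>\<^sub>M i\<in>insert a J. torus n). indicator D (restrict x B) * kernel_density n \<beta> \<theta> T F \<alpha> y (insert a J) x)) (at T)"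
proof -
  interpret P: product_sigma_finite "\<lambda>_. torus n" by (rule product_sigma_finite_torus)
  let ?P = "\<Pi>\<^sub>M i\<in>J. torus n"
  obtain r Bd where r: "0 < r" "\<And>\<beta>' T'. dist \<beta> \<beta>' < r \<Longrightarrow> dist T T' < r \<Longrightarrow> regular n \<beta>' \<theta> T'"
    "\<And>\<beta>' T' x. dist \<beta> \<beta>' < r \<Longrightarrow> dist T T' < r \<Longrightarrow> x \<in> space ?P \<Longrightarrow> norm (kernel_density n \<beta>' \<theta> T' F \<alpha> y J x) \<le> Bd"
    using kernel_density_locally_bounded[OF n reg J(1) F(1,2), of \<alpha>] by metis
  have Bd0: "0 \<le> Bd" if "x \<in> space ?P" for x using r(3)[of \<beta> T x] r(1) that norm_ge_zero order_trans by (metis dist_self)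
  define F' where "F' T x = indicator D (restrict x B) * (LINT c|torus n. kernel_density n \<beta> \<theta> T F \<alpha> y (insert a J) (x(a := c)))" for T x
  have "((\<lambda>T. LINT x|?P. indicator D (restrict x B) * kernel_density n \<beta> \<theta> T F \<alpha> y J x) has_field_derivative (LINT x|?P. F' T x)) (at T)"
  proof (rule has_field_derivative_lebesgue_integral[where S="ball T r" and B=Bd])
    show "finite_measure ?P" by (rule finite_measure_PiM_torus[OF J(1)])
    show "T \<in> ball T r" using r by simp
    fix s assume s: "s \<in> ball T r"
    show "(\<lambda>x. indicator D (restrict x B) * kernel_density n \<beta> \<theta> s F \<alpha> y J x) \<in> borel_measurable ?P"
      by (intro borel_measurable_times restrict_in_D_measurable[OF J(3) D] measurable_kernel_density)
    fix x assume x: "x \<in> space ?P"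
    show "norm (indicator D (restrict x B) * kernel_density n \<beta> \<theta> s F \<alpha> y J x) \<le> Bd"
      using r(3)[of \<beta> s x] s x r(1) Bd0[OF x] by (simp add: norm_mult indicator_def)
    have "((\<lambda>s. kernel_density n \<beta> \<theta> s F \<alpha> y J x) has_field_derivative
      (LINT c|torus n. kernel_density n \<beta> \<theta> s F \<alpha> y (insert a J) (x(a := c)))) (at s)"
    proof -
      have upd: "with_marks F \<alpha> y (x(a := c)) = (with_marks F \<alpha> y x)(a := (Bead, c))" for c
        using F(3) by (auto simp: with_marks_def)
      show ?thesis
        unfolding kernel_density_def upd Un_insert_left
        by (rule has_field_derivative_fdet_kernel[OF n])
           (use J F with_marks_time[OF x F(2)] r(1) r(2)[of \<beta> s] s in auto)
    qed
    then show "((\<lambda>s. indicator D (restrict x B) * kernel_density n \<beta> \<theta> s F \<alpha> y J x) has_field_derivative F' s x) (at s)"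
      unfolding F'_def by (rule DERIV_cmult)
  qed (rule open_ball)
  also have "(LINT x|?P. F' T x) = (LINT x|(\<Pi>\<^sub>M i\<in>insert a J. torus n). indicator D (restrict x B) * kernel_density n \<beta> \<theta> T F \<alpha> y (insert a J) x)"
  proof -
    have aJ: "finite (insert a J)" "B \<subseteq> insert a J" using J by auto
    obtain r' Bd' where r': "0 < r'" "\<And>\<beta>' T' x. dist \<beta> \<beta>' < r' \<Longrightarrow> dist T T' < r' \<Longrightarrow> x \<in> space (\<Pi>\<^sub>M i\<in>insert a J. torus n) \<Longrightarrow>
        norm (kernel_density n \<beta>' \<theta> T' F \<alpha> y (insert a J) x) \<le> Bd'"
      using kernel_density_locally_bounded[OF n reg aJ(1) F(1,2), of \<alpha>] by metis
    have "integrable (\<Pi>\<^sub>M i\<in>insert a J. torus n) (\<lambda>x. indicator D (restrict x B) * kernel_density n \<beta> \<theta> T F \<alpha> y (insert a J) x)"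
    proof (rule integrable_PiM_torus_bounded[OF aJ(1), where B="\<bar>Bd'\<bar>"])
      show "(\<lambda>x. indicator D (restrict x B) * kernel_density n \<beta> \<theta> T F \<alpha> y (insert a J) x) \<in> borel_measurable (\<Pi>\<^sub>M i\<in>insert a J. torus n)"
        by (intro borel_measurable_times restrict_in_D_measurable[OF aJ(2) D] measurable_kernel_density)
      fix x assume "x \<in> space (\<Pi>\<^sub>M i\<in>insert a J. torus n)"
      then show "norm (indicator D (restrict x B) * kernel_density n \<beta> \<theta> T F \<alpha> y (insert a J) x) \<le> \<bar>Bd'\<bar>"
        using r'(2)[of \<beta> T x] r'(1) by (auto simp: norm_mult indicator_def intro: order_trans[OF _ abs_ge_self])
    qed
    from P.product_integral_insert[OF J(1,2) this]
    have "(LINT x|(\<Pi>\<^sub>M i\<in>insert a J. torus n). indicator D (restrict x B) * kernel_density n \<beta> \<theta> T F \<alpha> y (insert a J) x) =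
      (LINT x|?P. LINT c|torus n. indicator D (restrict (x(a := c)) B) * kernel_density n \<beta> \<theta> T F \<alpha> y (insert a J) (x(a := c)))" .
    moreover have "restrict (x(a := c)) B = restrict x B" for x :: "nat \<Rightarrow> real \<times> nat" and c using J by (auto simp: fun_eq_iff)
    ultimately show ?thesis by (simp add: F'_def)
  qed
  finally show ?thesis .
qed

lemma continuous_integral_kernel_density:
  assumes n: "0 < n" and reg: "regular n \<beta> \<theta> T" and J: "finite J" "B \<subseteq> J" and F: "finite F" "y ` F \<subseteq> {0..<1} \<times> {..<n}"
    and D: "D \<in> sets (\<Pi>\<^sub>M i\<in>B. torus n)"
  shows "isCont (\<lambda>\<beta>. LINT x|(\<Pi>\<^sub>M i\<in>J. torus n). indicator D (restrict x B) * kernel_density n \<beta> \<theta> T F \<alpha> y J x) \<beta>"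
  unfolding isCont_def
proof (rule tendsto_at_iff_sequentially[THEN iffD2], intro allI impI)
  let ?P = "\<Pi>\<^sub>M i\<in>J. torus n"
  interpret P: finite_measure ?P by (rule finite_measure_PiM_torus[OF J(1)])
  fix X :: "nat \<Rightarrow> complex" assume "\<forall>i. X i \<in> UNIV - {\<beta>}" "X \<longlonglongrightarrow> \<beta>"
  then have X: "X \<longlonglongrightarrow> \<beta>" by simp
  obtain r Bd where r: "0 < r" "\<And>\<beta>' T'. dist \<beta> \<beta>' < r \<Longrightarrow> dist T T' < r \<Longrightarrow> regular n \<beta>' \<theta> T'"
    "\<And>\<beta>' T' x. dist \<beta> \<beta>' < r \<Longrightarrow> dist T T' < r \<Longrightarrow> x \<in> space ?P \<Longrightarrow> norm (kernel_density n \<beta>' \<theta> T' F \<alpha> y J x) \<le> Bd"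
    using kernel_density_locally_bounded[OF n reg J(1) F, of \<alpha>] by metis
  have "\<forall>\<^sub>F i in sequentially. dist \<beta> (X i) < r" using X r(1) by (simp add: tendsto_iff dist_commute)
  then obtain M where M: "\<And>i. M \<le> i \<Longrightarrow> dist \<beta> (X i) < r" by (auto simp: eventually_sequentially)
  let ?f = "\<lambda>\<beta> x. indicator D (restrict x B) * kernel_density n \<beta> \<theta> T F \<alpha> y J x"
  have "(\<lambda>i. LINT x|?P. ?f (X (i + M)) x) \<longlonglongrightarrow> (LINT x|?P. ?f \<beta> x)"
  proof (rule integral_dominated_convergence[where w="\<lambda>_. \<bar>Bd\<bar>"])
    show "?f \<beta>' \<in> borel_measurable ?P" for \<beta>'
      by (intro borel_measurable_times restrict_in_D_measurable[OF J(2) D] measurable_kernel_density)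
    then show "?f (X (i + M)) \<in> borel_measurable ?P" for i .
    show "AE x in ?P. (\<lambda>i. ?f (X (i + M)) x) \<longlonglongrightarrow> ?f \<beta> x"
    proof (rule AE_I2)
      fix x assume "x \<in> space ?P"
      have "1 - exp (- (\<beta> + T * z)) \<noteq> 0" if "z \<in> sign_roots n \<theta>" for z
        using reg that by (auto simp: regular_def)
      then have "isCont (\<lambda>\<beta>. kernel_density n \<beta> \<theta> T F \<alpha> y J x) \<beta>"
        unfolding kernel_density_def partition_det_def fdet_def kernel_def
        by (intro continuous_intros) auto
      then have "(\<lambda>i. kernel_density n (X i) \<theta> T F \<alpha> y J x) \<longlonglongrightarrow> kernel_density n \<beta> \<theta> T F \<alpha> y J x"
        using X by (rule isCont_tendsto_compose)
      then show "(\<lambda>i. ?f (X (i + M)) x) \<longlonglongrightarrow> ?f \<beta> x"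
        by (intro tendsto_mult_left) (rule LIMSEQ_ignore_initial_segment)
    qed
    show "AE x in ?P. norm (?f (X (i + M)) x) \<le> \<bar>Bd\<bar>" for i
    proof (rule AE_I2)
      fix x assume "x \<in> space ?P"
      then show "norm (?f (X (i + M)) x) \<le> \<bar>Bd\<bar>"
        using r(3)[of "X (i + M)" T x] M[of "i + M"] r(1)
          by (auto simp: norm_mult indicator_def intro: order_trans[OF _ abs_ge_self])
    qed
  qed simp
  then show "((\<lambda>\<beta>. LINT x|?P. ?f \<beta> x) \<circ> X) \<longlonglongrightarrow> (LINT x|?P. ?f \<beta> x)"
    unfolding comp_def by (rule LIMSEQ_offset)
qed

text \<open>The excluded T are countable, being indexed by finitely many roots and the integers, and
  the plane stays connected when a countable set is removed.\<close>

lemma regular_connected: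
  assumes n: "0 < n"
  shows "open {T. regular n \<beta> \<theta> T}" "connected {T. regular n \<beta> \<theta> T}"
proof -
  have "{T. regular n \<beta> \<theta> T} = (\<lambda>T. (\<beta>, T)) -` {p. regular n (fst p) \<theta> (snd p)}" by auto
  also have "open \<dots>" by (rule open_vimage[OF open_regular[OF n]]) (intro continuous_intros)
  finally show "open {T. regular n \<beta> \<theta> T}" .
  define X where "X = (\<Union>z\<in>sign_roots n \<theta>. range (\<lambda>m::int. (2 * of_real pi * \<i> * of_int m - \<beta>) / z))"
  have "{T. regular n \<beta> \<theta> T} = UNIV - X"
  proof -
    have "T \<in> X \<longleftrightarrow> \<not> regular n \<beta> \<theta> T" for T
    proof -
      have "\<not> regular n \<beta> \<theta> T \<longleftrightarrow> (\<exists>z\<in>sign_roots n \<theta>. \<exists>m::int. \<beta> + T * z = 2 * of_real pi * \<i> * of_int m)"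
        unfolding nondegenerate_iff_regular[symmetric] nondegenerate_def sign_roots_def by auto
      also have "\<dots> \<longleftrightarrow> (\<exists>z\<in>sign_roots n \<theta>. \<exists>m::int. T = (2 * of_real pi * \<i> * of_int m - \<beta>) / z)"
        using sign_roots_nonzero[OF n] by (intro bex_cong refl ex_cong1) (auto simp: field_simps)
      finally show ?thesis by (auto simp: X_def)
    qed
    then show ?thesis by auto
  qed
  moreover have "countable X"
    unfolding X_def using finite_sign_roots[OF n] by (intro countable_UN) (auto intro: countable_finite)
  ultimately show "connected {T. regular n \<beta> \<theta> T}"
    using connected_open_diff_countable[of "UNIV :: complex set" X] by (simp add: connected_UNIV)
qed

text \<open>A permutation with nonzero product sends a bead on string h to a point on the next
  string and a mark to a point on its own string. Counting the preimages of each string, the marks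
  cancel, and consecutive strings carry equally many beads.\<close>

lemma fdet_kernel0_nonzero_imp_balanced:
  assumes n: "0 < n" and I: "finite I" "finite F" "I \<inter> F = {}"
    and x: "\<And>i. i \<in> I \<Longrightarrow> snd (x i) < n" and y: "\<And>i. i \<in> F \<Longrightarrow> snd (y i) < n" "\<And>i. i \<in> F \<Longrightarrow> \<alpha> i \<noteq> Bead"
    and nz: "fdet (I \<union> F) (\<lambda>i j. kernel0 n \<beta> \<theta> (with_marks F \<alpha> y x i) (with_marks F \<alpha> y x j)) \<noteq> 0"
  obtains k where "card I = n * k" "balanced n k I (\<lambda>i. snd (x i))"
proof -
  let ?w = "with_marks F \<alpha> y x"
  define str where "str i = snd (snd (?w i))" for i
  obtain p where p: "p permutes I \<union> F" "\<And>i. i \<in> I \<union> F \<Longrightarrow> kernel0 n \<beta> \<theta> (?w i) (?w (p i)) \<noteq> 0"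
    using fdet_zero_if_no_perm[of "I \<union> F" "\<lambda>i j. kernel0 n \<beta> \<theta> (?w i) (?w j)"] I nz by blast
  have strI: "str i = snd (x i)" if "i \<in> I" for i using that I by (auto simp: str_def with_marks_def)
  have pI: "str (p i) = Suc (str i) mod n" if "i \<in> I" for i
  proof -
    obtain \<gamma> t h where v: "?w (p i) = (\<gamma>, t, h)" by (cases "?w (p i)")
    have "?w i = (Bead, fst (x i), snd (x i))" using that I by (auto simp: with_marks_def)
    then show ?thesis
      using p(2)[of i] that v kernel0_Bead[of n \<beta> \<theta> "fst (x i)" "snd (x i)" \<gamma> t h] by (auto simp: str_def)
  qed
  have pF: "str (p i) = str i" if "i \<in> F" for i
  proof -
    obtain \<gamma> t h where v: "?w (p i) = (\<gamma>, t, h)" by (cases "?w (p i)")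
    have "?w i = (\<alpha> i, fst (y i), snd (y i))" using that by (auto simp: with_marks_def)
    then show ?thesis using p(2)[of i] that v y(2)[OF that]
      by (cases "\<alpha> i"; cases "y i") (auto simp: kernel0_def str_def)
  qed
  have step: "card {i \<in> I. str i = Suc h mod n} = card {i \<in> I. str i = h}" if h: "h < n" for h
  proof -
    let ?g = "Suc h mod n"
    have "card {j \<in> I \<union> F. str j = ?g} = card (p ` {i \<in> I \<union> F. str (p i) = ?g})"
    proof (rule arg_cong[where f=card], intro equalityI subsetI)
      fix j assume "j \<in> {j \<in> I \<union> F. str j = ?g}"
      then have "inv_into UNIV p j \<in> I \<union> F" "p (inv_into UNIV p j) = j" "str j = ?g"
        using permutes_in_image[OF permutes_inv[OF p(1)], of j] permutes_inverses(1)[OF p(1)] by auto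
      then show "j \<in> p ` {i \<in> I \<union> F. str (p i) = ?g}" by (metis (mono_tags, lifting) imageI mem_Collect_eq)
    qed (use permutes_in_image[OF p(1)] in auto)
    also have "\<dots> = card {i \<in> I \<union> F. str (p i) = ?g}"
      by (rule card_image) (rule inj_on_subset[OF permutes_inj[OF p(1)]], simp)
    also have "{i \<in> I \<union> F. str (p i) = ?g} = {i \<in> I. str i = h} \<union> {i \<in> F. str i = ?g}"
    proof -
      have "Suc (str i) mod n = ?g \<longleftrightarrow> str i = h" if "i \<in> I" for i
        using pred_Suc_mod[OF h] pred_Suc_mod[of "str i" n] x[OF that] strI[OF that] by auto
      then show ?thesis using pI pF by auto
    qed
    also have "card \<dots> = card {i \<in> I. str i = h} + card {i \<in> F. str i = ?g}"
      using I by (intro card_Un_disjoint) auto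
    finally have "card {j \<in> I \<union> F. str j = ?g} = card {i \<in> I. str i = h} + card {i \<in> F. str i = ?g}" .
    moreover have "{j \<in> I \<union> F. str j = ?g} = {i \<in> I. str i = ?g} \<union> {i \<in> F. str i = ?g}" by auto
    moreover have "card ({i \<in> I. str i = ?g} \<union> {i \<in> F. str i = ?g}) = card {i \<in> I. str i = ?g} + card {i \<in> F. str i = ?g}"
      using I by (intro card_Un_disjoint) auto
    ultimately show ?thesis by simp
  qed
  define k where "k = card {i \<in> I. str i = 0}"
  have all: "card {i \<in> I. str i = h} = k" if "h < n" for h
    using that
  proof (induction h)
    case (Suc h)
    then show ?case using step[of h] by simp
  qed (simp add: k_def)
  show ?thesis
  proof (rule that)
    have "card I = (\<Sum>h<n. card {i \<in> I. str i = h})"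
      using sum.group[of I "{..<n}" str "\<lambda>_. 1 :: nat"] I x strI by (simp add: image_subset_iff)
    then show "card I = n * k" using all by simp
    have "{i \<in> I. snd (x i) = h} = {i \<in> I. str i = h}" for h using strI by auto
    then show "balanced n k I (\<lambda>i. snd (x i))" using all by (simp add: balanced_def)
  qed
qed

section \<open>Values at T = 0 as counts of families of beads\<close>

lemma kernel_density_at_0:
  assumes n: "0 < n" and x: "x \<in> space (\<Pi>\<^sub>M i\<in>I. torus n)" and y: "y ` F \<subseteq> {0..<1} \<times> {..<n}"
  shows "kernel_density n \<beta> \<theta> 0 F \<alpha> y I x = (1 - exp (- \<beta>)) ^ n *
    fdet (I \<union> F) (\<lambda>i j. kernel0 n \<beta> \<theta> (with_marks F \<alpha> y x i) (with_marks F \<alpha> y x j))"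
  unfolding kernel_density_def partition_det_0[OF n]
  by (intro arg_cong2[where f="(*)"] refl fdet_cong kernel_at_0 n with_marks_time(2)[OF x y])

text \<open>The factor (1 - exp (- \<beta>)) ^ n of \<open>partition_det\<close> at T = 0 cancels
  the denominator of the array determinant, and the result no longer depends on the
  labelling.\<close>

lemma kernel_density_at_array:
  assumes q: "exp (- \<beta>) \<noteq> (1::complex)" and n: "0 < n" "F = {} \<or> 2 \<le> n" and k: "0 < k" and b: "b \<in> sorted_arrays n k"
    and \<sigma>: "\<sigma> \<in> labellings n k I" and I: "finite I" "I \<inter> F = {}"
    and F: "finite F" "inj_on y F" "y ` F \<subseteq> {0..<1} \<times> {..<n}" "\<And>f. f \<in> F \<Longrightarrow> \<alpha> f \<noteq> Bead"
    and sep: "\<And>p f. p \<in> {..<n} \<times> {..<k} \<Longrightarrow> f \<in> F \<Longrightarrow> b p \<noteq> fst (y f)"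
  defines "l \<equiv> occupation_number n b"
  shows "kernel_density n \<beta> \<theta> 0 F \<alpha> y I (\<lambda>i\<in>I. (b (\<sigma> i), fst (\<sigma> i))) =
    (if b \<in> bead_arrays n k \<and> marked_event \<alpha> y F (occupation_process n k b)
     then (-1) ^ (l + k * (\<theta> + n + l + 1)) * exp (- \<beta>) ^ l else 0)"
proof -
  let ?A = "{..<n} \<times> {..<k}"
  let ?x = "\<lambda>i\<in>I. (b (\<sigma> i), fst (\<sigma> i))"
  define f where "f i = (if i \<in> F then Inr i else Inl (\<sigma> i))" for i
  have bij: "bij_betw \<sigma> I ?A" using \<sigma> by (simp add: labellings_def)
  have \<sigma>A: "\<sigma> i \<in> ?A" if "i \<in> I" for i using bij that by (auto simp: bij_betw_def)
  have bA: "b \<in> ?A \<rightarrow>\<^sub>E {0..<1}" using b by (simp add: sorted_arrays_def)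
  have x: "?x \<in> space (\<Pi>\<^sub>M i\<in>I. torus n)"
    using PiE_mem[OF bA \<sigma>A] \<sigma>A by (auto simp: space_PiM space_torus PiE_iff mem_Times_iff)
  have inj\<sigma>: "inj_on \<sigma> I" and im\<sigma>: "\<sigma> ` I = ?A" using bij by (auto simp: bij_betw_def)
  have "bij_betw f (I \<union> F) (Inl ` ?A \<union> Inr ` F)"
  proof (rule bij_betw_imageI)
    show "inj_on f (I \<union> F)" using inj\<sigma> I(2) by (auto simp: inj_on_def f_def split: if_splits)
    have "f ` I = Inl ` \<sigma> ` I" unfolding image_image using I(2) by (intro image_cong refl) (auto simp: f_def)
    moreover have "f ` F = Inr ` F" by (intro image_cong refl) (auto simp: f_def)
    ultimately show "f ` (I \<union> F) = Inl ` ?A \<union> Inr ` F" by (simp add: image_Un im\<sigma>)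
  qed
  then have "fdet (Inl ` ?A \<union> Inr ` F) (\<lambda>i j. kernel0 n \<beta> \<theta> (marked_points b \<alpha> y i) (marked_points b \<alpha> y j)) =
    fdet (I \<union> F) (\<lambda>i j. kernel0 n \<beta> \<theta> (marked_points b \<alpha> y (f i)) (marked_points b \<alpha> y (f j)))"
    by (rule fdet_reindex) (use I F in auto)
  also have "\<dots> = fdet (I \<union> F) (\<lambda>i j. kernel0 n \<beta> \<theta> (with_marks F \<alpha> y ?x i) (with_marks F \<alpha> y ?x j))"
  proof (rule fdet_cong[OF refl])
    have "marked_points b \<alpha> y (f i) = with_marks F \<alpha> y ?x i" if "i \<in> I \<union> F" for i
      using that by (auto simp: f_def with_marks_def)
    then show "kernel0 n \<beta> \<theta> (marked_points b \<alpha> y (f i)) (marked_points b \<alpha> y (f j)) =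
      kernel0 n \<beta> \<theta> (with_marks F \<alpha> y ?x i) (with_marks F \<alpha> y ?x j)" if "i \<in> I \<union> F" "j \<in> I \<union> F" for i j
      using that by simp
  qed
  finally have "kernel_density n \<beta> \<theta> 0 F \<alpha> y I ?x = (1 - exp (- \<beta>)) ^ n *
    fdet (Inl ` ?A \<union> Inr ` F) (\<lambda>i j. kernel0 n \<beta> \<theta> (marked_points b \<alpha> y i) (marked_points b \<alpha> y j))"
    unfolding kernel_density_at_0[OF n(1) x F(3)] by simp
  also have "\<dots> = (if b \<in> bead_arrays n k \<and> marked_event \<alpha> y F (occupation_process n k b)
     then (-1) ^ (l + k * (\<theta> + n + l + 1)) * exp (- \<beta>) ^ l else 0)"
    using fdet_marked_array[where \<alpha>=\<alpha> and \<theta>=\<theta>, OF q n k b F(1,2,3,4) sep] q by (simp add: l_def)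
  finally show ?thesis .
qed

definition bead_tuples :: "nat \<Rightarrow> nat \<Rightarrow> nat set \<Rightarrow> (nat \<Rightarrow> nat \<times> nat) set" where
  "bead_tuples n k B = {\<tau> \<in> B \<rightarrow>\<^sub>E {..<n} \<times> {..<k}. inj_on \<tau> B}"

text \<open>The number of families of distinct beads lying in D, computed from array positions
  rather than from the process; the two counts agree almost everywhere, see
  \<open>AE_bead_count\<close>.\<close>

definition tuple_count :: "nat \<Rightarrow> nat \<Rightarrow> nat set \<Rightarrow> (nat \<Rightarrow> real \<times> nat) set \<Rightarrow> (nat \<times> nat \<Rightarrow> real) \<Rightarrow> nat" where
  "tuple_count n k B D b = card {\<tau> \<in> bead_tuples n k B. (\<lambda>i\<in>B. (b (\<tau> i), fst (\<tau> i))) \<in> D}"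

lemma finite_bead_tuples: "finite B \<Longrightarrow> finite (bead_tuples n k B)"
  unfolding bead_tuples_def by (rule finite_subset[of _ "B \<rightarrow>\<^sub>E {..<n} \<times> {..<k}"]) (auto intro: finite_PiE)

lemma card_bead_tuples_le: "finite B \<Longrightarrow> card (bead_tuples n k B) \<le> (n * k) ^ card B"
proof -
  assume B: "finite B"
  have "card (bead_tuples n k B) \<le> card (B \<rightarrow>\<^sub>E {..<n} \<times> {..<k})"
    unfolding bead_tuples_def using B by (intro card_mono) (auto intro: finite_PiE)
  then show ?thesis using B by (simp add: card_PiE)
qed

lemma tuple_count_le: "finite B \<Longrightarrow> tuple_count n k B D b \<le> (n * k) ^ card B"
  unfolding tuple_count_def
  by (rule order_trans[OF card_mono card_bead_tuples_le]) (auto intro: finite_bead_tuples)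

lemma tuple_count_eq_sum:
  assumes "finite B"
  shows "of_nat (tuple_count n k B D b) = (\<Sum>\<tau>\<in>bead_tuples n k B. indicator D (\<lambda>i\<in>B. (b (\<tau> i), fst (\<tau> i))) :: complex)"
proof -
  have "(\<Sum>\<tau>\<in>bead_tuples n k B. indicator D (\<lambda>i\<in>B. (b (\<tau> i), fst (\<tau> i))) :: complex) =
     (\<Sum>\<tau>\<in>{\<tau> \<in> bead_tuples n k B. (\<lambda>i\<in>B. (b (\<tau> i), fst (\<tau> i))) \<in> D}. 1)"
    using finite_bead_tuples[OF assms] by (intro sum.mono_neutral_cong_right) auto
  then show ?thesis by (simp add: tuple_count_def)
qed

lemma tuple_count_measurable:
  assumes B: "finite B" and D: "D \<in> sets (\<Pi>\<^sub>M i\<in>B. torus n)"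
  obtains g :: "_ \<Rightarrow> complex" where "g \<in> borel_measurable (array_lebesgue n k)"
    "\<And>b. b \<in> unit_box ({..<n} \<times> {..<k}) \<Longrightarrow> g b = of_nat (tuple_count n k B D b)"
proof -
  let ?A = "{..<n} \<times> {..<k}" and ?M = "array_lebesgue n k"
  define clip where "clip u = (if 0 \<le> u \<and> u < 1 then u else 0)" for u :: real
  define g where "g b = (\<Sum>\<tau>\<in>bead_tuples n k B. indicator D (\<lambda>i\<in>B. (clip (b (\<tau> i)), fst (\<tau> i))) :: complex)" for b
  have "g \<in> borel_measurable ?M"
    unfolding g_def
  proof (intro borel_measurable_sum)
    fix \<tau> assume "\<tau> \<in> bead_tuples n k B"
    then have \<tau>A: "\<tau> i \<in> ?A" if "i \<in> B" for i using that by (auto simp: bead_tuples_def PiE_iff)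
    have "(\<lambda>b. \<lambda>i\<in>B. (clip (b (\<tau> i)), fst (\<tau> i))) \<in> ?M \<rightarrow>\<^sub>M (\<Pi>\<^sub>M i\<in>B. torus n)"
    proof (rule measurable_restrict)
      fix i assume i: "i \<in> B"
      have [measurable]: "(\<lambda>b. b (\<tau> i)) \<in> borel_measurable ?M"
        unfolding array_lebesgue_def using measurable_component_singleton[OF \<tau>A[OF i], of "\<lambda>_. lborel"] by simp
      have "(\<lambda>b. clip (b (\<tau> i))) \<in> ?M \<rightarrow>\<^sub>M restrict_space lborel {0..<1}"
        unfolding clip_def by (rule measurable_restrict_space2) auto
      then show "(\<lambda>b. (clip (b (\<tau> i)), fst (\<tau> i))) \<in> ?M \<rightarrow>\<^sub>M torus n"
        unfolding torus_def by (rule measurable_Pair) (use \<tau>A[OF i] in \<open>auto simp: mem_Times_iff\<close>)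
    qed
    from measurable_compose[OF this borel_measurable_indicator[OF D]]
    show "(\<lambda>b. indicator D (\<lambda>i\<in>B. (clip (b (\<tau> i)), fst (\<tau> i))) :: complex) \<in> borel_measurable ?M" .
  qed
  moreover have "g b = of_nat (tuple_count n k B D b)" if b: "b \<in> unit_box ?A" for b
    unfolding g_def tuple_count_eq_sum[OF B]
  proof (intro sum.cong refl arg_cong[where f="indicator D"] restrict_ext)
    fix \<tau> i assume "\<tau> \<in> bead_tuples n k B" "i \<in> B"
    then have "\<tau> i \<in> ?A" by (auto simp: bead_tuples_def PiE_iff)
    then show "(clip (b (\<tau> i)), fst (\<tau> i)) = (b (\<tau> i), fst (\<tau> i))" using PiE_mem[OF b] by (simp add: clip_def)
  qed
  ultimately show ?thesis by (rule that)
qed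

text \<open>An injective choice of positions for B extends to a labelling of I in (card I - card B)!
  ways. This factorial is later cancelled by that of the Taylor coefficient.\<close>

lemma sum_labellings_restrict:
  fixes \<phi> :: "(nat \<Rightarrow> nat \<times> nat) \<Rightarrow> complex"
  assumes I: "finite I" "card I = n * k" "B \<subseteq> I"
  shows "(\<Sum>\<sigma>\<in>labellings n k I. \<phi> (restrict \<sigma> B)) = fact (card I - card B) * (\<Sum>\<tau>\<in>bead_tuples n k B. \<phi> \<tau>)"
proof -
  let ?A = "{..<n} \<times> {..<k}"
  have lab: "labellings n k I = {\<sigma> \<in> I \<rightarrow>\<^sub>E ?A. inj_on \<sigma> I}"
  proof -
    have "\<sigma> ` I = ?A" if "\<sigma> \<in> I \<rightarrow>\<^sub>E ?A" "inj_on \<sigma> I" for \<sigma>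
    proof (rule card_subset_eq)
      show "\<sigma> ` I \<subseteq> ?A" using that(1) by (auto simp: PiE_iff)
    qed (use I that in \<open>auto simp: card_image\<close>)
    then show ?thesis by (auto simp: labellings_def bij_betw_def)
  qed
  have B: "finite B" using I finite_subset by auto
  have "(\<Sum>\<sigma>\<in>labellings n k I. \<phi> (restrict \<sigma> B)) =
    (\<Sum>\<tau>\<in>bead_tuples n k B. \<Sum>\<sigma>\<in>{\<sigma> \<in> labellings n k I. restrict \<sigma> B = \<tau>}. \<phi> (restrict \<sigma> B))"
  proof (rule sum.group[symmetric])
    show "(\<lambda>\<sigma>. restrict \<sigma> B) ` labellings n k I \<subseteq> bead_tuples n k B"
      unfolding lab bead_tuples_def using I(3) by (auto simp: PiE_iff intro: inj_on_subset)
  qed (use I B in \<open>auto intro: finite_labellings finite_bead_tuples\<close>)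
  also have "\<dots> = (\<Sum>\<tau>\<in>bead_tuples n k B. fact (card I - card B) * \<phi> \<tau>)"
  proof (intro sum.cong refl)
    fix \<tau> assume "\<tau> \<in> bead_tuples n k B"
    then have \<tau>: "\<tau> \<in> B \<rightarrow>\<^sub>E ?A" "inj_on \<tau> B" by (auto simp: bead_tuples_def)
    let ?S = "{\<sigma> \<in> labellings n k I. restrict \<sigma> B = \<tau>}"
    let ?R = "{f \<in> (I - B) \<rightarrow>\<^sub>E (?A - \<tau> ` B). inj_on f (I - B)}"
    have "card ?S = card ?R"
    proof (rule bij_betw_same_card[of "\<lambda>\<sigma>. restrict \<sigma> (I - B)"],
        rule bij_betw_byWitness[where f'="\<lambda>f. \<lambda>i\<in>I. if i \<in> B then \<tau> i else f i"])
      show "\<forall>\<sigma>\<in>?S. (\<lambda>i\<in>I. if i \<in> B then \<tau> i else restrict \<sigma> (I - B) i) = \<sigma>"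
        unfolding lab by (auto simp: fun_eq_iff PiE_iff extensional_def)
      show "\<forall>f\<in>?R. restrict (\<lambda>i\<in>I. if i \<in> B then \<tau> i else f i) (I - B) = f"
        by (auto simp: fun_eq_iff PiE_iff extensional_def)
      show "(\<lambda>\<sigma>. restrict \<sigma> (I - B)) ` ?S \<subseteq> ?R"
      proof (rule image_subsetI)
        fix \<sigma> assume "\<sigma> \<in> ?S"
        then have \<sigma>: "\<sigma> \<in> I \<rightarrow>\<^sub>E ?A" "inj_on \<sigma> I" "restrict \<sigma> B = \<tau>" by (auto simp: lab)
        have "\<sigma> i \<notin> \<tau> ` B" if "i \<in> I - B" for i
        proof
          assume "\<sigma> i \<in> \<tau> ` B"
          then obtain j where j: "j \<in> B" "\<sigma> i = \<sigma> j" using \<sigma>(3) by (auto simp: restrict_apply')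
          then have "i = j" using inj_onD[OF \<sigma>(2) j(2)] that I(3) by auto
          then show False using that j by auto
        qed
        moreover have "\<sigma> i \<in> ?A" if "i \<in> I - B" for i using PiE_mem[OF \<sigma>(1)] that by auto
        moreover have "inj_on (restrict \<sigma> (I - B)) (I - B)"
          using \<sigma>(2) by (auto simp: inj_on_def)
        ultimately show "restrict \<sigma> (I - B) \<in> ?R" by (auto simp: PiE_iff)
      qed
      show "(\<lambda>f. \<lambda>i\<in>I. if i \<in> B then \<tau> i else f i) ` ?R \<subseteq> ?S"
      proof (rule image_subsetI)
        fix f assume "f \<in> ?R"
        then have f: "f \<in> (I - B) \<rightarrow>\<^sub>E (?A - \<tau> ` B)" "inj_on f (I - B)" by auto
        let ?\<sigma> = "\<lambda>i\<in>I. if i \<in> B then \<tau> i else f i"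
        have fA: "f i \<in> ?A - \<tau> ` B" if "i \<in> I" "i \<notin> B" for i using PiE_mem[OF f(1)] that by auto
        have "?\<sigma> \<in> I \<rightarrow>\<^sub>E ?A" using fA PiE_mem[OF \<tau>(1)] by (auto simp: PiE_iff)
        moreover have "inj_on ?\<sigma> I"
        proof (rule inj_onI)
          fix i j assume ij: "i \<in> I" "j \<in> I" and eq: "?\<sigma> i = ?\<sigma> j"
          show "i = j"
          proof (cases "i \<in> B"; cases "j \<in> B")
            assume "i \<in> B" "j \<in> B" then show ?thesis using eq ij inj_onD[OF \<tau>(2)] by auto
          next
            assume "i \<in> B" "j \<notin> B" then show ?thesis using eq ij fA[of j] imageI[of i B \<tau>] by auto
          next
            assume "i \<notin> B" "j \<in> B" then show ?thesis using eq ij fA[of i] imageI[of j B \<tau>] by auto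
          next
            assume "i \<notin> B" "j \<notin> B" then show ?thesis using eq ij inj_onD[OF f(2)] by auto
          qed
        qed
        moreover have "restrict ?\<sigma> B = \<tau>" using I(3) \<tau>(1) by (auto simp: fun_eq_iff PiE_iff extensional_def)
        ultimately show "?\<sigma> \<in> ?S" by (simp add: lab)
      qed
    qed
    also have "card ?R = fact (card I - card B)"
    proof -
      have a: "card (I - B) = card I - card B" using B I by (simp add: card_Diff_subset)
      have b: "card (?A - \<tau> ` B) = card I - card B"
      proof -
        have "\<tau> ` B \<subseteq> ?A" using \<tau>(1) by (auto simp: PiE_iff)
        then have "card (?A - \<tau> ` B) = card ?A - card (\<tau> ` B)" using B by (intro card_Diff_subset) auto
        then show ?thesis using \<tau>(2) I(2) by (simp add: card_image)
      qed
      have "card ?R = card (?A - \<tau> ` B) ^ (card (I - B) - card (I - B)) * prod ((-) (card (?A - \<tau> ` B))) {0..<card (I - B)}"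
        by (rule card_inj_on_subset_funcset) (use I in auto)
      then show ?thesis unfolding a b by (simp add: fact_prod_rev)
    qed
    finally have c: "card ?S = fact (card I - card B)" .
    have "(\<Sum>\<sigma>\<in>?S. \<phi> (restrict \<sigma> B)) = (\<Sum>\<sigma>\<in>?S. \<phi> \<tau>)" by (intro sum.cong) auto
    then show "(\<Sum>\<sigma>\<in>?S. \<phi> (restrict \<sigma> B)) = fact (card I - card B) * \<phi> \<tau>" using c by simp
  qed
  finally show ?thesis by (simp add: sum_distrib_left)
qed

lemma occupation_number_le: "occupation_number n b \<le> n"
  unfolding occupation_number_def using card_mono[of "{..<n}" "{h. h < n \<and> b (h, 0) < b ((h + n - 1) mod n, 0)}"] by auto

lemma W_subset_sorted: "W n k l \<subseteq> sorted_arrays n k"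
  by (auto simp: W_def bead_arrays_def sorted_arrays_def)

lemma indicator_sorted_decompose:
  assumes "b \<notin> bead_arrays n k \<Longrightarrow> v = (0::complex)"
  shows "indicator (sorted_arrays n k) b *\<^sub>R v = (\<Sum>l\<le>n. indicator (W n k l) b *\<^sub>R v)"
proof (cases "b \<in> bead_arrays n k")
  case True
  have "(\<Sum>l\<le>n. indicator (W n k l) b *\<^sub>R v) = (\<Sum>l\<le>n. if l = occupation_number n b then v else 0)"
    using True by (intro sum.cong refl) (auto simp: W_def)
  also have "\<dots> = v" using occupation_number_le[of n b] by simp
  finally show ?thesis using True W_subset_sorted[of n k "occupation_number n b"] by (auto simp: W_def)
qed (use assms in simp)

lemma AE_array_avoids:
  assumes "finite F"
  shows "AE b in array_lebesgue n k. \<forall>p\<in>{..<n} \<times> {..<k}. \<forall>f\<in>F. b p \<noteq> c f"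
  unfolding array_lebesgue_def
  by (intro AE_finite_allI assms AE_PiM_lborel_const finite_cartesian_product finite_lessThan)

lemma measurable_marked_count:
  assumes n: "0 < n" and k: "0 < k" and B: "finite B" and F: "finite F" "y ` F \<subseteq> {0..<1} \<times> {..<n}" and D: "D \<in> sets (\<Pi>\<^sub>M i\<in>B. torus n)"
  shows "(\<lambda>b. indicator (W n k l) b *\<^sub>R (of_bool (marked_event \<alpha> y F (occupation_process n k b)) * of_nat (tuple_count n k B D b) :: complex))
    \<in> borel_measurable (array_lebesgue n k)"
proof -
  let ?M = "array_lebesgue n k"
  obtain g :: "_ \<Rightarrow> complex" where g: "g \<in> borel_measurable ?M" "\<And>b. b \<in> unit_box ({..<n} \<times> {..<k}) \<Longrightarrow> g b = of_nat (tuple_count n k B D b)"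
    using tuple_count_measurable[OF B D] by metis
  have "{b \<in> space ?M. marked_event \<alpha> y F (occupation_process n k b)} \<in> sets ?M"
    by (rule predE[OF pred_marked_event[OF F(1) k]]) (use F in auto)
  then have "(\<lambda>b. indicator (W n k l) b *\<^sub>R (indicator {b \<in> space ?M. marked_event \<alpha> y F (occupation_process n k b)} b * g b)) \<in> borel_measurable ?M"
    by (intro borel_measurable_scaleR borel_measurable_times borel_measurable_indicator W_measurable n k g)
  moreover have "indicator (W n k l) b *\<^sub>R (indicator {b \<in> space ?M. marked_event \<alpha> y F (occupation_process n k b)} b * g b) =
    indicator (W n k l) b *\<^sub>R (of_bool (marked_event \<alpha> y F (occupation_process n k b)) * of_nat (tuple_count n k B D b) :: complex)"
    if "b \<in> space ?M" for b
  proof (cases "b \<in> W n k l")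
    case True
    then have "b \<in> unit_box ({..<n} \<times> {..<k})" by (auto simp: W_def bead_arrays_def)
    then show ?thesis using g(2) that by (simp add: indicator_def)
  qed simp
  ultimately show ?thesis by (rule measurable_cong[THEN iffD1, rotated])
qed

text \<open>After folding onto sorted arrays the determinant is the same for every labelling and
  only D still sees the labels. The sum over labellings therefore counts the families in D, each
  with the multiplicity of \<open>sum_labellings_restrict\<close>.\<close>

lemma integral_kernel_density_0:
  assumes q: "exp (- \<beta>) \<noteq> (1::complex)" and n: "0 < n" "F = {} \<or> 2 \<le> n" and k: "0 < k"
    and I: "finite I" "card I = n * k" "I \<inter> F = {}" "B \<subseteq> I"
    and F: "finite F" "inj_on y F" "y ` F \<subseteq> {0..<1} \<times> {..<n}" "\<And>f. f \<in> F \<Longrightarrow> \<alpha> f \<noteq> Bead"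
    and D: "D \<in> sets (\<Pi>\<^sub>M i\<in>B. torus n)"
  shows "(LINT x|(\<Pi>\<^sub>M i\<in>I. torus n). indicator D (restrict x B) * kernel_density n \<beta> \<theta> 0 F \<alpha> y I x) =
    fact (card I - card B) * (\<Sum>l\<le>n. (-1) ^ (l + k * (\<theta> + n + l + 1)) * exp (- \<beta>) ^ l *
      (LINT b:W n k l|array_lebesgue n k. of_bool (marked_event \<alpha> y F (occupation_process n k b)) * of_nat (tuple_count n k B D b)))"
proof -
  let ?A = "{..<n} \<times> {..<k}" and ?M = "array_lebesgue n k" and ?L = "labellings n k I"
  have B: "finite B" using I finite_subset by auto
  define \<psi> where "\<psi> x = indicator D (restrict x B) * kernel_density n \<beta> \<theta> 0 F \<alpha> y I x" for x
  define Bd where "Bd = norm (partition_det n \<beta> \<theta> 0) * (fact (card (I \<union> F)) * kernel_bound n \<beta> \<theta> 0 ^ card (I \<union> F))"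
  have kb: "norm (kernel_density n \<beta> \<theta> 0 F \<alpha> y I x) \<le> Bd" if "x \<in> space (\<Pi>\<^sub>M i\<in>I. torus n)" for x
    unfolding Bd_def by (rule norm_kernel_density_le[OF n(1) I(1) F(1,3) that])
  have m: "\<psi> \<in> borel_measurable (\<Pi>\<^sub>M i\<in>I. torus n)"
    unfolding \<psi>_def by (intro borel_measurable_times restrict_in_D_measurable[OF I(4) D] measurable_kernel_density)
  have bd: "norm (\<psi> x) \<le> \<bar>Bd\<bar>" if "x \<in> space (\<Pi>\<^sub>M i\<in>I. torus n)" for x
    using kb[OF that] by (auto simp: \<psi>_def norm_mult indicator_def intro: order_trans[OF _ abs_ge_self])
  have zero: "\<psi> x = 0" if x: "x \<in> space (\<Pi>\<^sub>M i\<in>I. torus n)" and nb: "\<not> balanced n k I (\<lambda>i. snd (x i))" for x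
  proof (rule ccontr)
    assume "\<psi> x \<noteq> 0"
    then have nz: "fdet (I \<union> F) (\<lambda>i j. kernel0 n \<beta> \<theta> (with_marks F \<alpha> y x i) (with_marks F \<alpha> y x j)) \<noteq> 0"
      by (auto simp: \<psi>_def kernel_density_at_0[OF n(1) x F(3)])
    have xs: "snd (x i) < n" if "i \<in> I" for i using x that by (auto simp: space_PiM space_torus PiE_iff mem_Times_iff)
    have ys: "snd (y i) < n" if "i \<in> F" for i using F(3) that by force
    obtain k' where "card I = n * k'" "balanced n k' I (\<lambda>i. snd (x i))"
      by (rule fdet_kernel0_nonzero_imp_balanced[OF n(1) I(1) F(1) I(3) xs ys F(4) nz])
    then show False using nb I(2) n(1) by simp
  qed
  have sym: "(LINT x|(\<Pi>\<^sub>M i\<in>I. torus n). \<psi> x) =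
      (\<Sum>\<sigma>\<in>?L. LINT b:sorted_arrays n k|?M. \<psi> (\<lambda>i\<in>I. (b (\<sigma> i), fst (\<sigma> i))))"
    by (rule integral_torus_symmetrize(1)[OF I(1,2) m, where B="\<bar>Bd\<bar>"]) (use bd zero in auto)
  have symI: "set_integrable ?M (sorted_arrays n k) (\<lambda>b. \<psi> (\<lambda>i\<in>I. (b (\<sigma> i), fst (\<sigma> i))))" if "\<sigma> \<in> ?L" for \<sigma>
    by (rule integral_torus_symmetrize(2)[OF I(1,2) m, where B="\<bar>Bd\<bar>"]) (use bd zero that in auto)
  define \<Phi> where "\<Phi> \<sigma> b = (\<lambda>i\<in>I. (b (\<sigma> i), fst (\<sigma> i)))" for \<sigma> :: "nat \<Rightarrow> nat \<times> nat" and b :: "nat \<times> nat \<Rightarrow> real"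
  define \<Psi> where "\<Psi> b = (\<Sum>\<sigma>\<in>?L. \<psi> (\<Phi> \<sigma> b))" for b
  define c where "c b l = (-1) ^ (l + k * (\<theta> + n + l + 1)) * exp (- \<beta>) ^ l" for b :: "nat \<times> nat \<Rightarrow> real" and l
  define ev where "ev b \<longleftrightarrow> marked_event \<alpha> y F (occupation_process n k b)" for b
  have int: "integrable ?M (\<lambda>b. indicator (sorted_arrays n k) b *\<^sub>R \<psi> (\<Phi> \<sigma> b))" if "\<sigma> \<in> ?L" for \<sigma>
    using symI[OF that] by (simp add: set_integrable_def \<Phi>_def)
  have int\<Psi>: "set_integrable ?M (sorted_arrays n k) \<Psi>"
    unfolding set_integrable_def \<Psi>_def scaleR_sum_right by (intro Bochner_Integration.integrable_sum int)
  have Wm: "W n k l \<in> sets ?M" for l by (rule W_measurable[OF n(1) k])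
  have intW: "set_integrable ?M (W n k l) \<Psi>" for l
    by (rule set_integrable_subset[OF int\<Psi> Wm W_subset_sorted])
  have val: "\<Psi> b = fact (card I - card B) * (if b \<in> bead_arrays n k \<and> ev b then c b (occupation_number n b) else 0) * of_nat (tuple_count n k B D b)"
    if b: "b \<in> sorted_arrays n k" and sep: "\<forall>p\<in>?A. \<forall>f\<in>F. b p \<noteq> fst (y f)" for b
  proof -
    let ?v = "if b \<in> bead_arrays n k \<and> ev b then c b (occupation_number n b) else 0"
    have "\<Psi> b = (\<Sum>\<sigma>\<in>?L. ?v * indicator D (\<lambda>i\<in>B. (b (restrict \<sigma> B i), fst (restrict \<sigma> B i))))"
      unfolding \<Psi>_def
    proof (intro sum.cong refl)
      fix \<sigma> assume \<sigma>: "\<sigma> \<in> ?L"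
      have "restrict (\<Phi> \<sigma> b) B = (\<lambda>i\<in>B. (b (restrict \<sigma> B i), fst (restrict \<sigma> B i)))"
        using I(4) by (auto simp: \<Phi>_def fun_eq_iff)
      moreover have "kernel_density n \<beta> \<theta> 0 F \<alpha> y I (\<Phi> \<sigma> b) = ?v"
        unfolding \<Phi>_def ev_def c_def
        by (rule kernel_density_at_array[OF q n k b \<sigma> I(1,3) F]) (use sep in auto)
      ultimately show "\<psi> (\<Phi> \<sigma> b) = ?v * indicator D (\<lambda>i\<in>B. (b (restrict \<sigma> B i), fst (restrict \<sigma> B i)))"
        by (simp add: \<psi>_def)
    qed
    also have "\<dots> = ?v * (\<Sum>\<sigma>\<in>?L. indicator D (\<lambda>i\<in>B. (b (restrict \<sigma> B i), fst (restrict \<sigma> B i))))"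
      by (rule sum_distrib_left[symmetric])
    also have "(\<Sum>\<sigma>\<in>?L. indicator D (\<lambda>i\<in>B. (b (restrict \<sigma> B i), fst (restrict \<sigma> B i)))) =
        fact (card I - card B) * (of_nat (tuple_count n k B D b) :: complex)"
      unfolding tuple_count_eq_sum[OF B]
      by (rule sum_labellings_restrict[OF I(1,2,4), of "\<lambda>\<tau>. indicator D (\<lambda>i\<in>B. (b (\<tau> i), fst (\<tau> i)))"])
    finally show ?thesis by (simp only: mult_ac)
  qed
  note AE = AE_array_avoids[OF F(1), of n k "\<lambda>f. fst (y f)"]
  have "(LINT x|(\<Pi>\<^sub>M i\<in>I. torus n). \<psi> x) = (\<Sum>\<sigma>\<in>?L. LINT b|?M. indicator (sorted_arrays n k) b *\<^sub>R \<psi> (\<Phi> \<sigma> b))"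
    using sym by (simp add: set_lebesgue_integral_def \<Phi>_def)
  also have "\<dots> = (LINT b|?M. indicator (sorted_arrays n k) b *\<^sub>R \<Psi> b)"
    unfolding \<Psi>_def scaleR_sum_right by (rule Bochner_Integration.integral_sum[symmetric]) (rule int)
  also have "\<dots> = (LINT b|?M. (\<Sum>l\<le>n. indicator (W n k l) b *\<^sub>R \<Psi> b))"
  proof (rule integral_cong_AE)
    show "(\<lambda>b. indicator (sorted_arrays n k) b *\<^sub>R \<Psi> b) \<in> borel_measurable ?M"
      using int\<Psi> by (auto simp: set_integrable_def)
    show "(\<lambda>b. \<Sum>l\<le>n. indicator (W n k l) b *\<^sub>R \<Psi> b) \<in> borel_measurable ?M"
      using intW by (intro borel_measurable_sum) (auto simp: set_integrable_def)
    show "AE b in ?M. indicator (sorted_arrays n k) b *\<^sub>R \<Psi> b = (\<Sum>l\<le>n. indicator (W n k l) b *\<^sub>R \<Psi> b)"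
      using AE
    proof eventually_elim
      case (elim b)
      show ?case
      proof (cases "b \<in> sorted_arrays n k")
        case True
        show ?thesis by (rule indicator_sorted_decompose) (use val[OF True elim] in simp)
      next
        case False
        then have "b \<notin> W n k l" for l using W_subset_sorted by blast
        then show ?thesis using False by simp
      qed
    qed
  qed
  also have "\<dots> = (\<Sum>l\<le>n. LINT b|?M. indicator (W n k l) b *\<^sub>R \<Psi> b)"
    using intW by (intro Bochner_Integration.integral_sum) (auto simp: set_integrable_def)
  also have "\<dots> = (\<Sum>l\<le>n. fact (card I - card B) * (-1) ^ (l + k * (\<theta> + n + l + 1)) * exp (- \<beta>) ^ l *
      (LINT b:W n k l|?M. of_bool (ev b) * of_nat (tuple_count n k B D b)))"
  proof (intro sum.cong refl)
    fix l
    let ?c = "fact (card I - card B) * (-1) ^ (l + k * (\<theta> + n + l + 1)) * exp (- \<beta>) ^ l"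
    have meas: "(\<lambda>b. indicator (W n k l) b *\<^sub>R (of_bool (ev b) * of_nat (tuple_count n k B D b) :: complex)) \<in> borel_measurable ?M"
      unfolding ev_def by (rule measurable_marked_count[OF n(1) k B F(1,3) D])
    have "(LINT b|?M. indicator (W n k l) b *\<^sub>R \<Psi> b) = (LINT b|?M. ?c * (indicator (W n k l) b *\<^sub>R (of_bool (ev b) * of_nat (tuple_count n k B D b))))"
    proof (rule integral_cong_AE)
      show "(\<lambda>b. indicator (W n k l) b *\<^sub>R \<Psi> b) \<in> borel_measurable ?M" using intW by (auto simp: set_integrable_def)
      show "(\<lambda>b. ?c * (indicator (W n k l) b *\<^sub>R (of_bool (ev b) * of_nat (tuple_count n k B D b)))) \<in> borel_measurable ?M"
        by (intro borel_measurable_times borel_measurable_const meas)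
      show "AE b in ?M. indicator (W n k l) b *\<^sub>R \<Psi> b = ?c * (indicator (W n k l) b *\<^sub>R (of_bool (ev b) * of_nat (tuple_count n k B D b)))"
        using AE
      proof eventually_elim
        case (elim b)
        show ?case
        proof (cases "b \<in> W n k l")
          case True
          then have s: "b \<in> sorted_arrays n k" using W_subset_sorted by blast
          have l: "b \<in> bead_arrays n k" "occupation_number n b = l" using True by (auto simp: W_def)
          show ?thesis unfolding val[OF s elim] using True l by (simp add: c_def)
        qed simp
      qed
    qed
    also have "\<dots> = ?c * (LINT b|?M. indicator (W n k l) b *\<^sub>R (of_bool (ev b) * of_nat (tuple_count n k B D b)))"
      by (rule integral_mult_right_zero)
    finally show "(LINT b|?M. indicator (W n k l) b *\<^sub>R \<Psi> b) = ?c * (LINT b:W n k l|?M. of_bool (ev b) * of_nat (tuple_count n k B D b))"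
      unfolding set_lebesgue_integral_def .
  qed
  finally show ?thesis
    by (simp add: \<psi>_def ev_def sum_distrib_left mult.assoc)
qed

lemma integral_kernel_density_0_unbalanced:
  assumes n: "0 < n" and I: "finite I" "\<And>k. card I \<noteq> n * k" "I \<inter> F = {}"
    and F: "finite F" "y ` F \<subseteq> {0..<1} \<times> {..<n}" "\<And>f. f \<in> F \<Longrightarrow> \<alpha> f \<noteq> Bead"
  shows "(LINT x|(\<Pi>\<^sub>M i\<in>I. torus n). indicator D (restrict x B) * kernel_density n \<beta> \<theta> 0 F \<alpha> y I x) = 0"
proof -
  have "kernel_density n \<beta> \<theta> 0 F \<alpha> y I x = 0" if x: "x \<in> space (\<Pi>\<^sub>M i\<in>I. torus n)" for x
  proof (rule ccontr)
    assume "kernel_density n \<beta> \<theta> 0 F \<alpha> y I x \<noteq> 0"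
    then have nz: "fdet (I \<union> F) (\<lambda>i j. kernel0 n \<beta> \<theta> (with_marks F \<alpha> y x i) (with_marks F \<alpha> y x j)) \<noteq> 0"
      by (auto simp: kernel_density_at_0[OF n x F(2)])
    have xs: "snd (x i) < n" if "i \<in> I" for i using x that by (auto simp: space_PiM space_torus PiE_iff mem_Times_iff)
    have ys: "snd (y i) < n" if "i \<in> F" for i using F(2) that by force
    obtain k' where "card I = n * k'"
      by (rule fdet_kernel0_nonzero_imp_balanced[OF n I(1) F(1) I(3) xs ys F(3) nz])
    then show False using I(2) by simp
  qed
  then have "(LINT x|(\<Pi>\<^sub>M i\<in>I. torus n). indicator D (restrict x B) * kernel_density n \<beta> \<theta> 0 F \<alpha> y I x) = (LINT x|(\<Pi>\<^sub>M i\<in>I. torus n). 0)"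
    by (intro Bochner_Integration.integral_cong refl) simp
  then show ?thesis by simp
qed

text \<open>The empty product measure is the unit mass at \<open>\<lambda>_. undefined\<close>;
  hence the test whether D contains this function, which reappears as the empty family of
  beads.\<close>

lemma integral_kernel_density_0_empty:
  assumes q: "exp (- \<beta>) \<noteq> (1::complex)" and n: "0 < n" "F = {} \<or> 2 \<le> n"
    and F: "finite F" "inj_on y F" "y ` F \<subseteq> {0..<1} \<times> {..<n}" "\<And>f. f \<in> F \<Longrightarrow> \<alpha> f \<noteq> Bead"
  shows "(LINT x|(\<Pi>\<^sub>M i\<in>{}. torus n). indicator D (restrict x {}) * kernel_density n \<beta> \<theta> 0 F \<alpha> y {} x) =
    indicator D (\<lambda>_. undefined) * (\<Sum>A\<in>Pow {..<n}. (- exp (- \<beta>)) ^ card A * of_bool (marked_event \<alpha> y F (constant_process A)))"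
proof -
  let ?u = "\<lambda>_. undefined :: real \<times> nat"
  interpret P: product_sigma_finite "\<lambda>_. torus n" by (rule product_sigma_finite_torus)
  have u: "?u \<in> space (\<Pi>\<^sub>M i\<in>{}. torus n)" by (simp add: space_PiM)
  have "(LINT x|(\<Pi>\<^sub>M i\<in>{}. torus n). indicator D (restrict x {}) * kernel_density n \<beta> \<theta> 0 F \<alpha> y {} x) =
    indicator D ?u * kernel_density n \<beta> \<theta> 0 F \<alpha> y {} ?u"
  proof -
    have "(LINT x|count_space {?u}. indicator D (restrict x {}) * kernel_density n \<beta> \<theta> 0 F \<alpha> y {} x) =
        (\<Sum>x\<in>{?u}. indicator D (restrict x {}) * kernel_density n \<beta> \<theta> 0 F \<alpha> y {} x)"
      by (rule lebesgue_integral_count_space_finite) simp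
    also have "\<dots> = indicator D (restrict ?u {}) * kernel_density n \<beta> \<theta> 0 F \<alpha> y {} ?u" by (subst sum.insert) (simp_all only: finite.emptyI empty_iff not_False_eq_True sum.empty add_0_right)
    also have "restrict ?u {} = ?u" by (simp add: restrict_def)
    finally show ?thesis unfolding PiM_empty .
  qed
  also have "kernel_density n \<beta> \<theta> 0 F \<alpha> y {} ?u = (1 - exp (- \<beta>)) ^ n *
    fdet F (\<lambda>i j. kernel0 n \<beta> \<theta> (with_marks F \<alpha> y ?u i) (with_marks F \<alpha> y ?u j))"
    using kernel_density_at_0[OF n(1) u F(3), of \<beta> \<theta> \<alpha>] by simp
  also have "fdet F (\<lambda>i j. kernel0 n \<beta> \<theta> (with_marks F \<alpha> y ?u i) (with_marks F \<alpha> y ?u j)) =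
      fdet (Inr ` F) (\<lambda>i j. kernel0 n \<beta> \<theta> (marked_points (\<lambda>_. 0) \<alpha> y i) (marked_points (\<lambda>_. 0) \<alpha> y j))"
    by (subst fdet_reindex[of Inr F]) (auto simp: bij_betw_def F with_marks_def intro!: fdet_cong)
  also have "(1 - exp (- \<beta>)) ^ n * \<dots> = (\<Sum>A\<in>Pow {..<n}. (- exp (- \<beta>)) ^ card A * of_bool (marked_event \<alpha> y F (constant_process A)))"
    by (rule fdet_marked_constant[OF q n(2) F])
  finally show ?thesis .
qed

section \<open>Factorial decay of the volumes\<close>

lemma card_labellings:
  fixes I :: "nat set"
  assumes "finite I" "card I = n * k"
  shows "card (labellings n k I) = fact (n * k)"
proof -
  have "of_nat (card (labellings n k I)) = (of_nat (fact (n * k)) :: complex)"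
    using sum_labellings_restrict[OF assms, of "{}" "\<lambda>_. 1"] assms(2)
    by (simp add: bead_tuples_def)
  then show ?thesis by (simp only: of_nat_eq_iff)
qed

lemma emeasure_sorted_arrays_finite: "emeasure (array_lebesgue n k) (sorted_arrays n k) < \<infinity>"
proof -
  interpret L: product_sigma_finite "\<lambda>_. lborel :: real measure" by (rule product_sigma_finite_lborel)
  have "emeasure (array_lebesgue n k) (sorted_arrays n k) \<le> emeasure (array_lebesgue n k) (unit_box ({..<n} \<times> {..<k}))"
    unfolding array_lebesgue_def
    by (rule emeasure_mono) (auto simp: sorted_arrays_def intro: unit_box_measurable)
  also have "\<dots> = (\<Prod>p\<in>{..<n} \<times> {..<k}. emeasure lborel {0..<1::real})"
    unfolding array_lebesgue_def by (rule L.emeasure_PiM) auto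
  finally show ?thesis by (simp add: le_less_trans)
qed

text \<open>Folding the indicator of balanced families shows that (nk)! times this volume is the
  mass of the balanced families in a product of nk tori, whose total mass is n^(nk). This decay
  makes all the series in T converge everywhere.\<close>

lemma measure_sorted_arrays_le:
  assumes n: "0 < n"
  shows "measure (array_lebesgue n k) (sorted_arrays n k) \<le> real n ^ (n * k) / fact (n * k)"
proof -
  let ?I = "{..<n * k}" and ?M = "array_lebesgue n k"
  let ?P = "\<Pi>\<^sub>M i\<in>?I. torus n"
  define \<psi> where "\<psi> x = (if balanced n k ?I (\<lambda>i. snd (x i)) then 1 else 0 :: complex)" for x :: "nat \<Rightarrow> real \<times> nat"
  have "Measurable.pred ?P (\<lambda>x. \<forall>h\<in>{..<n}. (\<Sum>i<n * k. if snd (x i) = h then 1 else 0 :: nat) = k)"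
  proof (intro pred_intros_finite finite_lessThan)
    fix h
    have "(\<lambda>x. \<Sum>i<n * k. if snd (x i) = h then 1 else 0 :: nat) \<in> ?P \<rightarrow>\<^sub>M count_space UNIV"
    proof (intro measurable_sum_nat measurable_If measurable_const)
      fix i assume i: "i \<in> {..<n * k}"
      have "(\<lambda>x. snd (x i)) \<in> ?P \<rightarrow>\<^sub>M count_space UNIV"
        by (rule measurable_compose[OF measurable_component_singleton[OF i, of "\<lambda>_. torus n"] measurable_torus_snd])
      then have "(\<lambda>x. snd (x i)) -` {h} \<inter> space ?P \<in> sets ?P" by (rule measurable_sets) simp
      also have "(\<lambda>x. snd (x i)) -` {h} \<inter> space ?P = {x \<in> space ?P. snd (x i) = h}" by auto
      finally show "{x \<in> space ?P. snd (x i) = h} \<in> sets ?P" .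
    qed auto
    then have "(\<lambda>x. \<Sum>i<n * k. if snd (x i) = h then 1 else 0 :: nat) -` {k} \<inter> space ?P \<in> sets ?P" by (rule measurable_sets) simp
    also have "(\<lambda>x. \<Sum>i<n * k. if snd (x i) = h then 1 else 0 :: nat) -` {k} \<inter> space ?P =
      {x \<in> space ?P. (\<Sum>i<n * k. if snd (x i) = h then 1 else 0 :: nat) = k}" by auto
    finally show "Measurable.pred ?P (\<lambda>x. (\<Sum>i<n * k. if snd (x i) = h then 1 else 0 :: nat) = k)" by (simp only: Measurable.pred_def)
  qed
  moreover have "(\<forall>h\<in>{..<n}. (\<Sum>i<n * k. if snd (x i) = h then 1 else 0 :: nat) = k) \<longleftrightarrow> balanced n k ?I (\<lambda>i. snd (x i))" for x :: "nat \<Rightarrow> real \<times> nat"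
    by (simp add: balanced_def sum.inter_filter[symmetric] Ball_def)
  ultimately have "Measurable.pred ?P (\<lambda>x. balanced n k ?I (\<lambda>i. snd (x i)))" by (simp only:)
  then have m: "\<psi> \<in> borel_measurable ?P" unfolding \<psi>_def by (intro measurable_If predE) auto
  have bd: "norm (\<psi> x) \<le> 1" for x by (simp add: \<psi>_def)
  have one: "\<psi> (\<lambda>i\<in>?I. (b (\<sigma> i), fst (\<sigma> i))) = 1" if "\<sigma> \<in> labellings n k ?I" for \<sigma> b
  proof -
    have \<sigma>: "bij_betw \<sigma> ?I ({..<n} \<times> {..<k})" using that by (simp add: labellings_def)
    have "card {i \<in> ?I. snd ((\<lambda>i\<in>?I. (b (\<sigma> i), fst (\<sigma> i))) i) = h} = k" if h: "h < n" for h
    proof -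
      have "{i \<in> ?I. snd ((\<lambda>i\<in>?I. (b (\<sigma> i), fst (\<sigma> i))) i) = h} = {i \<in> ?I. fst (\<sigma> i) = h}" by auto
      moreover have "card {i \<in> ?I. fst (\<sigma> i) = h} = card (\<sigma> ` {i \<in> ?I. fst (\<sigma> i) = h})"
        by (intro card_image[symmetric] inj_on_subset[OF bij_betw_imp_inj_on[OF \<sigma>]]) auto
      moreover have "\<sigma> ` {i \<in> ?I. fst (\<sigma> i) = h} = {p \<in> {..<n} \<times> {..<k}. fst p = h}"
        unfolding bij_betw_imp_surj_on[OF \<sigma>, symmetric] by auto
      moreover have "{p \<in> {..<n} \<times> {..<k}. fst p = h} = {h} \<times> {..<k}" using h by auto
      ultimately show ?thesis by (simp add: card_cartesian_product)
    qed
    then show ?thesis by (simp add: \<psi>_def balanced_def)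
  qed
  have "(LINT x|?P. \<psi> x) = (\<Sum>\<sigma>\<in>labellings n k ?I. LINT b:sorted_arrays n k|?M. \<psi> (\<lambda>i\<in>?I. (b (\<sigma> i), fst (\<sigma> i))))"
    by (rule integral_torus_symmetrize(1)[OF _ _ m bd]) (auto simp: \<psi>_def)
  also have "\<dots> = (\<Sum>\<sigma>\<in>labellings n k ?I. of_real (measure ?M (sorted_arrays n k)))"
  proof (intro sum.cong refl)
    fix \<sigma> assume "\<sigma> \<in> labellings n k ?I"
    then have "(LINT b:sorted_arrays n k|?M. \<psi> (\<lambda>i\<in>?I. (b (\<sigma> i), fst (\<sigma> i)))) = (LINT b:sorted_arrays n k|?M. 1)"
      by (simp add: one cong: if_cong)
    also have "\<dots> = of_real (measure ?M (sorted_arrays n k))"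
      using emeasure_sorted_arrays_finite[of n k] sorted_arrays_measurable[of n k]
      by (simp add: set_lebesgue_integral_def scaleR_conv_of_real)
    finally show "(LINT b:sorted_arrays n k|?M. \<psi> (\<lambda>i\<in>?I. (b (\<sigma> i), fst (\<sigma> i)))) = of_real (measure ?M (sorted_arrays n k))" .
  qed
  also have "\<dots> = of_real (fact (n * k) * measure ?M (sorted_arrays n k))"
    by (simp add: card_labellings)
  finally have eq: "(LINT x|?P. \<psi> x) = of_real (fact (n * k) * measure ?M (sorted_arrays n k))" .
  interpret P: finite_measure ?P by (rule finite_measure_PiM_torus) simp
  have "norm (LINT x|?P. \<psi> x) \<le> (LINT x|?P. norm (\<psi> x))" by (rule integral_norm_bound)
  also have "\<dots> \<le> (LINT x|?P. 1)"
    using m bd by (intro integral_mono P.integrable_const_bound[of "\<lambda>x. norm (\<psi> x)" 1]) (auto intro: AE_I2)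
  also have "\<dots> = real n ^ (n * k)" using measure_PiM_torus[of ?I n] by simp
  finally have "fact (n * k) * measure ?M (sorted_arrays n k) \<le> real n ^ (n * k)" unfolding eq norm_of_real by simp
  then show ?thesis by (simp add: field_simps)
qed

text \<open>The power of N = nk bounds the number of bead families; it is absorbed by N^d \<le> d!
  exp N, and a subseries of an exponential series remains.\<close>

lemma summable_exp_subseries:
  fixes R :: real
  assumes n: "0 < n" and R: "0 \<le> R"
  shows "summable (\<lambda>k. R ^ (n * k) * real (n * k) ^ d * measure (array_lebesgue n k) (sorted_arrays n k))"
proof -
  let ?c = "fact d * 1 :: real"
  define f where "f N = (if n dvd N then (exp 1 * R * real n) ^ N / fact N else 0)" for N :: nat
  have "summable (\<lambda>N. (exp 1 * R * real n) ^ N / fact N)"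
    using summable_exp[of "exp 1 * R * real n"] by (simp add: divide_inverse mult.commute)
  then have "summable f"
    by (rule summable_comparison_test'[where N=0]) (use R in \<open>auto simp: f_def\<close>)
  moreover have "strict_mono (\<lambda>k. n * k)" using n by (auto simp: strict_mono_def)
  moreover have "f N = 0" if "N \<notin> range (\<lambda>k. n * k)" for N using that by (auto simp: f_def)
  ultimately have "summable (\<lambda>k. f (n * k))" by (subst summable_mono_reindex) auto
  then have "summable (\<lambda>k. fact d * f (n * k))" by (rule summable_mult)
  then show ?thesis
  proof (rule summable_comparison_test'[where N=0])
    fix k :: nat
    let ?N = "n * k"
    have "real ?N ^ d \<le> fact d * exp (real ?N)"
    proof -
      have "real ?N ^ d /\<^sub>R fact d \<le> exp (real ?N)"
        using sum_le_suminf[OF summable_exp_generic[of "real ?N"], of "{d}"] by (simp add: exp_def)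
      then show ?thesis by (simp add: field_simps)
    qed
    then have "R ^ ?N * real ?N ^ d * measure (array_lebesgue n k) (sorted_arrays n k) \<le>
       R ^ ?N * (fact d * exp (real ?N)) * (real n ^ ?N / fact ?N)"
      using R measure_sorted_arrays_le[OF n, of k] by (intro mult_mono) auto
    also have "\<dots> = fact d * f ?N"
      by (simp add: f_def power_mult_distrib exp_of_nat_mult[symmetric])
    finally show "norm (R ^ ?N * real ?N ^ d * measure (array_lebesgue n k) (sorted_arrays n k)) \<le> fact d * f ?N"
      using R by simp
  qed
qed

section \<open>The complex measure on occupation processes\<close>

text \<open>The coefficient of T ^ (n * k) in \<open>Q\<close> without the common factor 1/2
  (-1)^(\<theta> + n + 1); the signs left are those that the kernel determinants at T = 0
  produce.\<close>

definition layer :: "nat \<Rightarrow> complex \<Rightarrow> nat \<Rightarrow> nat \<Rightarrow> ((real \<Rightarrow> nat set) \<Rightarrow> complex) \<Rightarrow> complex" where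
  "layer n \<beta> \<theta> k F =
     (if k = 0 then \<Sum>A\<in>Pow {..<n}. (- exp (- \<beta>)) ^ card A * F (constant_process A)
      else \<Sum>l\<le>n. (-1) ^ (l + k * (\<theta> + n + l + 1)) * exp (- \<beta>) ^ l *
        (LINT b:W n k l|array_lebesgue n k. F (occupation_process n k b)))"

text \<open>The growth of counts of families of d beads. The bound is asked only almost everywhere
  because a count read off the process is compared with the array only where the times are
  distinct.\<close>

definition tame :: "nat \<Rightarrow> nat \<Rightarrow> ((real \<Rightarrow> nat set) \<Rightarrow> complex) \<Rightarrow> bool" where
  "tame n d F \<longleftrightarrow> (\<forall>k>0. \<forall>l.
     (\<lambda>b. indicator (W n k l) b *\<^sub>R F (occupation_process n k b)) \<in> borel_measurable (array_lebesgue n k) \<and>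
     (AE b in array_lebesgue n k. b \<in> W n k l \<longrightarrow> norm (F (occupation_process n k b)) \<le> real (n * k) ^ d))"

lemma Q_layers:
  assumes "summable (\<lambda>k. T ^ (n * k) * layer n \<beta> \<theta> k F)"
  shows "(\<lambda>k. 1 / 2 * (-1) ^ (\<theta> + n + 1) * (T ^ (n * k) * layer n \<beta> \<theta> k F)) sums Q n \<beta> \<theta> T F"
proof -
  define a where "a k = 1 / 2 * (-1) ^ (\<theta> + n + 1) * (T ^ (n * k) * layer n \<beta> \<theta> k F)" for k
  have sm: "summable a" unfolding a_def by (rule summable_mult[OF assms])
  have "1 / 2 * (-1) ^ ((Suc i + 1) * (\<theta> + n + l + 1)) * exp (- \<beta> * of_nat l) * T ^ (n * Suc i) * L =
    1 / 2 * (-1) ^ (\<theta> + n + 1) * (T ^ (n * Suc i) * ((-1) ^ (l + Suc i * (\<theta> + n + l + 1)) * exp (- \<beta>) ^ l * L))" for i l L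
  proof -
    have "(Suc i + 1) * (\<theta> + n + l + 1) = (\<theta> + n + 1) + (l + Suc i * (\<theta> + n + l + 1))" by simp
    then have "(-1 :: complex) ^ ((Suc i + 1) * (\<theta> + n + l + 1)) = (-1) ^ (\<theta> + n + 1) * (-1) ^ (l + Suc i * (\<theta> + n + l + 1))"
      by (simp only: power_add)
    then show ?thesis by (simp only: exp_of_nat2_mult mult_ac)
  qed
  then have "a (Suc i) = (let k = Suc i in \<Sum>l\<le>n.
        1 / 2 * (-1) ^ ((k + 1) * (\<theta> + n + l + 1)) * exp (- \<beta> * of_nat l) * T ^ (n * k) *
        (LINT b:W n k l|array_lebesgue n k. F (occupation_process n k b)))" for i
    by (simp only: a_def layer_def Let_def nat.simps if_False sum_distrib_left)
  moreover have "a 0 = (\<Sum>A\<in>Pow {..<n}. 1 / 2 * (-1) ^ (\<theta> + n + card A + 1) * exp (- \<beta> * of_nat (card A)) * F (constant_process A))"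
    unfolding a_def layer_def if_P[OF refl] sum_distrib_left mult_0_right power_0 mult_1
    by (simp only: power_minus[of "exp (- \<beta>)"] exp_of_nat2_mult power_add mult_ac)
  ultimately have "Q n \<beta> \<theta> T F = suminf (\<lambda>i. a (Suc i)) + a 0" by (simp add: Q_def)
  then have "Q n \<beta> \<theta> T F = suminf a" using suminf_split_head[OF sm] by simp
  then show ?thesis using summable_sums[OF sm] by (simp add: a_def[abs_def])
qed

lemma W_integral_bound:
  fixes f :: "_ \<Rightarrow> complex"
  assumes m: "(\<lambda>b. indicator (W n k l) b *\<^sub>R f b) \<in> borel_measurable (array_lebesgue n k)"
    and b: "AE b in array_lebesgue n k. b \<in> W n k l \<longrightarrow> norm (f b) \<le> c" and c: "0 \<le> c"
  shows "set_integrable (array_lebesgue n k) (W n k l) f"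
    and "norm (LINT b:W n k l|array_lebesgue n k. f b) \<le> c * measure (array_lebesgue n k) (sorted_arrays n k)"
proof -
  let ?M = "array_lebesgue n k"
  have g: "integrable ?M (\<lambda>b. c * indicator (sorted_arrays n k) b :: real)"
    by (intro integrable_mult_right integrable_real_indicator sorted_arrays_measurable emeasure_sorted_arrays_finite)
  have le: "AE b in ?M. norm (indicator (W n k l) b *\<^sub>R f b) \<le> c * indicator (sorted_arrays n k) b"
    using b
  proof eventually_elim
    case (elim b)
    then show ?case using W_subset_sorted[of n k l] c by (auto simp: indicator_def)
  qed
  have ii: "integrable ?M (\<lambda>b. indicator (W n k l) b *\<^sub>R f b)"
    by (rule Bochner_Integration.integrable_bound[OF g m]) (use le in eventually_elim, simp)
  then show "set_integrable ?M (W n k l) f" by (simp add: set_integrable_def)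
  have "norm (LINT b:W n k l|?M. f b) \<le> (LINT b|?M. norm (indicator (W n k l) b *\<^sub>R f b))"
    unfolding set_lebesgue_integral_def by (rule integral_norm_bound)
  also have "\<dots> \<le> (LINT b|?M. c * indicator (sorted_arrays n k) b)"
    by (rule integral_mono_AE[OF integrable_norm[OF ii] g le])
  also have "\<dots> = c * measure ?M (sorted_arrays n k)"
    using sorted_arrays_measurable[of n k] sets.sets_into_space by (simp add: Int_absorb2)
  finally show "norm (LINT b:W n k l|?M. f b) \<le> c * measure ?M (sorted_arrays n k)" .
qed

lemma tame_integral:
  assumes "tame n d F" "0 < k"
  shows "set_integrable (array_lebesgue n k) (W n k l) (\<lambda>b. F (occupation_process n k b))"
    and "norm (LINT b:W n k l|array_lebesgue n k. F (occupation_process n k b)) \<le>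
      real (n * k) ^ d * measure (array_lebesgue n k) (sorted_arrays n k)"
  using W_integral_bound[of n k l "\<lambda>b. F (occupation_process n k b)" "real (n * k) ^ d"] assms
  by (auto simp: tame_def)

lemma norm_signed_sum_le:
  assumes "\<And>l. l \<le> n \<Longrightarrow> norm (f l) \<le> c" "0 \<le> c"
  shows "norm (\<Sum>l\<le>n. (-1) ^ e l * x ^ l * f l) \<le> (\<Sum>l\<le>n. norm (x :: complex) ^ l) * c"
  unfolding sum_distrib_right using assms
  by (intro sum_norm_le) (auto simp: norm_mult norm_power intro!: mult_left_mono)

lemma norm_layer_le:
  assumes "tame n d F" "0 < k"
  shows "norm (layer n \<beta> \<theta> k F) \<le> (\<Sum>l\<le>n. norm (exp (- \<beta>)) ^ l) *
    (real (n * k) ^ d * measure (array_lebesgue n k) (sorted_arrays n k))"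
proof -
  have "layer n \<beta> \<theta> k F = (\<Sum>l\<le>n. (-1) ^ (l + k * (\<theta> + n + l + 1)) * exp (- \<beta>) ^ l *
      (LINT b:W n k l|array_lebesgue n k. F (occupation_process n k b)))"
    using assms(2) by (simp add: layer_def)
  then show ?thesis by (simp only:) (intro norm_signed_sum_le tame_integral(2)[OF assms] mult_nonneg_nonneg zero_le_power of_nat_0_le_iff measure_nonneg)
qed

lemma summable_geometric_bound:
  fixes T :: complex
  assumes n: "0 < n" and le: "\<And>k. 0 < k \<Longrightarrow> norm (a k) \<le> c * (real (n * k) ^ d * measure (array_lebesgue n k) (sorted_arrays n k))"
  shows "summable (\<lambda>k. norm (T ^ (n * k) * a k))"
proof (rule summable_comparison_test'[where N=1])
  show "summable (\<lambda>k. c * (norm T ^ (n * k) * real (n * k) ^ d * measure (array_lebesgue n k) (sorted_arrays n k)))"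
    by (intro summable_mult summable_exp_subseries n) simp
  fix k :: nat assume "1 \<le> k"
  then have "norm T ^ (n * k) * norm (a k) \<le> norm T ^ (n * k) * (c * (real (n * k) ^ d * measure (array_lebesgue n k) (sorted_arrays n k)))"
    using le[of k] by (intro mult_left_mono) auto
  then show "norm (norm (T ^ (n * k) * a k)) \<le> c * (norm T ^ (n * k) * real (n * k) ^ d * measure (array_lebesgue n k) (sorted_arrays n k))"
    by (simp add: norm_mult norm_power mult_ac)
qed

lemma Q_sums:
  assumes "0 < n" "tame n d F"
  shows "(\<lambda>k. 1 / 2 * (-1) ^ (\<theta> + n + 1) * (T ^ (n * k) * layer n \<beta> \<theta> k F)) sums Q n \<beta> \<theta> T F"
  by (rule Q_layers, rule summable_norm_cancel, rule summable_geometric_bound[OF assms(1)])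
     (rule norm_layer_le[OF assms(2)])

lemma Q_scale:
  assumes n: "0 < n" and F: "tame n d F" "tame n d' (\<lambda>X. c * F X)"
  shows "Q n \<beta> \<theta> T (\<lambda>X. c * F X) = c * Q n \<beta> \<theta> T F"
proof -
  have "layer n \<beta> \<theta> k (\<lambda>X. c * F X) = c * layer n \<beta> \<theta> k F" for k
    unfolding layer_def set_lebesgue_integral_def
    by (auto simp: sum_distrib_left mult_scaleR_right[symmetric] mult_ac simp del: mult_scaleR_right)
  then have "(\<lambda>k. c * (1 / 2 * (-1) ^ (\<theta> + n + 1) * (T ^ (n * k) * layer n \<beta> \<theta> k F))) sums Q n \<beta> \<theta> T (\<lambda>X. c * F X)"
    using Q_sums[OF n F(2), of \<theta> T \<beta>] by (simp add: mult_ac)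
  then show ?thesis by (rule sums_unique2) (rule sums_mult[OF Q_sums[OF n F(1)]])
qed

text \<open>\<open>Q\<close> is a series of integrals and not the integral of a measure, so
  countable additivity has to be proved: dominated convergence in each layer, then the theorem of
  Tannery over the layers. The same exchange evaluates expectations as sums over level sets.\<close>

lemma Q_exchange:
  fixes F :: "nat \<Rightarrow> (real \<Rightarrow> nat set) \<Rightarrow> complex"
  assumes n: "0 < n" and F: "\<And>i. tame n d (F i)" and G: "tame n d G"
    and part: "\<And>k l. 0 < k \<Longrightarrow> AE b in array_lebesgue n k. b \<in> W n k l \<longrightarrow>
      (\<forall>m. norm (\<Sum>i<m. F i (occupation_process n k b)) \<le> real (n * k) ^ d) \<and>
      (\<lambda>i. F i (occupation_process n k b)) sums G (occupation_process n k b)"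
    and const: "\<And>A. A \<subseteq> {..<n} \<Longrightarrow> (\<lambda>i. F i (constant_process A)) sums G (constant_process A)"
  shows "(\<lambda>i. Q n \<beta> \<theta> T (F i)) sums Q n \<beta> \<theta> T G"
proof -
  define S where "S m X = (\<Sum>i<m. F i X)" for m X
  let ?a = "\<lambda>F k. 1 / 2 * (-1) ^ (\<theta> + n + 1) * (T ^ (n * k) * layer n \<beta> \<theta> k F)"
  have S_meas: "(\<lambda>b. indicator (W n k l) b *\<^sub>R S m (occupation_process n k b)) \<in> borel_measurable (array_lebesgue n k)" if "0 < k" for m k l
    unfolding S_def scaleR_sum_right using F that by (intro borel_measurable_sum) (auto simp: tame_def)
  have tS: "tame n d (S m)" for m
    unfolding tame_def
  proof (intro allI impI conjI)
    fix k l :: nat assume k: "0 < k"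
    show "AE b in array_lebesgue n k. b \<in> W n k l \<longrightarrow> norm (S m (occupation_process n k b)) \<le> real (n * k) ^ d"
      using part[OF k, of l] by eventually_elim (simp add: S_def)
  qed (rule S_meas)
  have lin: "layer n \<beta> \<theta> k (S m) = (\<Sum>i<m. layer n \<beta> \<theta> k (F i))" for k m
  proof (cases "k = 0")
    case True
    then show ?thesis by (simp add: layer_def S_def sum_distrib_left sum.swap[of _ "Pow {..<n}"])
  next
    case False
    then have "(LINT b:W n k l|array_lebesgue n k. S m (occupation_process n k b)) =
      (\<Sum>i<m. LINT b:W n k l|array_lebesgue n k. F i (occupation_process n k b))" for l
      using tame_integral(1)[OF F, of k l] unfolding S_def set_lebesgue_integral_def scaleR_sum_right set_integrable_def
      by (intro Bochner_Integration.integral_sum) auto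
    then show ?thesis using False by (simp add: layer_def sum_distrib_left sum.swap[of _ "{..n}"])
  qed
  have lim: "(\<lambda>m. layer n \<beta> \<theta> k (S m)) \<longlonglongrightarrow> layer n \<beta> \<theta> k G" for k
  proof (cases "k = 0")
    case True
    have "(\<lambda>m. S m (constant_process A)) \<longlonglongrightarrow> G (constant_process A)" if "A \<in> Pow {..<n}" for A
      using const[of A] that by (simp add: sums_def S_def)
    then have "(\<lambda>m. \<Sum>A\<in>Pow {..<n}. (- exp (- \<beta>)) ^ card A * S m (constant_process A)) \<longlonglongrightarrow> (\<Sum>A\<in>Pow {..<n}. (- exp (- \<beta>)) ^ card A * G (constant_process A))"
      by (intro tendsto_sum tendsto_mult tendsto_const)
    then show ?thesis using True by (simp add: layer_def)
  next
    case False
    then have k: "0 < k" by simp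
    have "(\<lambda>m. LINT b:W n k l|array_lebesgue n k. S m (occupation_process n k b)) \<longlonglongrightarrow> (LINT b:W n k l|array_lebesgue n k. G (occupation_process n k b))" for l
      unfolding set_lebesgue_integral_def
    proof (rule integral_dominated_convergence[where w="\<lambda>b. real (n * k) ^ d * indicator (sorted_arrays n k) b"])
      show "(\<lambda>b. indicator (W n k l) b *\<^sub>R G (occupation_process n k b)) \<in> borel_measurable (array_lebesgue n k)"
        using G k by (simp add: tame_def)
      show "integrable (array_lebesgue n k) (\<lambda>b. real (n * k) ^ d * indicator (sorted_arrays n k) b :: real)"
        by (intro integrable_mult_right integrable_real_indicator sorted_arrays_measurable emeasure_sorted_arrays_finite)
      show "AE b in array_lebesgue n k. (\<lambda>m. indicator (W n k l) b *\<^sub>R S m (occupation_process n k b)) \<longlonglongrightarrow> indicator (W n k l) b *\<^sub>R G (occupation_process n k b)"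
        using part[OF k, of l]
      proof eventually_elim
        case (elim b)
        then show ?case by (cases "b \<in> W n k l") (auto simp: sums_def S_def)
      qed
      show "AE b in array_lebesgue n k. norm (indicator (W n k l) b *\<^sub>R S m (occupation_process n k b)) \<le> real (n * k) ^ d * indicator (sorted_arrays n k) b" for m
        using part[OF k, of l]
      proof eventually_elim
        case (elim b)
        then show ?case using W_subset_sorted[of n k l] by (auto simp: indicator_def S_def)
      qed
    qed (use S_meas[OF k] in auto)
    then show ?thesis using k by (auto simp: layer_def intro!: tendsto_sum tendsto_mult tendsto_const)
  qed
  have "(\<lambda>m. suminf (\<lambda>k. ?a (S m) k)) \<longlonglongrightarrow> suminf (?a G)"
  proof (rule tannerys_theorem[THEN conjunct2, THEN conjunct2])
    let ?M = "\<lambda>k. norm (1 / 2 * (-1) ^ (\<theta> + n + 1) :: complex) * (norm T ^ (n * k) * ((\<Sum>l\<le>n. norm (exp (- \<beta>)) ^ l) *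
      (real (n * k) ^ d * measure (array_lebesgue n k) (sorted_arrays n k))))"
    show "(\<lambda>m. ?a (S m) k) \<longlonglongrightarrow> ?a G k" for k by (intro tendsto_mult tendsto_const lim)
    \<comment> \<open>The bound for tame functions does not cover layer 0; domination is required
      only from some k on.\<close>
    have "\<forall>\<^sub>F (k, m) in at_top \<times>\<^sub>F sequentially. (0::nat) < k" by (subst eventually_prod1) (auto intro: eventually_gt_at_top)
    then show "\<forall>\<^sub>F (k, m) in at_top \<times>\<^sub>F sequentially. norm (?a (S m) k) \<le> ?M k"
    proof eventually_elim
      case (elim p)
      obtain k m where p: "p = (k, m)" by (cases p)
      show ?case using elim norm_layer_le[OF tS, of k \<beta> \<theta> m]
        unfolding p by (simp add: norm_mult norm_power mult_left_mono)
    qed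
    have "summable (\<lambda>k. norm (1 / 2 * (-1) ^ (\<theta> + n + 1) :: complex) * ((\<Sum>l\<le>n. norm (exp (- \<beta>)) ^ l) *
       (norm T ^ (n * k) * real (n * k) ^ d * measure (array_lebesgue n k) (sorted_arrays n k))))"
      by (intro summable_mult summable_exp_subseries n) simp
    then show "summable ?M" by (simp add: mult_ac)
  qed simp
  moreover have "suminf (?a (S m)) = (\<Sum>i<m. Q n \<beta> \<theta> T (F i))" for m
  proof -
    have "(\<lambda>k. \<Sum>i<m. ?a (F i) k) sums (\<Sum>i<m. Q n \<beta> \<theta> T (F i))"
      by (intro sums_sum Q_sums[OF n F])
    then show ?thesis by (simp add: lin sum_distrib_left sums_iff)
  qed
  moreover have "suminf (?a G) = Q n \<beta> \<theta> T G" using Q_sums[OF n G] by (simp add: sums_iff)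
  ultimately show ?thesis by (simp add: sums_def)
qed

section \<open>The power series for counts at marked points\<close>

definition marked_layer where
  "marked_layer n \<beta> \<theta> F \<alpha> y B D k =
     (if k = 0 then of_bool (B = {} \<and> (\<lambda>_. undefined) \<in> D) *
        (\<Sum>A\<in>Pow {..<n}. (- exp (- \<beta>)) ^ card A * of_bool (marked_event \<alpha> y F (constant_process A)))
      else \<Sum>l\<le>n. (-1) ^ (l + k * (\<theta> + n + l + 1)) * exp (- \<beta>) ^ l *
        (LINT b:W n k l|array_lebesgue n k.
           of_bool (marked_event \<alpha> y F (occupation_process n k b)) * of_nat (tuple_count n k B D b)) :: complex)"

text \<open>Extra bead variables are added one at a time, so coefficients are needed for all powers
  of T; only multiples of n can occur, since all strings carry equally many beads.\<close>

definition marked_coeff where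
  "marked_coeff n \<beta> \<theta> F \<alpha> y B D N = (if n dvd N then marked_layer n \<beta> \<theta> F \<alpha> y B D (N div n) else 0)"

lemma norm_marked_layer_le:
  assumes n: "0 < n" and k: "0 < k" and B: "finite B" and F: "finite F" "y ` F \<subseteq> {0..<1} \<times> {..<n}" and D: "D \<in> sets (\<Pi>\<^sub>M i\<in>B. torus n)"
  shows "norm (marked_layer n \<beta> \<theta> F \<alpha> y B D k) \<le> (\<Sum>l\<le>n. norm (exp (- \<beta>)) ^ l) *
    (real (n * k) ^ card B * measure (array_lebesgue n k) (sorted_arrays n k))"
proof -
  have "norm (LINT b:W n k l|array_lebesgue n k.
      of_bool (marked_event \<alpha> y F (occupation_process n k b)) * of_nat (tuple_count n k B D b) :: complex) \<le>
      real (n * k) ^ card B * measure (array_lebesgue n k) (sorted_arrays n k)" for l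
  proof (rule W_integral_bound(2)[OF measurable_marked_count[OF n k B F D]])
    have "real (tuple_count n k B D b) \<le> real (n * k) ^ card B" for b
      using tuple_count_le[OF B, of n k D b] by (metis of_nat_le_iff of_nat_power)
    then show "AE b in array_lebesgue n k. b \<in> W n k l \<longrightarrow> norm (of_bool (marked_event \<alpha> y F (occupation_process n k b)) *
        of_nat (tuple_count n k B D b) :: complex) \<le> real (n * k) ^ card B"
      by (auto simp: norm_mult of_bool_def)
  qed simp
  note le = this
  have "marked_layer n \<beta> \<theta> F \<alpha> y B D k = (\<Sum>l\<le>n. (-1) ^ (l + k * (\<theta> + n + l + 1)) * exp (- \<beta>) ^ l *
      (LINT b:W n k l|array_lebesgue n k. of_bool (marked_event \<alpha> y F (occupation_process n k b)) * of_nat (tuple_count n k B D b)))"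
    using k by (simp add: marked_layer_def)
  then show ?thesis by (simp only:) (intro norm_signed_sum_le le mult_nonneg_nonneg zero_le_power of_nat_0_le_iff measure_nonneg)
qed

lemma summable_marked_coeff:
  assumes n: "0 < n" and B: "finite B" and F: "finite F" "y ` F \<subseteq> {0..<1} \<times> {..<n}" and D: "D \<in> sets (\<Pi>\<^sub>M i\<in>B. torus n)"
  shows "summable (\<lambda>N. marked_coeff n \<beta> \<theta> F \<alpha> y B D N * s ^ N)"
    and "(\<lambda>k. s ^ (n * k) * marked_layer n \<beta> \<theta> F \<alpha> y B D k) sums (\<Sum>N. marked_coeff n \<beta> \<theta> F \<alpha> y B D N * s ^ N)"
proof -
  let ?f = "\<lambda>N. marked_coeff n \<beta> \<theta> F \<alpha> y B D N * s ^ N"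
  have mono: "strict_mono (\<lambda>k. n * k)" using n by (auto simp: strict_mono_def)
  have z: "?f N = 0" if "N \<notin> range (\<lambda>k. n * k)" for N using that by (auto simp: marked_coeff_def)
  have eq: "?f (n * k) = s ^ (n * k) * marked_layer n \<beta> \<theta> F \<alpha> y B D k" for k using n by (simp add: marked_coeff_def)
  have "summable (\<lambda>k. s ^ (n * k) * marked_layer n \<beta> \<theta> F \<alpha> y B D k)"
    by (rule summable_norm_cancel, rule summable_geometric_bound[OF n]) (rule norm_marked_layer_le[OF n _ B F D])
  then show s: "summable ?f" using summable_mono_reindex[OF mono, of ?f] z by (simp add: eq)
  then show "(\<lambda>k. s ^ (n * k) * marked_layer n \<beta> \<theta> F \<alpha> y B D k) sums (\<Sum>N. ?f N)"
    using sums_mono_reindex[OF mono, of ?f "\<Sum>N. ?f N"] z summable_sums[OF s] by (simp add: eq)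
qed

text \<open>A configuration with fewer than card B beads contains no family of distinct beads
  indexed by B. This allows T ^ card B to be split off the series.\<close>

lemma marked_coeff_small:
  assumes n: "0 < n" and B: "finite B" and N: "N < card B"
  shows "marked_coeff n \<beta> \<theta> F \<alpha> y B D N = 0"
proof (cases "n dvd N")
  case True
  then obtain k where k: "N = n * k" by auto
  have "bead_tuples n k B = {}"
  proof (rule ccontr)
    assume "bead_tuples n k B \<noteq> {}"
    then obtain \<tau> where "\<tau> ` B \<subseteq> {..<n} \<times> {..<k}" "inj_on \<tau> B" by (auto simp: bead_tuples_def PiE_iff)
    then have "card B \<le> card ({..<n} \<times> {..<k})" by (intro card_inj_on_le) auto
    then show False using N k by simp
  qed
  then have "tuple_count n k B D b = 0" for b by (simp add: tuple_count_def)
  moreover have "B \<noteq> {}" using N by auto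
  ultimately show ?thesis using n by (simp add: marked_coeff_def k marked_layer_def set_lebesgue_integral_def)
qed (simp add: marked_coeff_def)

lemma integral_kernel_density_at_0:
  assumes q: "exp (- \<beta>) \<noteq> (1::complex)" and n: "0 < n" "F = {} \<or> 2 \<le> n"
    and I: "finite I" "I \<inter> F = {}" "B \<subseteq> I"
    and F: "finite F" "inj_on y F" "y ` F \<subseteq> {0..<1} \<times> {..<n}" "\<And>f. f \<in> F \<Longrightarrow> \<alpha> f \<noteq> Bead"
    and D: "D \<in> sets (\<Pi>\<^sub>M i\<in>B. torus n)"
  shows "(LINT x|(\<Pi>\<^sub>M i\<in>I. torus n). indicator D (restrict x B) * kernel_density n \<beta> \<theta> 0 F \<alpha> y I x) =
    fact (card I - card B) * marked_coeff n \<beta> \<theta> F \<alpha> y B D (card I)"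
proof (cases "n dvd card I")
  case True
  then obtain k where k: "card I = n * k" by auto
  show ?thesis
  proof (cases "k = 0")
    case True
    then have "I = {}" "B = {}" using k I by auto
    then show ?thesis using integral_kernel_density_0_empty[where D=D and \<theta>=\<theta>, OF q n F(1,2,3,4)]
      by (simp add: marked_coeff_def marked_layer_def of_bool_def indicator_def)
  next
    case False
    then show ?thesis using integral_kernel_density_0[where \<theta>=\<theta>, OF q n _ I(1) k I(2,3) F(1,2,3,4) D] n
      by (simp add: marked_coeff_def marked_layer_def k)
  qed
next
  case False
  then have "card I \<noteq> n * k" for k by auto
  then show ?thesis using integral_kernel_density_0_unbalanced[where \<theta>=\<theta> and \<beta>=\<beta> and D=D and B=B, OF n(1) I(1) _ I(2) F(1,3,4)] False
    by (simp add: marked_coeff_def)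
qed

text \<open>The assumption exp (- \<beta>) \<noteq> 1 says that T = 0 is regular, so the iterated
  derivatives can be evaluated there by counting configurations, and continuation from 0 reaches
  T.\<close>

lemma marked_sums_generic:
  assumes q: "exp (- \<beta>) \<noteq> (1::complex)" and n: "0 < n" "F = {} \<or> 2 \<le> n" and reg: "regular n \<beta> \<theta> T"
    and B: "finite B" "B \<inter> F = {}"
    and F: "finite F" "inj_on y F" "y ` F \<subseteq> {0..<1} \<times> {..<n}" "\<And>f. f \<in> F \<Longrightarrow> \<alpha> f \<noteq> Bead"
    and D: "D \<in> sets (\<Pi>\<^sub>M i\<in>B. torus n)"
  shows "(\<lambda>k. T ^ (n * k) * marked_layer n \<beta> \<theta> F \<alpha> y B D k) sums
    (T ^ card B * (LINT x|(\<Pi>\<^sub>M i\<in>B. torus n). indicator D (restrict x B) * kernel_density n \<beta> \<theta> T F \<alpha> y B x))"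
proof -
  \<comment> \<open>The m extra bead variables receive fresh indices beyond B and F.\<close>
  obtain N where N: "B \<union> F \<subseteq> {..<N}" using finite_nat_iff_bounded[of "B \<union> F"] B F by auto
  define J where "J m = B \<union> {N..<N + m}" for m
  have J: "finite (J m)" "B \<subseteq> J m" "J m \<inter> F = {}" "card (J m) = card B + m" "J (Suc m) = insert (N + m) (J m)" "N + m \<notin> J m" "N + m \<notin> F" for m
  proof -
    have "B \<inter> {N..<N + m} = {}" using N by auto
    then show "card (J m) = card B + m" using B by (simp add: J_def card_Un_disjoint)
  qed (use B N in \<open>auto simp: J_def atLeastLessThanSuc\<close>)
  define G where "G m s = (LINT x|(\<Pi>\<^sub>M i\<in>J m. torus n). indicator D (restrict x B) * kernel_density n \<beta> \<theta> s F \<alpha> y (J m) x)" for m s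
  let ?c = "marked_coeff n \<beta> \<theta> F \<alpha> y B D" and ?d = "card B"
  \<comment> \<open>The factorial of the Taylor coefficient cancels the number of ways to label the
    m extra beads.\<close>
  have G0: "G m 0 / fact m = ?c (m + ?d)" for m
    using integral_kernel_density_at_0[where \<theta>=\<theta>, OF q n J(1,3,2)[of m] F(1,2,3,4) D] J(4)[of m] by (simp add: G_def add.commute)
  have sm: "summable (\<lambda>N. ?c N * s ^ N)" for s by (rule summable_marked_coeff(1)[OF n(1) B(1) F(1,3) D])
  have sm': "summable (\<lambda>m. ?c (m + ?d) * s ^ m)" for s
  proof (cases "s = 0")
    case False
    have "summable (\<lambda>m. (?c (m + ?d) * s ^ (m + ?d)) * (1 / s ^ ?d))"
      using sm[of s] by (intro summable_mult2) (simp only: summable_iff_shift[of "\<lambda>N. ?c N * s ^ N"])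
    then show ?thesis using False by (simp add: power_add)
  qed simp
  have "G 0 T = (\<Sum>m. ?c (m + ?d) * T ^ m)"
  proof (rule iterated_derivatives_power_series[where S="{T. regular n \<beta> \<theta> T}" and G=G])
    show "0 \<in> {T. regular n \<beta> \<theta> T}" using q by (simp add: regular_def)
    show "(G m has_field_derivative G (Suc m) s) (at s)" if "s \<in> {T. regular n \<beta> \<theta> T}" for m s
      unfolding G_def J(5) by (rule has_field_derivative_integral_kernel_density[OF n(1) _ J(1,6,2) F(1,3) J(7) D]) (use that in simp)
    show "(\<lambda>m. G m 0 / fact m * s ^ m) sums (\<Sum>m. ?c (m + ?d) * s ^ m)" for s
      unfolding G0 by (rule summable_sums[OF sm'])
  qed (use regular_connected[OF n(1)] reg in auto)
  then have "(\<lambda>m. ?c (m + ?d) * T ^ m) sums G 0 T" using summable_sums[OF sm'] by simp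
  then have "(\<lambda>m. T ^ ?d * (?c (m + ?d) * T ^ m)) sums (T ^ ?d * G 0 T)" by (rule sums_mult)
  then have "(\<lambda>m. ?c (m + ?d) * T ^ (m + ?d)) sums (T ^ ?d * G 0 T)" by (simp add: power_add mult_ac)
  then have "(\<lambda>N. ?c N * T ^ N) sums (T ^ ?d * G 0 T)"
    by (subst (asm) sums_zero_iff_shift) (use marked_coeff_small[OF n(1) B(1)] in auto)
  then have "(\<Sum>N. ?c N * T ^ N) = T ^ ?d * G 0 T" by (simp add: sums_iff)
  moreover have "J 0 = B" by (simp add: J_def)
  ultimately show ?thesis using summable_marked_coeff(2)[where \<theta>=\<theta> and \<beta>=\<beta> and s=T and \<alpha>=\<alpha>, OF n(1) B(1) F(1,3) D] by (simp add: G_def)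
qed

lemma continuous_marked_layer: "isCont (\<lambda>\<beta>. marked_layer n \<beta> \<theta> F \<alpha> y B D k) \<beta>"
  unfolding marked_layer_def by (cases "k = 0") (auto intro!: continuous_intros)

text \<open>For \<open>exp (-\<beta>) = 1\<close> the kernel is singular at \<open>T = 0\<close>; this case is a limit of real shifts of \<open>\<beta>\<close>.\<close>

lemma marked_sums:
  assumes n: "0 < n" "F = {} \<or> 2 \<le> n" and reg: "regular n \<beta> \<theta> T"
    and B: "finite B" "B \<inter> F = {}"
    and F: "finite F" "inj_on y F" "y ` F \<subseteq> {0..<1} \<times> {..<n}" "\<And>f. f \<in> F \<Longrightarrow> \<alpha> f \<noteq> Bead"
    and D: "D \<in> sets (\<Pi>\<^sub>M i\<in>B. torus n)"
  shows "(\<lambda>k. T ^ (n * k) * marked_layer n \<beta> \<theta> F \<alpha> y B D k) sums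
    (T ^ card B * (LINT x|(\<Pi>\<^sub>M i\<in>B. torus n). indicator D (restrict x B) * kernel_density n \<beta> \<theta> T F \<alpha> y B x))"
proof (cases "exp (- \<beta>) = 1")
  case True
  let ?R = "\<lambda>\<beta>. T ^ card B * (LINT x|(\<Pi>\<^sub>M i\<in>B. torus n). indicator D (restrict x B) * kernel_density n \<beta> \<theta> T F \<alpha> y B x)"
  let ?a = "\<lambda>\<beta> k. T ^ (n * k) * marked_layer n \<beta> \<theta> F \<alpha> y B D k"
  \<comment> \<open>Adding a positive real number to \<beta> strictly decreases the modulus of exp
    (- \<beta>). So it is no longer 1, and the bounds at \<beta> dominate the whole
    sequence.\<close>
  define \<gamma> where "\<gamma> j = \<beta> + of_real (1 / real (Suc j))" for j
  have \<gamma>: "\<gamma> \<longlonglongrightarrow> \<beta>"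
    unfolding \<gamma>_def using tendsto_add[OF tendsto_const tendsto_of_real[OF LIMSEQ_inverse_real_of_nat], of \<beta>]
    by (simp add: divide_inverse)
  have norm_le: "norm (exp (- \<gamma> j)) < norm (exp (- \<beta>))" for j by (simp add: norm_exp_eq_Re \<gamma>_def)
  have q: "exp (- \<gamma> j) \<noteq> 1" for j
  proof
    assume "exp (- \<gamma> j) = 1"
    with norm_le[of j] True show False by (simp only: less_irrefl)
  qed
  have lim: "(\<lambda>j. suminf (?a (\<gamma> j))) \<longlonglongrightarrow> suminf (?a \<beta>)"
  proof (rule tannerys_theorem[THEN conjunct2, THEN conjunct2])
    let ?M = "\<lambda>k. norm T ^ (n * k) * ((\<Sum>l\<le>n. norm (exp (- \<beta>)) ^ l) *
      (real (n * k) ^ card B * measure (array_lebesgue n k) (sorted_arrays n k)))"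
    show "(\<lambda>j. ?a (\<gamma> j) k) \<longlonglongrightarrow> ?a \<beta> k" for k
      by (intro tendsto_mult tendsto_const isCont_tendsto_compose[OF continuous_marked_layer \<gamma>])
    have "\<forall>\<^sub>F (k, j) in at_top \<times>\<^sub>F sequentially. (0::nat) < k" by (subst eventually_prod1) (auto intro: eventually_gt_at_top)
    then show "\<forall>\<^sub>F (k, j) in at_top \<times>\<^sub>F sequentially. norm (?a (\<gamma> j) k) \<le> ?M k"
    proof eventually_elim
      case (elim p)
      obtain k j where p: "p = (k, j)" by (cases p)
      then have "norm (marked_layer n (\<gamma> j) \<theta> F \<alpha> y B D k) \<le> (\<Sum>l\<le>n. norm (exp (- \<gamma> j)) ^ l) *
        (real (n * k) ^ card B * measure (array_lebesgue n k) (sorted_arrays n k))"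
        using elim by (intro norm_marked_layer_le[OF n(1) _ B(1) F(1,3) D]) auto
      also have "\<dots> \<le> (\<Sum>l\<le>n. norm (exp (- \<beta>)) ^ l) *
        (real (n * k) ^ card B * measure (array_lebesgue n k) (sorted_arrays n k))"
        using norm_le[of j] by (intro mult_right_mono sum_mono power_mono) auto
      finally show ?case unfolding p by (simp add: norm_mult norm_power mult_left_mono)
    qed
    have "summable (\<lambda>k. (\<Sum>l\<le>n. norm (exp (- \<beta>)) ^ l) *
       (norm T ^ (n * k) * real (n * k) ^ card B * measure (array_lebesgue n k) (sorted_arrays n k)))"
      by (intro summable_mult summable_exp_subseries n) simp
    then show "summable ?M" by (simp add: mult_ac)
  qed simp
  have limR: "(\<lambda>j. ?R (\<gamma> j)) \<longlonglongrightarrow> ?R \<beta>"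
    by (intro tendsto_mult tendsto_const isCont_tendsto_compose[OF continuous_integral_kernel_density[OF n(1) reg B(1) subset_refl F(1,3) D] \<gamma>])
  have ev: "\<forall>\<^sub>F j in sequentially. suminf (?a (\<gamma> j)) = ?R (\<gamma> j)"
  proof -
    obtain r where r: "0 < r" "\<And>\<beta>' T'. dist \<beta> \<beta>' < r \<Longrightarrow> dist T T' < r \<Longrightarrow> regular n \<beta>' \<theta> T'"
      using kernel_density_locally_bounded[OF n(1) reg B(1) F(1,3)] by metis
    have "\<forall>\<^sub>F j in sequentially. dist (\<gamma> j) \<beta> < r" using \<gamma> r(1) by (simp add: tendsto_iff)
    then show ?thesis
    proof eventually_elim
      case (elim j)
      then have "regular n (\<gamma> j) \<theta> T" using r by (simp add: dist_commute)
      then show ?case using marked_sums_generic[where \<theta>=\<theta>, OF q n _ B F(1,2,3,4) D, of j T] by (simp add: sums_iff)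
    qed
  qed
  have "suminf (?a \<beta>) = ?R \<beta>" by (rule LIMSEQ_unique[OF Lim_transform_eventually[OF lim ev] limR])
  moreover have "summable (?a \<beta>)"
    by (rule sums_summable[OF summable_marked_coeff(2)[OF n(1) B(1) F(1,3) D]])
  ultimately show ?thesis by (simp add: sums_iff)
qed (rule marked_sums_generic[OF _ n reg B F D])

text \<open>Agreement of G with the array count is required only almost everywhere: where times
  coincide, the beads of the process need not be those of the array.\<close>

lemma Q_marked:
  assumes n: "0 < n" "F = {} \<or> 2 \<le> n" and reg: "regular n \<beta> \<theta> T"
    and B: "finite B" "B \<inter> F = {}"
    and F: "finite F" "inj_on y F" "y ` F \<subseteq> {0..<1} \<times> {..<n}" "\<And>f. f \<in> F \<Longrightarrow> \<alpha> f \<noteq> Bead"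
    and D: "D \<in> sets (\<Pi>\<^sub>M i\<in>B. torus n)"
    and G: "tame n d G"
    and AE: "\<And>k l. 0 < k \<Longrightarrow> AE b in array_lebesgue n k. b \<in> W n k l \<longrightarrow>
      G (occupation_process n k b) = of_bool (marked_event \<alpha> y F (occupation_process n k b)) * of_nat (tuple_count n k B D b)"
    and const: "\<And>A. A \<subseteq> {..<n} \<Longrightarrow> G (constant_process A) =
      of_bool (B = {} \<and> (\<lambda>_. undefined) \<in> D) * of_bool (marked_event \<alpha> y F (constant_process A))"
  shows "Q n \<beta> \<theta> T G = 1 / 2 * (-1) ^ (\<theta> + n + 1) *
    (T ^ card B * (LINT x|(\<Pi>\<^sub>M i\<in>B. torus n). indicator D (restrict x B) * kernel_density n \<beta> \<theta> T F \<alpha> y B x))"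
proof -
  have "layer n \<beta> \<theta> k G = marked_layer n \<beta> \<theta> F \<alpha> y B D k" for k
  proof (cases "k = 0")
    case True
    show ?thesis unfolding layer_def marked_layer_def if_P[OF True] sum_distrib_left
      by (intro sum.cong refl) (simp add: const mult_ac)
  next
    case False
    then have k: "0 < k" by simp
    have "(LINT b:W n k l|array_lebesgue n k. G (occupation_process n k b)) =
      (LINT b:W n k l|array_lebesgue n k. of_bool (marked_event \<alpha> y F (occupation_process n k b)) * of_nat (tuple_count n k B D b))" for l
      unfolding set_lebesgue_integral_def
    proof (rule integral_cong_AE[OF _ measurable_marked_count[OF n(1) k B(1) F(1,3) D]])
      show "(\<lambda>b. indicator (W n k l) b *\<^sub>R G (occupation_process n k b)) \<in> borel_measurable (array_lebesgue n k)"
        using G k by (simp add: tame_def)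
      show "AE b in array_lebesgue n k. indicator (W n k l) b *\<^sub>R G (occupation_process n k b) =
        indicator (W n k l) b *\<^sub>R (of_bool (marked_event \<alpha> y F (occupation_process n k b)) * of_nat (tuple_count n k B D b))"
        using AE[OF k, of l]
      proof eventually_elim
        case (elim b)
        then show ?case by (cases "b \<in> W n k l") auto
      qed
    qed
    then show ?thesis using k by (simp add: layer_def marked_layer_def)
  qed
  then have "(\<lambda>k. 1 / 2 * (-1) ^ (\<theta> + n + 1) * (T ^ (n * k) * marked_layer n \<beta> \<theta> F \<alpha> y B D k)) sums Q n \<beta> \<theta> T G"
    using Q_sums[OF n(1) G, of \<theta> T \<beta>] by simp
  moreover have "(\<lambda>k. 1 / 2 * (-1) ^ (\<theta> + n + 1) * (T ^ (n * k) * marked_layer n \<beta> \<theta> F \<alpha> y B D k)) sums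
    (1 / 2 * (-1) ^ (\<theta> + n + 1) *
    (T ^ card B * (LINT x|(\<Pi>\<^sub>M i\<in>B. torus n). indicator D (restrict x B) * kernel_density n \<beta> \<theta> T F \<alpha> y B x)))"
    by (intro sums_mult marked_sums[OF n reg B F D])
  ultimately show ?thesis by (rule sums_unique2)
qed

section \<open>Mixed correlation functions\<close>

lemma one_le_bead_power: "0 < n \<Longrightarrow> 0 < k \<Longrightarrow> 1 \<le> real (n * k) ^ d"
  by (intro one_le_power) (simp add: Suc_le_eq flip: of_nat_mult)

lemma tame_cong:
  assumes "\<And>k b. 0 < k \<Longrightarrow> F (occupation_process n k b) = G (occupation_process n k b)"
  shows "tame n d F \<longleftrightarrow> tame n d G"
  using assms by (simp add: tame_def)

lemma tame_indicator:
  assumes n: "0 < n" and E: "E \<in> sets (process_space n)"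
  shows "tame n d (indicator E)"
  unfolding tame_def
proof (intro allI impI conjI)
  fix k l :: nat assume k: "0 < k"
  have "(\<lambda>b. indicator E (occupation_process n k b) :: complex) \<in> borel_measurable (array_lebesgue n k)"
    by (rule measurable_compose[OF measurable_occupation_process[OF k] borel_measurable_indicator[OF E]])
  then show "(\<lambda>b. indicator (W n k l) b *\<^sub>R (indicator E (occupation_process n k b) :: complex)) \<in> borel_measurable (array_lebesgue n k)"
    by (intro borel_measurable_scaleR borel_measurable_indicator W_measurable n k)
  show "AE b in array_lebesgue n k. b \<in> W n k l \<longrightarrow> norm (indicator E (occupation_process n k b) :: complex) \<le> real (n * k) ^ d"
    using one_le_bead_power[OF n k, of d] by (intro AE_I2) (auto simp: indicator_def)
qed

lemma occupation_process_in_space: "0 < k \<Longrightarrow> occupation_process n k b \<in> space (process_space n)"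
  by (simp add: space_process_space occupation_process_in_processes)

lemma integral_kernel_density_empty:
  "(LINT x|(\<Pi>\<^sub>M i\<in>{}. torus n). indicator {\<lambda>_. undefined} (restrict x {}) * kernel_density n \<beta> \<theta> T {} \<alpha> y {} x) =
    partition_det n \<beta> \<theta> T"
proof -
  have "(LINT x|(\<Pi>\<^sub>M i\<in>{}. torus n). indicator {\<lambda>_. undefined} (restrict x {}) * kernel_density n \<beta> \<theta> T {} \<alpha> y {} x) =
    (LINT x|(\<Pi>\<^sub>M i\<in>({} :: nat set). torus n). partition_det n \<beta> \<theta> T)"
    by (intro Bochner_Integration.integral_cong refl) (auto simp: space_PiM kernel_density_def restrict_def)
  also have "\<dots> = partition_det n \<beta> \<theta> T"
    using measure_PiM_torus[of "{} :: nat set" n] by simp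
  finally show ?thesis .
qed

lemma singleton_sets_PiM_empty: "{\<lambda>_. undefined} \<in> sets (\<Pi>\<^sub>M i\<in>{}. M i)"
  using sets.top[of "\<Pi>\<^sub>M i\<in>{}. M i"] by (simp only: space_PiM PiE_empty_domain)

text \<open>The case without any points. G is prescribed only on the space of processes, which
  covers the constant 1 as well as the indicator of the whole space.\<close>

lemma Q_total:
  assumes n: "0 < n" and reg: "regular n \<beta> \<theta> T" and G: "\<And>X. X \<in> space (process_space n) \<Longrightarrow> G X = 1"
  shows "Q n \<beta> \<theta> T G = 1 / 2 * (-1) ^ (\<theta> + n + 1) * partition_det n \<beta> \<theta> T"
proof -
  let ?u = "\<lambda>_. undefined :: real \<times> nat"
  have D: "{?u} \<in> sets (\<Pi>\<^sub>M i\<in>({} :: nat set). torus n)" by (rule singleton_sets_PiM_empty)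
  have t: "tame n 0 G"
    using tame_indicator[OF n sets.top, of 0]
    by (subst tame_cong[where G="indicator (space (process_space n))"]) (simp_all add: G occupation_process_in_space)
  have "tuple_count n k {} {?u} b = 1" for k b
  proof -
    have "{\<tau> \<in> bead_tuples n k {}. (\<lambda>i\<in>{}. (b (\<tau> i), fst (\<tau> i))) \<in> {?u}} = {\<lambda>_. undefined}"
      by (auto simp: bead_tuples_def restrict_def)
    then show ?thesis by (simp add: tuple_count_def)
  qed
  then have "Q n \<beta> \<theta> T G = 1 / 2 * (-1) ^ (\<theta> + n + 1) * (T ^ card ({} :: nat set) * (LINT x|(\<Pi>\<^sub>M i\<in>{}. torus n).
      indicator {?u} (restrict x {}) * kernel_density n \<beta> \<theta> T {} (\<lambda>_. Bead) ?u {} x))"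
    using n D
    by (intro Q_marked[OF n _ reg _ _ _ _ _ _ D t])
       (auto simp: G occupation_process_in_processes marked_event_def constant_process_in_processes(1) space_process_space)
  then show ?thesis by (simp only: integral_kernel_density_empty card.empty power_0 mult_1)
qed

lemma Q_one_nonzero:
  assumes "0 < n" "regular n \<beta> \<theta> T"
  shows "Q n \<beta> \<theta> T (\<lambda>X. 1) \<noteq> 0"
  using partition_det_nonzero[OF assms] by (simp add: Q_total[OF assms])

lemma sums_indicator_disjoint:
  assumes "disjoint_family A"
  shows "(\<lambda>i. indicator (A i) x :: complex) sums indicator (\<Union>i. A i) x"
proof (cases "\<exists>j. x \<in> A j")
  case True
  then obtain j where j: "x \<in> A j" by blast
  have "x \<in> A i \<longleftrightarrow> i = j" for i using assms j by (auto simp: disjoint_family_on_def)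
  then have "(\<lambda>i. indicator (A i) x :: complex) = (\<lambda>i. if i = j then 1 else 0)" by (auto simp: indicator_def)
  then show ?thesis using sums_single[of j "\<lambda>_. 1 :: complex"] True by (simp add: indicator_def)
qed (simp add: indicator_def)

lemma norm_sum_indicator_disjoint_le:
  fixes A :: "nat \<Rightarrow> 'a set"
  assumes "disjoint_family A"
  shows "norm (\<Sum>i<m. indicator (A i) x :: complex) \<le> 1"
proof -
  have "(\<Sum>i<m. indicator (A i) x :: complex) = indicator (\<Union>i<m. A i) x"
    by (rule indicator_UN_disjoint[symmetric]) (use assms in \<open>auto simp: disjoint_family_on_def\<close>)
  then show ?thesis by (simp add: indicator_def)
qed

lemma complex_prob_P:
  assumes n: "0 < n" and reg: "regular n \<beta> \<theta> T"
  shows "complex_prob (process_space n) (P n \<beta> \<theta> T)"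
  unfolding complex_prob_def
proof (intro conjI allI impI)
  fix A :: "nat \<Rightarrow> (real \<Rightarrow> nat set) set"
  assume A: "range A \<subseteq> sets (process_space n)" "disjoint_family A"
  have "(\<lambda>i. Q n \<beta> \<theta> T (indicator (A i))) sums Q n \<beta> \<theta> T (indicator (\<Union>i. A i))"
  proof (rule Q_exchange[where d=0, OF n])
    show "tame n 0 (indicator (A i))" for i using A by (intro tame_indicator n) auto
    show "tame n 0 (indicator (\<Union>i. A i))" using A by (intro tame_indicator n) auto
    show "AE b in array_lebesgue n k. b \<in> W n k l \<longrightarrow>
      (\<forall>m. norm (\<Sum>i<m. indicator (A i) (occupation_process n k b) :: complex) \<le> real (n * k) ^ 0) \<and>
      (\<lambda>i. indicator (A i) (occupation_process n k b) :: complex) sums indicator (\<Union>i. A i) (occupation_process n k b)" for k l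
      using sums_indicator_disjoint[OF A(2)] norm_sum_indicator_disjoint_le[OF A(2)] by simp
  qed (rule sums_indicator_disjoint[OF A(2)])
  then show "(\<lambda>i. P n \<beta> \<theta> T (A i)) sums P n \<beta> \<theta> T (\<Union>i. A i)"
    unfolding P_def by (rule sums_divide)
next
  have "Q n \<beta> \<theta> T (indicator (space (process_space n))) = Q n \<beta> \<theta> T (\<lambda>X. 1)"
    by (simp add: Q_total[OF n reg])
  then show "P n \<beta> \<theta> T (space (process_space n)) = 1"
    using Q_one_nonzero[OF n reg] by (simp add: P_def)
qed

section \<open>Counting the beads of the process\<close>

definition bead_count :: "nat \<Rightarrow> nat set \<Rightarrow> (nat \<Rightarrow> real \<times> nat) set \<Rightarrow> (real \<Rightarrow> nat set) \<Rightarrow> nat" where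
  "bead_count n B D X = card {x \<in> B \<rightarrow>\<^sub>E beads n X. inj_on x B \<and> x \<in> D}"

lemma bead_count_generic:
  assumes n: "2 \<le> n" "0 < k" and B: "finite B" and b: "b \<in> bead_arrays n k" "inj_on b ({..<n} \<times> {..<k})"
  shows "bead_count n B D (occupation_process n k b) = tuple_count n k B D b"
proof -
  let ?A = "{..<n} \<times> {..<k}"
  define g where "g p = (b p, fst p)" for p :: "nat \<times> nat"
  have g: "inj_on g ?A" using b(2) by (auto simp: g_def inj_on_def)
  have beads: "beads n (occupation_process n k b) = g ` ?A"
    using beads_occupation_process_generic[OF n b] by (simp add: g_def[abs_def])
  have inv: "inv_into ?A g (g p) = p" if "p \<in> ?A" for p using g that by (rule inv_into_f_f)
  let ?S = "{\<tau> \<in> bead_tuples n k B. (\<lambda>i\<in>B. g (\<tau> i)) \<in> D}" and ?R = "{x \<in> B \<rightarrow>\<^sub>E g ` ?A. inj_on x B \<and> x \<in> D}"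
  have "card ?S = card ?R"
  proof (rule bij_betw_same_card[of "\<lambda>\<tau>. \<lambda>i\<in>B. g (\<tau> i)"], rule bij_betw_byWitness[where f'="\<lambda>x. \<lambda>i\<in>B. inv_into ?A g (x i)"])
    show "\<forall>\<tau>\<in>?S. (\<lambda>i\<in>B. inv_into ?A g ((\<lambda>i\<in>B. g (\<tau> i)) i)) = \<tau>"
    proof
      fix \<tau> assume "\<tau> \<in> ?S"
      then have \<tau>: "\<tau> \<in> B \<rightarrow>\<^sub>E ?A" by (simp add: bead_tuples_def)
      show "(\<lambda>i\<in>B. inv_into ?A g ((\<lambda>i\<in>B. g (\<tau> i)) i)) = \<tau>"
        by (rule PiE_ext[OF _ \<tau>]) (use PiE_mem[OF \<tau>] inv in \<open>auto simp: PiE_iff\<close>)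
    qed
    show "\<forall>x\<in>?R. (\<lambda>i\<in>B. g ((\<lambda>i\<in>B. inv_into ?A g (x i)) i)) = x"
    proof
      fix x assume "x \<in> ?R"
      then have x: "x \<in> B \<rightarrow>\<^sub>E g ` ?A" by simp
      have "g (inv_into ?A g (x i)) = x i" if "i \<in> B" for i using PiE_mem[OF x that] by (rule f_inv_into_f)
      then show "(\<lambda>i\<in>B. g ((\<lambda>i\<in>B. inv_into ?A g (x i)) i)) = x"
        using x by (auto simp: fun_eq_iff PiE_iff extensional_def)
    qed
    show "(\<lambda>\<tau>. \<lambda>i\<in>B. g (\<tau> i)) ` ?S \<subseteq> ?R"
    proof (rule image_subsetI)
      fix \<tau> assume "\<tau> \<in> ?S"
      then have \<tau>: "\<tau> \<in> B \<rightarrow>\<^sub>E ?A" "inj_on \<tau> B" "(\<lambda>i\<in>B. g (\<tau> i)) \<in> D" by (auto simp: bead_tuples_def)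
      have "inj_on (\<lambda>i\<in>B. g (\<tau> i)) B"
      proof (rule inj_onI)
        fix i j assume ij: "i \<in> B" "j \<in> B" "(\<lambda>i\<in>B. g (\<tau> i)) i = (\<lambda>i\<in>B. g (\<tau> i)) j"
        then have "\<tau> i = \<tau> j" using inj_onD[OF g _ PiE_mem[OF \<tau>(1) ij(1)] PiE_mem[OF \<tau>(1) ij(2)]] by simp
        then show "i = j" using inj_onD[OF \<tau>(2) _ ij(1,2)] by simp
      qed
      moreover have "(\<lambda>i\<in>B. g (\<tau> i)) \<in> B \<rightarrow>\<^sub>E g ` ?A" using PiE_mem[OF \<tau>(1)] by (simp add: PiE_iff)
      ultimately show "(\<lambda>i\<in>B. g (\<tau> i)) \<in> ?R" using \<tau>(3) by simp
    qed
    show "(\<lambda>x. \<lambda>i\<in>B. inv_into ?A g (x i)) ` ?R \<subseteq> ?S"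
    proof (rule image_subsetI)
      fix x assume "x \<in> ?R"
      then have x: "x \<in> B \<rightarrow>\<^sub>E g ` ?A" "inj_on x B" "x \<in> D" by auto
      have gi: "g (inv_into ?A g (x i)) = x i" if "i \<in> B" for i using PiE_mem[OF x(1) that] by (rule f_inv_into_f)
      have "(\<lambda>i\<in>B. inv_into ?A g (x i)) \<in> B \<rightarrow>\<^sub>E ?A"
        using inv_into_into[OF PiE_mem[OF x(1)]] by (simp add: PiE_iff)
      moreover have "inj_on (\<lambda>i\<in>B. inv_into ?A g (x i)) B"
      proof (rule inj_onI)
        fix i j assume ij: "i \<in> B" "j \<in> B" "(\<lambda>i\<in>B. inv_into ?A g (x i)) i = (\<lambda>i\<in>B. inv_into ?A g (x i)) j"
        then have "inv_into ?A g (x i) = inv_into ?A g (x j)" by simp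
        from arg_cong[OF this, of g] have "x i = x j" by (simp only: gi[OF ij(1)] gi[OF ij(2)])
        then show "i = j" by (rule inj_onD[OF x(2) _ ij(1,2)])
      qed
      moreover have "(\<lambda>i\<in>B. g ((\<lambda>i\<in>B. inv_into ?A g (x i)) i)) = x"
        using x(1) gi by (auto simp: fun_eq_iff PiE_iff extensional_def)
      ultimately show "(\<lambda>i\<in>B. inv_into ?A g (x i)) \<in> ?S" using x(3) by (simp add: bead_tuples_def)
    qed
  qed
  then show ?thesis by (simp add: bead_count_def tuple_count_def beads g_def)
qed

lemma AE_bead_count:
  assumes "2 \<le> n" "0 < k" "finite B"
  shows "AE b in array_lebesgue n k. b \<in> W n k l \<longrightarrow> bead_count n B D (occupation_process n k b) = tuple_count n k B D b"
proof -
  have "AE b in array_lebesgue n k. inj_on b ({..<n} \<times> {..<k})"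
    unfolding array_lebesgue_def by (rule AE_PiM_lborel_inj) simp
  then show ?thesis by eventually_elim (auto simp: W_def intro!: bead_count_generic[OF assms])
qed

lemma bead_count_constant:
  assumes "A \<subseteq> {..<n}" "finite B"
  shows "bead_count n B D (constant_process A) = of_bool (B = {} \<and> (\<lambda>_. undefined) \<in> D)"
proof (cases "B = {}")
  case True
  then have "{x \<in> B \<rightarrow>\<^sub>E beads n (constant_process A). inj_on x B \<and> x \<in> D} = {\<lambda>_. undefined} \<inter> D" by auto
  then show ?thesis using True by (simp add: bead_count_def)
next
  case False
  then have "B \<rightarrow>\<^sub>E ({} :: (real \<times> nat) set) = {}" by (auto simp: PiE_eq_empty_iff)
  then show ?thesis using False by (simp add: bead_count_def beads_constant_process[OF assms(1)])
qed

definition marked_count :: "nat \<Rightarrow> nat set \<Rightarrow> (nat \<Rightarrow> kind) \<Rightarrow> (nat \<Rightarrow> real \<times> nat) \<Rightarrow> nat set \<Rightarrow> (nat \<Rightarrow> real \<times> nat) set \<Rightarrow> (real \<Rightarrow> nat set) \<Rightarrow> nat" where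
  "marked_count n F \<alpha> y B D X = (if marked_event \<alpha> y F X then bead_count n B D X else 0)"

text \<open>The function h is the embedding of counts into the complex numbers, a level-set
  indicator, or a level-set indicator times its level; \<open>max 1\<close> makes room for the
  indicators.\<close>

lemma tame_marked_count:
  fixes h :: "nat \<Rightarrow> complex"
  assumes n: "2 \<le> n" and B: "finite B" and F: "finite F" "y ` F \<subseteq> {0..<1} \<times> {..<n}" and D: "D \<in> sets (\<Pi>\<^sub>M i\<in>B. torus n)"
    and h: "\<And>c. norm (h c) \<le> max 1 (real c)"
  shows "tame n (card B) (\<lambda>X. h (marked_count n F \<alpha> y B D X))"
  unfolding tame_def
proof (intro allI impI conjI)
  fix k l :: nat assume k: "0 < k"
  have n0: "0 < n" using n by simp
  let ?M = "array_lebesgue n k"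
  obtain g where g: "g \<in> ?M \<rightarrow>\<^sub>M count_space UNIV"
    "\<And>b. b \<in> unit_box ({..<n} \<times> {..<k}) \<Longrightarrow> g b = bead_count n B D (occupation_process n k b)"
    by (rule measurable_bead_count[OF B n0 k D, folded bead_count_def]) (rule that)
  have ev: "{b \<in> space ?M. marked_event \<alpha> y F (occupation_process n k b)} \<in> sets ?M"
    by (rule predE[OF pred_marked_event[OF F(1) k]]) (use F in auto)
  have "(\<lambda>b. if marked_event \<alpha> y F (occupation_process n k b) then h (g b) else h 0) \<in> borel_measurable ?M"
    by (rule measurable_If[OF measurable_compose[OF g(1)] _ ev]) auto
  then have "(\<lambda>b. indicator (W n k l) b *\<^sub>R (if marked_event \<alpha> y F (occupation_process n k b) then h (g b) else h 0)) \<in> borel_measurable ?M"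
    by (intro borel_measurable_scaleR borel_measurable_indicator W_measurable n0 k)
  moreover have "indicator (W n k l) b *\<^sub>R (if marked_event \<alpha> y F (occupation_process n k b) then h (g b) else h 0) =
    indicator (W n k l) b *\<^sub>R h (marked_count n F \<alpha> y B D (occupation_process n k b))" for b
    using g(2)[of b] by (cases "b \<in> W n k l") (auto simp: marked_count_def W_def bead_arrays_def)
  ultimately show "(\<lambda>b. indicator (W n k l) b *\<^sub>R h (marked_count n F \<alpha> y B D (occupation_process n k b))) \<in> borel_measurable ?M"
    by (simp only:)
  show "AE b in ?M. b \<in> W n k l \<longrightarrow> norm (h (marked_count n F \<alpha> y B D (occupation_process n k b))) \<le> real (n * k) ^ card B"
    using AE_bead_count[OF n k B, of l D]
  proof eventually_elim
    case (elim b)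
    show ?case
    proof
      assume "b \<in> W n k l"
      then have "marked_count n F \<alpha> y B D (occupation_process n k b) \<le> (n * k) ^ card B"
        using elim tuple_count_le[OF B, of n k D b] by (simp add: marked_count_def)
      then have "real (marked_count n F \<alpha> y B D (occupation_process n k b)) \<le> real (n * k) ^ card B" by (metis of_nat_le_iff of_nat_power)
      then show "norm (h (marked_count n F \<alpha> y B D (occupation_process n k b))) \<le> real (n * k) ^ card B"
        using h[of "marked_count n F \<alpha> y B D (occupation_process n k b)"] one_le_bead_power[OF n0 k, of "card B"] by simp
    qed
  qed
qed

lemma Q_marked_count:
  assumes n: "2 \<le> n" and reg: "regular n \<beta> \<theta> T"
    and B: "finite B" "B \<inter> F = {}"
    and F: "finite F" "inj_on y F" "y ` F \<subseteq> {0..<1} \<times> {..<n}" "\<And>f. f \<in> F \<Longrightarrow> \<alpha> f \<noteq> Bead"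
    and D: "D \<in> sets (\<Pi>\<^sub>M i\<in>B. torus n)"
  shows "Q n \<beta> \<theta> T (\<lambda>X. of_nat (marked_count n F \<alpha> y B D X)) = 1 / 2 * (-1) ^ (\<theta> + n + 1) *
    (T ^ card B * (LINT x|(\<Pi>\<^sub>M i\<in>B. torus n). indicator D (restrict x B) * kernel_density n \<beta> \<theta> T F \<alpha> y B x))"
proof (rule Q_marked[OF _ _ reg B F D])
  show "tame n (card B) (\<lambda>X. of_nat (marked_count n F \<alpha> y B D X))"
    by (rule tame_marked_count[OF n B(1) F(1,3) D]) simp
  show "AE b in array_lebesgue n k. b \<in> W n k l \<longrightarrow> (of_nat (marked_count n F \<alpha> y B D (occupation_process n k b)) :: complex) =
     of_bool (marked_event \<alpha> y F (occupation_process n k b)) * of_nat (tuple_count n k B D b)" if "0 < k" for k l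
    using AE_bead_count[OF n that B(1), of l D] by eventually_elim (simp add: marked_count_def)
  show "(of_nat (marked_count n F \<alpha> y B D (constant_process A)) :: complex) =
      of_bool (B = {} \<and> (\<lambda>_. undefined) \<in> D) * of_bool (marked_event \<alpha> y F (constant_process A))" if "A \<subseteq> {..<n}" for A
    by (simp add: marked_count_def bead_count_constant[OF that B(1)])
qed (use n in auto)

text \<open>Level sets of the count are exchanged with \<open>Q\<close>. What enters is the
  measurability of their preimages among arrays, not of the level sets in the space of
  processes.\<close>

lemma has_expectation_marked_count:
  assumes n: "2 \<le> n" and reg: "regular n \<beta> \<theta> T"
    and B: "finite B" and F: "finite F" "y ` F \<subseteq> {0..<1} \<times> {..<n}"
    and D: "D \<in> sets (\<Pi>\<^sub>M i\<in>B. torus n)"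
  shows "has_expectation (process_space n) (P n \<beta> \<theta> T) (marked_count n F \<alpha> y B D)
    (Q n \<beta> \<theta> T (\<lambda>X. of_nat (marked_count n F \<alpha> y B D X)) / Q n \<beta> \<theta> T (\<lambda>X. 1))"
proof -
  have n0: "0 < n" using n by simp
  let ?c = "marked_count n F \<alpha> y B D" and ?d = "card B"
  let ?S = "\<lambda>m. {X \<in> space (process_space n). ?c X = m}"
  let ?f = "\<lambda>m X. of_nat m * indicator (?S m) X :: complex"
  have ind: "indicator (?S m) (occupation_process n k b) = (of_bool (?c (occupation_process n k b) = m) :: complex)" if "0 < k" for m k b
    using occupation_process_in_space[OF that, of n b] by (simp add: indicator_def)
  have t1: "tame n ?d (indicator (?S m))" for m
    using tame_marked_count[OF n B F D, of "\<lambda>c. of_bool (c = m)"] tame_cong[of "indicator (?S m)" n "\<lambda>X. of_bool (?c X = m)"] ind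
    by (simp add: max_def)
  have fop: "?f m (occupation_process n k b) = (if m = ?c (occupation_process n k b) then of_nat m else 0)" if "0 < k" for m k b
    unfolding ind[OF that] by simp
  have t2: "tame n ?d (?f m)" for m
    using tame_marked_count[OF n B F D, of "\<lambda>c. if m = c then of_nat m else 0"]
      tame_cong[of "?f m" n "\<lambda>X. if m = ?c X then of_nat m else 0"] fop
    by (simp add: max_def)
  have t3: "tame n ?d (\<lambda>X. of_nat (?c X))" by (rule tame_marked_count[OF n B F D]) simp
  have "(\<lambda>m. Q n \<beta> \<theta> T (?f m)) sums Q n \<beta> \<theta> T (\<lambda>X. of_nat (?c X))"
  proof (rule Q_exchange[OF n0 t2 t3])
    fix k l :: nat assume k: "0 < k"
    show "AE b in array_lebesgue n k. b \<in> W n k l \<longrightarrow>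
      (\<forall>m. norm (\<Sum>i<m. ?f i (occupation_process n k b)) \<le> real (n * k) ^ ?d) \<and>
      (\<lambda>i. ?f i (occupation_process n k b)) sums of_nat (?c (occupation_process n k b))"
      using AE_bead_count[OF n k B, of l D]
    proof eventually_elim
      case (elim b)
      show ?case
      proof (intro impI conjI allI)
        assume "b \<in> W n k l"
        then have "?c (occupation_process n k b) \<le> (n * k) ^ ?d"
          using elim tuple_count_le[OF B, of n k D b] by (simp add: marked_count_def)
        then have le: "real (?c (occupation_process n k b)) \<le> real (n * k) ^ ?d" by (metis of_nat_le_iff of_nat_power)
        have "(\<Sum>i<m. ?f i (occupation_process n k b)) = (if ?c (occupation_process n k b) < m then of_nat (?c (occupation_process n k b)) else 0)" for m
          unfolding fop[OF k] by (simp add: sum.delta)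
        then show "norm (\<Sum>i<m. ?f i (occupation_process n k b)) \<le> real (n * k) ^ ?d" for m
          using le by (simp add: zero_le_power)
        show "(\<lambda>i. ?f i (occupation_process n k b)) sums of_nat (?c (occupation_process n k b))"
          unfolding fop[OF k] by (rule sums_single)
      qed
    qed
  next
    fix A assume A: "A \<subseteq> {..<n}"
    have "?f i (constant_process A) = (if i = ?c (constant_process A) then of_nat i else 0)" for i
      using constant_process_in_processes(1)[OF A] by (simp add: space_process_space indicator_def)
    then show "(\<lambda>i. ?f i (constant_process A)) sums of_nat (?c (constant_process A))" by (simp only: sums_single)
  qed
  moreover have "Q n \<beta> \<theta> T (?f m) = of_nat m * Q n \<beta> \<theta> T (indicator (?S m))" for m
    by (rule Q_scale[OF n0 t1 t2])
  ultimately have "(\<lambda>m. of_nat m * Q n \<beta> \<theta> T (indicator (?S m))) sums Q n \<beta> \<theta> T (\<lambda>X. of_nat (?c X))" by simp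
  from sums_divide[OF this, of "Q n \<beta> \<theta> T (\<lambda>X. 1)"] show ?thesis by (simp add: has_expectation_def P_def)
qed

lemma mixed_correlation_P:
  assumes n: "2 \<le> n" and reg: "regular n \<beta> \<theta> T"
  shows "mixed_correlation n (P n \<beta> \<theta> T) N
    (\<lambda>w. Determinant.det (Matrix.mat N N (\<lambda>(i, j). H n \<beta> \<theta> T (fst (w i)) (difference (snd (w j)) (snd (w i))))))"
  unfolding mixed_correlation_def Let_def
proof (intro allI impI)
  fix \<alpha> :: "nat \<Rightarrow> kind" and y :: "nat \<Rightarrow> real \<times> nat"
  define B where "B = {i. i < N \<and> \<alpha> i = Bead}"
  define F where "F = {..<N} - B"
  let ?ev = "{X. \<forall>i<N. (\<alpha> i = Occupied \<longrightarrow> snd (y i) \<in> X (fst (y i))) \<and> (\<alpha> i = Unoccupied \<longrightarrow> snd (y i) \<notin> X (fst (y i)))}"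
  define density where "density x = Determinant.det (Matrix.mat N N (\<lambda>(i, j). H n \<beta> \<theta> T (fst (\<alpha> i, if i \<in> B then x i else y i))
     (difference (snd (\<alpha> j, if j \<in> B then x j else y j)) (snd (\<alpha> i, if i \<in> B then x i else y i)))))" for x :: "nat \<Rightarrow> real \<times> nat"
  let ?P = "\<Pi>\<^sub>M i\<in>B. torus n"
  let ?pd = "partition_det n \<beta> \<theta> T"
  assume "y ` ({..<N} - {i. i < N \<and> \<alpha> i = Bead}) \<subseteq> {0..<1} \<times> {..<n}" and "inj_on y ({..<N} - {i. i < N \<and> \<alpha> i = Bead})"
  then have y: "y ` F \<subseteq> {0..<1} \<times> {..<n}" "inj_on y F" by (auto simp: F_def B_def)
  have n0: "0 < n" using n by simp
  have fin: "finite B" "finite F" "B \<inter> F = {}" and BF: "{..<N} = B \<union> F" and \<alpha>F: "\<And>f. f \<in> F \<Longrightarrow> \<alpha> f \<noteq> Bead"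
    by (auto simp: B_def F_def)
  have pd: "?pd \<noteq> 0" by (rule partition_det_nonzero[OF n0 reg])
  \<comment> \<open>The factor T of each bead row of \<open>H\<close> is pulled out;
    \<open>partition_det\<close> is inserted and later cancels against the total mass.\<close>
  have density: "density x = T ^ card B / ?pd * kernel_density n \<beta> \<theta> T F \<alpha> y B x" for x
  proof -
    let ?w = "with_marks F \<alpha> y x"
    have w: "(\<alpha> i, if i \<in> B then x i else y i) = ?w i" if "i < N" for i
      using that by (auto simp: with_marks_def F_def B_def)
    have "density x = fdet {..<N} (\<lambda>i j. T ^ of_bool (\<alpha> i = Bead) * kernel n \<beta> \<theta> T (?w i) (?w j))"
      unfolding density_def det_mat_eq_fdet
    proof (rule fdet_cong[OF refl])
      fix i j assume "i \<in> {..<N}" "j \<in> {..<N}"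
      then have "i < N" "j < N" by auto
      moreover have "fst (?w i) = \<alpha> i" using w[OF \<open>i < N\<close>] by (metis fst_conv)
      ultimately show "H n \<beta> \<theta> T (fst (\<alpha> i, if i \<in> B then x i else y i))
         (difference (snd (\<alpha> j, if j \<in> B then x j else y j)) (snd (\<alpha> i, if i \<in> B then x i else y i))) =
        T ^ of_bool (\<alpha> i = Bead) * kernel n \<beta> \<theta> T (?w i) (?w j)"
        using H_eq_kernel[of n \<beta> \<theta> T "?w i" "?w j"] by (simp only: w)
    qed
    also have "\<dots> = (\<Prod>i<N. T ^ of_bool (\<alpha> i = Bead)) * fdet (B \<union> F) (\<lambda>i j. kernel n \<beta> \<theta> T (?w i) (?w j))"
      by (subst fdet_scale_rows) (simp_all add: BF fin)
    also have "(\<Prod>i<N. T ^ of_bool (\<alpha> i = Bead)) = T ^ (\<Sum>i<N. of_bool (\<alpha> i = Bead))" by (rule power_sum[symmetric])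
    also have "(\<Sum>i<N. of_bool (\<alpha> i = Bead) :: nat) = card B" unfolding B_def by (simp add: Int_def)
    finally show ?thesis using pd by (simp add: kernel_density_def)
  qed
  have meas: "kernel_density n \<beta> \<theta> T F \<alpha> y B \<in> borel_measurable ?P" by (rule measurable_kernel_density)
  have "integrable ?P (kernel_density n \<beta> \<theta> T F \<alpha> y B)"
    by (rule integrable_PiM_torus_bounded[OF fin(1) meas]) (rule norm_kernel_density_le[OF n0 fin(1,2) y(1)])
  then have int: "integrable ?P density" unfolding density[abs_def] by (rule integrable_mult_right)
  have "has_expectation (process_space n) (P n \<beta> \<theta> T) (\<lambda>X. if X \<in> ?ev then card {x \<in> B \<rightarrow>\<^sub>E beads n X. inj_on x B \<and> x \<in> D} else 0)
      (LINT x:D|?P. density x)" if D: "D \<in> sets ?P" for D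
  proof -
    have "(\<lambda>X. if X \<in> ?ev then card {x \<in> B \<rightarrow>\<^sub>E beads n X. inj_on x B \<and> x \<in> D} else 0) = marked_count n F \<alpha> y B D"
    proof
      fix X
      have "X \<in> ?ev \<longleftrightarrow> marked_event \<alpha> y F X" by (auto simp: marked_event_def F_def B_def)
      then show "(if X \<in> ?ev then card {x \<in> B \<rightarrow>\<^sub>E beads n X. inj_on x B \<and> x \<in> D} else 0) = marked_count n F \<alpha> y B D X"
        by (simp add: marked_count_def bead_count_def)
    qed
    moreover have "(LINT x:D|?P. density x) = Q n \<beta> \<theta> T (\<lambda>X. of_nat (marked_count n F \<alpha> y B D X)) / Q n \<beta> \<theta> T (\<lambda>X. 1)"
    proof -
      have "(LINT x:D|?P. density x) = (LINT x|?P. T ^ card B / ?pd * (indicator D (restrict x B) * kernel_density n \<beta> \<theta> T F \<alpha> y B x))"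
        unfolding set_lebesgue_integral_def
      proof (intro Bochner_Integration.integral_cong refl)
        fix x assume "x \<in> space ?P"
        then have "restrict x B = x" by (auto simp: space_PiM PiE_iff extensional_restrict)
        then show "indicator D x *\<^sub>R density x = T ^ card B / ?pd * (indicator D (restrict x B) * kernel_density n \<beta> \<theta> T F \<alpha> y B x)"
          by (simp add: density indicator_def)
      qed
      also have "\<dots> = T ^ card B / ?pd * (LINT x|?P. indicator D (restrict x B) * kernel_density n \<beta> \<theta> T F \<alpha> y B x)"
        by (rule integral_mult_right_zero)
      finally show ?thesis
        using pd by (simp add: Q_marked_count[OF n reg fin(1,3,2) y(2,1) \<alpha>F D] Q_total[OF n0 reg])
    qed
    ultimately show ?thesis using has_expectation_marked_count[OF n reg fin(1,2) y(1) D, of \<alpha>] by simp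
  qed
  then show "integrable (\<Pi>\<^sub>M i \<in> {i. i < N \<and> \<alpha> i = Bead}. torus n) (\<lambda>x. Determinant.det (Matrix.mat N N (\<lambda>(i, j).
        H n \<beta> \<theta> T (fst (\<alpha> i, if i \<in> {i. i < N \<and> \<alpha> i = Bead} then x i else y i))
         (difference (snd (\<alpha> j, if j \<in> {i. i < N \<and> \<alpha> i = Bead} then x j else y j)) (snd (\<alpha> i, if i \<in> {i. i < N \<and> \<alpha> i = Bead} then x i else y i)))))) \<and>
    (\<forall>D\<in>sets (\<Pi>\<^sub>M i \<in> {i. i < N \<and> \<alpha> i = Bead}. torus n).
      has_expectation (process_space n) (P n \<beta> \<theta> T)
        (\<lambda>X. if X \<in> ?ev then card {x \<in> {i. i < N \<and> \<alpha> i = Bead} \<rightarrow>\<^sub>E beads n X. inj_on x {i. i < N \<and> \<alpha> i = Bead} \<and> x \<in> D} else 0)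
        (LINT x:D|(\<Pi>\<^sub>M i \<in> {i. i < N \<and> \<alpha> i = Bead}. torus n). Determinant.det (Matrix.mat N N (\<lambda>(i, j).
          H n \<beta> \<theta> T (fst (\<alpha> i, if i \<in> {i. i < N \<and> \<alpha> i = Bead} then x i else y i))
           (difference (snd (\<alpha> j, if j \<in> {i. i < N \<and> \<alpha> i = Bead} then x j else y j)) (snd (\<alpha> i, if i \<in> {i. i < N \<and> \<alpha> i = Bead} then x i else y i)))))))"
    using int unfolding density_def[abs_def] B_def[symmetric] by blast
qed

section \<open>The affine combination\<close>

text \<open>A conjugation by powers of e = exp (\<theta> \<pi> \<i> / n): since e^n = (-1)^\<theta>,
  it spreads the twist concentrated between string n - 1 and string 0 evenly over all strings, and
  it leaves determinants unchanged.\<close>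

lemma kernel0_Bead_eq_C:
  assumes n: "0 < n" and h: "h < n" "h' < n"
  shows "C n \<beta> \<theta> (t, h) (t', h') = inverse (exp (of_nat \<theta> * of_real pi * \<i> / of_nat n) ^ h) *
    (exp (of_nat \<theta> * of_real pi * \<i> / of_nat n) ^ h' * kernel0 n \<beta> \<theta> (Bead, t, h) (Bead, t', h'))"
proof (cases "h' = Suc h mod n")
  case True
  define e where "e = exp (of_nat \<theta> * of_real pi * \<i> / of_nat n :: complex)"
  have e0: "e \<noteq> 0" by (simp add: e_def)
  have en: "e ^ n = (-1) ^ \<theta>"
  proof -
    have "e ^ n = exp (of_nat \<theta> * (of_real pi * \<i>))"
      using n by (simp add: e_def exp_of_nat_mult[symmetric] mult.assoc)
    then show ?thesis by (simp only: exp_of_nat_mult exp_pi_i)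
  qed
  have "e = inverse (e ^ h) * (e ^ h' * (if Suc h = n then (-1) ^ \<theta> else 1))"
  proof (cases "Suc h = n")
    case True
    then have "h' = 0" using \<open>h' = Suc h mod n\<close> by simp
    moreover have "e * e ^ h = (-1) ^ \<theta>" using en True by (metis power_Suc)
    ultimately show ?thesis using True e0 by (simp add: field_simps)
  next
    case False
    then have "h' = Suc h" using \<open>h' = Suc h mod n\<close> h by simp
    then show ?thesis using False e0 by (simp add: field_simps)
  qed
  then have eX: "e * X = inverse (e ^ h) * (e ^ h' * ((if Suc h = n then (-1) ^ \<theta> else 1) * X))" for X
    by (metis (no_types, opaque_lifting) mult.assoc)
  let ?Y = "exp (- \<beta> * of_real (cdist t t')) / (1 - exp (- \<beta>))"
  have C: "C n \<beta> \<theta> (t, h) (t', h') = e * ?Y"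
    using True by (simp add: C_def cdist_def e_def)
  have K: "kernel0 n \<beta> \<theta> (Bead, t, h) (Bead, t', h') = (if Suc h = n then (-1) ^ \<theta> else 1) * ?Y"
    using True by (simp add: kernel0_def bracket_eq_cdist)
  show ?thesis unfolding C K e_def[symmetric] by (rule eX)
next
  case False
  then show ?thesis by (simp add: C_def kernel0_def)
qed

lemma det_C_eq_fdet_kernel0:
  assumes n: "0 < n" and x: "x \<in> space (\<Pi>\<^sub>M i\<in>{..<N}. torus n)"
  shows "Determinant.det (Matrix.mat N N (\<lambda>(i, j). C n \<beta> \<theta> (x i) (x j))) =
    fdet {..<N} (\<lambda>i j. kernel0 n \<beta> \<theta> (Bead, x i) (Bead, x j))"
proof -
  let ?e = "exp (of_nat \<theta> * of_real pi * \<i> / of_nat n :: complex)"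
  have xs: "snd (x i) < n" if "i < N" for i using x that by (auto simp: space_PiM space_torus PiE_iff mem_Times_iff)
  have "Determinant.det (Matrix.mat N N (\<lambda>(i, j). C n \<beta> \<theta> (x i) (x j))) =
    fdet {..<N} (\<lambda>i j. inverse (?e ^ snd (x i)) * (?e ^ snd (x j) * kernel0 n \<beta> \<theta> (Bead, x i) (Bead, x j)))"
    unfolding det_mat_eq_fdet
  proof (rule fdet_cong[OF refl])
    fix i j assume "i \<in> {..<N}" "j \<in> {..<N}"
    then show "C n \<beta> \<theta> (x i) (x j) = inverse (?e ^ snd (x i)) * (?e ^ snd (x j) * kernel0 n \<beta> \<theta> (Bead, x i) (Bead, x j))"
      using kernel0_Bead_eq_C[OF n xs xs, of i j \<beta> \<theta> "fst (x i)" "fst (x j)"] by simp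
  qed
  also have "\<dots> = (\<Prod>i<N. inverse (?e ^ snd (x i))) * ((\<Prod>i<N. ?e ^ snd (x i)) * fdet {..<N} (\<lambda>i j. kernel0 n \<beta> \<theta> (Bead, x i) (Bead, x j)))"
    by (simp only: fdet_scale_rows[OF finite_lessThan] fdet_scale_cols[OF finite_lessThan])
  also have "\<dots> = fdet {..<N} (\<lambda>i j. kernel0 n \<beta> \<theta> (Bead, x i) (Bead, x j))"
    by (simp add: prod_inversef[symmetric] mult.assoc[symmetric] prod.distrib[symmetric])
  finally show ?thesis .
qed

text \<open>The integrals in the Fredholm series are, up to (1 - exp (- \<beta>)) ^ n and the
  factorial, the Taylor coefficients of \<open>partition_det\<close> at T = 0; this is the case of
  \<open>marked_sums\<close> without any points.\<close>

lemma fredholm_det_C: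
  assumes q: "exp (- \<beta>) \<noteq> (1::complex)" and n: "0 < n" and reg: "regular n \<beta> \<theta> T"
  shows "fredholm_det n T (C n \<beta> \<theta>) = partition_det n \<beta> \<theta> T / (1 - exp (- \<beta>)) ^ n"
proof -
  let ?u = "\<lambda>_. undefined :: real \<times> nat"
  let ?c = "marked_coeff n \<beta> \<theta> {} (\<lambda>_. Bead) ?u {} {?u}"
  have D: "{?u} \<in> sets (\<Pi>\<^sub>M i\<in>({} :: nat set). torus n)" by (rule singleton_sets_PiM_empty)
  have q0: "(1 - exp (- \<beta>)) ^ n \<noteq> 0" using q by simp
  have "T ^ N / fact N * (LINT x|(\<Pi>\<^sub>M i \<in> {..<N}. torus n). Determinant.det (Matrix.mat N N (\<lambda>(i, j). C n \<beta> \<theta> (x i) (x j)))) =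
    1 / (1 - exp (- \<beta>)) ^ n * (?c N * T ^ N)" for N
  proof -
    have "(LINT x|(\<Pi>\<^sub>M i\<in>{..<N}. torus n). indicator {?u} (restrict x {}) * kernel_density n \<beta> \<theta> 0 {} (\<lambda>_. Bead) ?u {..<N} x) =
      (LINT x|(\<Pi>\<^sub>M i\<in>{..<N}. torus n). (1 - exp (- \<beta>)) ^ n * Determinant.det (Matrix.mat N N (\<lambda>(i, j). C n \<beta> \<theta> (x i) (x j))))"
    proof (intro Bochner_Integration.integral_cong refl)
      fix x assume x: "x \<in> space (\<Pi>\<^sub>M i\<in>{..<N}. torus n)"
      have "restrict x {} = ?u" by (simp add: restrict_def)
      moreover have "with_marks {} (\<lambda>_. Bead) ?u x i = (Bead, x i)" for i by (simp add: with_marks_def)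
      ultimately show "indicator {?u} (restrict x {}) * kernel_density n \<beta> \<theta> 0 {} (\<lambda>_. Bead) ?u {..<N} x =
         (1 - exp (- \<beta>)) ^ n * Determinant.det (Matrix.mat N N (\<lambda>(i, j). C n \<beta> \<theta> (x i) (x j)))"
        by (simp add: kernel_density_at_0[OF n x] det_C_eq_fdet_kernel0[OF n x])
    qed
    also have "\<dots> = (1 - exp (- \<beta>)) ^ n * (LINT x|(\<Pi>\<^sub>M i\<in>{..<N}. torus n). Determinant.det (Matrix.mat N N (\<lambda>(i, j). C n \<beta> \<theta> (x i) (x j))))"
      by (rule integral_mult_right_zero)
    also have "(LINT x|(\<Pi>\<^sub>M i\<in>{..<N}. torus n). indicator {?u} (restrict x {}) * kernel_density n \<beta> \<theta> 0 {} (\<lambda>_. Bead) ?u {..<N} x) = fact N * ?c N"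
      using integral_kernel_density_at_0[where I="{..<N}" and F="{}" and B="{}" and D="{?u}" and \<alpha>="\<lambda>_. Bead" and y="?u" and \<theta>=\<theta>, OF q n] D by simp
    finally have "fact N * ?c N / (1 - exp (- \<beta>)) ^ n = (LINT x|(\<Pi>\<^sub>M i\<in>{..<N}. torus n). Determinant.det (Matrix.mat N N (\<lambda>(i, j). C n \<beta> \<theta> (x i) (x j))))"
      using q0 by (simp add: field_simps)
    then show ?thesis by (simp add: field_simps flip: \<open>fact N * ?c N / (1 - exp (- \<beta>)) ^ n = _\<close>)
  qed
  then have "fredholm_det n T (C n \<beta> \<theta>) = (\<Sum>N. 1 / (1 - exp (- \<beta>)) ^ n * (?c N * T ^ N))" by (simp add: fredholm_det_def)
  also have "\<dots> = 1 / (1 - exp (- \<beta>)) ^ n * (\<Sum>N. ?c N * T ^ N)"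
    using summable_marked_coeff(1)[where F="{}" and B="{}" and D="{?u}" and y="?u", OF n] D by (intro suminf_mult) auto
  also have "(\<Sum>N. ?c N * T ^ N) = partition_det n \<beta> \<theta> T"
  proof (rule sums_unique2)
    show "(\<lambda>k. T ^ (n * k) * marked_layer n \<beta> \<theta> {} (\<lambda>_. Bead) ?u {} {?u} k) sums (\<Sum>N. ?c N * T ^ N)"
      using summable_marked_coeff(2)[where F="{}" and B="{}" and D="{?u}" and y="?u", OF n] D by auto
    show "(\<lambda>k. T ^ (n * k) * marked_layer n \<beta> \<theta> {} (\<lambda>_. Bead) ?u {} {?u} k) sums partition_det n \<beta> \<theta> T"
      using marked_sums[where F="{}" and B="{}" and D="{?u}" and y="?u" and \<alpha>="\<lambda>_. Bead", OF n _ reg] D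
      by (simp add: integral_kernel_density_empty)
  qed
  finally show ?thesis by simp
qed

text \<open>The weight of E among configurations with k beads per string and occupation number l.
  \<open>bead_law\<close> and \<open>Q\<close> are both series in these numbers, which makes the
  affine combination a comparison of coefficients.\<close>

definition mass :: "nat \<Rightarrow> nat \<Rightarrow> nat \<Rightarrow> (real \<Rightarrow> nat set) set \<Rightarrow> real" where
  "mass n k l E = (if k = 0 then real (card {A \<in> Pow {..<n}. card A = l \<and> constant_process A \<in> E})
     else measure (array_lebesgue n k) {b \<in> W n k l. occupation_process n k b \<in> E})"

lemma W_preimage_measurable:
  assumes n: "0 < n" and k: "0 < k" and E: "E \<in> sets (process_space n)"
  shows "{b \<in> W n k l. occupation_process n k b \<in> E} \<in> sets (array_lebesgue n k)"
proof -
  have "W n k l \<inter> (occupation_process n k -` E \<inter> space (array_lebesgue n k)) \<in> sets (array_lebesgue n k)"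
    by (intro sets.Int W_measurable n k measurable_sets[OF measurable_occupation_process[OF k] E])
  also have "W n k l \<inter> (occupation_process n k -` E \<inter> space (array_lebesgue n k)) = {b \<in> W n k l. occupation_process n k b \<in> E}"
    using sets.sets_into_space[OF W_measurable[OF n k, of l]] by auto
  finally show ?thesis .
qed

lemma mass_nonneg: "0 \<le> mass n k l E"
  by (simp add: mass_def)

lemma mass_space: "mass n k l (space (process_space n)) = Vol n k l"
proof (cases "k = 0")
  case True
  have "{A \<in> Pow {..<n}. card A = l \<and> constant_process A \<in> space (process_space n)} = {A. A \<subseteq> {..<n} \<and> card A = l}"
    by (auto simp: space_process_space constant_process_in_processes(1))
  then show ?thesis using True n_subsets[of "{..<n}" l] by (simp add: mass_def Vol_def)
next
  case False
  then have "{b \<in> W n k l. occupation_process n k b \<in> space (process_space n)} = W n k l"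
    by (auto simp: occupation_process_in_space)
  then show ?thesis using False by (simp add: mass_def Vol_def)
qed

lemma layer_indicator:
  assumes n: "0 < n" and E: "E \<in> sets (process_space n)"
  shows "layer n \<beta> \<theta> k (indicator E) = (\<Sum>l\<le>n. (-1) ^ (l + k * (\<theta> + n + l + 1)) * exp (- \<beta>) ^ l * of_real (mass n k l E))"
proof (cases "k = 0")
  case True
  have "(\<Sum>A\<in>Pow {..<n}. (- exp (- \<beta>)) ^ card A * indicator E (constant_process A)) =
    (\<Sum>l\<le>n. \<Sum>A\<in>{A \<in> Pow {..<n}. card A = l}. (- exp (- \<beta>)) ^ card A * indicator E (constant_process A))"
    by (rule sum.group[symmetric]) (auto dest: card_mono[rotated])
  also have "\<dots> = (\<Sum>l\<le>n. (- exp (- \<beta>)) ^ l * of_nat (card {A \<in> Pow {..<n}. card A = l \<and> constant_process A \<in> E}))"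
  proof (intro sum.cong refl)
    fix l
    have "(\<Sum>A\<in>{A \<in> Pow {..<n}. card A = l}. (- exp (- \<beta>)) ^ card A * indicator E (constant_process A)) =
      (\<Sum>A\<in>{A \<in> Pow {..<n}. card A = l \<and> constant_process A \<in> E}. (- exp (- \<beta>)) ^ l)"
      by (intro sum.mono_neutral_cong_right) (auto simp: indicator_def)
    then show "(\<Sum>A\<in>{A \<in> Pow {..<n}. card A = l}. (- exp (- \<beta>)) ^ card A * indicator E (constant_process A)) =
      (- exp (- \<beta>)) ^ l * of_nat (card {A \<in> Pow {..<n}. card A = l \<and> constant_process A \<in> E})" by simp
  qed
  finally show ?thesis
    using True by (simp add: layer_def mass_def power_minus[of "exp (- \<beta>)"])
next
  case False
  then have k: "0 < k" by simp
  have "(LINT b:W n k l|array_lebesgue n k. indicator E (occupation_process n k b)) = (of_real (mass n k l E) :: complex)" for l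
  proof -
    let ?S = "{b \<in> W n k l. occupation_process n k b \<in> E}"
    have "(LINT b:W n k l|array_lebesgue n k. indicator E (occupation_process n k b)) =
      (LINT b|array_lebesgue n k. complex_of_real (indicator ?S b))"
      unfolding set_lebesgue_integral_def by (intro Bochner_Integration.integral_cong refl) (auto simp: indicator_def)
    also have "\<dots> = of_real (LINT b|array_lebesgue n k. indicator ?S b)" by (rule integral_complex_of_real)
    also have "(LINT b|array_lebesgue n k. indicator ?S b :: real) = mass n k l E"
      using sets.sets_into_space[OF W_preimage_measurable[OF n k E, of l]] k by (simp add: mass_def Int_absorb2)
    finally show ?thesis .
  qed
  then show ?thesis using k by (simp add: layer_def)
qed

text \<open>With \<beta> = \<lambda> + \<theta>1 \<pi> \<i>, the factor exp (- \<beta> l)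
  contributes the sign (-1)^(\<theta>1 l). Together with the prefactor of \<open>Z_theta\<close> all
  signs merge into (-1)^((\<theta>1 + k + 1)(\<theta>2 + n + l + 1)), so every term is real.\<close>

lemma Q_indicator_sums:
  fixes lam T :: real
  assumes n: "0 < n" and E: "E \<in> sets (process_space n)" and \<theta>1: "\<theta>1 \<in> {0, 1::nat}"
  shows "(\<lambda>k. \<Sum>l\<le>n. of_real (1 / 2 * (-1) ^ ((\<theta>1 + k + 1) * (\<theta>2 + n + l + 1)) * (T ^ (n * k) * exp (- lam * real l) * mass n k l E)))
    sums ((-1) ^ (\<theta>1 * (\<theta>2 + n + 1)) * Q n (of_real lam + of_nat \<theta>1 * of_real pi * \<i>) \<theta>2 (of_real T) (indicator E))"
proof -
  let ?\<beta> = "of_real lam + of_nat \<theta>1 * of_real pi * \<i> :: complex"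
  have q: "exp (- ?\<beta>) = (-1) ^ \<theta>1 * of_real (exp (- lam))"
    using \<theta>1 by (auto simp: exp_minus exp_add exp_diff exp_of_real)
  have "(-1) ^ (\<theta>1 * (\<theta>2 + n + 1)) * (1 / 2 * (-1) ^ (\<theta>2 + n + 1) * (of_real T ^ (n * k) * layer n ?\<beta> \<theta>2 k (indicator E))) =
    (\<Sum>l\<le>n. of_real (1 / 2 * (-1) ^ ((\<theta>1 + k + 1) * (\<theta>2 + n + l + 1)) * (T ^ (n * k) * exp (- lam * real l) * mass n k l E)))" for k
    unfolding layer_indicator[OF n E] sum_distrib_left
  proof (intro sum.cong refl)
    fix l
    have e: "(\<theta>1 + k + 1) * (\<theta>2 + n + l + 1) = \<theta>1 * (\<theta>2 + n + 1) + ((\<theta>2 + n + 1) + ((l + k * (\<theta>2 + n + l + 1)) + \<theta>1 * l))"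
      by (simp add: algebra_simps)
    have "(-1 :: complex) ^ ((\<theta>1 + k + 1) * (\<theta>2 + n + l + 1)) =
      (-1) ^ (\<theta>1 * (\<theta>2 + n + 1)) * ((-1) ^ (\<theta>2 + n + 1) * ((-1) ^ (l + k * (\<theta>2 + n + l + 1)) * ((-1) ^ \<theta>1) ^ l))"
      unfolding e by (simp only: power_add power_mult)
    moreover have "complex_of_real (exp (- lam * real l)) = of_real (exp (- lam)) ^ l"
      by (simp only: exp_of_nat2_mult of_real_power)
    ultimately show "(-1) ^ (\<theta>1 * (\<theta>2 + n + 1)) * (1 / 2 * (-1) ^ (\<theta>2 + n + 1) * (of_real T ^ (n * k) *
        ((-1) ^ (l + k * (\<theta>2 + n + l + 1)) * exp (- ?\<beta>) ^ l * of_real (mass n k l E)))) =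
      complex_of_real (1 / 2 * (-1) ^ ((\<theta>1 + k + 1) * (\<theta>2 + n + l + 1)) * (T ^ (n * k) * exp (- lam * real l) * mass n k l E))"
      unfolding q by (simp only: of_real_mult of_real_divide of_real_power of_real_minus of_real_1 of_real_numeral power_mult_distrib mult_ac)
  qed
  then show ?thesis
    using sums_mult[OF Q_sums[OF n tame_indicator[OF n E, of 0], of \<theta>2 "of_real T" ?\<beta>], of "(-1) ^ (\<theta>1 * (\<theta>2 + n + 1))"] by simp
qed

lemma sums_Reals:
  fixes f :: "nat \<Rightarrow> complex"
  assumes "f sums s" "\<And>k. f k \<in> \<real>"
  shows "s \<in> \<real>"
proof -
  have "(\<lambda>k. Im (f k)) sums Im s" using assms(1) by (rule sums_Im)
  moreover have "Im (f k) = 0" for k using assms(2)[of k] by (simp add: complex_is_Real_iff)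
  ultimately have "Im s = 0" using sums_unique2[OF _ sums_zero] by (simp only:)
  then show ?thesis by (simp add: complex_is_Real_iff)
qed

lemma Q_indicator_real:
  fixes lam T :: real
  assumes n: "0 < n" and E: "E \<in> sets (process_space n)" and \<theta>1: "\<theta>1 \<in> {0, 1::nat}"
  shows "Q n (of_real lam + of_nat \<theta>1 * of_real pi * \<i>) \<theta>2 (of_real T) (indicator E) \<in> \<real>"
proof -
  let ?s = "(-1) ^ (\<theta>1 * (\<theta>2 + n + 1)) :: complex"
  let ?q = "Q n (of_real lam + of_nat \<theta>1 * of_real pi * \<i>) \<theta>2 (of_real T) (indicator E)"
  have "?s * ?q \<in> \<real>"
    by (rule sums_Reals[OF Q_indicator_sums[OF assms]]) (intro sum_in_Reals Reals_of_real)
  then have real: "?s * (?s * ?q) \<in> \<real>" by (rule Reals_mult[rotated]) (intro Reals_power Reals_minus Reals_1)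
  have "?s * ?s = 1" by (simp add: power_add[symmetric] mult_2[symmetric] power_mult)
  then have "?s * (?s * ?q) = ?q" by (simp only: mult.assoc[symmetric] mult_1)
  from real[unfolded this] show ?thesis .
qed

lemma signed_prob_P:
  fixes lam T :: real
  assumes n: "0 < n" and \<theta>1: "\<theta>1 \<in> {0, 1::nat}"
    and reg: "regular n (of_real lam + of_nat \<theta>1 * of_real pi * \<i>) \<theta>2 (of_real T)"
  shows "signed_prob (process_space n) (P n (of_real lam + of_nat \<theta>1 * of_real pi * \<i>) \<theta>2 (of_real T))"
  unfolding signed_prob_def
proof (intro conjI ballI complex_prob_P n reg)
  let ?\<beta> = "of_real lam + of_nat \<theta>1 * of_real pi * \<i> :: complex"
  fix E assume E: "E \<in> sets (process_space n)"
  have "Q n ?\<beta> \<theta>2 (of_real T) (\<lambda>X. 1) = Q n ?\<beta> \<theta>2 (of_real T) (indicator (space (process_space n)))"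
    by (simp add: Q_total[OF n reg])
  then show "P n ?\<beta> \<theta>2 (of_real T) E \<in> \<real>"
    unfolding P_def using Q_indicator_real[OF n E \<theta>1] Q_indicator_real[OF n sets.top \<theta>1] by (simp add: Reals_divide)
qed

text \<open>The constant in front of the Fredholm determinant cancels its denominator and leaves the
  total mass of \<open>Q\<close> up to sign. The condition \<lambda> \<noteq> 0 keeps exp (-
  \<beta>) away from 1, where the kernel \<open>C\<close> is singular.\<close>

lemma Z_theta_eq:
  assumes n: "0 < n" and \<theta>1: "\<theta>1 \<in> {0, 1::nat}" and lam: "lam \<noteq> 0"
    and reg: "regular n (of_real lam + of_nat \<theta>1 * of_real pi * \<i>) \<theta>2 (of_real T)"
  shows "Z_theta n \<theta>1 \<theta>2 lam T =
    (-1) ^ (\<theta>1 * (\<theta>2 + n + 1)) * Q n (of_real lam + of_nat \<theta>1 * of_real pi * \<i>) \<theta>2 (of_real T) (indicator (space (process_space n)))"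
proof -
  let ?\<beta> = "of_real lam + of_nat \<theta>1 * of_real pi * \<i> :: complex"
  have q: "exp (- ?\<beta>) = of_real ((-1) ^ \<theta>1 * exp (- lam))"
    using \<theta>1 by (auto simp: exp_minus exp_add exp_diff exp_of_real)
  have "\<bar>(-1) ^ \<theta>1 * exp (- lam)\<bar> \<noteq> 1" using lam by (simp add: abs_mult)
  then have "(-1) ^ \<theta>1 * exp (- lam) \<noteq> 1" by (metis abs_one)
  then have q1: "exp (- ?\<beta>) \<noteq> 1" unfolding q by (simp only: of_real_eq_1_iff not_False_eq_True)
  have "of_real ((1 - (-1) ^ \<theta>1 * exp (- lam)) ^ n) = (1 - exp (- ?\<beta>)) ^ n" unfolding q by simp
  moreover have "(\<theta>1 + 1) * (\<theta>2 + n + 1) = \<theta>1 * (\<theta>2 + n + 1) + (\<theta>2 + n + 1)" by simp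
  ultimately show ?thesis
    unfolding Z_theta_def fredholm_det_C[OF q1 n reg] using q1
    by (simp only: power_add) (simp add: Q_total[OF n reg] power_add)
qed

text \<open>Both factors of the exponent run through both parities, so exactly one of the four
  exponents is odd.\<close>

lemma sum_signs:
  "(\<Sum>\<theta>1\<in>{0, 1}. \<Sum>\<theta>2\<in>{0, 1}. 1 / 2 * (-1) ^ ((\<theta>1 + k + 1) * (\<theta>2 + n + l + 1))) = (1 :: real)"
  by (cases "even k"; cases "even (n + l)") (auto simp: minus_one_power_iff)

lemma bead_law_sums:
  fixes lam T :: real
  assumes n: "0 < n" and E: "E \<in> sets (process_space n)"
  shows "(\<lambda>k. complex_of_real (\<Sum>l\<le>n. T ^ (n * k) * exp (- lam * real l) * mass n k l E)) sums
    (\<Sum>\<theta>1\<in>{0, 1}. \<Sum>\<theta>2\<in>{0, 1}. (-1) ^ (\<theta>1 * (\<theta>2 + n + 1)) *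
       Q n (of_real lam + of_nat \<theta>1 * of_real pi * \<i>) \<theta>2 (of_real T) (indicator E))"
proof -
  let ?m = "\<lambda>k l. T ^ (n * k) * exp (- lam * real l) * mass n k l E"
  have "(\<lambda>k. \<Sum>\<theta>1\<in>{0, 1}. \<Sum>\<theta>2\<in>{0, 1}. \<Sum>l\<le>n. complex_of_real (1 / 2 * (-1) ^ ((\<theta>1 + k + 1) * (\<theta>2 + n + l + 1)) * ?m k l)) sums
    (\<Sum>\<theta>1\<in>{0, 1}. \<Sum>\<theta>2\<in>{0, 1}. (-1) ^ (\<theta>1 * (\<theta>2 + n + 1)) *
       Q n (of_real lam + of_nat \<theta>1 * of_real pi * \<i>) \<theta>2 (of_real T) (indicator E))"
    by (intro sums_sum Q_indicator_sums[OF n E])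
  moreover have "(\<Sum>\<theta>1\<in>{0, 1}. \<Sum>\<theta>2\<in>{0, 1}. \<Sum>l\<le>n. complex_of_real (1 / 2 * (-1) ^ ((\<theta>1 + k + 1) * (\<theta>2 + n + l + 1)) * ?m k l)) =
    complex_of_real (\<Sum>l\<le>n. ?m k l)" for k
  proof -
    have "(\<Sum>\<theta>1\<in>{0, 1}. \<Sum>\<theta>2\<in>{0, 1}. \<Sum>l\<le>n. 1 / 2 * (-1) ^ ((\<theta>1 + k + 1) * (\<theta>2 + n + l + 1)) * ?m k l) =
      (\<Sum>\<theta>1\<in>{0, 1}. \<Sum>l\<le>n. \<Sum>\<theta>2\<in>{0, 1}. 1 / 2 * (-1) ^ ((\<theta>1 + k + 1) * (\<theta>2 + n + l + 1)) * ?m k l)"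
      by (intro sum.cong refl sum.swap)
    also have "\<dots> = (\<Sum>l\<le>n. \<Sum>\<theta>1\<in>{0, 1}. \<Sum>\<theta>2\<in>{0, 1}. 1 / 2 * (-1) ^ ((\<theta>1 + k + 1) * (\<theta>2 + n + l + 1)) * ?m k l)"
      by (rule sum.swap)
    also have "\<dots> = (\<Sum>l\<le>n. (\<Sum>\<theta>1\<in>{0, 1}. \<Sum>\<theta>2\<in>{0, 1}. 1 / 2 * (-1) ^ ((\<theta>1 + k + 1) * (\<theta>2 + n + l + 1))) * ?m k l)"
      by (simp only: sum_distrib_right)
    also have "\<dots> = (\<Sum>l\<le>n. ?m k l)" by (simp only: sum_signs mult_1)
    finally have "(\<Sum>l\<le>n. ?m k l) = (\<Sum>\<theta>1\<in>{0, 1}. \<Sum>\<theta>2\<in>{0, 1}. \<Sum>l\<le>n. 1 / 2 * (-1) ^ ((\<theta>1 + k + 1) * (\<theta>2 + n + l + 1)) * ?m k l)" ..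
    then show ?thesis by (simp only: of_real_sum)
  qed
  ultimately show ?thesis by (simp only:)
qed

lemma summable_mass:
  fixes lam T :: real
  assumes "0 < n" "E \<in> sets (process_space n)"
  shows "summable (\<lambda>k. \<Sum>l\<le>n. T ^ (n * k) * exp (- lam * real l) * mass n k l E)"
  using sums_summable[OF bead_law_sums[OF assms]] by (simp only: summable_complex_of_real)

lemma Z_eq_suminf_mass:
  "Z n lam T = (\<Sum>k. \<Sum>l\<le>n. T ^ (n * k) * exp (- lam * real l) * mass n k l (space (process_space n)))"
  by (simp add: Z_def mass_space)

lemma Z_pos:
  assumes n: "0 < n" and T: "0 \<le> T"
  shows "0 < Z n lam T"
  unfolding Z_eq_suminf_mass
proof (rule suminf_pos2[OF summable_mass[OF n sets.top]])
  show "0 < (\<Sum>l\<le>n. T ^ (n * 0) * exp (- lam * real l) * mass n 0 l (space (process_space n)))"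
    by (intro sum_pos) (auto simp: mass_space Vol_def)
qed (use T in \<open>auto intro!: sum_nonneg mult_nonneg_nonneg simp: mass_nonneg\<close>)

section \<open>The bead law as a sum over layers\<close>

lemma sets_conditional_law: "sets (conditional_law n k l) = sets (process_space n)"
  by (simp add: conditional_law_def)

lemma emeasure_conditional_law:
  assumes n: "0 < n" and E: "E \<in> sets (process_space n)" and l: "l \<le> n"
  shows "ennreal (Vol n k l) * emeasure (conditional_law n k l) E = ennreal (mass n k l E)"
proof (cases "k = 0")
  case True
  let ?S = "{A. A \<subseteq> {..<n} \<and> card A = l}"
  have fin: "finite ?S" by (rule finite_subset[of _ "Pow {..<n}"]) auto
  have cS: "card ?S = n choose l" using n_subsets[of "{..<n}" l] by simp
  have "constant_process \<in> uniform_count_measure ?S \<rightarrow>\<^sub>M process_space n"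
    by (rule measurableI) (auto simp: space_uniform_count_measure sets_uniform_count_measure space_process_space constant_process_in_processes(1))
  then have "emeasure (conditional_law n k l) E = emeasure (uniform_count_measure ?S) (constant_process -` E \<inter> ?S)"
    using True E by (simp add: conditional_law_def emeasure_distr space_uniform_count_measure)
  also have "\<dots> = ennreal (real (card (constant_process -` E \<inter> ?S)) / real (card ?S))"
    by (rule emeasure_uniform_count_measure[OF fin]) auto
  also have "constant_process -` E \<inter> ?S = {A \<in> Pow {..<n}. card A = l \<and> constant_process A \<in> E}" by auto
  finally show ?thesis
    using True l by (simp add: cS Vol_def mass_def ennreal_mult''[symmetric])
next
  case False
  then have k: "0 < k" by simp
  let ?M = "array_lebesgue n k"
  have Wm: "W n k l \<in> sets ?M" by (rule W_measurable[OF n k])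
  have le: "emeasure ?M X < \<infinity>" if "X \<subseteq> W n k l" for X
  proof -
    have "emeasure ?M X \<le> emeasure ?M (sorted_arrays n k)"
      using that W_subset_sorted by (intro emeasure_mono sorted_arrays_measurable) blast
    then show ?thesis using emeasure_sorted_arrays_finite[of n k] by (rule le_less_trans)
  qed
  have V: "emeasure ?M (W n k l) = ennreal (Vol n k l)"
    using le[of "W n k l"] k by (simp add: Vol_def emeasure_eq_ennreal_measure less_top)
  have mE: "emeasure ?M {b \<in> W n k l. occupation_process n k b \<in> E} = ennreal (mass n k l E)"
    using le[of "{b \<in> W n k l. occupation_process n k b \<in> E}"] k by (simp add: mass_def emeasure_eq_ennreal_measure less_top Collect_mono_iff)
  have "emeasure (conditional_law n k l) E = emeasure (uniform_measure ?M (W n k l)) (occupation_process n k -` E \<inter> space ?M)"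
    using k E measurable_occupation_process[OF k, of n]
    by (simp add: conditional_law_def emeasure_distr measurable_def)
  also have "\<dots> = emeasure ?M (W n k l \<inter> (occupation_process n k -` E \<inter> space ?M)) / emeasure ?M (W n k l)"
    by (rule emeasure_uniform_measure[OF Wm measurable_sets[OF measurable_occupation_process[OF k] E]])
  also have "W n k l \<inter> (occupation_process n k -` E \<inter> space ?M) = {b \<in> W n k l. occupation_process n k b \<in> E}"
    using sets.sets_into_space[OF Wm] by auto
  finally have eq: "emeasure (conditional_law n k l) E = ennreal (mass n k l E) / ennreal (Vol n k l)" by (simp only: V mE)
  show ?thesis
  \<comment> \<open>For volume 0 the conditional law need not be a probability measure, but then
    both sides vanish.\<close>
  proof (cases "Vol n k l = 0")
    case True
    have "emeasure ?M {b \<in> W n k l. occupation_process n k b \<in> E} \<le> emeasure ?M (W n k l)"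
      by (rule emeasure_mono[OF _ Wm]) auto
    then have "ennreal (mass n k l E) \<le> 0" unfolding V mE True by (simp only: ennreal_0)
    then show ?thesis unfolding True by (simp only: le_zero_eq ennreal_0 mult_zero_left)
  next
    case False
    moreover have "0 \<le> Vol n k l" by (simp add: Vol_def)
    ultimately have V0: "0 < Vol n k l" by simp
    then show ?thesis unfolding eq divide_ennreal[OF mass_nonneg V0]
      by (subst ennreal_mult[symmetric]) (auto simp: mass_nonneg)
  qed
qed

lemma suminf_ennreal_swap:
  fixes f :: "nat \<Rightarrow> nat \<Rightarrow> ennreal"
  shows "(\<Sum>i. \<Sum>k. f i k) = (\<Sum>k. \<Sum>i. f i k)"
  using nn_integral_suminf[of "\<lambda>i k. f i k" "count_space UNIV"] by (simp add: nn_integral_count_space_nat)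

lemma emeasure_bead_law:
  assumes n: "0 < n" and T: "0 \<le> T" and E: "E \<in> sets (process_space n)"
  shows "emeasure (bead_law n lam T) E = ennreal ((\<Sum>k. \<Sum>l\<le>n. T ^ (n * k) * exp (- lam * real l) * mass n k l E) / Z n lam T)"
proof -
  let ?c = "\<lambda>k l. ennreal (T ^ (n * k) * exp (- lam * real l) * Vol n k l / Z n lam T)"
  define \<mu> where "\<mu> E = (\<Sum>k. \<Sum>l\<le>n. ?c k l * emeasure (conditional_law n k l) E)" for E
  have Zp: "0 < Z n lam T" by (rule Z_pos[OF n T])
  have "emeasure (bead_law n lam T) E = \<mu> E"
    unfolding bead_law_def \<mu>_def[symmetric]
  proof (rule emeasure_measure_of_sigma[OF sets.sigma_algebra_axioms _ _ E])
    show "positive (sets (process_space n)) \<mu>" by (simp add: positive_def \<mu>_def)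
    show "countably_additive (sets (process_space n)) \<mu>"
    proof (rule countably_additiveI)
      fix A :: "nat \<Rightarrow> (real \<Rightarrow> nat set) set" assume A: "range A \<subseteq> sets (process_space n)" "disjoint_family A"
      have "(\<Sum>i. \<mu> (A i)) = (\<Sum>k. \<Sum>i. \<Sum>l\<le>n. ?c k l * emeasure (conditional_law n k l) (A i))"
        unfolding \<mu>_def by (rule suminf_ennreal_swap)
      also have "\<dots> = (\<Sum>k. \<Sum>l\<le>n. ?c k l * (\<Sum>i. emeasure (conditional_law n k l) (A i)))"
        by (subst suminf_sum) auto
      also have "\<dots> = \<mu> (\<Union>i. A i)"
        unfolding \<mu>_def using A by (simp add: suminf_emeasure sets_conditional_law)
      finally show "(\<Sum>i. \<mu> (A i)) = \<mu> (\<Union>i. A i)" .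
    qed
  qed
  also have "\<mu> E = (\<Sum>k. ennreal ((\<Sum>l\<le>n. T ^ (n * k) * exp (- lam * real l) * mass n k l E) / Z n lam T))"
    unfolding \<mu>_def
  proof (intro suminf_cong)
    fix k
    have "(\<Sum>l\<le>n. ?c k l * emeasure (conditional_law n k l) E) = (\<Sum>l\<le>n. ennreal (T ^ (n * k) * exp (- lam * real l) * mass n k l E / Z n lam T))"
    proof (intro sum.cong refl)
      fix l assume "l \<in> {..n}"
      have "?c k l = ennreal (T ^ (n * k) * exp (- lam * real l) / Z n lam T) * ennreal (Vol n k l)"
        using T Zp by (subst ennreal_mult[symmetric]) (auto simp: Vol_def)
      then have "?c k l * emeasure (conditional_law n k l) E = ennreal (T ^ (n * k) * exp (- lam * real l) / Z n lam T) * ennreal (mass n k l E)"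
        using emeasure_conditional_law[OF n E, of l k] \<open>l \<in> {..n}\<close> by (simp add: mult.assoc)
      also have "\<dots> = ennreal (T ^ (n * k) * exp (- lam * real l) * mass n k l E / Z n lam T)"
        using T Zp by (subst ennreal_mult[symmetric]) (auto simp: mass_nonneg)
      finally show "?c k l * emeasure (conditional_law n k l) E = ennreal (T ^ (n * k) * exp (- lam * real l) * mass n k l E / Z n lam T)" .
    qed
    also have "\<dots> = ennreal (\<Sum>l\<le>n. T ^ (n * k) * exp (- lam * real l) * mass n k l E / Z n lam T)"
      using T Zp by (intro sum_ennreal) (auto simp: mass_nonneg)
    finally show "(\<Sum>l\<le>n. ?c k l * emeasure (conditional_law n k l) E) = ennreal ((\<Sum>l\<le>n. T ^ (n * k) * exp (- lam * real l) * mass n k l E) / Z n lam T)"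
      by (simp add: sum_divide_distrib)
  qed
  also have "\<dots> = ennreal (\<Sum>k. (\<Sum>l\<le>n. T ^ (n * k) * exp (- lam * real l) * mass n k l E) / Z n lam T)"
    using T Zp by (intro suminf_ennreal2 summable_divide summable_mass n E) (auto intro!: sum_nonneg divide_nonneg_nonneg simp: mass_nonneg)
  also have "(\<Sum>k. (\<Sum>l\<le>n. T ^ (n * k) * exp (- lam * real l) * mass n k l E) / Z n lam T) =
    (\<Sum>k. \<Sum>l\<le>n. T ^ (n * k) * exp (- lam * real l) * mass n k l E) / Z n lam T"
    by (rule suminf_divide[OF summable_mass[OF n E]])
  finally show ?thesis .
qed

lemma space_bead_law: "space (bead_law n lam T) = space (process_space n)"
  unfolding bead_law_def by (rule space_measure_of[OF sets.space_closed])

lemma prob_space_bead_law: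
  assumes "0 < n" "0 \<le> T"
  shows "prob_space (bead_law n lam T)"
proof (rule prob_spaceI)
  have "Z n lam T \<noteq> 0" using Z_pos[OF assms, of lam] by simp
  then show "emeasure (bead_law n lam T) (space (bead_law n lam T)) = 1"
    unfolding space_bead_law emeasure_bead_law[OF assms sets.top] Z_eq_suminf_mass[symmetric] by simp
qed

lemma measure_bead_law:
  assumes n: "0 < n" and T: "0 \<le> T" and E: "E \<in> sets (process_space n)"
  shows "complex_of_real (measure (bead_law n lam T) E) =
    (\<Sum>\<theta>1\<in>{0, 1}. \<Sum>\<theta>2\<in>{0, 1}. (-1) ^ (\<theta>1 * (\<theta>2 + n + 1)) *
       Q n (of_real lam + of_nat \<theta>1 * of_real pi * \<i>) \<theta>2 (of_real T) (indicator E)) / of_real (Z n lam T)"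
proof -
  let ?s = "\<Sum>k. \<Sum>l\<le>n. T ^ (n * k) * exp (- lam * real l) * mass n k l E"
  have "0 \<le> ?s" using T by (intro suminf_nonneg summable_mass n E sum_nonneg) (simp add: mass_nonneg)
  then have "measure (bead_law n lam T) E = ?s / Z n lam T"
    unfolding measure_def emeasure_bead_law[OF assms] using Z_pos[OF n T, of lam] by simp
  moreover have "complex_of_real ?s = (\<Sum>\<theta>1\<in>{0, 1}. \<Sum>\<theta>2\<in>{0, 1}. (-1) ^ (\<theta>1 * (\<theta>2 + n + 1)) *
       Q n (of_real lam + of_nat \<theta>1 * of_real pi * \<i>) \<theta>2 (of_real T) (indicator E))"
    by (rule sums_unique2[OF _ bead_law_sums[OF n E]]) (rule sums_of_real[OF summable_sums[OF summable_mass[OF n E]]])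
  ultimately show ?thesis by (simp only: of_real_divide)
qed

lemma affine_combination:
  fixes lam T :: real
  assumes n: "0 < n" and T: "0 \<le> T" and lam: "lam \<noteq> 0"
    and reg: "\<And>\<theta>1 \<theta>2. \<theta>1 \<in> {0, 1::nat} \<Longrightarrow> \<theta>2 \<in> {0, 1::nat} \<Longrightarrow> regular n (of_real lam + of_nat \<theta>1 * of_real pi * \<i>) \<theta>2 (of_real T)"
    and E: "E \<in> sets (process_space n)"
  shows "of_real (measure (bead_law n lam T) E) =
    (\<Sum>\<theta>1\<in>{0, 1}. \<Sum>\<theta>2\<in>{0, 1}. Z_theta n \<theta>1 \<theta>2 lam T / of_real (Z n lam T) *
       P n (of_real lam + of_nat \<theta>1 * of_real pi * \<i>) \<theta>2 (of_real T) E)"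
  unfolding measure_bead_law[OF n T E] sum_divide_distrib
proof (intro sum.cong refl)
  fix \<theta>1 \<theta>2 :: nat assume \<theta>: "\<theta>1 \<in> {0, 1}" "\<theta>2 \<in> {0, 1}"
  let ?\<beta> = "of_real lam + of_nat \<theta>1 * of_real pi * \<i> :: complex"
  have "Q n ?\<beta> \<theta>2 (of_real T) (\<lambda>X. 1) = Q n ?\<beta> \<theta>2 (of_real T) (indicator (space (process_space n)))"
    by (simp add: Q_total[OF n reg[OF \<theta>]])
  then show "(-1) ^ (\<theta>1 * (\<theta>2 + n + 1)) * Q n ?\<beta> \<theta>2 (of_real T) (indicator E) / of_real (Z n lam T) =
    Z_theta n \<theta>1 \<theta>2 lam T / of_real (Z n lam T) * P n ?\<beta> \<theta>2 (of_real T) E"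
    using Q_one_nonzero[OF n reg[OF \<theta>]] by (simp add: Z_theta_eq[OF n \<theta>(1) lam reg[OF \<theta>]] P_def)
qed

theorem theorem1p7:
  fixes n :: nat
  assumes "1 \<le> n"
  shows
    "(\<forall>(lam::real) (T::real).
        0 \<le> T \<longrightarrow> lam \<noteq> 0 \<longrightarrow>
        (\<forall>\<theta>1\<in>{0, 1}. \<forall>\<theta>2\<in>{0, 1}.
           nondegenerate n (of_real lam + of_nat \<theta>1 * of_real pi * \<i>) \<theta>2 (of_real T)) \<longrightarrow>
        prob_space (bead_law n lam T) \<and>
        (\<forall>\<theta>1\<in>{0, 1}. \<forall>\<theta>2\<in>{0, 1}.
           Z_theta n \<theta>1 \<theta>2 lam T \<in> \<real> \<and>
           signed_prob (process_space n)
             (P n (of_real lam + of_nat \<theta>1 * of_real pi * \<i>) \<theta>2 (of_real T))) \<and>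
        (\<Sum>\<theta>1\<in>{0, 1}. \<Sum>\<theta>2\<in>{0, 1}. Z_theta n \<theta>1 \<theta>2 lam T / of_real (Z n lam T)) = 1 \<and>
        (\<forall>E\<in>sets (process_space n).
           of_real (measure (bead_law n lam T) E) =
           (\<Sum>\<theta>1\<in>{0, 1}. \<Sum>\<theta>2\<in>{0, 1}.
              Z_theta n \<theta>1 \<theta>2 lam T / of_real (Z n lam T) *
              P n (of_real lam + of_nat \<theta>1 * of_real pi * \<i>) \<theta>2 (of_real T) E))) \<and>
     (\<forall>(\<beta>::complex) (T::complex). \<forall>\<theta>2\<in>{0, 1}.
        nondegenerate n \<beta> \<theta>2 T \<longrightarrow>
        complex_prob (process_space n) (P n \<beta> \<theta>2 T) \<and>
        (2 \<le> n \<longrightarrow>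
         (\<forall>N. mixed_correlation n (P n \<beta> \<theta>2 T) N
            (\<lambda>w. Determinant.det (Matrix.mat N N (\<lambda>(i, j).
               H n \<beta> \<theta>2 T (fst (w i)) (difference (snd (w j)) (snd (w i))))))))) \<and>
     (\<forall>(lam::real) (T::real). \<forall>\<theta>1\<in>{0, 1}. \<forall>\<theta>2\<in>{0, 1}.
        nondegenerate n (of_real lam + of_nat \<theta>1 * of_real pi * \<i>) \<theta>2 (of_real T) \<longrightarrow>
        signed_prob (process_space n)
          (P n (of_real lam + of_nat \<theta>1 * of_real pi * \<i>) \<theta>2 (of_real T)))"
proof -
  have n: "0 < n" using assms by simp
  have one: "prob_space (bead_law n lam T) \<and>
        (\<forall>\<theta>1\<in>{0, 1}. \<forall>\<theta>2\<in>{0, 1}.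
           Z_theta n \<theta>1 \<theta>2 lam T \<in> \<real> \<and>
           signed_prob (process_space n)
             (P n (of_real lam + of_nat \<theta>1 * of_real pi * \<i>) \<theta>2 (of_real T))) \<and>
        (\<Sum>\<theta>1\<in>{0, 1}. \<Sum>\<theta>2\<in>{0, 1}. Z_theta n \<theta>1 \<theta>2 lam T / of_real (Z n lam T)) = 1 \<and>
        (\<forall>E\<in>sets (process_space n).
           of_real (measure (bead_law n lam T) E) =
           (\<Sum>\<theta>1\<in>{0, 1}. \<Sum>\<theta>2\<in>{0, 1}.
              Z_theta n \<theta>1 \<theta>2 lam T / of_real (Z n lam T) *
              P n (of_real lam + of_nat \<theta>1 * of_real pi * \<i>) \<theta>2 (of_real T) E))"
    if T: "0 \<le> T" and lam: "lam \<noteq> 0"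
      and nd: "\<forall>\<theta>1\<in>{0, 1}. \<forall>\<theta>2\<in>{0, 1}. nondegenerate n (of_real lam + of_nat \<theta>1 * of_real pi * \<i>) \<theta>2 (of_real T)" for lam T :: real
  proof -
    have reg: "regular n (of_real lam + of_nat \<theta>1 * of_real pi * \<i>) \<theta>2 (of_real T)" if "\<theta>1 \<in> {0, 1}" "\<theta>2 \<in> {0, 1}" for \<theta>1 \<theta>2 :: nat
      using nd that unfolding nondegenerate_iff_regular by blast
    show ?thesis
    proof (intro conjI ballI)
    show "prob_space (bead_law n lam T)" by (rule prob_space_bead_law[OF n T])
    fix \<theta>1 \<theta>2 :: nat assume \<theta>: "\<theta>1 \<in> {0, 1}" "\<theta>2 \<in> {0, 1}"
    show "signed_prob (process_space n) (P n (of_real lam + of_nat \<theta>1 * of_real pi * \<i>) \<theta>2 (of_real T))"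
      by (rule signed_prob_P[OF n \<theta>(1) reg[OF \<theta>]])
    show "Z_theta n \<theta>1 \<theta>2 lam T \<in> \<real>"
      unfolding Z_theta_eq[OF n \<theta>(1) lam reg[OF \<theta>]]
      by (intro Reals_mult Reals_power Reals_minus Reals_1 Q_indicator_real n \<theta>(1)) (rule sets.top)
  next
    show affine: "of_real (measure (bead_law n lam T) E) = (\<Sum>\<theta>1\<in>{0, 1}. \<Sum>\<theta>2\<in>{0, 1}.
        Z_theta n \<theta>1 \<theta>2 lam T / of_real (Z n lam T) * P n (of_real lam + of_nat \<theta>1 * of_real pi * \<i>) \<theta>2 (of_real T) E)"
      if "E \<in> sets (process_space n)" for E
      by (rule affine_combination[OF n T lam reg that])
    \<comment> \<open>The weights are summed by evaluating the affine identity at the whole space,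
      where all the measures have mass 1.\<close>
    have "P n (of_real lam + of_nat \<theta>1 * of_real pi * \<i>) \<theta>2 (of_real T) (space (process_space n)) = 1"
      if "\<theta>1 \<in> {0, 1}" "\<theta>2 \<in> {0, 1}" for \<theta>1 \<theta>2 :: nat
      using complex_prob_P[OF n reg[OF that]] by (simp add: complex_prob_def)
    moreover have "measure (bead_law n lam T) (space (process_space n)) = 1"
      using prob_space.prob_space[OF prob_space_bead_law[OF n T, of lam]] by (simp add: space_bead_law)
    ultimately show "(\<Sum>\<theta>1\<in>{0, 1}. \<Sum>\<theta>2\<in>{0, 1}. Z_theta n \<theta>1 \<theta>2 lam T / of_real (Z n lam T)) = 1"
      using affine[OF sets.top] by simp
    qed
  qed
  show ?thesis
    using one complex_prob_P[OF n] mixed_correlation_P signed_prob_P[OF n]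
    unfolding nondegenerate_iff_regular by blast
qed

end
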